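(* Let $n\ge 1$ and $t>0$. For every non-negative integer $m$, the holomorphic Sobolev space $W_t^{m,2}(\mathbb{C}^n)$ coincides with $\mathcal{B}_t^m(\mathbb{C}^n)$ (the completion of $\mathcal{F}_t^m(\mathbb{C}^n)$), and the Hermite semigroup operator $e^{-tH}$ is, up to a constant multiple, an isometric isomorphism of $W_H^{m,2}(\mathbb{R}^n)$ onto $\mathcal{B}_t^m(\mathbb{C}^n)$; that is, $e^{-tH}$ is a linear bijection between these spaces and there is a constant $c>0$ with $\|e^{-tH}f\|_m=c\,\|f\|_{W_H^{m,2}}$ for all $f\in W_H^{m,2}(\mathbb{R}^n)$.
   Context: For $x\in\mathbb{R}^n$, $x^2$ denotes $x_1^2+\cdots+x_n^2$. Let $h_k(x)=(2^kk!\sqrt{\pi})^{-1/2}(-1)^k\frac{d^k}{dx^k}(e^{-x^2})e^{x^2/2}$, $k\ge 0$, be the normalised Hermite functions on $\mathbb{R}$, and for $\alpha\in\mathbb{N}^n$ ($\mathbb{N}=\{0,1,2,\dots\}$) let $\Phi_\alpha(x)=\prod_{i=1}^n h_{\alpha_i}(x_i)$, an orthonormal basis of $L^2(\mathbb{R}^n)$. $H$ is the Hermite operator, with $H\Phi_\alpha=(2|\alpha|+n)\Phi_\alpha$, and $e^{-tH}f=\sum_\alpha e^{-(2|\alpha|+n)t}(f,\Phi_\alpha)\Phi_\alpha$ for $f\in L^2(\mathbb{R}^n)$; the function $e^{-tH}f$ extends to an entire function on $\mathbb{C}^n$, still denoted $e^{-tH}f(z)$, $z=x+iy$. Hermite Sobolev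 space: $W_H^{m,2}(\mathbb{R}^n)$ is the set of $f\in L^2(\mathbb{R}^n)$ with $\|f\|_{W_H^{m,2}}^2=\sum_\alpha(2|\alpha|+n)^{2m}|(f,\Phi_\alpha)|^2<\infty$. Holomorphic Sobolev space: $W_t^{m,2}(\mathbb{C}^n)$ is the image of $W_H^{m,2}(\mathbb{R}^n)$ under $e^{-tH}$ (as a space of entire functions), with the Hilbert space structure transported so that $e^{-tH}:W_H^{m,2}(\mathbb{R}^n)\to W_t^{m,2}(\mathbb{C}^n)$ is an isometric isomorphism. Weight: $U_t(x+iy)=2^n(\sinh 4t)^{-n/2}e^{\tanh(2t)x^2-\coth(2t)y^2}$. $\mathcal{F}_t^m(\mathbb{C}^n)$ is the space of entire functions on $\mathbb{C}^n$ that are square integrable with respect to $\left|\frac{d^{2m}}{dt^{2m}}U_t(z)\right|dz$ ($dz$ is Lebesgue measure on $\mathbb{C}^n$), equipped with the sesquilinear form $(F,G)_m=\int_{\mathbb{C}^n}F(z)\overline{G(z)}\frac{d^{2m}}{dt^{2m}}U_t(z)\,dz$, which is an inner product on $\mathcal{F}_t^m(\mathbb{C}^n)$, with norm $\|F\|_m^2=(F,F)_m$. $\mathcal{B}_t^m(\mathbb{C}^n)$ is the completion of $\mathcal{F}_t^m(\mathbb{C}^n)$ with respect to $\|\cdot\|_m$ (its norm is still denoted $\|\cdot\|_m$); the identification with $W_t^{m,2}(\mathbb{C}^n)$ is the one extending the inclusion of $\mathcal{F}_t^m(\mathbb{C}^n)$ as entire functions. *)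

theory Defs
  imports "HOL-Analysis.Analysis"
begin

definition hermite_fun :: "nat \<Rightarrow> real \<Rightarrow> real" where
  "hermite_fun k x =
     (-1) ^ k * (deriv ^^ k) (\<lambda>u. exp (- (u\<^sup>2))) x * exp (x\<^sup>2 / 2)
       / sqrt (2 ^ k * fact k * sqrt pi)"

definition Hermite_Phi :: "nat ^ 'n \<Rightarrow> real ^ 'n \<Rightarrow> real" where
  "Hermite_Phi \<alpha> x = (\<Prod>i\<in>UNIV. hermite_fun (\<alpha> $ i) (x $ i))"

definition Hermite_eigenvalue :: "nat ^ 'n \<Rightarrow> real" where
  "Hermite_eigenvalue \<alpha> = 2 * real (\<Sum>i\<in>UNIV. \<alpha> $ i) + real CARD('n)"

text \<open>Elements of \<open>L\<^sup>2(\<real>\<^sup>n)\<close> are handled through representatives;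
  equality in \<open>L\<^sup>2(\<real>\<^sup>n)\<close> is equality almost everywhere.\<close>

definition L2_Rn :: "(real ^ 'n \<Rightarrow> complex) set" where
  "L2_Rn = {f. f \<in> borel_measurable lebesgue \<and> integrable lebesgue (\<lambda>x. (norm (f x))\<^sup>2)}"

definition Hermite_coeff :: "(real ^ 'n \<Rightarrow> complex) \<Rightarrow> nat ^ 'n \<Rightarrow> complex" where
  "Hermite_coeff f \<alpha> = (LINT x|lebesgue. f x * cnj (complex_of_real (Hermite_Phi \<alpha> x)))"

text \<open>\<open>is_Hermite_semigroup t f g\<close>: the function \<open>g\<close> represents the element
  \<open>e\<^bsup>-tH\<^esup>f\<close> of \<open>L\<^sup>2(\<real>\<^sup>n)\<close>, the defining series converging unconditionally in
  \<open>L\<^sup>2\<close> norm.\<close>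

definition is_Hermite_semigroup ::
    "real \<Rightarrow> (real ^ 'n \<Rightarrow> complex) \<Rightarrow> (real ^ 'n \<Rightarrow> complex) \<Rightarrow> bool" where
  "is_Hermite_semigroup t f g \<longleftrightarrow>
     g \<in> L2_Rn \<and>
     ((\<lambda>A. LINT x|lebesgue.
         (norm (g x - (\<Sum>\<alpha>\<in>A. complex_of_real (exp (- (Hermite_eigenvalue \<alpha> * t)))
                            * Hermite_coeff f \<alpha> * complex_of_real (Hermite_Phi \<alpha> x))))\<^sup>2)
       \<longlongrightarrow> 0) (finite_subsets_at_top UNIV)"

text \<open>Entire functions on \<open>\<complex>\<^sup>n\<close>: Frechet differentiable at every point, with a
  complex-linear derivative.\<close>

definition entire_Cn :: "(complex ^ 'n \<Rightarrow> complex) \<Rightarrow> bool" where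
  "entire_Cn F \<longleftrightarrow>
     (\<forall>z. \<exists>D. (F has_derivative D) (at z) \<and> (\<forall>c v. D (c *s v) = c * D v))"

definition Rn_to_Cn :: "real ^ 'n \<Rightarrow> complex ^ 'n" where
  "Rn_to_Cn x = (\<chi> i. complex_of_real (x $ i))"

definition Hermite_semigroup ::
    "real \<Rightarrow> (real ^ 'n \<Rightarrow> complex) \<Rightarrow> complex ^ 'n \<Rightarrow> complex" where
  "Hermite_semigroup t f =
     (THE F. entire_Cn F \<and> is_Hermite_semigroup t f (\<lambda>x. F (Rn_to_Cn x)))"

definition WH :: "nat \<Rightarrow> (real ^ 'n \<Rightarrow> complex) set" where
  "WH m = {f \<in> L2_Rn.
     (\<lambda>\<alpha>. Hermite_eigenvalue \<alpha> ^ (2 * m) * (norm (Hermite_coeff f \<alpha>))\<^sup>2) summable_on UNIV}"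

definition WH_norm :: "nat \<Rightarrow> (real ^ 'n \<Rightarrow> complex) \<Rightarrow> real" where
  "WH_norm m f =
     sqrt (\<Sum>\<^sub>\<infinity>\<alpha>. Hermite_eigenvalue \<alpha> ^ (2 * m) * (norm (Hermite_coeff f \<alpha>))\<^sup>2)"

definition W_hol :: "real \<Rightarrow> nat \<Rightarrow> (complex ^ 'n \<Rightarrow> complex) set" where
  "W_hol t m = Hermite_semigroup t ` WH m"

definition W_hol_norm :: "real \<Rightarrow> nat \<Rightarrow> (complex ^ 'n \<Rightarrow> complex) \<Rightarrow> real" where
  "W_hol_norm t m F = (THE r. \<exists>f\<in>WH m. Hermite_semigroup t f = F \<and> WH_norm m f = r)"

definition weight_U :: "real \<Rightarrow> complex ^ 'n \<Rightarrow> real" where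
  "weight_U t z =
     2 ^ CARD('n) * sinh (4 * t) powr (- (real CARD('n) / 2)) *
     exp (tanh (2 * t) * (\<Sum>i\<in>UNIV. (Re (z $ i))\<^sup>2)
          - (cosh (2 * t) / sinh (2 * t)) * (\<Sum>i\<in>UNIV. (Im (z $ i))\<^sup>2))"

definition weight_dU :: "nat \<Rightarrow> real \<Rightarrow> complex ^ 'n \<Rightarrow> real" where
  "weight_dU m t z = (deriv ^^ (2 * m)) (\<lambda>s. weight_U s z) t"

definition F_space :: "real \<Rightarrow> nat \<Rightarrow> (complex ^ 'n \<Rightarrow> complex) set" where
  "F_space t m =
     {F. entire_Cn F \<and> integrable lborel (\<lambda>z. (norm (F z))\<^sup>2 * \<bar>weight_dU m t z\<bar>)}"

definition F_form ::
    "real \<Rightarrow> nat \<Rightarrow> (complex ^ 'n \<Rightarrow> complex) \<Rightarrow> (complex ^ 'n \<Rightarrow> complex) \<Rightarrow> complex" where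
  "F_form t m F G = (LINT z|lborel. F z * cnj (G z) * complex_of_real (weight_dU m t z))"

definition F_norm :: "real \<Rightarrow> nat \<Rightarrow> (complex ^ 'n \<Rightarrow> complex) \<Rightarrow> real" where
  "F_norm t m F = sqrt (Re (F_form t m F F))"

text \<open>For a space \<open>V\<close> of complex functions with norm \<open>N\<close>: Cauchy sequences in \<open>V\<close>
  modulo sequences converging to zero in norm.\<close>

definition Cauchy_seqs :: "('a \<Rightarrow> complex) set \<Rightarrow> (('a \<Rightarrow> complex) \<Rightarrow> real)
    \<Rightarrow> (nat \<Rightarrow> 'a \<Rightarrow> complex) set" where
  "Cauchy_seqs V N =
     {X. (\<forall>k. X k \<in> V) \<and>
         (\<forall>e>0. \<exists>K. \<forall>j\<ge>K. \<forall>k\<ge>K. N (\<lambda>z. X j z - X k z) < e)}"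

definition null_rel :: "('a \<Rightarrow> complex) set \<Rightarrow> (('a \<Rightarrow> complex) \<Rightarrow> real)
    \<Rightarrow> ((nat \<Rightarrow> 'a \<Rightarrow> complex) \<times> (nat \<Rightarrow> 'a \<Rightarrow> complex)) set" where
  "null_rel V N =
     {(X, Y). X \<in> Cauchy_seqs V N \<and> Y \<in> Cauchy_seqs V N \<and>
              (\<lambda>k. N (\<lambda>z. X k z - Y k z)) \<longlonglongrightarrow> 0}"

type_synonym 'a compl = "(nat \<Rightarrow> 'a \<Rightarrow> complex) set"

definition compl_space ::
    "('a \<Rightarrow> complex) set \<Rightarrow> (('a \<Rightarrow> complex) \<Rightarrow> real) \<Rightarrow> 'a compl set" where
  "compl_space V N = Cauchy_seqs V N // null_rel V N"

definition compl_embed ::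
    "('a \<Rightarrow> complex) set \<Rightarrow> (('a \<Rightarrow> complex) \<Rightarrow> real) \<Rightarrow> ('a \<Rightarrow> complex) \<Rightarrow> 'a compl" where
  "compl_embed V N F = null_rel V N `` {\<lambda>k. F}"

definition compl_add ::
    "('a \<Rightarrow> complex) set \<Rightarrow> (('a \<Rightarrow> complex) \<Rightarrow> real) \<Rightarrow> 'a compl \<Rightarrow> 'a compl \<Rightarrow> 'a compl" where
  "compl_add V N b b' =
     (\<Union>X\<in>b. \<Union>Y\<in>b'. null_rel V N `` {\<lambda>k z. X k z + Y k z})"

definition compl_scale ::
    "('a \<Rightarrow> complex) set \<Rightarrow> (('a \<Rightarrow> complex) \<Rightarrow> real) \<Rightarrow> complex \<Rightarrow> 'a compl \<Rightarrow> 'a compl" where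
  "compl_scale V N a b = (\<Union>X\<in>b. null_rel V N `` {\<lambda>k z. a * X k z})"

definition compl_norm :: "(('a \<Rightarrow> complex) \<Rightarrow> real) \<Rightarrow> 'a compl \<Rightarrow> real" where
  "compl_norm N b = (THE r. \<forall>X\<in>b. (\<lambda>k. N (X k)) \<longlonglongrightarrow> r)"

definition B_space :: "real \<Rightarrow> nat \<Rightarrow> (complex ^ 'n) compl set" where
  "B_space t m = compl_space (F_space t m) (F_norm t m)"

definition B_embed :: "real \<Rightarrow> nat \<Rightarrow> (complex ^ 'n \<Rightarrow> complex) \<Rightarrow> (complex ^ 'n) compl" where
  "B_embed t m = compl_embed (F_space t m) (F_norm t m)"

definition B_add ::
    "real \<Rightarrow> nat \<Rightarrow> (complex ^ 'n) compl \<Rightarrow> (complex ^ 'n) compl \<Rightarrow> (complex ^ 'n) compl" where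
  "B_add t m = compl_add (F_space t m) (F_norm t m)"

definition B_scale ::
    "real \<Rightarrow> nat \<Rightarrow> complex \<Rightarrow> (complex ^ 'n) compl \<Rightarrow> (complex ^ 'n) compl" where
  "B_scale t m = compl_scale (F_space t m) (F_norm t m)"

definition B_norm :: "real \<Rightarrow> nat \<Rightarrow> (complex ^ 'n) compl \<Rightarrow> real" where
  "B_norm t m = compl_norm (F_norm t m)"

text \<open>\<open>B_identification t m c J\<close>: the linear bijection \<open>J\<close> identifies the completion
  with the holomorphic Sobolev space, extends the inclusion of entire functions, and
  preserves norms up to the factor \<open>c\<close>. Being bounded, \<open>J\<close> is determined by its values on
  the dense image of \<open>F_space t m\<close>.\<close>

definition B_identification ::
    "real \<Rightarrow> nat \<Rightarrow> real \<Rightarrow> ((complex ^ 'n) compl \<Rightarrow> complex ^ 'n \<Rightarrow> complex) \<Rightarrow> bool" where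
  "B_identification t m c J \<longleftrightarrow>
     bij_betw J (B_space t m) (W_hol t m) \<and>
     (\<forall>b\<in>B_space t m. \<forall>b'\<in>B_space t m. J (B_add t m b b') = (\<lambda>z. J b z + J b' z)) \<and>
     (\<forall>a. \<forall>b\<in>B_space t m. J (B_scale t m a b) = (\<lambda>z. a * J b z)) \<and>
     (\<forall>F\<in>F_space t m. J (B_embed t m F) = F) \<and>
     (\<forall>b\<in>B_space t m. B_norm t m b = c * W_hol_norm t m (J b))"

end

theory Submission
  imports Defs "HOL-Probability.Probability" "HOL-Complex_Analysis.Complex_Analysis" "HOL-Real_Asymp.Real_Asymp"
begin

text \<open>Let \<open>F\<close> be entire and square integrable with respect to \<open>U\<^sub>s\<close>. Integrating \<open>F cnj \<Phi>\<^sub>\<alpha> U\<^sub>s\<close>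
  first over the real parts, shifting this contour back to the real axis and then integrating over
  the imaginary parts, where a Gaussian transform reproduces \<open>\<Phi>\<^sub>\<alpha>\<close>, one finds
  \<open>(F, \<Phi>\<^sub>\<alpha>)\<close> in \<open>L\<^sup>2(U\<^sub>s)\<close> to be \<open>C exp (2 \<lambda>\<^sub>\<alpha> s) b\<^sub>\<alpha>\<close>, where \<open>b\<^sub>\<alpha>\<close> is the Hermite coefficient of the
  restriction of \<open>F\<close> to real arguments and \<open>\<lambda>\<^sub>\<alpha>\<close> the eigenvalue. So the \<open>\<Phi>\<^sub>\<alpha>\<close> are orthogonal in \<open>L\<^sup>2(U\<^sub>s)\<close>,
  and completeness on the real side turns Bessel's inequality into \<open>\<integral> |F|\<^sup>2 U\<^sub>s = C \<Sum> |b\<^sub>\<alpha>|\<^sup>2 exp (2 \<lambda>\<^sub>\<alpha> s)\<close>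
  for \<open>s \<le> t\<close>. Off a compact set the \<open>2m\<close>-th time derivative of the weight is comparable to
  \<open>(1 + |z|\<^sup>2)\<^bsup>2m\<^esup> U\<^sub>t\<close>, which allows differentiating this identity \<open>2m\<close> times for \<open>s < t\<close> and letting
  \<open>s\<close> tend to \<open>t\<close>: the norm of \<open>F\<close> is a constant times the Sobolev norm of \<open>a\<^sub>\<alpha> = exp (\<lambda>\<^sub>\<alpha> t) b\<^sub>\<alpha>\<close>.
  Finite combinations of the \<open>\<Phi>\<^sub>\<alpha>\<close> being dense, the completion is the full weighted sequence space.\<close>

text \<open>For fixed imaginary part \<open>y\<close> the conjugate of a Hermite function at
  \<open>x + i y\<close> is that function at \<open>x - i y\<close>, and the weight is the
  exponential of a quadratic polynomial in \<open>x\<close>; so every factor continues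
  holomorphically in \<open>x\<close>, which is why the contour may be moved. The move by
  \<open>- i y\<close> frees \<open>F\<close> of \<open>y\<close>. The remaining Gaussian average in
  \<open>y\<close> multiplies the Hermite function of degree \<open>k\<close> by a multiple of
  \<open>((1 + T) / (1 - T)) ^ k\<close>; with \<open>T = tanh (2 s)\<close> this ratio is
  \<open>exp (4 s)\<close>, and the prefactor of the weight turns the rest into
  \<open>exp (2 s)\<close> per coordinate times a constant free of \<open>s\<close>. Hence a time
  derivative of the weight costs exactly a factor twice the eigenvalue, the origin of the constant
  \<open>(2 pi) ^ (n / 4) * 2 ^ m\<close>. The obstacle is that the differentiated weight is known
  to be positive only off a compact set, so positivity of the form has to come from the series.
  Integrability is therefore expressed through the positive weight
  \<open>(1 + |z|^2) ^ (2 m) * U_t\<close>. Points of the completion are labelled by the limits of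
  the coefficient sequences of their representatives.\<close>

no_notation fps_nth (infixl "$" 75)

subsection \<open>Lebesgue measure on complex vectors\<close>

lemma Basis_real_vec: "(Basis :: (real ^ 'n) set) = range (\<lambda>i. axis i 1)"
  by (auto simp: Basis_vec_def)

text \<open>\<open>lborel\<close> on vectors is a product over \<open>Basis\<close>; the bijection
  \<open>axis i 1\<close> of coordinates with basis vectors carries Fubini for products over to
  coordinates. It reduces the integrals of tensor products, Hermite functions and Gaussians alike,
  to one variable.\<close>

lemma lborel_vec_prod:
  fixes f :: "'n::finite \<Rightarrow> real \<Rightarrow> complex"
  assumes f: "\<And>i. integrable lborel (f i)"
  shows integrable_lborel_vec_prod: "integrable lborel (\<lambda>x::real^'n. \<Prod>i\<in>UNIV. f i (x $ i))"
    and integral_lborel_vec_prod: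
      "(LINT x|lborel. (\<Prod>i\<in>UNIV. f i ((x::real^'n) $ i))) = (\<Prod>i\<in>UNIV. (LINT u|lborel. f i u))"
proof -
  define ax :: "'n \<Rightarrow> real^'n" where "ax i = axis i 1" for i
  define g where "g b = f (inv ax b)" for b
  have inj: "inj ax" by (auto simp: inj_def ax_def axis_eq_axis)
  have Basis: "Basis = range ax" unfolding ax_def by (rule Basis_real_vec)
  have g: "g (ax i) = f i" for i using inj by (simp add: g_def)
  have coord: "(\<Sum>b\<in>Basis. h b *\<^sub>R b) $ i = h (ax i)" for h :: "real^'n \<Rightarrow> real" and i
  proof -
    have "(\<Sum>b\<in>Basis. h b *\<^sub>R b) \<bullet> ax i = h (ax i)"
      by (rule inner_sum_left_Basis) (simp add: Basis)
    then show ?thesis by (simp add: ax_def inner_axis)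
  qed
  have eq: "(\<Prod>i\<in>UNIV. f i ((\<Sum>b\<in>Basis. h b *\<^sub>R b) $ i)) = (\<Prod>b\<in>Basis. g b (h b))" for h :: "real^'n \<Rightarrow> real"
  proof -
    have "(\<Prod>b\<in>Basis. g b (h b)) = (\<Prod>i\<in>UNIV. f i (h (ax i)))"
      unfolding Basis by (subst prod.reindex[OF inj]) (simp add: g)
    then show ?thesis by (simp only: coord)
  qed
  interpret product_sigma_finite "\<lambda>b::real^'n. lborel :: real measure" by standard
  have lb: "(lborel :: (real^'n) measure) = distr (\<Pi>\<^sub>M b\<in>Basis. lborel) borel (\<lambda>f. \<Sum>b\<in>Basis. f b *\<^sub>R b)"
    by (rule lborel_eq)
  have int: "integrable lborel (g b)" for b using f by (simp add: g_def)
  have [measurable]: "f i \<in> borel_measurable borel" for i using f[of i] by (auto dest: borel_measurable_integrable)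
  have "(\<lambda>f. \<Sum>b\<in>Basis. f b *\<^sub>R b) \<in> measurable (Pi\<^sub>M Basis (\<lambda>b::real^'n. lborel::real measure)) (borel :: (real^'n) measure)"
    by measurable
  note meas = this
  have m2: "(\<lambda>x::real^'n. \<Prod>i\<in>UNIV. f i (x $ i)) \<in> borel_measurable borel" by measurable
  show "integrable lborel (\<lambda>x::real^'n. \<Prod>i\<in>UNIV. f i (x $ i))"
    unfolding lb integrable_distr_eq[OF meas m2] eq by (intro product_integrable_prod int) simp
  have "(LINT x|lborel. (\<Prod>i\<in>UNIV. f i ((x::real^'n) $ i))) = (\<Prod>b\<in>Basis. (LINT u|lborel. g b u))"
    unfolding lb integral_distr[OF meas m2] eq by (intro product_integral_prod int) simp
  then show "(LINT x|lborel. (\<Prod>i\<in>UNIV. f i ((x::real^'n) $ i))) = (\<Prod>i\<in>UNIV. (LINT u|lborel. f i u))"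
    by (simp add: Basis prod.reindex inj g)
qed

definition cvec :: "real ^ 'n \<Rightarrow> real ^ 'n \<Rightarrow> complex ^ 'n" where
  "cvec x y = (\<chi> i. Complex (x $ i) (y $ i))"

lemma cvec_nth [simp]: "cvec x y $ i = Complex (x $ i) (y $ i)"
  by (simp add: cvec_def)

lemma continuous_on_cvec [continuous_intros]:
  "continuous_on S f \<Longrightarrow> continuous_on S g \<Longrightarrow> continuous_on S (\<lambda>x. cvec (f x) (g x))"
  unfolding cvec_def Complex_eq by (intro continuous_intros)

lemma cvec_measurable [measurable]: "(\<lambda>(x, y). cvec x y) \<in> borel_measurable (lborel \<Otimes>\<^sub>M lborel)"
proof -
  have "continuous_on UNIV (\<lambda>p. cvec (fst p) (snd p))" by (intro continuous_intros)
  then show ?thesis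
    unfolding lborel_prod case_prod_beta' measurable_lborel2
    by (rule borel_measurable_continuous_onI)
qed

text \<open>Lebesgue measure is characterised by its values on boxes, and the \<open>Basis\<close>
  of complex vectors consists of the \<open>axis i 1\<close> and the \<open>axis i \<i>\<close>, so
  a box is a box of real parts times a box of imaginary parts. This opens the way to Fubini in
  \<open>x\<close> and \<open>y\<close> separately.\<close>

lemma lborel_complex_vec: "(lborel :: (complex ^ 'n) measure) = distr (lborel \<Otimes>\<^sub>M lborel) borel (\<lambda>(x, y). cvec x y)"
proof (rule lborel_eqI)
  fix l u :: "complex ^ 'n"
  assume le: "\<And>b. b \<in> Basis \<Longrightarrow> l \<bullet> b \<le> u \<bullet> b"
  define R where "R z = (\<chi> i. Re (z $ i))" for z :: "complex^'n"
  define I where "I z = (\<chi> i. Im (z $ i))" for z :: "complex^'n"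
  have ax: "axis i 1 \<in> (Basis :: (complex^'n) set)" "axis i \<i> \<in> (Basis :: (complex^'n) set)" for i
    by (auto simp: axis_in_Basis_iff)
  have leR: "Re (l $ i) \<le> Re (u $ i)" and leI: "Im (l $ i) \<le> Im (u $ i)" for i
    using le[OF ax(1)[of i]] le[OF ax(2)[of i]] by (simp_all add: inner_axis inner_complex_def)
  have B: "Basis = (\<lambda>i. axis i 1) ` UNIV \<union> (\<lambda>i. axis i \<i>) ` (UNIV::'n set)"
    by (auto simp: Basis_vec_def Basis_complex_def)
  have box: "z \<in> box l u \<longleftrightarrow> R z \<in> box (R l) (R u) \<and> I z \<in> box (I l) (I u)" for z
    unfolding mem_box B Basis_real_vec ball_Un ball_simps
    by (auto simp: R_def I_def inner_axis inner_complex_def)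
  have pre: "(\<lambda>(x, y). cvec x y) -` box l u = box (R l) (R u) \<times> box (I l) (I u)"
    by (auto simp: box R_def I_def)
  have "emeasure (distr (lborel \<Otimes>\<^sub>M lborel) borel (\<lambda>(x, y). cvec x y)) (box l u) =
     emeasure (lborel \<Otimes>\<^sub>M lborel) (box (R l) (R u) \<times> box (I l) (I u))"
    by (subst emeasure_distr) (auto simp: pre space_pair_measure)
  also have "\<dots> = emeasure lborel (box (R l) (R u)) * emeasure lborel (box (I l) (I u))"
    by (rule lborel.emeasure_pair_measure_Times) auto
  also have "\<dots> = ennreal (\<Prod>b\<in>Basis. (R u - R l) \<bullet> b) * ennreal (\<Prod>b\<in>Basis. (I u - I l) \<bullet> b)"
    using leR leI by (subst (1 2) emeasure_lborel_box) (auto simp: Basis_real_vec R_def I_def inner_axis)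
  also have "\<dots> = ennreal ((\<Prod>b\<in>Basis. (R u - R l) \<bullet> b) * (\<Prod>b\<in>Basis. (I u - I l) \<bullet> b))"
    using leR leI by (subst ennreal_mult) (auto intro!: prod_nonneg simp: Basis_real_vec R_def I_def inner_axis)
  also have "(\<Prod>b\<in>Basis. (R u - R l) \<bullet> b) * (\<Prod>b\<in>Basis. (I u - I l) \<bullet> b) = (\<Prod>b\<in>Basis. (u - l) \<bullet> b)"
    unfolding B Basis_real_vec
    by (subst prod.union_disjoint)
      (auto simp: prod.reindex inj_on_def axis_eq_axis R_def I_def inner_axis inner_complex_def)
  finally show "emeasure (distr (lborel \<Otimes>\<^sub>M lborel) borel (\<lambda>(x, y). cvec x y)) (box l u) = (\<Prod>b\<in>Basis. (u - l) \<bullet> b)" .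
qed simp

text \<open>Two translation-invariant measures are proportional (Fubini); the factor is 1 because
  the unit ball is preserved.\<close>

lemma lborel_distr_isometry:
  fixes f :: "'a::euclidean_space \<Rightarrow> 'a"
  assumes "linear f" and norm: "\<And>x. norm (f x) = norm x"
  shows "distr lborel borel f = lborel"
proof -
  interpret f: linear f by fact
  have cont: "continuous_on UNIV f" using \<open>linear f\<close> linear_continuous_on linear_linear by blast
  then have [measurable]: "f \<in> borel_measurable borel" by (rule borel_measurable_continuous_onI)
  have "inj f" using norm f.inj_iff_eq_0 norm_eq_zero by metis
  then have "surj f" using \<open>linear f\<close> linear_injective_imp_surjective by metis
  define \<mu> where "\<mu> = distr lborel borel f"
  have [measurable_cong, simp]: "sets \<mu> = sets borel" by (simp add: \<mu>_def)
  have shift: "(\<integral>\<^sup>+x. h x \<partial>\<mu>) = (\<integral>\<^sup>+x. h (x + y) \<partial>\<mu>)" if [measurable]: "h \<in> borel_measurable borel" for h y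
  proof -
    obtain y' where y': "f y' = y" using \<open>surj f\<close> by (metis surjD)
    have "(\<integral>\<^sup>+x. h x \<partial>\<mu>) = (\<integral>\<^sup>+x. h (f x) \<partial>lborel)" by (simp add: \<mu>_def nn_integral_distr)
    also have "\<dots> = (\<integral>\<^sup>+x. h (f x) \<partial>distr lborel borel ((+) y'))" by (simp add: lborel_distr_plus)
    also have "\<dots> = (\<integral>\<^sup>+x. h (f x + y) \<partial>lborel)" by (simp add: nn_integral_distr f.add y' add.commute)
    also have "\<dots> = (\<integral>\<^sup>+x. h (x + y) \<partial>\<mu>)" by (simp add: \<mu>_def nn_integral_distr)
    finally show ?thesis .
  qed
  define B where "B = ball (0::'a) 1"
  have [measurable]: "B \<in> sets borel" by (simp add: B_def)
  have Bsym: "x - y \<in> B \<longleftrightarrow> y - x \<in> B" for x y by (simp add: B_def norm_minus_commute)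
  have ball: "emeasure \<mu> B = emeasure lborel B"
  proof -
    have "f -` B = B" by (auto simp: B_def norm)
    then show ?thesis by (simp add: \<mu>_def emeasure_distr)
  qed
  have fin: "emeasure lborel B < \<infinity>"
    unfolding B_def by (rule emeasure_lborel_ball_finite)
  have lb_pos: "emeasure lborel B > 0"
    using content_ball_pos[of 1 "0::'a"] by (auto simp: B_def measure_def enn2real_positive_iff)
  have sf: "sigma_finite_measure \<mu>"
  proof
    show "\<exists>A. countable A \<and> A \<subseteq> sets \<mu> \<and> \<Union> A = space \<mu> \<and> (\<forall>a\<in>A. emeasure \<mu> a \<noteq> \<infinity>)"
    proof (intro exI conjI)
      let ?A = "range (\<lambda>n::nat. ball (0::'a) n)"
      show "countable ?A" "?A \<subseteq> sets \<mu>" by auto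
      show "\<Union> ?A = space \<mu>"
        by (auto simp: \<mu>_def) (metis reals_Archimedean2)
      have "f -` ball 0 (real n) = ball 0 (real n)" for n by (auto simp: norm)
      then show "\<forall>a\<in>?A. emeasure \<mu> a \<noteq> \<infinity>"
        using emeasure_lborel_ball_finite[of "0::'a"] by (auto simp: \<mu>_def emeasure_distr less_top)
    qed
  qed
  interpret pair_sigma_finite \<mu> lborel
    unfolding pair_sigma_finite_def using sf sigma_finite_lborel by blast
  have "emeasure \<mu> A = emeasure lborel A" if [measurable]: "A \<in> sets borel" for A
  proof -
    have lshift: "(\<integral>\<^sup>+y. h y \<partial>lborel) = (\<integral>\<^sup>+y. h (y + c) \<partial>lborel)" if [measurable]: "h \<in> borel_measurable borel" for h and c :: 'a
      by (subst lborel_distr_plus[of c, symmetric]) (simp add: nn_integral_distr add.commute)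
    have "emeasure \<mu> A * emeasure lborel B = (\<integral>\<^sup>+x. indicator A x * (\<integral>\<^sup>+y. indicator B y \<partial>lborel) \<partial>\<mu>)"
      by (simp add: nn_integral_multc)
    also have "\<dots> = (\<integral>\<^sup>+x. (\<integral>\<^sup>+y. indicator A x * indicator B (y - x) \<partial>lborel) \<partial>\<mu>)"
      using lshift[of "indicator B" "- x" for x] by (simp add: nn_integral_cmult)
    also have "\<dots> = (\<integral>\<^sup>+y. (\<integral>\<^sup>+x. indicator A x * indicator B (y - x) \<partial>\<mu>) \<partial>lborel)"
      by (rule Fubini'[symmetric]) measurable
    \<comment> \<open>The ball is symmetric, so \<open>y - x\<close> may become
      \<open>x - y\<close>; translating \<open>x\<close> by \<open>y\<close> then leaves
      \<open>A\<close> as the only factor that depends on \<open>y\<close>.\<close>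
    also have "\<dots> = (\<integral>\<^sup>+y. (\<integral>\<^sup>+x. indicator A x * indicator B (x - y) \<partial>\<mu>) \<partial>lborel)"
      using Bsym by (intro nn_integral_cong) (auto simp: indicator_def)
    also have "\<dots> = (\<integral>\<^sup>+y. (\<integral>\<^sup>+x. indicator A (x + y) * indicator B x \<partial>\<mu>) \<partial>lborel)"
    proof (rule nn_integral_cong)
      fix y
      show "(\<integral>\<^sup>+x. indicator A x * indicator B (x - y) \<partial>\<mu>) = (\<integral>\<^sup>+x. indicator A (x + y) * indicator B x \<partial>\<mu>)"
        using shift[of "\<lambda>x. indicator A x * indicator B (x - y)" y] by simp
    qed
    also have "\<dots> = (\<integral>\<^sup>+x. (\<integral>\<^sup>+y. indicator A (x + y) * indicator B x \<partial>lborel) \<partial>\<mu>)"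
      by (rule Fubini') measurable
    also have "\<dots> = (\<integral>\<^sup>+x. (\<integral>\<^sup>+y. indicator A y \<partial>lborel) * indicator B x \<partial>\<mu>)"
      using lshift[of "indicator A" x for x] by (simp add: nn_integral_multc add.commute)
    also have "\<dots> = emeasure lborel A * emeasure lborel B"
      by (simp add: nn_integral_cmult ball)
    finally show ?thesis using lb_pos fin
      by (auto simp: mult.commute[of _ "emeasure lborel B"] ennreal_mult_cancel_left)
  qed
  then show ?thesis unfolding \<mu>_def[symmetric] by (intro measure_eqI) auto
qed

subsection \<open>Orthonormal systems\<close>

text \<open>Square integrability is a predicate on plain functions over an arbitrary measure, with
  no quotient: the same Hilbert space facts serve \<open>lborel\<close>, \<open>lebesgue\<close> and
  the weighted measures on complex vectors, and pointwise values of entire functions remain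
  available.\<close>

definition L2 :: "'a measure \<Rightarrow> ('a \<Rightarrow> complex) \<Rightarrow> bool" where
  "L2 M f \<longleftrightarrow> f \<in> borel_measurable M \<and> integrable M (\<lambda>x. (norm (f x))\<^sup>2)"

definition ip :: "'a measure \<Rightarrow> ('a \<Rightarrow> complex) \<Rightarrow> ('a \<Rightarrow> complex) \<Rightarrow> complex" where
  "ip M f g = (LINT x|M. f x * cnj (g x))"

abbreviation nsq :: "'a measure \<Rightarrow> ('a \<Rightarrow> complex) \<Rightarrow> real" where
  "nsq M f \<equiv> (LINT x|M. (norm (f x))\<^sup>2)"

lemma L2_measurable: "L2 M f \<Longrightarrow> f \<in> borel_measurable M"
  by (simp add: L2_def)

lemma L2_integrable: "L2 M f \<Longrightarrow> integrable M (\<lambda>x. (norm (f x))\<^sup>2)"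
  by (simp add: L2_def)

lemma L2_mult_integrable:
  assumes "L2 M f" "L2 M g"
  shows "integrable M (\<lambda>x. f x * cnj (g x))"
proof (rule Bochner_Integration.integrable_bound)
  show "integrable M (\<lambda>x. (norm (f x))\<^sup>2 + (norm (g x))\<^sup>2)"
    using assms by (auto simp: L2_def)
  have [measurable]: "f \<in> borel_measurable M" "g \<in> borel_measurable M"
    using assms by (auto simp: L2_def)
  have "(\<lambda>x. cnj (g x)) \<in> borel_measurable M"
    by (rule measurable_compose[OF _ borel_measurable_continuous_onI]) (auto intro: continuous_intros)
  then show "(\<lambda>x. f x * cnj (g x)) \<in> borel_measurable M" by simp
  have b: "a * b \<le> a\<^sup>2 + b\<^sup>2" if "0 \<le> a" "0 \<le> b" for a b :: real
  proof -
    have "0 \<le> a * b" using that by simp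
    then show ?thesis using sum_squares_bound[of a b] by linarith
  qed
  show "AE x in M. norm (f x * cnj (g x)) \<le> norm ((norm (f x))\<^sup>2 + (norm (g x))\<^sup>2)"
    by (intro AE_I2) (simp add: norm_mult b)
qed

lemma L2_scale: "L2 M f \<Longrightarrow> L2 M (\<lambda>x. a * f x)"
  by (auto simp: L2_def norm_mult power_mult_distrib)

lemma L2_0: "L2 M (\<lambda>x. 0)"
  by (auto simp: L2_def)

lemma L2_add:
  assumes "L2 M f" "L2 M g"
  shows "L2 M (\<lambda>x. f x + g x)"
proof -
  have [measurable]: "f \<in> borel_measurable M" "g \<in> borel_measurable M"
    using assms by (auto simp: L2_def)
  have b: "(norm (a + b))\<^sup>2 \<le> 2 * (norm a)\<^sup>2 + 2 * (norm b)\<^sup>2" for a b :: complex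
  proof -
    have "(norm (a + b))\<^sup>2 \<le> (norm a + norm b)\<^sup>2" by (intro power_mono norm_triangle_ineq) auto
    also have "\<dots> \<le> 2 * (norm a)\<^sup>2 + 2 * (norm b)\<^sup>2"
      using sum_squares_bound[of "norm a" "norm b"] by (simp add: power2_sum)
    finally show ?thesis .
  qed
  have "integrable M (\<lambda>x. (norm (f x + g x))\<^sup>2)"
  proof (rule Bochner_Integration.integrable_bound)
    show "integrable M (\<lambda>x. 2 * (norm (f x))\<^sup>2 + 2 * (norm (g x))\<^sup>2)"
      using assms by (auto simp: L2_def)
  qed (auto simp: b)
  then show ?thesis by (simp add: L2_def)
qed

lemma L2_minus: "L2 M f \<Longrightarrow> L2 M g \<Longrightarrow> L2 M (\<lambda>x. f x - g x)"
  using L2_add[of M f "\<lambda>x. - 1 * g x"] L2_scale[of M g "- 1"] by simp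

lemma L2_sum: "(\<And>i. i \<in> A \<Longrightarrow> L2 M (f i)) \<Longrightarrow> L2 M (\<lambda>x. \<Sum>i\<in>A. f i x)"
  by (induction A rule: infinite_finite_induct) (auto simp: L2_0 L2_add)

lemma ip_self: "ip M f f = complex_of_real (nsq M f)"
proof -
  have "ip M f f = (LINT x|M. complex_of_real ((norm (f x))\<^sup>2))"
    unfolding ip_def by (simp only: complex_norm_square)
  then show ?thesis by (simp only: integral_complex_of_real)
qed

lemma ip_add: "L2 M f \<Longrightarrow> L2 M g \<Longrightarrow> L2 M h \<Longrightarrow> ip M (\<lambda>x. f x + g x) h = ip M f h + ip M g h"
  unfolding ip_def by (simp add: distrib_right L2_mult_integrable)

lemma ip_minus: "L2 M f \<Longrightarrow> L2 M g \<Longrightarrow> L2 M h \<Longrightarrow> ip M (\<lambda>x. f x - g x) h = ip M f h - ip M g h"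
  unfolding ip_def by (simp add: left_diff_distrib L2_mult_integrable)

lemma ip_scale: "ip M (\<lambda>x. a * f x) h = a * ip M f h"
  unfolding ip_def by (simp add: mult.assoc)

lemma ip_cnj: "cnj (ip M f g) = ip M g f"
  unfolding ip_def by (subst Bochner_Integration.integral_cnj[symmetric]) (simp add: mult.commute)

lemma ip_sum:
  "(\<And>i. i \<in> A \<Longrightarrow> L2 M (f i)) \<Longrightarrow> L2 M h \<Longrightarrow> ip M (\<lambda>x. \<Sum>i\<in>A. f i x) h = (\<Sum>i\<in>A. ip M (f i) h)"
  unfolding ip_def by (simp add: sum_distrib_right L2_mult_integrable)

locale orthonormal =
  fixes M :: "'a measure" and \<psi> :: "'i \<Rightarrow> 'a \<Rightarrow> complex"
  assumes L2: "\<And>i. L2 M (\<psi> i)"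
    and ortho: "\<And>i j. ip M (\<psi> i) (\<psi> j) = (if i = j then 1 else 0)"
begin

definition S :: "('i \<Rightarrow> complex) \<Rightarrow> 'i set \<Rightarrow> 'a \<Rightarrow> complex" where
  "S c A x = (\<Sum>i\<in>A. c i * \<psi> i x)"

lemma L2_S: "L2 M (S c A)"
  unfolding S_def by (intro L2_sum L2_scale L2)

lemma ip_S:
  assumes "finite A" "L2 M h"
  shows "ip M (S c A) h = (\<Sum>i\<in>A. c i * ip M (\<psi> i) h)"
  unfolding S_def using assms by (simp add: ip_sum L2_scale L2 ip_scale)

lemma ip_S_\<psi>:
  assumes "finite A" shows "ip M (S c A) (\<psi> j) = (if j \<in> A then c j else 0)"
  using assms by (simp add: ip_S L2 ortho if_distrib[of "\<lambda>x. _ * x"] cong: if_cong)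

lemma ip_S_S:
  assumes "finite A"
  shows "ip M (S c A) (S c A) = (\<Sum>i\<in>A. complex_of_real ((norm (c i))\<^sup>2))"
proof -
  have "ip M (\<psi> i) (S c A) = cnj (c i)" if "i \<in> A" for i
    using ip_cnj[of M "S c A" "\<psi> i"] ip_S_\<psi>[OF assms, of c i] that by simp
  then show ?thesis
    using assms by (simp add: ip_S L2_S complex_norm_square del: of_real_power)
qed

lemma nsq_S: "finite A \<Longrightarrow> nsq M (S c A) = (\<Sum>i\<in>A. (norm (c i))\<^sup>2)"
  using ip_S_S[of A c] unfolding ip_self by (metis of_real_sum of_real_eq_iff)

text \<open>Completing the square coefficient by coefficient. The coefficients \<open>c\<close> are
  arbitrary: the choice \<open>ip M f (\<psi> i)\<close> gives Bessel's inequality, while a general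
  \<open>c\<close> bounds the distance of the coefficients of \<open>f\<close> from prescribed
  ones.\<close>

lemma nsq_diff:
  assumes f: "L2 M f" and A: "finite A"
  shows "nsq M (\<lambda>x. f x - S c A x) =
     nsq M f - (\<Sum>i\<in>A. (norm (ip M f (\<psi> i)))\<^sup>2) + (\<Sum>i\<in>A. (norm (ip M f (\<psi> i) - c i))\<^sup>2)"
proof -
  have fS: "ip M (S c A) f = (\<Sum>i\<in>A. c i * cnj (ip M f (\<psi> i)))"
    using f A by (simp add: ip_S ip_cnj)
  define D where "D = (\<lambda>x. f x - S c A x)"
  have D: "L2 M D" unfolding D_def by (intro L2_minus f L2_S)
  have "complex_of_real (nsq M D) = ip M f D - ip M (S c A) D"
    unfolding ip_self[symmetric] by (subst (2) D_def) (simp add: ip_minus f L2_S D)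
  also have "ip M f D = cnj (ip M D f)" by (simp add: ip_cnj)
  also have "ip M D f = ip M f f - ip M (S c A) f" unfolding D_def by (simp add: ip_minus f L2_S)
  also have "ip M (S c A) D = cnj (ip M D (S c A))" by (simp add: ip_cnj)
  also have "ip M D (S c A) = ip M f (S c A) - ip M (S c A) (S c A)" unfolding D_def by (simp add: ip_minus f L2_S)
  also have "ip M f (S c A) = cnj (ip M (S c A) f)" by (simp add: ip_cnj)
  finally have "complex_of_real (nsq M D) = complex_of_real (nsq M f) - (\<Sum>i\<in>A. cnj (c i) * ip M f (\<psi> i))
     - (\<Sum>i\<in>A. c i * cnj (ip M f (\<psi> i))) + (\<Sum>i\<in>A. complex_of_real ((norm (c i))\<^sup>2))"
    using A by (simp add: fS ip_self nsq_S)
  also have "(\<Sum>i\<in>A. complex_of_real ((norm (c i))\<^sup>2)) =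
     (\<Sum>i\<in>A. complex_of_real ((norm (ip M f (\<psi> i) - c i))\<^sup>2) - complex_of_real ((norm (ip M f (\<psi> i)))\<^sup>2)
        + cnj (c i) * ip M f (\<psi> i) + c i * cnj (ip M f (\<psi> i)))"
    unfolding complex_norm_square by (intro sum.cong refl) (simp add: algebra_simps)
  also have "complex_of_real (nsq M f) - (\<Sum>i\<in>A. cnj (c i) * ip M f (\<psi> i))
     - (\<Sum>i\<in>A. c i * cnj (ip M f (\<psi> i))) + \<dots> =
     complex_of_real (nsq M f - (\<Sum>i\<in>A. (norm (ip M f (\<psi> i)))\<^sup>2) + (\<Sum>i\<in>A. (norm (ip M f (\<psi> i) - c i))\<^sup>2))"
    unfolding sum.distrib sum_subtractf of_real_add of_real_diff of_real_sum by simp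
  finally show ?thesis unfolding D_def by (simp only: of_real_eq_iff)
qed

lemma Bessel:
  assumes "L2 M f" "finite A"
  shows "(\<Sum>i\<in>A. (norm (ip M f (\<psi> i)))\<^sup>2) \<le> nsq M f"
proof -
  have "0 \<le> nsq M (\<lambda>x. f x - S (\<lambda>i. ip M f (\<psi> i)) A x)" by simp
  then show ?thesis using nsq_diff[OF assms, of "\<lambda>i. ip M f (\<psi> i)"] by simp
qed

lemma nsq_S_diff:
  assumes "finite B" "A \<subseteq> B"
  shows "nsq M (\<lambda>x. S c B x - S c A x) = (\<Sum>i\<in>B - A. (norm (c i))\<^sup>2)"
proof -
  have "S c B x - S c A x = S c (B - A) x" for x
    unfolding S_def using assms by (simp add: sum_diff)
  then show ?thesis using assms by (simp add: nsq_S)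
qed

end

section \<open>Finite exhaustion and the Riesz-Fischer theorem\<close>

text \<open>An increasing sequence of finite sets exhausting a countable index type. Fatou's lemma,
  almost everywhere convergence and termwise differentiation work along sequences, whereas
  \<open>has_sum\<close> uses the filter of finite subsets.\<close>

definition initial_set :: "nat \<Rightarrow> 'i::countable set" where
  "initial_set k = {i. to_nat i < k}"

lemma finite_initial_set [simp]: "finite (initial_set k :: 'i::countable set)"
  unfolding initial_set_def
  by (rule finite_imageD[of to_nat]) (auto intro: finite_subset[of _ "{..<k}"] inj_on_subset[OF inj_to_nat])

lemma initial_set_mono: "j \<le> k \<Longrightarrow> initial_set j \<subseteq> initial_set k"
  by (auto simp: initial_set_def)

lemma filterlim_initial_set:
  "filterlim (initial_set :: nat \<Rightarrow> 'i::countable set) (finite_subsets_at_top UNIV) sequentially"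
  unfolding filterlim_finite_subsets_at_top
proof safe
  fix X :: "'i set" assume "finite X"
  then obtain N where "\<forall>i\<in>X. to_nat i < N"
    using finite_nat_set_iff_bounded[of "to_nat ` X"] by auto
  then have "\<forall>n\<ge>N. X \<subseteq> initial_set n" by (auto simp: initial_set_def intro: less_le_trans)
  then show "\<forall>\<^sub>F y in sequentially. finite (initial_set y :: 'i set) \<and> X \<subseteq> initial_set y \<and> initial_set y \<subseteq> (UNIV :: 'i set)"
    by (auto simp: eventually_sequentially)
qed

lemma has_sum_initial_set:
  "(f has_sum s) UNIV \<Longrightarrow> (\<lambda>k. sum f (initial_set k)) \<longlonglongrightarrow> s"
  unfolding has_sum_def by (rule filterlim_compose[OF _ filterlim_initial_set])

text \<open>Besides the element with prescribed coefficients, a subsequence of the partial sums is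
  made to converge almost everywhere; this is what later identifies the abstract limit with the
  pointwise sum of an entire series.\<close>

lemma Riesz_Fischer:
  fixes \<psi> :: "'i::countable \<Rightarrow> 'a \<Rightarrow> complex" and c :: "'i \<Rightarrow> complex"
  assumes "orthonormal M \<psi>" and c: "(\<lambda>i. (norm (c i))\<^sup>2) summable_on UNIV"
  obtains f N where "L2 M f" "\<And>i. ip M f (\<psi> i) = c i" "nsq M f = (\<Sum>\<^sub>\<infinity>i. (norm (c i))\<^sup>2)"
    "strict_mono N" "AE x in M. (\<lambda>k. \<Sum>i\<in>initial_set (N k). c i * \<psi> i x) \<longlonglongrightarrow> f x"
proof -
  interpret orthonormal M \<psi> by fact
  define q where "q k = (\<Sum>i\<in>initial_set k. (norm (c i))\<^sup>2)" for k
  define s where "s = (\<Sum>\<^sub>\<infinity>i. (norm (c i))\<^sup>2)"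
  have "((\<lambda>i. (norm (c i))\<^sup>2) has_sum s) UNIV" unfolding s_def using c by (rule has_sum_infsum)
  then have q: "q \<longlonglongrightarrow> s" unfolding q_def by (rule has_sum_initial_set)
  have q_mono: "q j \<le> q k" if "j \<le> k" for j k
    unfolding q_def using initial_set_mono[OF that] by (intro sum_mono2) auto
  have q_le: "q k \<le> s" for k using q q_mono by (rule_tac incseq_le) (auto simp: incseq_def)
  have "\<exists>n. \<forall>k\<ge>n. s - q k < (1/8)^j" for j
  proof -
    have "\<forall>\<^sub>F k in sequentially. dist (q k) s < (1/8)^j" using q by (rule tendstoD) simp
    then show ?thesis by (auto simp: eventually_sequentially dist_real_def) (metis abs_ge_minus_self minus_diff_eq le_less_trans)
  qed
  then obtain n where n: "\<And>j k. n j \<le> k \<Longrightarrow> s - q k < (1/8)^j" by metis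
  \<comment> \<open>Adding up the \<open>Suc (n i)\<close> makes \<open>N\<close> strictly
    increasing and keeps \<open>n j \<le> N j\<close>.\<close>
  define N where "N j = (\<Sum>i\<le>j. Suc (n i))" for j
  have N: "strict_mono N" by (simp add: strict_mono_Suc_iff N_def)
  have "n j \<le> N j" for j unfolding N_def by (rule order_trans[OF _ member_le_sum[of j]]) auto
  then have sN: "s - q (N j) < (1/8)^j" for j by (rule n)
  define g where "g k = S c (initial_set (N k))" for k
  have L2g: "L2 M (g k)" for k unfolding g_def by (rule L2_S)
  have [measurable]: "g k \<in> borel_measurable M" for k using L2g by (rule L2_measurable)
  have gd: "nsq M (\<lambda>x. g j x - g k x) = q (N j) - q (N k)" if "k \<le> j" for j k
  proof -
    have sub: "initial_set (N k) \<subseteq> (initial_set (N j) :: 'i set)"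
      using N that by (intro initial_set_mono) (simp add: strict_mono_less_eq)
    then show ?thesis unfolding g_def by (simp add: nsq_S_diff q_def sum_diff)
  qed
  have gdn: "(\<integral>\<^sup>+x. ennreal ((norm (g j x - g k x))\<^sup>2) \<partial>M) = ennreal (q (N j) - q (N k))" if "k \<le> j" for j k
    using gd[OF that] L2_integrable[OF L2_minus[OF L2g L2g], of j k] by (simp add: nn_integral_eq_integral)
  \<comment> \<open>Successive differences have squared norm at most \<open>(1/8)^k\<close>; the
    weights \<open>2^k\<close> below still leave a convergent series and force, almost everywhere,
    the geometric decay \<open>sqrt (1/2) ^ k\<close> of \<open>d k x\<close>.\<close>
  define d where "d k x = g (Suc k) x - g k x" for k x
  have [measurable]: "d k \<in> borel_measurable M" for k unfolding d_def[abs_def] by measurable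
  have "(\<integral>\<^sup>+x. (\<Sum>k. ennreal (2^k * (norm (d k x))\<^sup>2)) \<partial>M) = (\<Sum>k. \<integral>\<^sup>+x. ennreal (2^k * (norm (d k x))\<^sup>2) \<partial>M)"
    by (rule nn_integral_suminf) measurable
  also have "\<dots> \<le> (\<Sum>k. ennreal ((1/4)^k))"
  proof (intro suminf_le)
    fix k
    have "(\<integral>\<^sup>+x. ennreal (2^k * (norm (d k x))\<^sup>2) \<partial>M) = ennreal (2^k) * ennreal (q (N (Suc k)) - q (N k))"
      using gdn[of k "Suc k"] by (simp add: ennreal_mult nn_integral_cmult d_def)
    also have "\<dots> \<le> ennreal (2^k) * ennreal ((1/8)^k)"
      using sN[of k] q_le[of "N (Suc k)"] by (intro mult_left_mono ennreal_leI) auto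
    also have "\<dots> = ennreal ((1/4)^k)" by (simp add: ennreal_mult[symmetric] power_mult_distrib[symmetric])
    finally show "(\<integral>\<^sup>+x. ennreal (2^k * (norm (d k x))\<^sup>2) \<partial>M) \<le> ennreal ((1/4)^k)" .
  qed auto
  also have "\<dots> = ennreal (\<Sum>k. (1/4)^k)" by (rule suminf_ennreal2) (auto simp: summable_geometric)
  also have "\<dots> < \<infinity>" by simp
  finally have "AE x in M. (\<Sum>k. ennreal (2^k * (norm (d k x))\<^sup>2)) \<noteq> \<infinity>"
    by (intro nn_integral_PInf_AE) auto
  then have conv: "AE x in M. convergent (\<lambda>k. g k x)"
  proof eventually_elim
    case (elim x)
    have "summable (\<lambda>k. 2^k * (norm (d k x))\<^sup>2)"
      by (rule summable_suminf_not_top) (use elim in auto)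
    then have "(\<lambda>k. 2^k * (norm (d k x))\<^sup>2) \<longlonglongrightarrow> 0" by (rule summable_LIMSEQ_zero)
    then have "Bseq (\<lambda>k. 2^k * (norm (d k x))\<^sup>2)" using convergentI convergent_imp_Bseq by blast
    then obtain K where K: "K > 0" and Kb: "\<forall>k. norm (2^k * (norm (d k x))\<^sup>2) \<le> K"
      unfolding Bseq_def by auto
    have "norm (d k x) \<le> sqrt K * sqrt (1/2) ^ k" for k
    proof (rule power2_le_imp_le)
      show "(norm (d k x))\<^sup>2 \<le> (sqrt K * sqrt (1/2) ^ k)\<^sup>2"
      proof -
        have e: "(sqrt (1/2) ^ k)\<^sup>2 = 1 / (2::real) ^ k"
          by (subst power_mult[symmetric], subst mult.commute, subst power_mult) (simp add: power_one_over)
        have "2^k * (norm (d k x))\<^sup>2 \<le> K" using Kb[rule_format, of k] by (simp add: norm_mult)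
        then show ?thesis using K unfolding power_mult_distrib e by (simp add: field_simps)
      qed
    qed (use K in auto)
    note dn = this
    have sg: "summable (\<lambda>k. sqrt K * sqrt (1/2) ^ k)"
      by (intro summable_mult summable_geometric) (auto simp: real_sqrt_divide)
    have "summable (\<lambda>k. d k x)" by (rule summable_comparison_test'[OF sg]) (rule dn)
    then have "convergent (\<lambda>n. \<Sum>k<n. d k x)" by (simp add: summable_iff_convergent)
    then have "convergent (\<lambda>n. g n x - g 0 x)" by (simp add: d_def sum_lessThan_telescope[of "\<lambda>k. g k x"])
    then have "convergent (\<lambda>n. (g n x - g 0 x) + g 0 x)" by (intro convergent_add convergent_const)
    then show ?case by simp
  qed
  define f where "f x = lim (\<lambda>k. g k x)" for x
  have [measurable]: "f \<in> borel_measurable M"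
    unfolding f_def by (rule borel_measurable_lim_metric) measurable
  have lim: "AE x in M. (\<lambda>k. g k x) \<longlonglongrightarrow> f x"
    using conv by eventually_elim (simp add: f_def convergent_LIMSEQ_iff)
  \<comment> \<open>Fatou's lemma in \<open>j\<close> for fixed \<open>k\<close>: the bound on
    \<open>g j - g k\<close> passes to the almost everywhere limit, which also puts \<open>f\<close>
    into the space.\<close>
  have fat: "(\<integral>\<^sup>+x. ennreal ((norm (f x - g k x))\<^sup>2) \<partial>M) \<le> ennreal (s - q (N k))" for k
  proof -
    have "(\<integral>\<^sup>+x. ennreal ((norm (f x - g k x))\<^sup>2) \<partial>M) = (\<integral>\<^sup>+x. liminf (\<lambda>j. ennreal ((norm (g j x - g k x))\<^sup>2)) \<partial>M)"
    proof (rule nn_integral_cong_AE)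
      show "AE x in M. ennreal ((norm (f x - g k x))\<^sup>2) = liminf (\<lambda>j. ennreal ((norm (g j x - g k x))\<^sup>2))"
        using lim
      proof eventually_elim
        case (elim x)
        have "(\<lambda>j. ennreal ((norm (g j x - g k x))\<^sup>2)) \<longlonglongrightarrow> ennreal ((norm (f x - g k x))\<^sup>2)"
          by (intro tendsto_ennrealI tendsto_intros elim)
        then show ?case by (intro lim_imp_Liminf[symmetric]) auto
      qed
    qed
    also have "\<dots> \<le> liminf (\<lambda>j. \<integral>\<^sup>+x. ennreal ((norm (g j x - g k x))\<^sup>2) \<partial>M)"
      by (rule nn_integral_liminf) measurable
    also have "\<dots> \<le> ennreal (s - q (N k))"
    proof (rule Liminf_le)
      show "\<forall>\<^sub>F j in sequentially. (\<integral>\<^sup>+x. ennreal ((norm (g j x - g k x))\<^sup>2) \<partial>M) \<le> ennreal (s - q (N k))"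
        using eventually_ge_at_top[of k]
        by eventually_elim (auto simp: gdn q_le intro!: ennreal_leI)
    qed auto
    finally show ?thesis .
  qed
  have L2d: "L2 M (\<lambda>x. f x - g k x)" for k
    unfolding L2_def using fat[of k] by (auto intro!: integrableI_bounded simp: less_top[symmetric] top_unique)
  have L2f: "L2 M f" using L2_add[OF L2d[of 0] L2g[of 0]] by simp
  have le: "nsq M (\<lambda>x. f x - g k x) \<le> (1/8)^k" for k
  proof -
    have "nsq M (\<lambda>x. f x - g k x) \<le> s - q (N k)"
      using fat[of k] q_le[of "N k"] L2_integrable[OF L2d[of k]] by (simp add: nn_integral_eq_integral)
    then show ?thesis using sN[of k] by simp
  qed
  have to0: "(\<lambda>k. nsq M (\<lambda>x. f x - g k x)) \<longlonglongrightarrow> 0"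
  proof (rule Lim_null_comparison)
    show "(\<lambda>k. (1/8::real)^k) \<longlonglongrightarrow> 0" by (rule LIMSEQ_power_zero) simp
  qed (simp add: le)
  have coeff: "ip M f (\<psi> i) = c i" for i
  proof -
    have "(norm (ip M f (\<psi> i) - c i))\<^sup>2 \<le> nsq M (\<lambda>x. f x - g k x)" if "k > to_nat i" for k
    proof -
      have "k \<le> N k" using N by (rule strict_mono_imp_increasing)
      then have i: "i \<in> initial_set (N k)" using that by (simp add: initial_set_def)
      have "(norm (ip M f (\<psi> i) - c i))\<^sup>2 \<le> (\<Sum>j\<in>initial_set (N k). (norm (ip M f (\<psi> j) - c j))\<^sup>2)"
        by (rule member_le_sum[OF i]) auto
      also have "\<dots> \<le> nsq M (\<lambda>x. f x - g k x)"
        unfolding g_def using nsq_diff[OF L2f, of "initial_set (N k)" c] Bessel[OF L2f, of "initial_set (N k)"] by simp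
      finally show ?thesis .
    qed
    then have "(norm (ip M f (\<psi> i) - c i))\<^sup>2 \<le> 0"
      by (intro LIMSEQ_le_const[OF to0]) (auto intro!: exI[of _ "Suc (to_nat i)"])
    then show ?thesis by simp
  qed
  have "nsq M f = nsq M (\<lambda>x. f x - g k x) + q (N k)" for k
    unfolding g_def using nsq_diff[OF L2f, of "initial_set (N k)" c] by (simp add: coeff q_def)
  then have "(\<lambda>k. nsq M (\<lambda>x. f x - g k x) + q (N k)) \<longlonglongrightarrow> nsq M f" by simp
  moreover have "(\<lambda>k. nsq M (\<lambda>x. f x - g k x) + q (N k)) \<longlonglongrightarrow> 0 + s"
    using LIMSEQ_subseq_LIMSEQ[OF q N] by (intro tendsto_add to0) (simp add: o_def)
  ultimately have "nsq M f = s" using LIMSEQ_unique by fastforce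
  then show ?thesis using that[OF L2f coeff _ N] lim unfolding s_def g_def S_def by blast
qed

subsection \<open>Hermite functions on the complex plane\<close>

text \<open>The Hermite polynomials, over any normed field so that one recursion covers real and
  complex arguments. In the uniform recursion \<open>Hp_Suc\<close> the index \<open>k - 1\<close>
  is 0 for \<open>k = 0\<close>, where the factor \<open>of_nat k\<close> makes the term
  vanish.\<close>

fun Hp :: "nat \<Rightarrow> 'a::real_normed_field \<Rightarrow> 'a" where
  "Hp 0 z = 1"
| "Hp (Suc 0) z = 2 * z"
| "Hp (Suc (Suc k)) z = 2 * z * Hp (Suc k) z - 2 * of_nat (Suc k) * Hp k z"

lemma Hp_Suc: "Hp (Suc k) z = 2 * z * Hp k z - 2 * of_nat k * Hp (k - 1) z"
  by (cases k) simp_all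

declare Hp.simps(2,3) [simp del]

lemma Hp_deriv: "(Hp k has_field_derivative 2 * of_nat k * Hp (k - 1) z) (at z)"
proof (induction k z rule: Hp.induct)
  case (1 z)
  have "Hp 0 = (\<lambda>z::'a. 1)" by auto
  then show ?case by simp
next
  case (2 z)
  have "Hp (Suc 0) = (\<lambda>z::'a. 2 * z)" by (auto simp: Hp.simps)
  then show ?case by (auto intro!: derivative_eq_intros)
next
  case (3 k z)
  have e: "Hp (Suc (Suc k)) = (\<lambda>z::'a. 2 * z * Hp (Suc k) z - 2 * of_nat (Suc k) * Hp k z)"
    by (auto simp: Hp.simps)
  have "((\<lambda>z::'a. 2 * z * Hp (Suc k) z - 2 * of_nat (Suc k) * Hp k z) has_field_derivative
     2 * Hp (Suc k) z + 2 * z * (2 * of_nat (Suc k) * Hp k z) - 2 * of_nat (Suc k) * (2 * of_nat k * Hp (k - 1) z)) (at z)"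
    by (auto intro!: derivative_eq_intros 3 simp del: of_nat_Suc)
  also have "2 * Hp (Suc k) z + 2 * z * (2 * of_nat (Suc k) * Hp k z) - 2 * of_nat (Suc k) * (2 * of_nat k * Hp (k - 1) z)
     = 2 * Hp (Suc k) z + 2 * of_nat (Suc k) * (2 * z * Hp k z - 2 * of_nat k * Hp (k - 1) z)"
    by (simp add: algebra_simps)
  also have "\<dots> = 2 * of_nat (Suc (Suc k)) * Hp (Suc k) z"
    unfolding Hp_Suc[symmetric] by (simp add: algebra_simps)
  finally show ?case unfolding e by simp
qed

lemmas Hp_has_field_derivative [derivative_intros] = Hp_deriv[THEN DERIV_chain2]

lemma continuous_on_Hp [continuous_intros]: "continuous_on S f \<Longrightarrow> continuous_on S (\<lambda>x. Hp k (f x))"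
proof -
  have "continuous_on UNIV (Hp k :: 'b \<Rightarrow> 'b)" by (meson Hp_deriv DERIV_isCont continuous_at_imp_continuous_on)
  then show "continuous_on S f \<Longrightarrow> continuous_on S (\<lambda>x. Hp k (f x))"
    by (rule continuous_on_compose2) auto
qed

lemma Hp_of_real: "Hp k (complex_of_real x) = complex_of_real (Hp k x)"
  by (induction k x rule: Hp.induct) (simp_all add: Hp.simps)

lemma funpow_deriv_gauss:
  "(deriv ^^ k) (\<lambda>u::real. exp (- (u\<^sup>2))) = (\<lambda>u. (-1) ^ k * Hp k u * exp (- (u\<^sup>2)))"
proof (induction k)
  case (Suc k)
  have "((\<lambda>u. (-1) ^ k * Hp k u * exp (- (u\<^sup>2))) has_field_derivative (-1) ^ Suc k * Hp (Suc k) u * exp (- (u\<^sup>2))) (at u)" for u :: real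
    unfolding Hp_Suc by (auto intro!: derivative_eq_intros simp: algebra_simps)
  then have "deriv (\<lambda>u. (-1) ^ k * Hp k u * exp (- (u\<^sup>2))) = (\<lambda>u::real. (-1) ^ Suc k * Hp (Suc k) u * exp (- (u\<^sup>2)))"
    by (intro ext DERIV_imp_deriv)
  then show ?case using Suc by simp
qed simp

definition hnorm :: "nat \<Rightarrow> real" where
  "hnorm k = sqrt (2 ^ k * fact k * sqrt pi)"

lemma hnorm_pos: "hnorm k > 0"
  by (simp add: hnorm_def)

lemma hermite_fun_eq: "hermite_fun k x = Hp k x * exp (- (x\<^sup>2) / 2) / hnorm k"
proof -
  have "exp (- (x\<^sup>2)) * exp (x\<^sup>2 / 2) = exp (- (x\<^sup>2) / 2)" by (simp add: exp_add[symmetric] field_simps)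
  moreover have "(-1::real) ^ k * (-1) ^ k = 1" by (simp add: power_add[symmetric])
  moreover have "(-1) ^ k * ((-1) ^ k * Hp k x * exp (- (x\<^sup>2))) * exp (x\<^sup>2 / 2) =
      ((-1) ^ k * (-1) ^ k) * (Hp k x * (exp (- (x\<^sup>2)) * exp (x\<^sup>2 / 2)))"
    by (simp only: mult_ac)
  ultimately show ?thesis
    unfolding hermite_fun_def funpow_deriv_gauss hnorm_def by (simp only: mult_1)
qed

definition hc :: "nat \<Rightarrow> complex \<Rightarrow> complex" where
  "hc k z = Hp k z * exp (- (z\<^sup>2) / 2) / complex_of_real (hnorm k)"

lemma hc_of_real: "hc k (complex_of_real x) = complex_of_real (hermite_fun k x)"
  by (simp add: hc_def hermite_fun_eq Hp_of_real exp_of_real[symmetric])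

lemma continuous_on_hc [continuous_intros]: "continuous_on S f \<Longrightarrow> continuous_on S (\<lambda>x. hc k (f x))"
  unfolding hc_def using hnorm_pos[of k] by (auto intro!: continuous_intros)

lemma holomorphic_on_hc: "hc k holomorphic_on S"
proof -
  have "(Hp k :: complex \<Rightarrow> complex) holomorphic_on S"
    by (meson Hp_deriv field_differentiable_def holomorphic_on_def field_differentiable_at_within)
  then show ?thesis
    unfolding hc_def[abs_def] using hnorm_pos[of k] by (intro holomorphic_intros) auto
qed

subsection \<open>Gaussian bounds and integrals\<close>

text \<open>A single term of the exponential series bounds \<open>(1 + r) ^ k / fact k\<close> by
  \<open>exp (1 + r)\<close>, and completing the square gives
  \<open>r \<le> \<delta> r^2 + 1 / (4 \<delta>)\<close>.\<close>

lemma pow_le_gauss: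
  assumes "\<delta> > (0::real)"
  obtains C where "C > 0" "\<And>r. r \<ge> 0 \<Longrightarrow> (1 + r) ^ k \<le> C * exp (\<delta> * r\<^sup>2)"
proof
  show "fact k * exp (1 + 1 / (4 * \<delta>)) > 0" by simp
  fix r :: real assume r: "r \<ge> 0"
  have "(1 + r) ^ k / fact k \<le> exp (1 + r)"
  proof -
    have "sum (\<lambda>n. (1 + r) ^ n /\<^sub>R fact n) {k} \<le> (\<Sum>n. (1 + r) ^ n /\<^sub>R fact n)"
      by (rule sum_le_suminf) (use r in \<open>auto simp: summable_exp\<close>)
    then show ?thesis by (simp add: exp_def divide_inverse mult.commute)
  qed
  then have "(1 + r) ^ k \<le> fact k * exp (1 + r)" by (simp add: field_simps)
  also have "r \<le> \<delta> * r\<^sup>2 + 1 / (4 * \<delta>)"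
  proof -
    have "0 \<le> \<delta> * (r - 1 / (2 * \<delta>))\<^sup>2" using assms by simp
    also have "\<delta> * (r - 1 / (2 * \<delta>))\<^sup>2 = \<delta> * r\<^sup>2 - r + 1 / (4 * \<delta>)"
      using assms by (simp add: field_simps power2_eq_square)
    finally show ?thesis by simp
  qed
  then have "fact k * exp (1 + r) \<le> fact k * exp (1 + 1 / (4 * \<delta>) + \<delta> * r\<^sup>2)" by simp
  also have "\<dots> = fact k * exp (1 + 1 / (4 * \<delta>)) * exp (\<delta> * r\<^sup>2)" by (simp add: exp_add)
  finally show "(1 + r) ^ k \<le> fact k * exp (1 + 1 / (4 * \<delta>)) * exp (\<delta> * r\<^sup>2)" .
qed

text \<open>The characteristic function of the standard normal distribution, rescaled by
  \<open>sqrt (2 a)\<close>.\<close>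

lemma gauss_fourier:
  fixes a \<xi> :: real
  assumes a: "a > 0"
  shows gauss_fourier_integrable: "integrable lborel (\<lambda>y. exp (\<i> * \<xi> * y - complex_of_real (a * y\<^sup>2)))"
    and gauss_fourier_integral:
      "(LINT y|lborel. exp (\<i> * \<xi> * y - complex_of_real (a * y\<^sup>2))) = complex_of_real (sqrt (pi / a) * exp (- \<xi>\<^sup>2 / (4 * a)))"
proof -
  define c where "c = sqrt (2 * a)"
  have c: "c > 0" "c\<^sup>2 = 2 * a" using a by (auto simp: c_def)
  define g where "g y = std_normal_density y *\<^sub>R iexp (\<xi> / c * y)" for y
  have gc: "g (0 + c * y) = complex_of_real (1 / sqrt (2 * pi)) * exp (\<i> * \<xi> * y - complex_of_real (a * y\<^sup>2))" for y
  proof -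
    have "g (0 + c * y) = complex_of_real (1 / sqrt (2 * pi)) * (exp (complex_of_real (- (c * y)\<^sup>2 / 2)) * exp (\<i> * complex_of_real (\<xi> / c * (c * y))))"
      by (simp add: g_def std_normal_density_def scaleR_conv_of_real exp_of_real[symmetric])
    also have "- (c * y)\<^sup>2 / 2 = - (a * y\<^sup>2)" by (simp add: power_mult_distrib c)
    also have "\<xi> / c * (c * y) = \<xi> * y" using c by simp
    finally show ?thesis by (simp add: exp_add[symmetric] algebra_simps)
  qed
  interpret real_distribution std_normal_distribution by (rule real_dist_normal_dist)
  have "(\<lambda>y. complex_of_real (\<xi> / c * y)) \<in> borel_measurable std_normal_distribution"
    by (simp add: borel_measurable_continuous_onI continuous_intros)
  then have "integrable std_normal_distribution (\<lambda>y. iexp (\<xi> / c * y))" by (rule integrable_iexp) simp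
  then have gi: "integrable lborel g"
    unfolding g_def by (subst (asm) integrable_density) auto
  have "(LINT y|lborel. g y) = char std_normal_distribution (\<xi> / c)"
    unfolding char_def g_def by (subst integral_density) auto
  also have "\<dots> = complex_of_real (exp (- (\<xi>\<^sup>2) / (4 * a)))"
    unfolding char_std_normal_distribution by (simp add: power_divide c)
  finally have gI: "(LINT y|lborel. g y) = complex_of_real (exp (- (\<xi>\<^sup>2) / (4 * a)))" .
  have "integrable lborel (\<lambda>y. complex_of_real (sqrt (2 * pi)) * g (0 + c * y))"
    using lborel_integrable_real_affine[OF gi, of c 0] c by (intro integrable_mult_right) auto
  then show "integrable lborel (\<lambda>y. exp (\<i> * \<xi> * y - complex_of_real (a * y\<^sup>2)))"
    unfolding gc by (simp add: mult.assoc[symmetric] of_real_mult[symmetric] del: of_real_mult)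
  have "(LINT y|lborel. exp (\<i> * \<xi> * y - complex_of_real (a * y\<^sup>2))) = (LINT y|lborel. complex_of_real (sqrt (2 * pi)) * g (0 + c * y))"
    unfolding gc by (simp add: mult.assoc[symmetric] of_real_mult[symmetric] del: of_real_mult)
  also have "\<dots> = complex_of_real (sqrt (2 * pi)) * (LINT y|lborel. g (0 + c * y))" by simp
  also have "(LINT y|lborel. g (0 + c * y)) = complex_of_real (exp (- (\<xi>\<^sup>2) / (4 * a))) / c"
    using lborel_integral_real_affine[of c g 0] gI c by (simp add: field_simps scaleR_conv_of_real)
  also have "complex_of_real (sqrt (2 * pi)) * (complex_of_real (exp (- (\<xi>\<^sup>2) / (4 * a))) / c) =
     complex_of_real (sqrt (2 * pi) / c * exp (- (\<xi>\<^sup>2) / (4 * a)))" by simp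
  also have "sqrt (2 * pi) / c = sqrt (pi / a)" unfolding c_def by (simp add: real_sqrt_divide[symmetric])
  finally show "(LINT y|lborel. exp (\<i> * \<xi> * y - complex_of_real (a * y\<^sup>2))) = complex_of_real (sqrt (pi / a) * exp (- \<xi>\<^sup>2 / (4 * a)))"
    by simp
qed

lemma integrable_gauss:
  assumes "a > 0"
  shows "integrable lborel (\<lambda>y::real. exp (- a * y\<^sup>2))"
proof -
  have "integrable lborel (\<lambda>y. norm (exp (\<i> * complex_of_real 0 * y - complex_of_real (a * y\<^sup>2))))"
    by (rule integrable_norm, rule gauss_fourier_integrable[OF assms])
  then show ?thesis by (simp add: norm_exp_eq_Re)
qed

lemma norm_vec_power2: "(norm (x :: 'a::real_normed_vector ^ 'n))\<^sup>2 = (\<Sum>i\<in>UNIV. (norm (x $ i))\<^sup>2)"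
  by (simp add: norm_vec_def L2_set_def sum_nonneg)

lemma integrable_gauss_vec:
  assumes a: "a > 0"
  shows "integrable lborel (\<lambda>x::real^'n. exp (- a * (norm x)\<^sup>2))"
proof -
  have "integrable lborel (\<lambda>y. complex_of_real (exp (- a * y\<^sup>2)))"
    using integrable_gauss[OF a] by (rule integrable_of_real)
  then have "integrable lborel (\<lambda>x::real^'n. \<Prod>i\<in>UNIV. complex_of_real (exp (- a * (x $ i)\<^sup>2)))"
    by (rule integrable_lborel_vec_prod)
  then have "integrable lborel (\<lambda>x::real^'n. norm (\<Prod>i\<in>UNIV. complex_of_real (exp (- a * (x $ i)\<^sup>2))))"
    by (rule integrable_norm)
  also have "(\<lambda>x::real^'n. norm (\<Prod>i\<in>UNIV. complex_of_real (exp (- a * (x $ i)\<^sup>2)))) = (\<lambda>x. exp (- a * (norm x)\<^sup>2))"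
    by (simp add: prod_norm[symmetric] norm_vec_power2 sum_distrib_left exp_sum sum_negf[symmetric])
  finally show ?thesis .
qed

lemma integrable_gauss_poly:
  assumes a: "a > 0"
  shows "integrable lborel (\<lambda>x::real. (1 + \<bar>x\<bar>) ^ k * exp (- a * x\<^sup>2))"
proof -
  obtain C where C: "C > 0" "\<And>r. r \<ge> 0 \<Longrightarrow> (1 + r) ^ k \<le> C * exp ((a/2) * r\<^sup>2)"
    using pow_le_gauss[of "a/2" k] a by auto
  show ?thesis
  proof (rule Bochner_Integration.integrable_bound)
    show "integrable lborel (\<lambda>x::real. C * exp (- (a/2) * x\<^sup>2))"
      using a by (intro integrable_mult_right integrable_gauss) auto
    show "AE x in lborel. norm ((1 + \<bar>x\<bar>) ^ k * exp (- a * x\<^sup>2)) \<le> norm (C * exp (- (a/2) * x\<^sup>2))"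
    proof (rule AE_I2)
      fix x :: real
      have "(1 + \<bar>x\<bar>) ^ k * exp (- a * x\<^sup>2) \<le> C * exp ((a/2) * \<bar>x\<bar>\<^sup>2) * exp (- a * x\<^sup>2)"
        by (intro mult_right_mono C) auto
      also have "\<dots> = C * exp (- (a/2) * x\<^sup>2)" by (simp add: exp_add[symmetric])
      finally show "norm ((1 + \<bar>x\<bar>) ^ k * exp (- a * x\<^sup>2)) \<le> norm (C * exp (- (a/2) * x\<^sup>2))"
        using C(1) by simp
    qed
  qed auto
qed

lemma integrable_gauss_boundI:
  fixes f :: "real \<Rightarrow> 'b::{banach, second_countable_topology}"
  assumes "continuous_on UNIV f" "a > 0" "\<And>x. norm (f x) \<le> C * (1 + \<bar>x\<bar>) ^ k * exp (- a * x\<^sup>2)"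
  shows "integrable lborel f"
proof (rule Bochner_Integration.integrable_bound)
  show "integrable lborel (\<lambda>x::real. C * ((1 + \<bar>x\<bar>) ^ k * exp (- a * x\<^sup>2)))"
    by (intro integrable_mult_right integrable_gauss_poly assms)
  show "f \<in> borel_measurable lborel" using assms(1) by (simp add: borel_measurable_continuous_onI)
  show "AE x in lborel. norm (f x) \<le> norm (C * ((1 + \<bar>x\<bar>) ^ k * exp (- a * x\<^sup>2)))"
    using assms(3) by (intro AE_I2) (simp add: mult.assoc, meson abs_ge_self order_trans)
qed

lemma tendsto_gauss_bound:
  fixes f :: "real \<Rightarrow> 'b::real_normed_vector"
  assumes a: "a > 0" and f: "\<And>x. norm (f x) \<le> C * (1 + \<bar>x\<bar>) ^ k * exp (- a * x\<^sup>2)"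
  shows "(f \<longlongrightarrow> 0) at_top" "(f \<longlongrightarrow> 0) at_bot"
proof -
  obtain D where D: "D > 0" "\<And>r. r \<ge> 0 \<Longrightarrow> (1 + r) ^ k \<le> D * exp ((a/2) * r\<^sup>2)"
    using pow_le_gauss[of "a/2" k] a by auto
  have b: "norm (f x) \<le> \<bar>C\<bar> * D * exp (- (a/2) * x\<^sup>2)" for x
  proof -
    have "norm (f x) \<le> \<bar>C\<bar> * (1 + \<bar>x\<bar>) ^ k * exp (- a * x\<^sup>2)"
      using f[of x] by (rule order_trans) (intro mult_right_mono, auto)
    also have "\<dots> \<le> \<bar>C\<bar> * (D * exp ((a/2) * \<bar>x\<bar>\<^sup>2)) * exp (- a * x\<^sup>2)"
      by (intro mult_right_mono mult_left_mono D) auto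
    also have "\<dots> = \<bar>C\<bar> * D * exp (- (a/2) * x\<^sup>2)" by (simp add: exp_add[symmetric])
    finally show ?thesis .
  qed
  have "((\<lambda>x. \<bar>C\<bar> * D * exp (- (a/2) * x\<^sup>2)) \<longlongrightarrow> 0) at_top" using a by real_asymp
  then show "(f \<longlongrightarrow> 0) at_top" by (rule Lim_null_comparison[rotated]) (intro always_eventually allI b)
  have "((\<lambda>x. \<bar>C\<bar> * D * exp (- (a/2) * x\<^sup>2)) \<longlongrightarrow> 0) at_bot" using a by real_asymp
  then show "(f \<longlongrightarrow> 0) at_bot" by (rule Lim_null_comparison[rotated]) (intro always_eventually allI b)
qed

lemma integral_deriv_eq_0:
  fixes F f :: "real \<Rightarrow> complex"
  assumes "\<And>x. (F has_vector_derivative f x) (at x)" "continuous_on UNIV f" "integrable lborel f"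
    and "(F \<longlongrightarrow> 0) at_top" "(F \<longlongrightarrow> 0) at_bot"
  shows "(LINT x|lborel. f x) = 0"
proof -
  have "(LBINT x=-\<infinity>..\<infinity>. f x) = 0 - 0"
  proof (rule interval_integral_FTC_integrable)
    show "set_integrable lborel (einterval (- \<infinity>) \<infinity>) f"
      using assms(3) by (simp add: set_integrable_def einterval_def)
    show "((F \<circ> real_of_ereal) \<longlongrightarrow> 0) (at_right (- \<infinity>))" "((F \<circ> real_of_ereal) \<longlongrightarrow> 0) (at_left \<infinity>)"
      using assms(4,5) by (auto simp: ereal_tendsto_simps1)
  qed (use assms in \<open>auto simp: continuous_on_eq_continuous_at\<close>)
  then show ?thesis by (simp add: interval_lebesgue_integral_def set_lebesgue_integral_def einterval_def)
qed

lemma Hp_bound: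
  obtains C where "C > 0" "\<And>z::'a::real_normed_field. norm (Hp k z) \<le> C * (1 + norm z) ^ k"
proof -
  have "\<exists>C>0. \<forall>z::'a. norm (Hp k z) \<le> C * (1 + norm z) ^ k"
  proof (induction k rule: less_induct)
    case (less k)
    show ?case
    proof (cases k)
      case 0 then show ?thesis by (intro exI[of _ 1]) auto
    next
      case (Suc m)
      obtain C1 where C1: "C1 > 0" "\<And>z::'a. norm (Hp m z) \<le> C1 * (1 + norm z) ^ m"
        using less[of m] Suc by auto
      obtain C2 where C2: "C2 > 0" "\<And>z::'a. norm (Hp (m - 1) z) \<le> C2 * (1 + norm z) ^ (m - 1)"
      proof -
        have "m - 1 < k" using Suc by simp
        from less[OF this] show ?thesis using that by blast
      qed
      have "norm (Hp k z) \<le> (2 * C1 + 2 * real m * C2) * (1 + norm z) ^ k" for z :: 'a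
      proof -
        have "norm (Hp k z) \<le> 2 * norm z * norm (Hp m z) + 2 * real m * norm (Hp (m - 1) z)"
          unfolding Suc Hp_Suc by (rule norm_triangle_ineq4[THEN order_trans]) (simp add: norm_mult)
        also have "\<dots> \<le> 2 * (1 + norm z) * (C1 * (1 + norm z) ^ m) + 2 * real m * (C2 * (1 + norm z) ^ k)"
        proof (intro add_mono mult_mono mult_left_mono C1)
          have "(1 + norm z) ^ (m - 1) \<le> (1 + norm z) ^ k" by (intro power_increasing) (auto simp: Suc)
          then show "norm (Hp (m - 1) z) \<le> C2 * (1 + norm z) ^ k"
            using C2 by (meson less_imp_le mult_left_mono order_trans)
        qed auto
        also have "\<dots> = (2 * C1 + 2 * real m * C2) * (1 + norm z) ^ k"
          unfolding Suc by (simp add: algebra_simps)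
        finally show ?thesis .
      qed
      then show ?thesis using C1(1) C2(1) by (intro exI[of _ "2 * C1 + 2 * real m * C2"]) (auto intro: add_pos_nonneg)
    qed
  qed
  then show ?thesis using that by blast
qed

lemma vector_derivative_of_real_line:
  assumes "(G has_field_derivative g) (at (complex_of_real x))"
  shows "((\<lambda>x. G (complex_of_real x)) has_vector_derivative g) (at x)"
proof -
  have "(complex_of_real has_vector_derivative 1) (at x)"
    using has_vector_derivative_of_real[OF DERIV_ident, of "at x"] by simp
  from field_vector_diff_chain_at[OF this assms] show ?thesis by (simp add: o_def)
qed

text \<open>Integration by parts without boundary terms. It is applied with \<open>G\<close> a
  Hermite polynomial, or a product of two, times a Gaussian and with \<open>g\<close> its expanded
  derivative, so that the conclusion is a linear relation between integrals.\<close>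

lemma integral_holomorphic_deriv_eq_0:
  fixes G g :: "complex \<Rightarrow> complex"
  assumes "\<And>z. (G has_field_derivative g z) (at z)" "continuous_on UNIV g" "a > 0"
    and "\<And>x::real. norm (G x) \<le> C * (1 + \<bar>x\<bar>) ^ k * exp (- a * x\<^sup>2)"
    and "integrable lborel (\<lambda>x::real. g x)"
  shows "(LINT x|lborel. g (complex_of_real x)) = 0"
proof (rule integral_deriv_eq_0)
  show "((\<lambda>x. G (complex_of_real x)) has_vector_derivative g (complex_of_real x)) (at x)" for x
    by (rule vector_derivative_of_real_line) (rule assms)
  show "continuous_on UNIV (\<lambda>x. g (complex_of_real x))"
    by (rule continuous_on_compose2[OF assms(2)]) (auto intro: continuous_intros)
  show "((\<lambda>x. G (complex_of_real x)) \<longlongrightarrow> 0) at_top" "((\<lambda>x. G (complex_of_real x)) \<longlongrightarrow> 0) at_bot"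
    using tendsto_gauss_bound[OF assms(3,4)] by auto
qed (rule assms)

section \<open>Orthonormality of the Hermite functions\<close>

lemma Hp_gauss_integrable:
  "integrable lborel (\<lambda>x. Hp j (complex_of_real x) * Hp k (complex_of_real x) * exp (- (complex_of_real x)\<^sup>2))"
  and Hp_gauss_bound: "\<exists>C. \<forall>x. norm (Hp j (complex_of_real x) * Hp k (complex_of_real x) * exp (- (complex_of_real x)\<^sup>2))
     \<le> C * (1 + \<bar>x\<bar>) ^ (j + k) * exp (- 1 * x\<^sup>2)"
proof -
  obtain C where C: "C > 0" "\<And>z::complex. norm (Hp j z) \<le> C * (1 + norm z) ^ j" using Hp_bound[of j] by blast
  obtain D where D: "D > 0" "\<And>z::complex. norm (Hp k z) \<le> D * (1 + norm z) ^ k" using Hp_bound[of k] by blast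
  have b: "norm (Hp j (complex_of_real x) * Hp k (complex_of_real x) * exp (- (complex_of_real x)\<^sup>2))
     \<le> C * D * (1 + \<bar>x\<bar>) ^ (j + k) * exp (- 1 * x\<^sup>2)" for x
  proof -
    have "norm (Hp j (complex_of_real x)) * norm (Hp k (complex_of_real x)) \<le> (C * (1 + \<bar>x\<bar>) ^ j) * (D * (1 + \<bar>x\<bar>) ^ k)"
      using C(2)[of "complex_of_real x"] D(2)[of "complex_of_real x"] C(1) D(1)
      by (intro mult_mono) auto
    moreover have "norm (exp (- (complex_of_real x)\<^sup>2)) = exp (- 1 * x\<^sup>2)" by (simp add: norm_exp_eq_Re)
    ultimately show ?thesis
      by (simp add: norm_mult power_add mult_ac)
  qed
  then show "\<exists>C. \<forall>x. norm (Hp j (complex_of_real x) * Hp k (complex_of_real x) * exp (- (complex_of_real x)\<^sup>2))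
     \<le> C * (1 + \<bar>x\<bar>) ^ (j + k) * exp (- 1 * x\<^sup>2)" by blast
  show "integrable lborel (\<lambda>x. Hp j (complex_of_real x) * Hp k (complex_of_real x) * exp (- (complex_of_real x)\<^sup>2))"
    by (rule integrable_gauss_boundI[OF _ _ b]) (auto intro!: continuous_intros)
qed

text \<open>The derivative of \<open>Hp j * Hp k * exp (- z^2)\<close> is
  \<open>2 k * Hp j * Hp (k - 1) - Hp (j + 1) * Hp k\<close>, times the Gaussian. Its integral
  vanishes, which lowers both indices at once, down to the Gaussian integral
  \<open>sqrt pi\<close>.\<close>

lemma integral_Hp_Hp:
  "(LINT x|lborel. Hp j (complex_of_real x) * Hp k (complex_of_real x) * exp (- (complex_of_real x)\<^sup>2)) =
     (if j = k then complex_of_real ((hnorm k)\<^sup>2) else 0)"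
proof -
  define K where "K j k = (LINT x|lborel. Hp j (complex_of_real x) * Hp k (complex_of_real x) * exp (- (complex_of_real x)\<^sup>2))" for j k
  have step: "K (Suc j) k = 2 * of_nat k * K j (k - 1)" for j k
  proof -
    obtain C where C: "\<And>x. norm (Hp j (complex_of_real x) * Hp k (complex_of_real x) * exp (- (complex_of_real x)\<^sup>2))
     \<le> C * (1 + \<bar>x\<bar>) ^ (j + k) * exp (- 1 * x\<^sup>2)" using Hp_gauss_bound by blast
    define g where "g z = 2 * of_nat k * (Hp j z * Hp (k - 1) z * exp (- z\<^sup>2)) - Hp (Suc j) z * Hp k z * exp (- z\<^sup>2)" for z :: complex
    have gi: "(LINT x|lborel. g (complex_of_real x)) = 2 * of_nat k * K j (k - 1) - K (Suc j) k"
      unfolding g_def K_def by (simp add: Hp_gauss_integrable)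
    have "(LINT x|lborel. g (complex_of_real x)) = 0"
    proof (rule integral_holomorphic_deriv_eq_0[OF _ _ _ C])
      show "((\<lambda>z. Hp j z * Hp k z * exp (- z\<^sup>2)) has_field_derivative g z) (at z)" for z
        unfolding g_def Hp_Suc by (auto intro!: derivative_eq_intros simp: algebra_simps)
      show "integrable lborel (\<lambda>x. g (complex_of_real x))"
        unfolding g_def by (intro Bochner_Integration.integrable_diff integrable_mult_right Hp_gauss_integrable)
      show "continuous_on UNIV g" unfolding g_def by (intro continuous_intros)
    qed simp
    then show ?thesis using gi by simp
  qed
  have sym: "K j k = K k j" for j k unfolding K_def by (simp add: mult_ac)
  have K00: "K 0 0 = sqrt pi"
    unfolding K_def using gauss_fourier_integral[of 1 0] by simp
  have "K j k = (if j = k then complex_of_real ((hnorm k)\<^sup>2) else 0)" for j k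
  proof (induction j arbitrary: k)
    case 0
    then show ?case using K00 sym[of 0 k] step[of "k - 1" 0] by (cases k) (auto simp: hnorm_def)
  next
    case (Suc j)
    then show ?case using step[of j k] by (cases k) (auto simp: hnorm_def)
  qed
  then show ?thesis unfolding K_def .
qed

lemma hc_mult: "hc j (complex_of_real x) * hc k (complex_of_real x) =
  Hp j (complex_of_real x) * Hp k (complex_of_real x) * exp (- (complex_of_real x)\<^sup>2) / complex_of_real (hnorm j * hnorm k)"
  by (simp add: hc_def exp_add[symmetric] field_simps)

lemma integrable_hc_hc: "integrable lborel (\<lambda>x. hc j (complex_of_real x) * hc k (complex_of_real x))"
  unfolding hc_mult by (intro integrable_divide_zero impI Hp_gauss_integrable)

lemma integral_hc_hc:
  "(LINT x|lborel. hc j (complex_of_real x) * hc k (complex_of_real x)) = (if j = k then 1 else 0)"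
  unfolding hc_mult integral_divide_zero integral_Hp_Hp using hnorm_pos[of k] by (simp add: power2_eq_square)

subsection \<open>A Gaussian transform of the Hermite functions\<close>

text \<open>The integrand is \<open>Hp k (x - 2 i y)\<close> times a Gaussian in \<open>y\<close>.
  The recursion for \<open>Hp\<close> produces first moments in \<open>y\<close>, integration by
  parts removes them, and what is left is the recursion satisfied by
  \<open>\<rho> ^ k * Hp k x\<close> with \<open>\<rho> = (1 + T) / (1 - T)\<close>.\<close>

lemma hermite_gauss_transform:
  fixes T x :: real
  assumes T: "0 < T" "T < 1"
  shows "(LINT y|lborel. hc k (x - 2 * \<i> * y) * exp (T * (x - \<i> * y)\<^sup>2 - y\<^sup>2 / T)) =
     complex_of_real (sqrt (pi * T) / (1 - T) * ((1 + T) / (1 - T)) ^ k) * hc k x"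
proof -
  \<comment> \<open>The coefficient of \<open>- y^2\<close> in the exponent of \<open>G\<close>,
    namely \<open>T + 1 / T - 2\<close>.\<close>
  define a where "a = (1 - T)\<^sup>2 / T"
  have a: "a > 0" using T by (simp add: a_def)
  define \<rho> where "\<rho> = (1 + T) / (1 - T)"
  define G where "G w = exp (T * (x - \<i> * w)\<^sup>2 - w\<^sup>2 / T - (x - 2 * \<i> * w)\<^sup>2 / 2)" for w :: complex
  have G_eq: "G w = exp (complex_of_real (x\<^sup>2 * (T - 1/2))) * exp (\<i> * complex_of_real (2 * x * (1 - T)) * w - complex_of_real a * w\<^sup>2)" for w
    unfolding G_def a_def exp_add[symmetric] using T
    by (intro arg_cong[of _ _ exp]) (simp add: divide_simps power2_eq_square, simp add: algebra_simps)
  have Gn: "norm (G (complex_of_real y)) = exp (x\<^sup>2 * (T - 1/2)) * exp (- a * y\<^sup>2)" for y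
    unfolding G_eq by (simp add: norm_mult norm_exp_eq_Re)
  have G': "(G has_field_derivative (G w * (2 * \<i> * x * (1 - T) - 2 * a * w))) (at w)" for w :: complex
    unfolding G_eq by (auto intro!: derivative_eq_intros simp: algebra_simps)
  have Gc: "continuous_on UNIV G" unfolding G_eq by (intro continuous_intros)
  have bound: "\<exists>C. \<forall>y. norm (complex_of_real y ^ p * (Hp k (x - 2 * \<i> * complex_of_real y) * G y)) \<le> C * (1 + \<bar>y\<bar>) ^ (p + k) * exp (- a * y\<^sup>2)" for p k
  proof -
    obtain C where C: "C > 0" "\<And>z::complex. norm (Hp k z) \<le> C * (1 + norm z) ^ k" using Hp_bound[of k] by blast
    define D where "D = C * (2 * (1 + \<bar>x\<bar>)) ^ k * exp (x\<^sup>2 * (T - 1/2))"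
    have "norm (complex_of_real y ^ p * (Hp k (x - 2 * \<i> * complex_of_real y) * G y)) \<le> D * (1 + \<bar>y\<bar>) ^ (p + k) * exp (- a * y\<^sup>2)" for y
    proof -
      have n: "norm (x - 2 * \<i> * complex_of_real y) \<le> \<bar>x\<bar> + 2 * \<bar>y\<bar>"
        by (rule norm_triangle_ineq4[THEN order_trans]) (simp add: norm_mult)
      have "norm (Hp k (x - 2 * \<i> * complex_of_real y)) \<le> C * (1 + norm (x - 2 * \<i> * complex_of_real y)) ^ k" by (rule C)
      also have "\<dots> \<le> C * (2 * (1 + \<bar>x\<bar>) * (1 + \<bar>y\<bar>)) ^ k"
      proof (intro mult_left_mono power_mono)
        have "0 \<le> \<bar>x\<bar> * \<bar>y\<bar>" by simp
        moreover have "2 * (1 + \<bar>x\<bar>) * (1 + \<bar>y\<bar>) = 2 + 2 * \<bar>x\<bar> + 2 * \<bar>y\<bar> + 2 * (\<bar>x\<bar> * \<bar>y\<bar>)" by (simp add: algebra_simps)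
        ultimately show "1 + norm (x - 2 * \<i> * complex_of_real y) \<le> 2 * (1 + \<bar>x\<bar>) * (1 + \<bar>y\<bar>)"
          using n abs_ge_zero[of x] by linarith
      qed (use C in auto)
      also have "\<dots> = C * (2 * (1 + \<bar>x\<bar>)) ^ k * (1 + \<bar>y\<bar>) ^ k" by (simp add: power_mult_distrib)
      finally have "norm (complex_of_real y ^ p) * (norm (Hp k (x - 2 * \<i> * complex_of_real y)) * norm (G y)) \<le>
          (1 + \<bar>y\<bar>) ^ p * (C * (2 * (1 + \<bar>x\<bar>)) ^ k * (1 + \<bar>y\<bar>) ^ k * norm (G y))"
        using C(1) by (intro mult_mono mult_right_mono) (auto simp: norm_power intro!: power_mono)
      then show ?thesis unfolding norm_mult Gn D_def by (simp add: power_add mult_ac)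
    qed
    then show ?thesis by blast
  qed
  have int: "integrable lborel (\<lambda>y. complex_of_real y ^ p * (Hp k (x - 2 * \<i> * complex_of_real y) * G y))" for p k
  proof -
    obtain C where C: "\<And>y. norm (complex_of_real y ^ p * (Hp k (x - 2 * \<i> * complex_of_real y) * G y)) \<le> C * (1 + \<bar>y\<bar>) ^ (p + k) * exp (- a * y\<^sup>2)"
      using bound by blast
    show ?thesis
      by (rule integrable_gauss_boundI[OF _ a C])
        (intro continuous_intros continuous_on_compose2[OF Gc], auto)
  qed
  define Q where "Q k = (LINT y|lborel. Hp k (x - 2 * \<i> * complex_of_real y) * G y)" for k
  define Y where "Y k = (LINT y|lborel. complex_of_real y * (Hp k (x - 2 * \<i> * complex_of_real y) * G y))" for k
  note int0 = int[of 0, simplified] and int1 = int[of 1, simplified]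
  \<comment> \<open>The integral of the derivative of \<open>Hp k (x - 2 i w) * G w\<close>
    vanishes, which expresses the first moment \<open>Y k\<close> through the
    \<open>Q\<close>.\<close>
  have Y: "2 * a * Y k = 2 * \<i> * x * (1 - T) * Q k - 4 * \<i> * of_nat k * Q (k - 1)" for k
  proof -
    define g where "g w = 2 * \<i> * x * (1 - T) * (Hp k (x - 2 * \<i> * w) * G w) - 4 * \<i> * of_nat k * (Hp (k - 1) (x - 2 * \<i> * w) * G w)
        - 2 * a * (w * (Hp k (x - 2 * \<i> * w) * G w))" for w :: complex
    obtain C where C: "\<And>y. norm (Hp k (x - 2 * \<i> * complex_of_real y) * G y) \<le> C * (1 + \<bar>y\<bar>) ^ k * exp (- a * y\<^sup>2)"
      using bound[of 0 k] by auto
    have "(LINT y|lborel. g (complex_of_real y)) = 0"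
    proof (rule integral_holomorphic_deriv_eq_0[OF _ _ a C])
      show "((\<lambda>w. Hp k (x - 2 * \<i> * w) * G w) has_field_derivative g w) (at w)" for w
        unfolding g_def by (auto intro!: derivative_eq_intros G' simp: algebra_simps)
      show "continuous_on UNIV g"
        unfolding g_def by (intro continuous_intros Gc)
      show "integrable lborel (\<lambda>y. g (complex_of_real y))"
        unfolding g_def by (intro Bochner_Integration.integrable_diff integrable_mult_right int0 int1)
    qed
    moreover have "(LINT y|lborel. g (complex_of_real y)) = 2 * \<i> * x * (1 - T) * Q k - 4 * \<i> * of_nat k * Q (k - 1) - 2 * a * Y k"
      unfolding g_def Q_def Y_def by (simp add: int0 int1 del: of_real_mult)
    ultimately show ?thesis by simp
  qed
  have Q_rec: "Q (Suc k) = 2 * x * Q k - 4 * \<i> * Y k - 2 * of_nat k * Q (k - 1)" for k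
  proof -
    have "Q (Suc k) = (LINT y|lborel. 2 * x * (Hp k (x - 2 * \<i> * complex_of_real y) * G y)
        - 4 * \<i> * (complex_of_real y * (Hp k (x - 2 * \<i> * complex_of_real y) * G y))
        - 2 * of_nat k * (Hp (k - 1) (x - 2 * \<i> * complex_of_real y) * G y))"
      unfolding Q_def Hp_Suc by (intro Bochner_Integration.integral_cong refl) (simp add: algebra_simps)
    also have "\<dots> = 2 * x * Q k - 4 * \<i> * Y k - 2 * of_nat k * Q (k - 1)"
      unfolding Q_def Y_def by (simp add: int0 int1)
    finally show ?thesis .
  qed
  have Q_rec': "Q (Suc k) = 2 * x * \<rho> * Q k - 2 * of_nat k * \<rho>\<^sup>2 * Q (k - 1)" for k
  proof -
    have Yk: "Y k = (2 * \<i> * x * (1 - T) * Q k - 4 * \<i> * of_nat k * Q (k - 1)) / (2 * a)"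
      using Y[of k] a by (simp add: field_simps)
    have A: "- 4 * \<i> * Y k = complex_of_real (2 * (1 - T) / a) * (2 * x * Q k) - complex_of_real (4 / a) * (2 * of_nat k * Q (k - 1))"
      unfolding Yk using a by (simp add: field_simps)
    \<comment> \<open>With these two values the terms from \<open>Y k\<close> add up with those of
      the plain recursion: \<open>1 + (\<rho> - 1) = \<rho>\<close> and
      \<open>1 + (\<rho>^2 - 1) = \<rho>^2\<close>.\<close>
    have r1: "2 * (1 - T) / a = \<rho> - 1" and r2: "4 / a = \<rho>\<^sup>2 - 1"
      unfolding a_def \<rho>_def using T by (simp_all add: divide_simps power2_eq_square) (simp_all add: algebra_simps)
    have "Q (Suc k) = 2 * x * Q k + (- 4 * \<i> * Y k) - 2 * of_nat k * Q (k - 1)"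
      unfolding Q_rec by simp
    then show ?thesis unfolding A[unfolded r1 r2] by (simp add: algebra_simps)
  qed
  have alg: "2 * X * r * (q * p * H) - 2 * n * r\<^sup>2 * (q * p' * H') = q * (r * p) * (2 * X * H - 2 * n * H')"
    if "n * r\<^sup>2 * p' = n * (r * p)" for X r q p p' n H H' :: complex
  proof -
    have "2 * n * r\<^sup>2 * (q * p' * H') = 2 * (n * r\<^sup>2 * p') * (q * H')" by (simp only: mult_ac)
    also have "\<dots> = 2 * (n * (r * p)) * (q * H')" by (simp only: that)
    finally have e: "2 * n * r\<^sup>2 * (q * p' * H') = 2 * (n * (r * p)) * (q * H')" .
    show ?thesis unfolding e by (simp add: algebra_simps)
  qed
  have Q: "Q k = Q 0 * \<rho> ^ k * Hp k (complex_of_real x)" for k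
  proof (induction k rule: less_induct)
    case (less k)
    show ?case
    proof (cases k)
      case (Suc m)
      have m: "Q m = Q 0 * complex_of_real \<rho> ^ m * Hp m (complex_of_real x)" using less[of m] Suc by simp
      have m1: "Q (m - 1) = Q 0 * complex_of_real \<rho> ^ (m - 1) * Hp (m - 1) (complex_of_real x)" using less[of "m - 1"] Suc by simp
      have e: "of_nat m * (complex_of_real \<rho>)\<^sup>2 * complex_of_real \<rho> ^ (m - 1) = of_nat m * (complex_of_real \<rho> * complex_of_real \<rho> ^ m)"
        by (cases m) (simp_all add: power2_eq_square mult_ac)
      have "Q k = 2 * complex_of_real x * complex_of_real \<rho> * Q m - 2 * of_nat m * (complex_of_real \<rho>)\<^sup>2 * Q (m - 1)"
        using Q_rec'[of m] Suc by simp
      also have "\<dots> = Q 0 * (complex_of_real \<rho> * complex_of_real \<rho> ^ m) * (2 * complex_of_real x * Hp m (complex_of_real x) - 2 * of_nat m * Hp (m - 1) (complex_of_real x))"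
        unfolding m m1 by (rule alg[OF e])
      finally show ?thesis unfolding Suc Hp_Suc by simp
    qed simp
  qed
  have Q0: "Q 0 = complex_of_real (sqrt (pi * T) / (1 - T)) * exp (- (complex_of_real x)\<^sup>2 / 2)"
  proof -
    have "Q 0 = exp (complex_of_real (x\<^sup>2 * (T - 1/2))) * (LINT y|lborel. exp (\<i> * complex_of_real (2 * x * (1 - T)) * complex_of_real y - complex_of_real (a * y\<^sup>2)))"
      unfolding Q_def G_eq by simp
    also have "\<dots> = exp (complex_of_real (x\<^sup>2 * (T - 1/2))) * complex_of_real (sqrt (pi / a) * exp (- (2 * x * (1 - T))\<^sup>2 / (4 * a)))"
      by (subst gauss_fourier_integral[OF a]) simp
    also have "sqrt (pi / a) = sqrt (pi * T) / (1 - T)"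
      unfolding a_def using T by (simp add: real_sqrt_divide real_sqrt_mult)
    also have "- (2 * x * (1 - T))\<^sup>2 / (4 * a) = - (x\<^sup>2 * T)"
      unfolding a_def using T by (simp add: power_mult_distrib)
    also have "exp (complex_of_real (x\<^sup>2 * (T - 1/2))) * complex_of_real (sqrt (pi * T) / (1 - T) * exp (- (x\<^sup>2 * T))) =
       complex_of_real (sqrt (pi * T) / (1 - T)) * complex_of_real (exp (x\<^sup>2 * (T - 1/2)) * exp (- (x\<^sup>2 * T)))"
      by (simp add: exp_of_real[symmetric])
    also have "exp (x\<^sup>2 * (T - 1/2)) * exp (- (x\<^sup>2 * T)) = exp (- x\<^sup>2 / 2)"
      by (simp add: exp_add[symmetric] algebra_simps)
    finally show ?thesis by (simp add: exp_of_real[symmetric])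
  qed
  have "(LINT y|lborel. hc k (x - 2 * \<i> * y) * exp (T * (x - \<i> * y)\<^sup>2 - y\<^sup>2 / T)) = (LINT y|lborel. (Hp k (x - 2 * \<i> * complex_of_real y) * G y) / hnorm k)"
  proof (intro Bochner_Integration.integral_cong refl)
    fix y :: real
    have "exp (- (x - 2 * \<i> * y)\<^sup>2 / 2) * exp (T * (x - \<i> * y)\<^sup>2 - y\<^sup>2 / T) = G y"
      unfolding G_def exp_add[symmetric] by (simp add: algebra_simps)
    then show "hc k (x - 2 * \<i> * y) * exp (T * (x - \<i> * y)\<^sup>2 - y\<^sup>2 / T) = (Hp k (x - 2 * \<i> * complex_of_real y) * G y) / hnorm k"
      unfolding hc_def by (metis (no_types, lifting) mult.assoc times_divide_eq_left)
  qed
  also have "\<dots> = Q k / hnorm k" unfolding Q_def by simp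
  also have "\<dots> = complex_of_real (sqrt (pi * T) / (1 - T) * ((1 + T) / (1 - T)) ^ k) * hc k x"
    unfolding Q[of k] Q0 hc_def \<rho>_def by simp
  finally show ?thesis .
qed

subsection \<open>Growth of the Hermite functions in the index\<close>

text \<open>In the normalised recursion the coefficient of \<open>z * hc k z\<close> becomes small
  for large \<open>k\<close> and the other stays below 1, which is what controls the growth in
  \<open>k\<close>.\<close>

lemma hc_Suc:
  fixes z :: complex
  shows "hc (Suc k) z = 2 / sqrt (2 * (k + 1)) * z * hc k z - sqrt (k / (k + 1)) * hc (k - 1) z"
proof -
  have h: "hnorm (Suc k) = sqrt (2 * (k + 1)) * hnorm k" for k
    unfolding hnorm_def real_sqrt_mult[symmetric] by (simp add: algebra_simps)
  have "2 * real k / hnorm (Suc k) = sqrt (k / (k + 1)) / hnorm (k - 1)"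
  proof (cases k)
    case (Suc m)
    have "sqrt (2 * (k + 1)) * sqrt (2 * k) * sqrt (k / (k + 1)) = sqrt ((2 * (k + 1)) * (2 * k) * (k / (k + 1)))"
      by (simp only: real_sqrt_mult of_nat_mult)
    also have "(2 * (k + 1)) * (2 * k) * (k / (k + 1)) = (2 * real k)\<^sup>2"
      by (simp add: field_simps power2_eq_square)
    also have "sqrt ((2 * real k)\<^sup>2) = 2 * real k" by (simp only: real_sqrt_abs)
    finally have e: "sqrt (2 * (k + 1)) * sqrt (2 * k) * sqrt (k / (k + 1)) = 2 * real k" .
    have hk: "hnorm (Suc k) = sqrt (2 * (k + 1)) * sqrt (2 * k) * hnorm (k - 1)"
      using h[of k] h[of m] Suc by (simp add: add.commute)
    have "hnorm (Suc k) * (sqrt (k / (k + 1))) = 2 * real k * hnorm (k - 1)"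
      unfolding hk by (metis e mult.assoc mult.commute)
    then show ?thesis using hnorm_pos[of "Suc k"] hnorm_pos[of "k - 1"] by (simp add: field_simps)
  qed simp
  then have c: "2 * of_nat k / complex_of_real (hnorm (Suc k)) = sqrt (k / (k + 1)) / complex_of_real (hnorm (k - 1))"
    by (metis of_real_divide of_real_mult of_real_numeral of_real_of_nat_eq)
  have c2: "2 / complex_of_real (hnorm (Suc k)) = (2 / sqrt (2 * (k + 1))) / hnorm k"
    unfolding h by simp
  have "hc (Suc k) z = (2 / complex_of_real (hnorm (Suc k))) * z * Hp k z * exp (- (z\<^sup>2) / 2)
     - (2 * of_nat k / complex_of_real (hnorm (Suc k))) * Hp (k - 1) z * exp (- (z\<^sup>2) / 2)"
    unfolding hc_def Hp_Suc by (simp add: diff_divide_distrib left_diff_distrib)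
  then show ?thesis unfolding c c2 by (simp add: hc_def ac_simps)
qed

text \<open>For \<open>k\<close> past a threshold the recursion bounds a term by \<epsilon> times
  the previous one plus the one before, and \<open>(1 + \<epsilon>) ^ k\<close> dominates such
  sequences because \<open>\<epsilon> (1 + \<epsilon>) + 1 \<le> (1 + \<epsilon>)^2\<close>. This
  crude bound, uniform on a disc, is enough against the geometric heat factors.\<close>

lemma hc_growth:
  assumes "\<epsilon> > 0"
  obtains C where "C > 0" "\<And>k z. norm z \<le> R \<Longrightarrow> norm (hc k z) \<le> C * (1 + \<epsilon>) ^ k"
proof -
  \<comment> \<open>Beyond \<open>K\<close> the coefficient \<open>2 / sqrt (2 (m + 1))\<close>
    times the radius is at most \<epsilon>; the finitely many smaller indices go into
    \<open>C\<close>.\<close>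
  obtain K :: nat where K: "real K > (2 * \<bar>R\<bar> / \<epsilon>)\<^sup>2" using reals_Archimedean2 by blast
  have "\<exists>B. \<forall>z\<in>cball 0 R. norm (hc k z) \<le> B" for k
  proof -
    have "compact (hc k ` cball 0 R)"
      by (intro compact_continuous_image continuous_intros compact_cball continuous_on_hc)
    then show ?thesis by (auto dest!: compact_imp_bounded simp: bounded_iff)
  qed
  then obtain B where B: "\<And>k z. norm z \<le> R \<Longrightarrow> norm (hc k z) \<le> B k"
    by (metis dist_0_norm mem_cball)
  define C where "C = 1 + (\<Sum>k\<le>K. \<bar>B k\<bar>)"
  have C: "C > 0" by (auto simp: C_def intro!: add_pos_nonneg sum_nonneg)
  have "norm (hc k z) \<le> C * (1 + \<epsilon>) ^ k" if z: "norm z \<le> R" for k z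
  proof (induction k rule: less_induct)
    case (less k)
    show ?case
    proof (cases "k \<le> K")
      case True
      have "norm (hc k z) \<le> \<bar>B k\<bar>" using B[OF z, of k] by simp
      also have "\<dots> \<le> (\<Sum>k\<le>K. \<bar>B k\<bar>)" using True by (intro member_le_sum) auto
      also have "\<dots> \<le> C" by (simp add: C_def)
      also have "\<dots> \<le> C * (1 + \<epsilon>) ^ k" using C assms by (simp add: one_le_power)
      finally show ?thesis .
    next
      case False
      then obtain m where m: "k = Suc m" "K \<le> m" by (cases k) auto
      show ?thesis
      proof (cases m)
        case 0
        then have "(2 * \<bar>R\<bar> / \<epsilon>)\<^sup>2 < 0" using K m by simp
        then show ?thesis by (simp add: not_less)
      next
        case (Suc j)
        have "2 * \<bar>R\<bar> / \<epsilon> < sqrt (2 * (m + 1))"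
        proof (rule real_less_rsqrt)
          show "(2 * \<bar>R\<bar> / \<epsilon>)\<^sup>2 < real (2 * (m + 1))" using K m(2) by simp
        qed
        then have "2 * \<bar>R\<bar> / sqrt (2 * (m + 1)) \<le> \<epsilon>"
          using assms by (simp add: field_simps)
        moreover have "2 / sqrt (2 * (m + 1)) * norm z \<le> 2 / sqrt (2 * (m + 1)) * \<bar>R\<bar>"
          using z by (intro mult_left_mono) auto
        ultimately have e: "2 / sqrt (2 * (m + 1)) * norm z \<le> \<epsilon>" by simp
        have "norm (hc k z) \<le> (2 / sqrt (2 * (m + 1)) * norm z) * norm (hc m z) + sqrt (m / (m + 1)) * norm (hc (m - 1) z)"
        proof -
          have "hc k z = complex_of_real (2 / sqrt (2 * (m + 1))) * z * hc m z - complex_of_real (sqrt (m / (m + 1))) * hc (m - 1) z"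
            using hc_Suc[of m z] m(1) by (simp add: add.commute)
          then show ?thesis
            using norm_triangle_ineq4[of "complex_of_real (2 / sqrt (2 * (m + 1))) * z * hc m z" "complex_of_real (sqrt (m / (m + 1))) * hc (m - 1) z"]
            by (simp only: norm_mult norm_of_real) (simp add: add.commute)
        qed
        also have "\<dots> \<le> \<epsilon> * norm (hc m z) + 1 * norm (hc (m - 1) z)"
          using e by (intro add_mono mult_right_mono) auto
        also have "\<dots> \<le> \<epsilon> * (C * (1 + \<epsilon>) ^ m) + 1 * (C * (1 + \<epsilon>) ^ (m - 1))"
          using less m Suc assms by (intro add_mono mult_left_mono less) auto
        also have "\<dots> \<le> C * (1 + \<epsilon>) ^ k"
        proof -
          have "\<epsilon> * (1 + \<epsilon>) + 1 \<le> (1 + \<epsilon>) * (1 + \<epsilon>)" using assms by (simp add: algebra_simps)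
          then have "C * (1 + \<epsilon>) ^ j * (\<epsilon> * (1 + \<epsilon>) + 1) \<le> C * (1 + \<epsilon>) ^ j * ((1 + \<epsilon>) * (1 + \<epsilon>))"
            using C assms by (intro mult_left_mono) auto
          then show ?thesis unfolding m Suc by (simp add: algebra_simps)
        qed
        finally show ?thesis .
      qed
    qed
  qed
  then show ?thesis using that C by blast
qed

subsection \<open>Entire functions of several variables\<close>

lemma entire_CnE:
  assumes "entire_Cn F"
  obtains D where "(F has_derivative D) (at z)" "\<And>c v. D (c *s v) = c * D v"
  using assms unfolding entire_Cn_def by blast

lemma entire_continuous: "entire_Cn F \<Longrightarrow> continuous_on S F"
  by (meson entire_Cn_def has_derivative_continuous continuous_at_imp_continuous_on)

lemma entire_measurable: "entire_Cn F \<Longrightarrow> F \<in> borel_measurable borel"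
  by (simp add: entire_continuous borel_measurable_continuous_onI)

lemma entire_const: "entire_Cn (\<lambda>z. c)"
  unfolding entire_Cn_def by (auto intro!: exI[of _ "\<lambda>_. 0"])

lemma entire_nth: "entire_Cn (\<lambda>z. z $ i)"
  unfolding entire_Cn_def
  by (auto intro!: exI[of _ "\<lambda>z. z $ i"] bounded_linear_imp_has_derivative bounded_linear_vec_nth)

lemma entire_add: "entire_Cn F \<Longrightarrow> entire_Cn G \<Longrightarrow> entire_Cn (\<lambda>z. F z + G z)"
  unfolding entire_Cn_def by (metis (mono_tags, lifting) has_derivative_add distrib_left)

lemma entire_mult:
  assumes "entire_Cn F" "entire_Cn G" shows "entire_Cn (\<lambda>z. F z * G z)"
  unfolding entire_Cn_def
proof
  fix z
  obtain D where D: "(F has_derivative D) (at z)" "\<And>c v. D (c *s v) = c * D v" using assms(1) entire_CnE by blast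
  obtain E where E: "(G has_derivative E) (at z)" "\<And>c v. E (c *s v) = c * E v" using assms(2) entire_CnE by blast
  show "\<exists>D. ((\<lambda>z. F z * G z) has_derivative D) (at z) \<and> (\<forall>c v. D (c *s v) = c * D v)"
    using has_derivative_mult[OF D(1) E(1)] D(2) E(2)
    by (intro exI[of _ "\<lambda>h. F z * E h + D h * G z"]) (auto simp: algebra_simps)
qed

lemma entire_compose:
  assumes f: "f holomorphic_on UNIV" and "entire_Cn F" shows "entire_Cn (\<lambda>z. f (F z))"
  unfolding entire_Cn_def
proof
  fix z
  obtain D where D: "(F has_derivative D) (at z)" "\<And>c v. D (c *s v) = c * D v" using assms(2) entire_CnE by blast
  have "(f has_field_derivative deriv f (F z)) (at (F z))" using f holomorphic_derivI by blast
  then have "(f has_derivative (*) (deriv f (F z))) (at (F z))" by (simp add: has_field_derivative_def)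
  from has_derivative_compose[OF D(1) this]
  show "\<exists>D. ((\<lambda>z. f (F z)) has_derivative D) (at z) \<and> (\<forall>c v. D (c *s v) = c * D v)"
    using D(2) by (intro exI[of _ "\<lambda>h. deriv f (F z) * D h"]) auto
qed

lemma entire_exp: "entire_Cn F \<Longrightarrow> entire_Cn (\<lambda>z. exp (F z))"
  by (rule entire_compose) (auto intro: holomorphic_intros)

lemma entire_scale: "entire_Cn F \<Longrightarrow> entire_Cn (\<lambda>z. c * F z)"
  by (intro entire_mult entire_const)

lemma entire_sum: "(\<And>i. i \<in> A \<Longrightarrow> entire_Cn (F i)) \<Longrightarrow> entire_Cn (\<lambda>z. \<Sum>i\<in>A. F i z)"
  by (induction A rule: infinite_finite_induct) (auto simp: entire_const entire_add)

lemma entire_prod: "(\<And>i. i \<in> A \<Longrightarrow> entire_Cn (F i)) \<Longrightarrow> entire_Cn (\<lambda>z. \<Prod>i\<in>A. F i z)"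
  by (induction A rule: infinite_finite_induct) (auto simp: entire_const entire_mult)

lemma entire_power: "entire_Cn F \<Longrightarrow> entire_Cn (\<lambda>z. F z ^ k)"
  by (induction k) (auto simp: entire_const entire_mult)

lemma entire_shift:
  assumes "entire_Cn F" shows "entire_Cn (\<lambda>z. F (z0 + z))"
  unfolding entire_Cn_def
proof
  fix z
  obtain D where D: "(F has_derivative D) (at (z0 + z))" "\<And>c v. D (c *s v) = c * D v" using assms entire_CnE by blast
  have "((\<lambda>z. z0 + z) has_derivative (\<lambda>h. h)) (at z)" by (auto intro!: derivative_eq_intros)
  from has_derivative_compose[OF this D(1)]
  show "\<exists>D. ((\<lambda>z. F (z0 + z)) has_derivative D) (at z) \<and> (\<forall>c v. D (c *s v) = c * D v)"
    using D(2) by blast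
qed

lemma bounded_linear_scale_vec: "bounded_linear (\<lambda>s. s *s (v :: complex ^ 'n))"
proof -
  have "linear (\<lambda>s. s *s v)"
    by (rule linearI) (auto simp: vec_eq_iff distrib_right)
  then show ?thesis by (simp add: linear_conv_bounded_linear)
qed

lemma entire_line:
  fixes F :: "complex ^ 'n \<Rightarrow> complex"
  assumes "(F has_derivative D) (at (z + s *s v))" "\<And>c v. D (c *s v) = c * D v"
  shows "((\<lambda>s. F (z + s *s v)) has_field_derivative D v) (at s)"
proof -
  have "((\<lambda>s. z + s *s v) has_derivative (\<lambda>s. s *s v)) (at s)"
    by (auto intro!: derivative_eq_intros bounded_linear_imp_has_derivative bounded_linear_scale_vec)
  from has_derivative_compose[OF this assms(1)]
  show ?thesis unfolding has_field_derivative_def by (simp add: assms(2) mult_commute_abs)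
qed

lemma entire_line_holomorphic: "entire_Cn F \<Longrightarrow> (\<lambda>s. F (z + s *s v)) holomorphic_on S"
  unfolding holomorphic_on_def field_differentiable_def
proof
  fix s assume F: "entire_Cn F"
  obtain D where "(F has_derivative D) (at (z + s *s v))" "\<And>c v. D (c *s v) = c * D v"
    using F entire_CnE by blast
  from entire_line[OF this] show "\<exists>f'. ((\<lambda>s. F (z + s *s v)) has_field_derivative f') (at s within S)"
    using has_field_derivative_at_within by blast
qed

text \<open>The point \<open>x + i y\<close> lies on the complex line \<open>x + s y\<close>, whose
  real parameters \<open>s\<close> give real points: the identity theorem in one variable applies to
  \<open>s\<close>.\<close>

lemma entire_eq_on_Rn:
  assumes F: "entire_Cn F" and G: "entire_Cn G" and eq: "\<And>x. F (Rn_to_Cn x) = G (Rn_to_Cn x)"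
  shows "F = G"
proof
  fix z :: "complex ^ 'a"
  define x where "x = (\<chi> i. Re (z $ i))"
  define y where "y = (\<chi> i. Im (z $ i))"
  define \<phi> where "\<phi> s = F (Rn_to_Cn x + s *s Rn_to_Cn y) - G (Rn_to_Cn x + s *s Rn_to_Cn y)" for s
  have hol: "\<phi> holomorphic_on UNIV"
    unfolding \<phi>_def by (intro holomorphic_on_diff entire_line_holomorphic F G)
  have "\<phi> (\<i>) = 0"
  proof (rule analytic_continuation[OF hol])
    show "(0::complex) islimpt \<real>"
      unfolding islimpt_approachable
    proof safe
      fix e :: real assume "e > 0"
      then show "\<exists>x'\<in>\<real>. x' \<noteq> (0::complex) \<and> dist x' 0 < e"
        by (intro bexI[of _ "complex_of_real (e/2)"]) auto
    qed
    fix s :: complex assume "s \<in> \<real>"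
    then obtain r where s: "s = complex_of_real r" by (auto elim: Reals_cases)
    have "Rn_to_Cn x + s *s Rn_to_Cn y = Rn_to_Cn (x + r *\<^sub>R y)"
      by (simp add: s vec_eq_iff Rn_to_Cn_def)
    then show "\<phi> s = 0" by (simp add: \<phi>_def eq)
  qed auto
  moreover have "Rn_to_Cn x + \<i> *s Rn_to_Cn y = z"
    by (simp add: vec_eq_iff Rn_to_Cn_def x_def y_def complex_eq_iff)
  ultimately show "F z = G z" by (simp add: \<phi>_def)
qed

lemma norm_scale_vec: "norm (c *s (v :: complex ^ 'n)) = norm c * norm v"
  by (simp add: norm_vec_def L2_set_def norm_mult power_mult_distrib sum_distrib_left[symmetric] real_sqrt_mult)

text \<open>Cauchy's inequality on the unit circle of the complex line through \<open>z\<close> in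
  the normalised direction of \<open>v\<close>; linearity of \<open>D\<close> over the complex
  numbers restores the length of \<open>v\<close>.\<close>

lemma entire_deriv_bound:
  assumes F: "entire_Cn F" and D: "(F has_derivative D) (at z)" "\<And>c v. D (c *s v) = c * D v"
    and B: "\<And>w. norm w \<le> norm z + 1 \<Longrightarrow> norm (F w) \<le> B"
  shows "norm (D v) \<le> B * norm v"
proof (cases "v = 0")
  case True
  then show ?thesis using D(1) has_derivative_bounded_linear linear_simps(3) by fastforce
next
  case False
  define u where "u = complex_of_real (1 / norm v) *s v"
  have nu: "norm u = 1" using False by (simp add: u_def norm_scale_vec norm_divide)
  have "(deriv ^^ 1) (\<lambda>s. F (z + s *s u)) 0 = D u"
    using entire_line[of F D z 0 u] D by (simp add: DERIV_imp_deriv)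
  moreover have "norm ((deriv ^^ 1) (\<lambda>s. F (z + s *s u)) 0) \<le> fact 1 * B / 1 ^ 1"
  proof (rule Cauchy_inequality)
    show "(\<lambda>s. F (z + s *s u)) holomorphic_on ball 0 1" by (rule entire_line_holomorphic[OF F])
    show "continuous_on (cball 0 1) (\<lambda>s. F (z + s *s u))"
      by (rule holomorphic_on_imp_continuous_on[OF entire_line_holomorphic[OF F]])
    fix s :: complex assume "norm (0 - s) = 1"
    then have "norm (z + s *s u) \<le> norm z + 1"
      using norm_triangle_ineq[of z "s *s u"] by (simp add: norm_scale_vec nu)
    then show "norm (F (z + s *s u)) \<le> B" by (rule B)
  qed auto
  ultimately have "norm (D u) \<le> B" by simp
  moreover have "D v = complex_of_real (norm v) * D u"
    unfolding D(2)[symmetric] u_def using False by (simp add: vector_smult_assoc)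
  ultimately show ?thesis using mult_right_mono[of "norm (D u)" B "norm v"] by (simp add: norm_mult mult.commute)
qed

text \<open>Weierstrass' test: by Cauchy's inequality the majorant of the terms on a larger ball
  also dominates their derivatives, so the series may be differentiated termwise, and complex
  linearity passes to the sum of the derivatives.\<close>

lemma entire_series:
  fixes F :: "'i::countable \<Rightarrow> complex ^ 'n \<Rightarrow> complex"
  assumes F: "\<And>i. entire_Cn (F i)"
    and M: "\<And>R. R > 0 \<Longrightarrow> \<exists>M. M summable_on UNIV \<and> (\<forall>i z. norm z \<le> R \<longrightarrow> norm (F i z) \<le> M i)"
  shows entire_series_has_sum: "((\<lambda>i. F i z) has_sum (\<Sum>\<^sub>\<infinity>i. F i z)) UNIV"
    and entire_series_entire: "entire_Cn (\<lambda>z. \<Sum>\<^sub>\<infinity>i. F i z)"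
proof -
  have summ: "(\<lambda>i. F i z) summable_on UNIV" for z
  proof -
    obtain M where M: "M summable_on UNIV" "\<And>i w. norm w \<le> norm z + 1 \<Longrightarrow> norm (F i w) \<le> M i"
      using M[of "norm z + 1"] norm_ge_zero[of z] by (metis add.commute less_add_one add_pos_nonneg zero_less_one)
    show ?thesis
      by (rule abs_summable_summable, rule summable_on_comparison_test[OF M(1)]) (auto intro: M(2))
  qed
  then show hs: "((\<lambda>i. F i z) has_sum (\<Sum>\<^sub>\<infinity>i. F i z)) UNIV" for z by (rule has_sum_infsum)
  have "\<exists>D. (F i has_derivative D) (at z) \<and> (\<forall>c v. D (c *s v) = c * D v)" for i z
    using F unfolding entire_Cn_def by blast
  then obtain D where D: "\<And>i z. (F i has_derivative D i z) (at z)" "\<And>i z c v. D i z (c *s v) = c * D i z v"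
    by metis
  show "entire_Cn (\<lambda>z. \<Sum>\<^sub>\<infinity>i. F i z)"
    unfolding entire_Cn_def
  proof
    fix z0 :: "complex ^ 'n"
    define R where "R = norm z0 + 1"
    have R: "R > 0" by (simp add: R_def add_nonneg_pos)
    \<comment> \<open>One unit of radius is given up to Cauchy's inequality.\<close>
    obtain M where Ms: "M summable_on UNIV" and M: "\<And>i w. norm w \<le> R + 1 \<Longrightarrow> norm (F i w) \<le> M i"
      using M[of "R + 1"] R by auto
    have M0: "M i \<ge> 0" for i using order_trans[OF norm_ge_zero M[of 0 i]] R by simp
    have Db: "norm (D i z h) \<le> M i * norm h" if "z \<in> ball 0 R" for i z h
      by (rule entire_deriv_bound[OF F D]) (use that in \<open>auto intro: M\<close>)
    have Ds: "(\<lambda>i. D i z h) summable_on UNIV" if "z \<in> ball 0 R" for z h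
      by (rule abs_summable_summable, rule summable_on_comparison_test[OF summable_on_cmult_left[OF Ms, of "norm h"]])
        (auto intro: Db that)
    define g' where "g' z h = (\<Sum>\<^sub>\<infinity>i. D i z h)" for z h
    have tail: "norm (sum (\<lambda>i. D i z h) (initial_set n) - g' z h) \<le> (infsum M UNIV - sum M (initial_set n)) * norm h"
      if z: "z \<in> ball 0 R" for z h n
    proof -
      have e: "g' z h = sum (\<lambda>i. D i z h) (initial_set n) + infsum (\<lambda>i. D i z h) (- initial_set n)"
        unfolding g'_def by (subst infsum_Un_disjoint[symmetric, of _ "initial_set n", simplified])
          (auto simp: Ds[OF z] intro: summable_on_subset_banach[OF Ds[OF z]])
      have e2: "infsum M UNIV = sum M (initial_set n) + infsum M (- initial_set n)"
        by (subst infsum_Un_disjoint[symmetric, of _ "initial_set n", simplified])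
          (auto simp: Ms intro: summable_on_subset_banach[OF Ms])
      have Ms': "M summable_on (- initial_set n)" by (rule summable_on_subset_banach[OF Ms]) auto
      have "norm (infsum (\<lambda>i. D i z h) (- initial_set n)) \<le> infsum (\<lambda>i. M i * norm h) (- initial_set n)"
        by (rule norm_infsum_le) (auto intro: Db z has_sum_infsum summable_on_cmult_left Ms' summable_on_subset_banach[OF Ds[OF z]])
      also have "\<dots> = infsum M (- initial_set n) * norm h" by (rule infsum_cmult_left) (use Ms' in auto)
      finally show ?thesis unfolding e e2 by simp
    qed
    have "\<exists>g. \<forall>x\<in>ball 0 R. (\<lambda>n. \<Sum>i\<in>initial_set n. F i x) \<longlonglongrightarrow> g x \<and> (g has_derivative g' x) (at x within ball 0 R)"
    proof (rule has_derivative_sequence)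
      show "((\<lambda>x. \<Sum>i\<in>initial_set n. F i x) has_derivative (\<lambda>h. \<Sum>i\<in>initial_set n. D i x h)) (at x within ball 0 R)" for n x
        by (rule has_derivative_at_withinI) (intro has_derivative_sum D(1))
      show "z0 \<in> ball 0 R" by (simp add: R_def)
      show "(\<lambda>n. \<Sum>i\<in>initial_set n. F i z0) \<longlonglongrightarrow> (\<Sum>\<^sub>\<infinity>i. F i z0)"
        by (rule has_sum_initial_set[OF hs])
      fix e :: real assume e: "e > 0"
      have "(\<lambda>n. sum M (initial_set n)) \<longlonglongrightarrow> infsum M UNIV" by (rule has_sum_initial_set[OF has_sum_infsum[OF Ms]])
      then have "\<forall>\<^sub>F n in sequentially. dist (sum M (initial_set n)) (infsum M UNIV) < e" using e by (rule tendstoD)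
      then show "\<forall>\<^sub>F n in sequentially. \<forall>x\<in>ball 0 R. \<forall>h. norm ((\<Sum>i\<in>initial_set n. D i x h) - g' x h) \<le> e * norm h"
      proof eventually_elim
        case (elim n)
        then have "infsum M UNIV - sum M (initial_set n) \<le> e" by (auto simp: dist_real_def abs_if split: if_splits)
        then show ?case using tail by (meson mult_right_mono norm_ge_zero order_trans)
      qed
    qed (rule convex_ball)
    then obtain g where g: "\<And>x. x \<in> ball 0 R \<Longrightarrow> (\<lambda>n. \<Sum>i\<in>initial_set n. F i x) \<longlonglongrightarrow> g x"
      "\<And>x. x \<in> ball 0 R \<Longrightarrow> (g has_derivative g' x) (at x within ball 0 R)" by blast
    have z0: "z0 \<in> ball 0 R" by (simp add: R_def)
    have "(g has_derivative g' z0) (at z0)"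
      using g(2)[OF z0] at_within_open[OF z0 open_ball] by simp
    then have "((\<lambda>z. \<Sum>\<^sub>\<infinity>i. F i z) has_derivative g' z0) (at z0)"
    proof (rule has_derivative_transform_within_open[OF _ open_ball z0])
      show "g x = (\<Sum>\<^sub>\<infinity>i. F i x)" if "x \<in> ball 0 R" for x
        using g(1)[OF that] has_sum_initial_set[OF hs] by (rule LIMSEQ_unique)
    qed
    moreover have "g' z0 (c *s v) = c * g' z0 v" for c v
      unfolding g'_def D(2) by (rule infsum_cmult_right) (use Ds[OF z0] in auto)
    ultimately show "\<exists>D. ((\<lambda>z. \<Sum>\<^sub>\<infinity>i. F i z) has_derivative D) (at z0) \<and> (\<forall>c v. D (c *s v) = c * D v)"
      by blast
  qed
qed

subsection \<open>Mean values\<close>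

lemma circle_mean:
  assumes f: "f holomorphic_on UNIV"
  shows "integral {0..1} (\<lambda>\<theta>. f (exp (2 * of_real pi * \<i> * complex_of_real \<theta>))) = f 0"
proof -
  have "((\<lambda>u. f u / (u - 0)) has_contour_integral (2 * of_real pi * \<i> * f 0)) (circlepath 0 1)"
    by (rule Cauchy_integral_circlepath_simple) (use f holomorphic_on_subset in auto)
  then have "((\<lambda>\<theta>. f (exp (2 * of_real pi * \<i> * of_real \<theta>)) * (2 * of_real pi * \<i>)) has_integral (2 * of_real pi * \<i> * f 0)) {0..1}"
    unfolding has_contour_integral
  proof (rule has_integral_eq[rotated])
    fix x :: real
    have "circlepath 0 1 x = exp (2 * of_real pi * \<i> * of_real x)" by (simp add: circlepath)
    then show "f (circlepath 0 1 x) / (circlepath 0 1 x - 0) * vector_derivative (circlepath 0 1) (at x) =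
       f (exp (2 * of_real pi * \<i> * of_real x)) * (2 * of_real pi * \<i>)"
      by (simp add: vector_derivative_circlepath)
  qed
  from has_integral_mult_right[OF this, of "1 / (2 * of_real pi * \<i>)"]
  have "((\<lambda>\<theta>. f (exp (2 * of_real pi * \<i> * of_real \<theta>))) has_integral f 0) {0..1}"
    by simp
  then show ?thesis by (rule integral_unique)
qed

lemma continuous_on_scale_vec [continuous_intros]:
  fixes g :: "'a::topological_space \<Rightarrow> complex ^ 'n"
  assumes "continuous_on S f" "continuous_on S g"
  shows "continuous_on S (\<lambda>x. f x *s g x)"
  unfolding vector_scalar_mult_def using assms by (intro continuous_intros)

text \<open>Multiplication by a unit complex number preserves the ball and its measure. Averaging
  over all these rotations and exchanging the integrals leaves, for each \<open>w\<close>, a circle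
  mean on the complex line through \<open>w\<close>.\<close>

lemma entire_mean_ball:
  fixes H :: "complex ^ 'n \<Rightarrow> complex"
  assumes H: "entire_Cn H"
  shows "(LINT w|lborel. indicator (ball 0 1) w *\<^sub>R H w) = measure lborel (ball 0 1 :: (complex ^ 'n) set) *\<^sub>R H 0"
proof -
  let ?B = "ball 0 1 :: (complex ^ 'n) set"
  define e where "e \<theta> = exp (2 * of_real pi * \<i> * complex_of_real \<theta>)" for \<theta>
  have ne: "norm (e \<theta>) = 1" for \<theta> by (simp add: e_def)
  have ce: "continuous_on S e" for S unfolding e_def by (intro continuous_intros)
  note Hc = entire_continuous[OF H]
  have [measurable]: "H \<in> borel_measurable borel" using H by (rule entire_measurable)
  have rot: "(LINT w|lborel. indicator ?B w *\<^sub>R H (e \<theta> *s w)) = (LINT w|lborel. indicator ?B w *\<^sub>R H w)" for \<theta>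
  proof -
    have "linear (\<lambda>w :: complex ^ 'n. e \<theta> *s w)"
      by (rule linearI) (auto simp: vec_eq_iff distrib_left)
    then have d: "distr lborel borel (\<lambda>w :: complex ^ 'n. e \<theta> *s w) = lborel"
      by (rule lborel_distr_isometry) (simp add: norm_scale_vec ne)
    have [measurable]: "(\<lambda>w :: complex ^ 'n. e \<theta> *s w) \<in> borel_measurable borel"
      by (intro borel_measurable_continuous_onI continuous_intros)
    have hm: "(\<lambda>w. indicator ?B w *\<^sub>R H w) \<in> borel_measurable borel"
      using entire_measurable[OF H] by (intro borel_measurable_scaleR borel_measurable_indicator) auto
    have "(LINT w|lborel. indicator ?B w *\<^sub>R H w) = (LINT w|distr lborel borel (\<lambda>w. e \<theta> *s w). indicator ?B w *\<^sub>R H w)"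
      by (simp add: d)
    also have "\<dots> = (LINT w|lborel. indicator ?B (e \<theta> *s w) *\<^sub>R H (e \<theta> *s w))"
      by (rule integral_distr[OF _ hm]) measurable
    also have "\<dots> = (LINT w|lborel. indicator ?B w *\<^sub>R H (e \<theta> *s w))"
      by (intro Bochner_Integration.integral_cong refl) (simp add: indicator_def norm_scale_vec ne)
    finally show ?thesis by simp
  qed
  have "bounded (H ` cball 0 1)"
    by (intro compact_imp_bounded compact_continuous_image Hc compact_cball)
  then obtain C where "\<forall>w\<in>cball 0 1. norm (H w) \<le> C" by (auto simp: bounded_iff)
  then have C: "norm (H w) \<le> C" if "norm w \<le> 1" for w using that by simp
  have meas: "(\<lambda>(\<theta>, w). H (e \<theta> *s w)) \<in> borel_measurable (lborel \<Otimes>\<^sub>M lborel)"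
    unfolding lborel_prod measurable_lborel2 case_prod_beta'
    by (intro borel_measurable_continuous_onI continuous_on_compose2[OF Hc] continuous_intros continuous_on_compose2[OF ce]) auto
  define g where "g = (\<lambda>(\<theta>::real, w). (indicator {0..1} \<theta> * indicator ?B w) *\<^sub>R H (e \<theta> *s w))"
  have mg: "g \<in> borel_measurable (lborel \<Otimes>\<^sub>M lborel)"
  proof -
    note [measurable] = meas[unfolded case_prod_beta']
    have [measurable]: "?B \<in> sets borel" by simp
    show ?thesis unfolding g_def case_prod_beta' by measurable
  qed
  have fin: "emeasure lborel ?B < \<infinity>" by (rule emeasure_lborel_ball_finite)
  have int: "integrable (lborel \<Otimes>\<^sub>M lborel) g"
  proof (rule Bochner_Integration.integrable_bound[OF _ mg])
    show "integrable (lborel \<Otimes>\<^sub>M lborel) (\<lambda>p. C * indicator ({0..1::real} \<times> ?B) p)"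
      by (intro integrable_mult_right integrable_real_indicator)
        (use fin in \<open>auto simp: lborel.emeasure_pair_measure_Times ennreal_mult_less_top\<close>)
    show "AE p in lborel \<Otimes>\<^sub>M lborel. norm (g p) \<le> norm (C * indicator ({0..1} \<times> ?B) p)"
    proof (intro AE_I2)
      fix p :: "real \<times> (complex ^ 'n)"
      show "norm (g p) \<le> norm (C * indicator ({0..1} \<times> ?B) p)"
        using C[of "e (fst p) *s snd p"]
        by (auto simp: g_def indicator_def norm_scale_vec ne split: prod.splits)
    qed
  qed
  have "(LINT w|lborel. indicator ?B w *\<^sub>R H w) = (LINT \<theta>|lborel. indicator {0..1::real} \<theta> *\<^sub>R (LINT w|lborel. indicator ?B w *\<^sub>R H (e \<theta> *s w)))"
    unfolding rot by simp
  also have "\<dots> = (LINT \<theta>|lborel. LINT w|lborel. g (\<theta>, w))"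
    by (simp add: g_def scaleR_scaleR[symmetric] del: scaleR_scaleR)
  also have "\<dots> = (LINT w|lborel. LINT \<theta>|lborel. g (\<theta>, w))"
    using lborel_pair.Fubini_integral[of "\<lambda>\<theta> w. g (\<theta>, w)"] int by simp
  also have "\<dots> = (LINT w|lborel. indicator ?B w *\<^sub>R H 0)"
  proof (intro Bochner_Integration.integral_cong refl)
    fix w :: "complex ^ 'n"
    have si: "set_integrable lborel {0..1} (\<lambda>\<theta>. H (e \<theta> *s w))"
      unfolding set_integrable_def
      by (intro borel_integrable_compact continuous_on_compose2[OF Hc] continuous_intros ce) auto
    have "(LINT \<theta>|lborel. g (\<theta>, w)) = (LINT \<theta>|lborel. indicator ?B w *\<^sub>R (indicator {0..1} \<theta> *\<^sub>R H (e \<theta> *s w)))"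
      by (simp add: g_def mult.commute)
    also have "\<dots> = indicator ?B w *\<^sub>R (LINT \<theta>|lborel. indicator {0..1} \<theta> *\<^sub>R H (e \<theta> *s w))"
      by (rule integral_scaleR_right)
    also have "(LINT \<theta>|lborel. indicator {0..1} \<theta> *\<^sub>R H (e \<theta> *s w)) = integral {0..1} (\<lambda>\<theta>. H (e \<theta> *s w))"
      using set_borel_integral_eq_integral(2)[OF si] by (simp add: set_lebesgue_integral_def)
    also have "\<dots> = H 0"
      using circle_mean[of "\<lambda>s. H (0 + s *s w)", OF entire_line_holomorphic[OF H]] by (simp add: e_def)
    finally show "(LINT \<theta>|lborel. g (\<theta>, w)) = indicator ?B w *\<^sub>R H 0" .
  qed
  also have "\<dots> = measure lborel ?B *\<^sub>R H 0" using fin by (simp add: less_top[symmetric])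
  finally show ?thesis .
qed

lemma entire_submean_ball:
  fixes H :: "complex ^ 'n \<Rightarrow> complex"
  assumes H: "entire_Cn H"
  shows "measure lborel (ball 0 1 :: (complex ^ 'n) set) * norm (H 0) \<le> (LINT w|lborel. indicator (ball 0 1) w * norm (H w))"
proof -
  have "measure lborel (ball 0 1 :: (complex ^ 'n) set) * norm (H 0) = norm (LINT w|lborel. indicator (ball 0 1) w *\<^sub>R H w)"
    unfolding entire_mean_ball[OF H] by simp
  also have "\<dots> \<le> (LINT w|lborel. norm (indicator (ball 0 1) w *\<^sub>R H w))"
    by (rule integral_norm_bound)
  finally show ?thesis by simp
qed

subsection \<open>Pointwise bounds from weighted integrability\<close>

text \<open>The exponential part of the weight in the parameter \<open>T = tanh (2 t)\<close>, for
  which \<open>coth (2 t)\<close> is \<open>1 / T\<close>.\<close>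

definition gw :: "real \<Rightarrow> complex ^ 'n \<Rightarrow> real" where
  "gw T z = exp (T * (\<Sum>i\<in>UNIV. (Re (z $ i))\<^sup>2) - (\<Sum>i\<in>UNIV. (Im (z $ i))\<^sup>2) / T)"

lemma gw_pos: "gw T z > 0" by (simp add: gw_def)

lemma continuous_on_gw [continuous_intros]: "continuous_on S f \<Longrightarrow> continuous_on S (\<lambda>x. gw T (f x))"
  unfolding gw_def divide_inverse by (intro continuous_intros)

lemma gw_measurable [measurable]: "gw T \<in> borel_measurable borel"
  by (intro borel_measurable_continuous_onI continuous_intros)

lemma lborel_integral_shift:
  fixes f :: "'a::euclidean_space \<Rightarrow> 'b::{banach, second_countable_topology}"
  assumes [measurable]: "f \<in> borel_measurable borel"
  shows "integrable lborel (\<lambda>x. f (c + x)) \<longleftrightarrow> integrable lborel f" "(LINT x|lborel. f (c + x)) = (LINT x|lborel. f x)"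
proof -
  have d: "distr lborel borel ((+) c) = (lborel :: 'a measure)" by (rule lborel_distr_plus)
  show "integrable lborel (\<lambda>x. f (c + x)) \<longleftrightarrow> integrable lborel f"
    by (subst (2) d[symmetric]) (simp add: integrable_distr_eq)
  show "(LINT x|lborel. f (c + x)) = (LINT x|lborel. f x)"
    by (subst (2) d[symmetric]) (simp add: integral_distr)
qed

text \<open>The weight equals \<open>exp (- b |z|\<^sup>2) |exp (\<kappa> z \<cdot> z)|\<close>; after multiplying by
  \<open>exp (\<kappa> z \<cdot> z - 2 b w \<cdot> cnj z0)\<close> the mean value property at \<open>z0\<close> has weighted integrand.\<close>

lemma entire_gw_bound:
  fixes T :: real
  assumes T: "0 < T" "T < 1"
  obtains C where "C > 0"
    "\<And>F :: complex ^ 'n \<Rightarrow> complex. \<And>z. entire_Cn F \<Longrightarrow> integrable lborel (\<lambda>z. (norm (F z))\<^sup>2 * gw T z) \<Longrightarrow>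
       (norm (F z))\<^sup>2 * gw T z \<le> C * (LINT z|lborel. (norm (F z))\<^sup>2 * gw T z)"
proof -
  define b where "b = (1/T - T) / 2"
  define \<kappa> where "\<kappa> = (1/T + T) / 2"
  have "T * T < 1 * 1" using T by (intro mult_strict_mono) auto
  then have b: "b > 0" using T by (simp add: b_def field_simps)
  have Tb: "T = \<kappa> - b" "1/T = \<kappa> + b" by (simp_all add: b_def \<kappa>_def field_simps)
  define q where "q z = (\<Sum>i\<in>UNIV. (z $ i)\<^sup>2)" for z :: "complex ^ 'n"
  have gw_eq: "gw T z = exp (- b * (norm z)\<^sup>2) * norm (exp (\<kappa> * q z))" for z :: "complex ^ 'n"
  proof -
    have Re2: "Re ((z $ i)\<^sup>2) = (Re (z $ i))\<^sup>2 - (Im (z $ i))\<^sup>2" for i by (simp add: power2_eq_square)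
    have "T * (\<Sum>i\<in>UNIV. (Re (z $ i))\<^sup>2) - (\<Sum>i\<in>UNIV. (Im (z $ i))\<^sup>2) / T =
       (\<kappa> - b) * (\<Sum>i\<in>UNIV. (Re (z $ i))\<^sup>2) - (\<Sum>i\<in>UNIV. (Im (z $ i))\<^sup>2) * (\<kappa> + b)"
      unfolding Tb(2)[symmetric] unfolding Tb(1)[symmetric] by simp
    also have "\<dots> = - b * (norm z)\<^sup>2 + Re (\<kappa> * q z)"
      by (simp add: norm_vec_power2 q_def cmod_power2 Re2 sum.distrib sum_subtractf algebra_simps)
    finally show ?thesis unfolding gw_def norm_exp_eq_Re exp_add[symmetric] by simp
  qed
  define vol where "vol = measure lborel (ball 0 1 :: (complex ^ 'n) set)"
  have vol: "vol > 0" unfolding vol_def by (rule content_ball_pos) simp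
  show ?thesis
  proof (rule that[of "exp b / vol"])
    show "exp b / vol > 0" using vol by simp
    fix F :: "complex ^ 'n \<Rightarrow> complex" and z0
    assume F: "entire_Cn F" and int: "integrable lborel (\<lambda>z. (norm (F z))\<^sup>2 * gw T z)"
    have [measurable]: "F \<in> borel_measurable borel" using F by (rule entire_measurable)
    define I where "I = (LINT z|lborel. (norm (F z))\<^sup>2 * gw T z)"
    define l where "l w = (\<Sum>i\<in>UNIV. w $ i * cnj (z0 $ i))" for w :: "complex ^ 'n"
    \<comment> \<open>\<open>F\<close> is squared so that the modulus of a holomorphic function
      carries \<open>(norm F)^2\<close>; the factor with \<open>l w\<close> cancels the mixed term
      of \<open>(norm (z0 + w))^2\<close>.\<close>
    define H where "H w = (F (z0 + w))\<^sup>2 * exp (\<kappa> * q (z0 + w)) * exp (- 2 * b * l w)" for w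
    have "entire_Cn H"
      unfolding H_def q_def l_def
      by (intro entire_mult entire_power entire_exp entire_scale entire_sum entire_nth entire_const
          entire_shift[where F="\<lambda>z. exp (\<kappa> * (\<Sum>i\<in>UNIV. (z $ i)\<^sup>2))"] entire_shift F)
    have normH: "norm (H w) = (norm (F (z0 + w)))\<^sup>2 * gw T (z0 + w) * (exp (b * (norm z0)\<^sup>2) * exp (b * (norm w)\<^sup>2))" for w
    proof -
      have "(norm (z0 + w))\<^sup>2 = (norm z0)\<^sup>2 + (norm w)\<^sup>2 + 2 * Re (l w)"
      proof -
        have "(norm (z0 $ i + w $ i))\<^sup>2 = (norm (z0 $ i))\<^sup>2 + (norm (w $ i))\<^sup>2 + 2 * Re (w $ i * cnj (z0 $ i))" for i
          unfolding cmod_power2 by (simp add: power2_eq_square algebra_simps)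
        then show ?thesis by (simp add: norm_vec_power2 l_def sum.distrib sum_distrib_left)
      qed
      then have "exp (- b * (norm (z0 + w))\<^sup>2) * (exp (b * (norm z0)\<^sup>2) * exp (b * (norm w)\<^sup>2)) = exp (Re (- 2 * b * l w))"
        by (simp add: exp_add[symmetric] algebra_simps)
      then show ?thesis
        unfolding H_def gw_eq norm_mult norm_power norm_exp_eq_Re by (simp add: mult_ac)
    qed
    have "vol * norm (H 0) \<le> (LINT w|lborel. indicator (ball 0 1) w * norm (H w))"
      unfolding vol_def by (rule entire_submean_ball) fact
    also have "\<dots> \<le> (LINT w|lborel. exp (b * (norm z0)\<^sup>2) * exp b * ((norm (F (z0 + w)))\<^sup>2 * gw T (z0 + w)))"
    proof (rule integral_mono_AE')
      show "integrable lborel (\<lambda>w. exp (b * (norm z0)\<^sup>2) * exp b * ((norm (F (z0 + w)))\<^sup>2 * gw T (z0 + w)))"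
        using lborel_integral_shift(1)[of "\<lambda>z. (norm (F z))\<^sup>2 * gw T z" z0] int by (intro integrable_mult_right) simp
      show "AE w in lborel. indicator (ball 0 1) w * norm (H w) \<le> exp (b * (norm z0)\<^sup>2) * exp b * ((norm (F (z0 + w)))\<^sup>2 * gw T (z0 + w))"
      proof (rule AE_I2)
        fix w :: "complex ^ 'n"
        show "indicator (ball 0 1) w * norm (H w) \<le> exp (b * (norm z0)\<^sup>2) * exp b * ((norm (F (z0 + w)))\<^sup>2 * gw T (z0 + w))"
        proof (cases "norm w < 1")
          case True
          then have "b * (norm w)\<^sup>2 \<le> b * 1" using b by (intro mult_left_mono) (auto simp: power_le_one)
          then have "exp (b * (norm w)\<^sup>2) \<le> exp b" by simp
          then have "((norm (F (z0 + w)))\<^sup>2 * gw T (z0 + w) * exp (b * (norm z0)\<^sup>2)) * exp (b * (norm w)\<^sup>2)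
              \<le> ((norm (F (z0 + w)))\<^sup>2 * gw T (z0 + w) * exp (b * (norm z0)\<^sup>2)) * exp b"
            using gw_pos[of T "z0 + w"] by (intro mult_left_mono) auto
          then show ?thesis using True unfolding normH by (simp add: mult_ac)
        qed (use gw_pos[of T "z0 + w"] in \<open>auto simp: indicator_def\<close>)
      qed
    qed (intro AE_I2 mult_nonneg_nonneg, auto intro: less_imp_le gw_pos)
    also have "\<dots> = exp (b * (norm z0)\<^sup>2) * exp b * I"
      using lborel_integral_shift(2)[of "\<lambda>z. (norm (F z))\<^sup>2 * gw T z" z0] by (simp add: I_def)
    finally have "exp (b * (norm z0)\<^sup>2) * (vol * ((norm (F z0))\<^sup>2 * gw T z0)) \<le> exp (b * (norm z0)\<^sup>2) * (exp b * I)"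
      unfolding normH by (simp add: mult_ac)
    then have "vol * ((norm (F z0))\<^sup>2 * gw T z0) \<le> exp b * I" by simp
    then show "(norm (F z0))\<^sup>2 * gw T z0 \<le> exp b / vol * (LINT z|lborel. (norm (F z))\<^sup>2 * gw T z)"
      using vol by (simp add: I_def field_simps)
  qed
qed

subsection \<open>Completeness of the Hermite functions\<close>

text \<open>The admissible one-variable factors for the completeness proof. Half of the decay
  \<open>exp (- x^2 / 2)\<close> of a Hermite function is given away, which leaves room for
  polynomials and exponentials and provides one dominating function for all limits.\<close>

definition gb :: "(real \<Rightarrow> complex) \<Rightarrow> bool" where
  "gb u \<longleftrightarrow> u \<in> borel_measurable borel \<and> (\<exists>C. \<forall>x. norm (u x) \<le> C * exp (- x\<^sup>2 / 4))"

lemma gbI: "u \<in> borel_measurable borel \<Longrightarrow> (\<And>x. norm (u x) \<le> C * exp (- x\<^sup>2 / 4)) \<Longrightarrow> gb u"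
  unfolding gb_def by blast

lemma gb_lin:
  assumes "gb u" "gb v" shows "gb (\<lambda>x. a * u x + b * v x)"
proof -
  obtain C D where C: "\<And>x. norm (u x) \<le> C * exp (- x\<^sup>2 / 4)" and D: "\<And>x. norm (v x) \<le> D * exp (- x\<^sup>2 / 4)"
    using assms unfolding gb_def by blast
  have [measurable]: "u \<in> borel_measurable borel" "v \<in> borel_measurable borel" using assms by (auto simp: gb_def)
  show ?thesis
  proof (rule gbI)
    fix x
    have "norm (a * u x + b * v x) \<le> norm a * norm (u x) + norm b * norm (v x)"
      by (rule order_trans[OF norm_triangle_ineq]) (simp add: norm_mult)
    also have "\<dots> \<le> norm a * (C * exp (- x\<^sup>2 / 4)) + norm b * (D * exp (- x\<^sup>2 / 4))"
      by (intro add_mono mult_left_mono C D) auto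
    finally show "norm (a * u x + b * v x) \<le> (norm a * C + norm b * D) * exp (- x\<^sup>2 / 4)"
      by (simp add: algebra_simps)
  qed measurable
qed

lemma gb_monom_hc: "gb (\<lambda>x. complex_of_real x ^ m * hc k (complex_of_real x))"
proof -
  obtain C where C: "C > 0" "\<And>z::complex. norm (Hp k z) \<le> C * (1 + norm z) ^ k" using Hp_bound[of k] by blast
  obtain D where D: "D > 0" "\<And>r::real. r \<ge> 0 \<Longrightarrow> (1 + r) ^ (m + k) \<le> D * exp ((1/4) * r\<^sup>2)"
    using pow_le_gauss[of "1/4" "m + k"] by auto
  show ?thesis
  proof (rule gbI)
    show "(\<lambda>x. complex_of_real x ^ m * hc k (complex_of_real x)) \<in> borel_measurable borel"
      by (intro borel_measurable_continuous_onI continuous_intros)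
    fix x :: real
    have "norm (complex_of_real x ^ m * hc k (complex_of_real x)) = \<bar>x\<bar> ^ m * norm (Hp k (complex_of_real x)) * exp (- x\<^sup>2 / 2) / hnorm k"
      using hnorm_pos[of k] by (simp add: hc_def norm_mult norm_divide norm_power norm_exp_eq_Re)
    also have "\<dots> \<le> (1 + \<bar>x\<bar>) ^ m * (C * (1 + \<bar>x\<bar>) ^ k) * exp (- x\<^sup>2 / 2) / hnorm k"
      using C(2)[of "complex_of_real x"] C(1) hnorm_pos[of k]
      by (intro divide_right_mono mult_right_mono mult_mono power_mono) auto
    also have "\<dots> = C / hnorm k * ((1 + \<bar>x\<bar>) ^ (m + k) * exp (- x\<^sup>2 / 2))" by (simp add: power_add mult_ac)
    also have "\<dots> \<le> C / hnorm k * (D * exp ((1/4) * \<bar>x\<bar>\<^sup>2) * exp (- x\<^sup>2 / 2))"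
      using C(1) hnorm_pos[of k] by (intro mult_left_mono mult_right_mono D) auto
    also have "\<dots> = C / hnorm k * D * exp (- x\<^sup>2 / 4)" by (simp add: exp_add[symmetric])
    finally show "norm (complex_of_real x ^ m * hc k (complex_of_real x)) \<le> C / hnorm k * D * exp (- x\<^sup>2 / 4)" .
  qed
qed

lemma gb_hc: "gb (\<lambda>x. hc k (complex_of_real x))"
  using gb_monom_hc[of 0] by simp

lemma gb_gauss: "gb (\<lambda>x. complex_of_real (exp (- x\<^sup>2 / 2) * a x))"
  if [measurable]: "a \<in> borel_measurable borel" and b: "\<And>x. \<bar>a x\<bar> \<le> C" for a
proof (rule gbI)
  fix x
  have "\<bar>a x\<bar> * exp (- x\<^sup>2 / 2) \<le> C * exp (- x\<^sup>2 / 4)"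
    using b[of x] by (intro mult_mono) auto
  then show "norm (complex_of_real (exp (- x\<^sup>2 / 2) * a x)) \<le> C * exp (- x\<^sup>2 / 4)"
    by (simp add: norm_mult abs_mult mult.commute del: of_real_mult)
qed measurable

text \<open>If \<open>g\<close> is orthogonal to all Hermite functions, then one coordinate at a
  time the Hermite factor in a tensor product can be traded for monomials times Gaussians,
  exponentials, narrow Gaussians and finally indicators of intervals, always keeping the pairing
  with \<open>g\<close> zero.\<close>

locale L2_pairing =
  fixes g :: "real ^ 'n \<Rightarrow> complex"
  assumes g: "L2 lborel g"
begin

lemma g_measurable [measurable]: "g \<in> borel_measurable borel"
  using g by (simp add: L2_def)

definition J :: "('n \<Rightarrow> real \<Rightarrow> complex) \<Rightarrow> complex" where
  "J u = (LINT x|lborel. g x * (\<Prod>i\<in>UNIV. u i (x $ i)))"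

lemma w_integrable: "integrable lborel (\<lambda>x. norm (g x) * exp (- (norm x)\<^sup>2 / 4))"
proof -
  have "L2 lborel (\<lambda>x :: real ^ 'n. complex_of_real (exp (- (norm x)\<^sup>2 / 4)))"
    unfolding L2_def
  proof
    have "(\<lambda>x :: real ^ 'n. (norm (complex_of_real (exp (- (norm x)\<^sup>2 / 4))))\<^sup>2) = (\<lambda>x. exp (- (1/2) * (norm x)\<^sup>2))"
      by (simp add: exp_double[symmetric] fun_eq_iff)
    then show "integrable lborel (\<lambda>x :: real ^ 'n. (norm (complex_of_real (exp (- (norm x)\<^sup>2 / 4))))\<^sup>2)"
      using integrable_gauss_vec[of "1/2", where 'n='n] by simp
  qed measurable
  from integrable_norm[OF L2_mult_integrable[OF g this]] show ?thesis by (simp add: norm_mult)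
qed

lemma prod_bound:
  assumes "\<And>i. norm (u i (x $ i)) \<le> C i * exp (- (x $ i)\<^sup>2 / 4)"
  shows "norm (g x * (\<Prod>i\<in>UNIV. u i (x $ i))) \<le> (\<Prod>i\<in>UNIV. C i) * (norm (g x) * exp (- (norm (x :: real ^ 'n))\<^sup>2 / 4))"
proof -
  have "norm (\<Prod>i\<in>UNIV. u i (x $ i)) \<le> (\<Prod>i\<in>UNIV. C i * exp (- (x $ i)\<^sup>2 / 4))"
    unfolding prod_norm[symmetric] by (intro prod_mono) (use assms in auto)
  also have "\<dots> = (\<Prod>i\<in>UNIV. C i) * exp (- (norm x)\<^sup>2 / 4)"
    by (simp add: prod.distrib exp_sum[symmetric] norm_vec_power2 sum_divide_distrib sum_negf[symmetric])
  finally show ?thesis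
    unfolding norm_mult by (metis mult.left_commute mult_left_mono norm_ge_zero)
qed

lemma gb_prod_measurable:
  assumes "\<And>i. gb (u i)" shows "(\<lambda>x :: real ^ 'n. g x * (\<Prod>i\<in>UNIV. u i (x $ i))) \<in> borel_measurable borel"
proof -
  have [measurable]: "u i \<in> borel_measurable borel" for i using assms by (simp add: gb_def)
  show ?thesis by measurable
qed

lemma J_int:
  assumes "\<And>i. gb (u i)" shows "integrable lborel (\<lambda>x. g x * (\<Prod>i\<in>UNIV. u i (x $ i)))"
proof -
  obtain C where C: "\<And>i x. norm (u i x) \<le> C i * exp (- x\<^sup>2 / 4)" using assms unfolding gb_def by metis
  show ?thesis
  proof (rule Bochner_Integration.integrable_bound)
    show "integrable lborel (\<lambda>x. (\<Prod>i\<in>UNIV. C i) * (norm (g x) * exp (- (norm x)\<^sup>2 / 4)))"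
      by (intro integrable_mult_right w_integrable)
    show "AE x in lborel. norm (g x * (\<Prod>i\<in>UNIV. u i (x $ i))) \<le> norm ((\<Prod>i\<in>UNIV. C i) * (norm (g x) * exp (- (norm x)\<^sup>2 / 4)))"
      using prod_bound[of u _ C] C by (intro AE_I2) (metis abs_ge_self order_trans real_norm_def)
  qed (use gb_prod_measurable[OF assms] in simp)
qed

lemma prod_upd: "(\<Prod>i\<in>UNIV. (u(j := v)) i (x $ i)) = v (x $ j) * (\<Prod>i\<in>UNIV - {j}. u i (x $ i))" for x :: "real ^ 'n"
  by (subst prod.remove[of UNIV j]) (auto intro!: prod.cong)

context
  fixes u :: "'n \<Rightarrow> real \<Rightarrow> complex" and j :: 'n
  assumes u: "\<And>i. gb (u i)"
begin

lemma upd_gb: "gb v \<Longrightarrow> gb ((u(j := v)) i)"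
  using u by auto

lemma J_lin:
  assumes "gb v" "gb w"
  shows "J (u(j := \<lambda>x. a * v x + b * w x)) = a * J (u(j := v)) + b * J (u(j := w))"
proof -
  have "J (u(j := \<lambda>x. a * v x + b * w x)) =
    (LINT x|lborel. a * (g x * (\<Prod>i\<in>UNIV. (u(j := v)) i (x $ i))) + b * (g x * (\<Prod>i\<in>UNIV. (u(j := w)) i (x $ i))))"
    unfolding J_def prod_upd by (intro Bochner_Integration.integral_cong refl) (simp add: algebra_simps)
  also have "\<dots> = a * J (u(j := v)) + b * J (u(j := w))"
    using J_int[of "u(j := v)", OF upd_gb[OF assms(1)]] J_int[of "u(j := w)", OF upd_gb[OF assms(2)]]
    unfolding J_def by (subst Bochner_Integration.integral_add) (auto intro: integrable_mult_right)
  finally show ?thesis .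
qed

text \<open>Dominated convergence. The exceptional set \<open>X\<close> of coordinate values is
  finite, hence contributes finitely many hyperplanes, a null set; it absorbs the end points of
  intervals.\<close>

lemma J_lim:
  assumes v: "\<And>n. v n \<in> borel_measurable borel" "\<And>n x. norm (v n x) \<le> C * exp (- x\<^sup>2 / 4)" "gb w"
    and lim: "\<And>x. x \<notin> X \<Longrightarrow> (\<lambda>n. v n x) \<longlonglongrightarrow> w x" "finite X"
    and 0: "\<And>n. J (u(j := v n)) = 0"
  shows "J (u(j := w)) = 0"
proof -
  obtain D where D: "\<And>i x. norm (u i x) \<le> D i * exp (- x\<^sup>2 / 4)" using u unfolding gb_def by metis
  have vgb: "gb (v n)" for n by (rule gbI[OF v(1,2)])
  have null: "AE x in lborel. (x :: real ^ 'n) $ j \<notin> X"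
  proof -
    have "AE x in lborel. (x :: real ^ 'n) $ j \<noteq> c" for c
    proof -
      have "negligible {x :: real ^ 'n. x \<bullet> axis j 1 = c}" by (rule negligible_standard_hyperplane) (simp add: Basis_real_vec)
      then have "{x :: real ^ 'n. x $ j = c} \<in> null_sets lebesgue"
        by (simp add: negligible_iff_null_sets inner_axis)
      then have "AE x in lebesgue. (x :: real ^ 'n) $ j \<noteq> c" using AE_not_in by fastforce
      then show ?thesis by (simp add: AE_completion_iff)
    qed
    then have "AE x in lborel. \<forall>c\<in>X. (x :: real ^ 'n) $ j \<noteq> c" using \<open>finite X\<close> by (simp add: AE_finite_all)
    then show ?thesis by eventually_elim auto
  qed
  define E where "E = D(j := C)"
  have "(\<lambda>n. J (u(j := v n))) \<longlonglongrightarrow> J (u(j := w))"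
    unfolding J_def
  proof (rule integral_dominated_convergence)
    show "integrable lborel (\<lambda>x. (\<Prod>i\<in>UNIV. E i) * (norm (g x) * exp (- (norm x)\<^sup>2 / 4)))"
      by (intro integrable_mult_right w_integrable)
    show "AE x in lborel. norm (g x * (\<Prod>i\<in>UNIV. (u(j := v n)) i (x $ i))) \<le> (\<Prod>i\<in>UNIV. E i) * (norm (g x) * exp (- (norm x)\<^sup>2 / 4))" for n
      by (intro AE_I2 prod_bound) (use D v in \<open>auto simp: E_def\<close>)
    show "AE x in lborel. (\<lambda>n. g x * (\<Prod>i\<in>UNIV. (u(j := v n)) i (x $ i))) \<longlonglongrightarrow> g x * (\<Prod>i\<in>UNIV. (u(j := w)) i (x $ i))"
      using null unfolding prod_upd by eventually_elim (intro tendsto_intros lim)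
  qed (use gb_prod_measurable[of "u(j := w)", OF upd_gb[OF v(3)]] gb_prod_measurable[of "u(j := v _)", OF upd_gb[OF vgb]] in \<open>simp_all del: fun_upd_apply\<close>)
  then show ?thesis using 0 by (simp add: LIMSEQ_const_iff)
qed

text \<open>Superpositions of annihilated factors are annihilated: the integral over the parameter
  commutes with the pairing, thanks to the majorant \<open>w s * exp (- x^2 / 4)\<close>.\<close>

lemma J_fub:
  fixes V :: "real \<Rightarrow> real \<Rightarrow> complex"
  assumes V [measurable]: "(\<lambda>(s, x). V s x) \<in> borel_measurable (lborel \<Otimes>\<^sub>M lborel)"
    and w: "integrable lborel w" "\<And>s x. norm (V s x) \<le> w s * exp (- x\<^sup>2 / 4)"
    and 0: "\<And>s. J (u(j := V s)) = 0"
  shows "J (u(j := \<lambda>x. LINT s|lborel. V s x)) = 0"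
proof -
  obtain D where D: "\<And>i x. norm (u i x) \<le> D i * exp (- x\<^sup>2 / 4)" using u unfolding gb_def by metis
  have [measurable]: "u i \<in> borel_measurable borel" for i using u by (simp add: gb_def)
  define f where "f = (\<lambda>(s, x :: real ^ 'n). g x * (V s (x $ j) * (\<Prod>i\<in>UNIV - {j}. u i (x $ i))))"
  have fm: "f \<in> borel_measurable (lborel \<Otimes>\<^sub>M lborel)"
  proof -
    have "(\<lambda>(s, x :: real ^ 'n). V s (x $ j)) \<in> borel_measurable (lborel \<Otimes>\<^sub>M lborel)"
    proof -
      have "(\<lambda>p :: real \<times> (real ^ 'n). (fst p, snd p $ j)) \<in> measurable (lborel \<Otimes>\<^sub>M lborel) (lborel \<Otimes>\<^sub>M lborel)"
      proof -
        have "(\<lambda>x :: real ^ 'n. x $ j) \<in> borel_measurable borel"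
          by (intro borel_measurable_continuous_onI continuous_intros)
        then have "(\<lambda>p :: real \<times> (real ^ 'n). snd p $ j) \<in> borel_measurable (lborel \<Otimes>\<^sub>M lborel)"
          by (intro measurable_compose[OF measurable_snd]) simp
        then show ?thesis by simp
      qed
      from measurable_compose[OF this V] show ?thesis by (simp add: case_prod_beta')
    qed
    note mV = this[unfolded case_prod_beta']
    have "(\<lambda>x :: real ^ 'n. \<Prod>i\<in>UNIV - {j}. u i (x $ i)) \<in> borel_measurable lborel" by measurable
    from measurable_compose[OF measurable_snd this]
    have mP: "(\<lambda>p :: real \<times> (real ^ 'n). \<Prod>i\<in>UNIV - {j}. u i (snd p $ i)) \<in> borel_measurable (lborel \<Otimes>\<^sub>M lborel)" .
    show ?thesis unfolding f_def case_prod_beta' by (intro borel_measurable_times mV mP) measurable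
  qed
  \<comment> \<open>The slot \<open>j\<close> is set to 1 because its bound \<open>w s\<close>
    depends on the parameter and is kept apart.\<close>
  define K where "K = (\<Prod>i\<in>UNIV. (D(j := 1)) i)"
  have int: "integrable (lborel \<Otimes>\<^sub>M lborel) f"
  proof (rule Bochner_Integration.integrable_bound[OF _ fm])
    show "integrable (lborel \<Otimes>\<^sub>M lborel) (\<lambda>p :: real \<times> (real ^ 'n). K * (w (fst p) * (norm (g (snd p)) * exp (- (norm (snd p))\<^sup>2 / 4))))"
      using lborel_pair.integrable_product_swap
      by (intro integrable_mult_right lborel_pair.Fubini_integrable)
        (use w w_integrable in \<open>auto simp: abs_mult case_prod_beta' dest: borel_measurable_integrable\<close>)
    show "AE p in lborel \<Otimes>\<^sub>M lborel. norm (f p) \<le> norm (K * (w (fst p) * (norm (g (snd p)) * exp (- (norm (snd p))\<^sup>2 / 4))))"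
    proof (intro AE_I2)
      fix p :: "real \<times> (real ^ 'n)"
      obtain s x where p: "p = (s, x)" by (cases p)
      have "norm (g x * (\<Prod>i\<in>UNIV. (u(j := V s)) i (x $ i))) \<le> (\<Prod>i\<in>UNIV. (D(j := w s)) i) * (norm (g x) * exp (- (norm x)\<^sup>2 / 4))"
        by (rule prod_bound) (use D w in auto)
      also have "(\<Prod>i\<in>UNIV. (D(j := w s)) i) = w s * K"
        unfolding K_def by (subst (1 2) prod.remove[of UNIV j]) (auto intro!: prod.cong)
      finally show "norm (f p) \<le> norm (K * (w (fst p) * (norm (g (snd p)) * exp (- (norm (snd p))\<^sup>2 / 4))))"
        unfolding prod_upd p f_def by (simp add: mult_ac)
    qed
  qed
  have "J (u(j := \<lambda>x. LINT s|lborel. V s x)) = (LINT x|lborel. LINT s|lborel. f (s, x))"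
    unfolding J_def prod_upd f_def by (simp add: mult.assoc[symmetric])
  also have "\<dots> = (LINT s|lborel. LINT x|lborel. f (s, x))"
    using lborel_pair.Fubini_integral[of "\<lambda>s x. f (s, x)"] int by simp
  also have "\<dots> = (LINT s|lborel. J (u(j := V s)))"
    unfolding J_def prod_upd f_def by simp
  also have "\<dots> = 0" by (simp add: 0)
  finally show ?thesis .
qed

text \<open>The three-term recursion, solved for \<open>x * hc k x\<close>, trades one power of
  \<open>x\<close> for the neighbouring Hermite functions.\<close>

lemma J_monom:
  assumes hc: "\<And>k. J (u(j := \<lambda>x. hc k (complex_of_real x))) = 0"
  shows "J (u(j := \<lambda>x. complex_of_real x ^ m * hc k (complex_of_real x))) = 0"
proof (induction m arbitrary: k)
  case (Suc m)
  have "complex_of_real x * hc k (complex_of_real x) =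
     complex_of_real (hnorm (Suc k) / (2 * hnorm k)) * hc (Suc k) (complex_of_real x) +
     complex_of_real (k * hnorm (k - 1) / hnorm k) * hc (k - 1) (complex_of_real x)" for x
    using hnorm_pos[of k] hnorm_pos[of "Suc k"] hnorm_pos[of "k - 1"]
    unfolding hc_def Hp_Suc by (simp add: field_simps)
  then have e: "(\<lambda>x. complex_of_real x ^ Suc m * hc k (complex_of_real x)) =
     (\<lambda>x. complex_of_real (hnorm (Suc k) / (2 * hnorm k)) * (complex_of_real x ^ m * hc (Suc k) (complex_of_real x)) +
       complex_of_real (k * hnorm (k - 1) / hnorm k) * (complex_of_real x ^ m * hc (k - 1) (complex_of_real x)))"
    by (intro ext) (simp only: power_Suc2 mult.assoc distrib_left mult.left_commute)
  show ?case unfolding e by (subst J_lin) (auto intro: gb_monom_hc simp: Suc)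
qed (simp add: hc)

text \<open>Partial sums of the exponential series are combinations of monomials times
  \<open>hc 0\<close>, and they are dominated by
  \<open>exp \<bar>\<xi> x\<bar> \<le> exp (\<xi>^2 + x^2 / 4)\<close>, which uses up exactly the
  spare Gaussian decay.\<close>

lemma J_exp:
  assumes hc: "\<And>k. J (u(j := \<lambda>x. hc k (complex_of_real x))) = 0"
  shows "J (u(j := \<lambda>x. exp (\<i> * complex_of_real (\<xi> * x)) * complex_of_real (exp (- x\<^sup>2 / 2)))) = 0"
proof -
  define v where "v n x = (\<Sum>m<n. (\<i> * complex_of_real (\<xi> * x)) ^ m / fact m) * complex_of_real (exp (- x\<^sup>2 / 2))" for n x
  have hc0: "complex_of_real (exp (- x\<^sup>2 / 2)) = hnorm 0 * hc 0 (complex_of_real x)" for x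
    using hnorm_pos[of 0] by (simp add: hc_def exp_of_real[symmetric])
  have b1: "norm (\<Sum>m<n. (\<i> * complex_of_real (\<xi> * x)) ^ m / fact m) \<le> exp (\<xi>\<^sup>2 + x\<^sup>2 / 4)" for n x
  proof -
    have "norm (\<Sum>m<n. (\<i> * complex_of_real (\<xi> * x)) ^ m / fact m) \<le> (\<Sum>m<n. \<bar>\<xi> * x\<bar> ^ m / fact m)"
      by (rule sum_norm_le) (simp add: norm_divide norm_power norm_mult abs_mult)
    also have "\<dots> \<le> (\<Sum>m. \<bar>\<xi> * x\<bar> ^ m / fact m)"
      using summable_exp[of "\<bar>\<xi> * x\<bar>"] by (intro sum_le_suminf) (auto simp: divide_inverse mult.commute)
    also have "\<dots> = exp \<bar>\<xi> * x\<bar>" by (simp add: exp_def divide_inverse mult.commute)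
    also have "\<dots> \<le> exp (\<xi>\<^sup>2 + x\<^sup>2 / 4)"
    proof -
      have "0 \<le> (\<bar>\<xi>\<bar> - \<bar>x\<bar> / 2)\<^sup>2" by simp
      then show ?thesis by (simp add: power2_diff abs_mult power_divide)
    qed
    finally show ?thesis .
  qed
  have b2: "norm (a * complex_of_real (exp (- x\<^sup>2 / 2))) \<le> exp (\<xi>\<^sup>2) * exp (- x\<^sup>2 / 4)" if "norm a \<le> exp (\<xi>\<^sup>2 + x\<^sup>2 / 4)" for a x
  proof -
    have "norm (a * complex_of_real (exp (- x\<^sup>2 / 2))) \<le> exp (\<xi>\<^sup>2 + x\<^sup>2 / 4) * exp (- x\<^sup>2 / 2)"
      using that by (simp add: norm_mult)
    also have "\<dots> = exp (\<xi>\<^sup>2) * exp (- x\<^sup>2 / 4)" by (simp add: exp_add[symmetric])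
    finally show ?thesis .
  qed
  have gbv: "gb (v n)" for n
  proof (rule gbI)
    show "v n \<in> borel_measurable borel" unfolding v_def by measurable
    show "norm (v n x) \<le> exp (\<xi>\<^sup>2) * exp (- x\<^sup>2 / 4)" for x unfolding v_def by (rule b2[OF b1])
  qed
  show ?thesis
  proof (rule J_lim[where v = v and C = "exp (\<xi>\<^sup>2)" and X = "{}"])
    show "v n \<in> borel_measurable borel" for n using gbv by (simp add: gb_def)
    show "norm (v n x) \<le> exp (\<xi>\<^sup>2) * exp (- x\<^sup>2 / 4)" for n x unfolding v_def by (rule b2[OF b1])
    show "gb (\<lambda>x. exp (\<i> * complex_of_real (\<xi> * x)) * complex_of_real (exp (- x\<^sup>2 / 2)))"
    proof (rule gbI)
      show "(\<lambda>x. exp (\<i> * complex_of_real (\<xi> * x)) * complex_of_real (exp (- x\<^sup>2 / 2))) \<in> borel_measurable borel"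
        by (intro borel_measurable_continuous_onI continuous_intros) auto
      show "norm (exp (\<i> * complex_of_real (\<xi> * x)) * complex_of_real (exp (- x\<^sup>2 / 2))) \<le> exp (\<xi>\<^sup>2) * exp (- x\<^sup>2 / 4)" for x
        by (rule b2) simp
    qed
    show "(\<lambda>n. v n x) \<longlonglongrightarrow> exp (\<i> * complex_of_real (\<xi> * x)) * complex_of_real (exp (- x\<^sup>2 / 2))" for x
    proof -
      have "(\<lambda>m. (\<i> * complex_of_real (\<xi> * x)) ^ m / fact m) sums exp (\<i> * complex_of_real (\<xi> * x))"
        using exp_converges[of "\<i> * complex_of_real (\<xi> * x)"] by (simp add: scaleR_conv_of_real divide_inverse mult.commute)
      then show ?thesis unfolding v_def sums_def by (intro tendsto_intros)
    qed
    show "J (u(j := v n)) = 0" for n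
    proof (induction n)
      case 0
      have "v 0 = (\<lambda>x. 0 * hc 0 (complex_of_real x) + 0 * hc 0 (complex_of_real x))" by (simp add: v_def fun_eq_iff)
      then show ?case using J_lin[of "\<lambda>x. hc 0 (complex_of_real x)" "\<lambda>x. hc 0 (complex_of_real x)" 0 0] by (simp add: gb_hc del: fun_upd_apply)
    next
      case (Suc n)
      have "v (Suc n) = (\<lambda>x. 1 * v n x + ((\<i> * complex_of_real \<xi>) ^ n / fact n * complex_of_real (hnorm 0)) * (complex_of_real x ^ n * hc 0 (complex_of_real x)))"
        unfolding v_def hc0 by (simp add: fun_eq_iff algebra_simps power_mult_distrib)
      then show ?case using J_lin[OF gbv gb_monom_hc, of 1 n "(\<i> * complex_of_real \<xi>) ^ n / fact n * complex_of_real (hnorm 0)" n 0] Suc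
        by (simp add: J_monom[OF hc] del: fun_upd_apply)
    qed
  qed auto
qed

lemma J_scale: "gb v \<Longrightarrow> J (u(j := v)) = 0 \<Longrightarrow> J (u(j := \<lambda>x. a * v x)) = 0"
  using J_lin[of v v a 0] by simp

text \<open>A shifted Gaussian is a superposition of the exponentials
  \<open>exp (i \<xi> (x - s))\<close> with density \<open>exp (- \<epsilon> \<xi>^2)\<close>;
  \<open>\<epsilon> = \<delta>^2 / 4\<close> gives the width \<delta>.\<close>

lemma J_gauss:
  assumes hc: "\<And>k. J (u(j := \<lambda>x. hc k (complex_of_real x))) = 0" and \<delta>: "\<delta> > 0"
  shows "J (u(j := \<lambda>x. complex_of_real (exp (- x\<^sup>2 / 2) * exp (- ((x - s)\<^sup>2 / \<delta>\<^sup>2))))) = 0"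
proof -
  define \<epsilon> where "\<epsilon> = \<delta>\<^sup>2 / 4"
  have \<epsilon>: "\<epsilon> > 0" using \<delta> by (simp add: \<epsilon>_def)
  define V where "V \<xi> x = (exp (- \<i> * complex_of_real (\<xi> * s)) * complex_of_real (exp (- \<epsilon> * \<xi>\<^sup>2))) *
     (exp (\<i> * complex_of_real (\<xi> * x)) * complex_of_real (exp (- x\<^sup>2 / 2)))" for \<xi> x :: real
  have gbE: "gb (\<lambda>x. exp (\<i> * complex_of_real (\<xi> * x)) * complex_of_real (exp (- x\<^sup>2 / 2)))" for \<xi>
  proof (rule gbI)
    show "(\<lambda>x. exp (\<i> * complex_of_real (\<xi> * x)) * complex_of_real (exp (- x\<^sup>2 / 2))) \<in> borel_measurable borel"
      by (intro borel_measurable_continuous_onI continuous_intros) auto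
    show "norm (exp (\<i> * complex_of_real (\<xi> * x)) * complex_of_real (exp (- x\<^sup>2 / 2))) \<le> 1 * exp (- x\<^sup>2 / 4)" for x
      by (simp add: norm_mult)
  qed
  have "J (u(j := \<lambda>x. LINT \<xi>|lborel. V \<xi> x)) = 0"
  proof (rule J_fub)
    show "(\<lambda>(\<xi>, x). V \<xi> x) \<in> borel_measurable (lborel \<Otimes>\<^sub>M lborel)"
      unfolding lborel_prod measurable_lborel2 case_prod_beta' V_def
      by (intro borel_measurable_continuous_onI continuous_intros) auto
    show "integrable lborel (\<lambda>\<xi>. exp (- \<epsilon> * \<xi>\<^sup>2))" by (rule integrable_gauss[OF \<epsilon>])
    show "norm (V \<xi> x) \<le> exp (- \<epsilon> * \<xi>\<^sup>2) * exp (- x\<^sup>2 / 4)" for \<xi> x by (simp add: V_def norm_mult)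
    show "J (u(j := V \<xi>)) = 0" for \<xi>
      unfolding V_def by (rule J_scale[OF gbE J_exp[OF hc]])
  qed
  also have "(\<lambda>x. LINT \<xi>|lborel. V \<xi> x) = (\<lambda>x. complex_of_real (sqrt (pi / \<epsilon>)) * complex_of_real (exp (- x\<^sup>2 / 2) * exp (- ((x - s)\<^sup>2 / \<delta>\<^sup>2))))"
  proof
    fix x
    have "V \<xi> x = complex_of_real (exp (- x\<^sup>2 / 2)) * exp (\<i> * complex_of_real (x - s) * complex_of_real \<xi> - complex_of_real (\<epsilon> * \<xi>\<^sup>2))" for \<xi>
      by (simp add: V_def exp_of_real[symmetric] exp_add[symmetric] algebra_simps)
    then have "(LINT \<xi>|lborel. V \<xi> x) = complex_of_real (exp (- x\<^sup>2 / 2)) * complex_of_real (sqrt (pi / \<epsilon>) * exp (- (x - s)\<^sup>2 / (4 * \<epsilon>)))"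
      using gauss_fourier_integral[OF \<epsilon>, of "x - s"] by simp
    then show "(LINT \<xi>|lborel. V \<xi> x) = complex_of_real (sqrt (pi / \<epsilon>)) * complex_of_real (exp (- x\<^sup>2 / 2) * exp (- ((x - s)\<^sup>2 / \<delta>\<^sup>2)))"
      by (simp add: \<epsilon>_def)
  qed
  finally have "J (u(j := \<lambda>x. complex_of_real (sqrt (pi / \<epsilon>)) * complex_of_real (exp (- x\<^sup>2 / 2) * exp (- ((x - s)\<^sup>2 / \<delta>\<^sup>2))))) = 0" .
  moreover have g1: "gb (\<lambda>x. complex_of_real (exp (- x\<^sup>2 / 2) * exp (- ((x - s)\<^sup>2 / \<delta>\<^sup>2))))"
    by (rule gb_gauss[where C = 1]) auto
  ultimately show ?thesis
    using J_lin[OF g1 g1, of "complex_of_real (sqrt (pi / \<epsilon>))" 0] \<epsilon> by simp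
qed

text \<open>Gaussians of width \<open>\<delta> n\<close> with centres spread over the interval form
  an approximate identity: their normalised superposition tends to \<open>sqrt pi\<close> times the
  indicator, except at the two end points.\<close>

lemma J_indicator:
  assumes hc: "\<And>k. J (u(j := \<lambda>x. hc k (complex_of_real x))) = 0"
  shows "J (u(j := \<lambda>x. complex_of_real (exp (- x\<^sup>2 / 2) * indicator {c<..<d} x))) = 0"
proof -
  define \<delta> where "\<delta> n = 1 / real (Suc n)" for n
  have \<delta>: "\<delta> n > 0" for n by (simp add: \<delta>_def)
  have \<delta>0: "\<delta> \<longlonglongrightarrow> 0" unfolding \<delta>_def using LIMSEQ_inverse_real_of_nat by (simp add: divide_inverse)
  \<comment> \<open>The superposition after the substitution \<open>s = x + \<delta> n * r\<close>:
    in this form the Gaussian is free of \<open>n\<close> and serves as the dominating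
    function.\<close>
  define a where "a n x = (LINT r|lborel. indicator {c..d} (x + \<delta> n * r) * exp (- 1 * r\<^sup>2))" for n :: nat and x :: real
  have ig: "integrable lborel (\<lambda>r::real. exp (- 1 * r\<^sup>2))" by (rule integrable_gauss) simp
  have a_le: "\<bar>a n x\<bar> \<le> (LINT r|lborel. exp (- 1 * (r::real)\<^sup>2))" for n x
  proof -
    have "\<bar>a n x\<bar> \<le> (LINT r|lborel. \<bar>indicator {c..d} (x + \<delta> n * r) * exp (- 1 * r\<^sup>2)\<bar>)"
      unfolding a_def by (rule integral_abs_bound)
    also have "\<dots> \<le> (LINT r|lborel. exp (- 1 * r\<^sup>2))"
      by (rule integral_mono_AE'[OF ig]) (auto simp: indicator_def)
    finally show ?thesis .
  qed
  have a_alt: "a n x = (1 / \<delta> n) * (LINT s|lborel. indicator {c..d} s * exp (- ((x - s)\<^sup>2 / (\<delta> n)\<^sup>2)))" for n x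
    using lborel_integral_real_affine[of "\<delta> n" "\<lambda>s. indicator {c..d} s * exp (- ((x - s)\<^sup>2 / (\<delta> n)\<^sup>2))" x] \<delta>[of n]
    by (simp add: a_def power_mult_distrib)
  have am: "a n \<in> borel_measurable borel" for n
    unfolding a_def[abs_def] by (rule lborel.borel_measurable_lebesgue_integral[of _ borel, simplified]) measurable
  have gba: "gb (\<lambda>x. complex_of_real (exp (- x\<^sup>2 / 2) * a n x))" for n
    by (rule gb_gauss[OF am a_le])
  have lim: "(\<lambda>n. a n x) \<longlonglongrightarrow> sqrt pi * indicator {c<..<d} x" if x: "x \<notin> {c, d}" for x
  proof -
    have "(\<lambda>n. a n x) \<longlonglongrightarrow> (LINT r|lborel. indicator {c<..<d} x * exp (- 1 * r\<^sup>2))"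
      unfolding a_def
    proof (rule integral_dominated_convergence[OF _ _ ig])
      show "AE r in lborel. (\<lambda>n. indicator {c..d} (x + \<delta> n * r) * exp (- 1 * r\<^sup>2)) \<longlonglongrightarrow> indicator {c<..<d} x * exp (- 1 * r\<^sup>2)"
      proof (intro AE_I2 tendsto_mult tendsto_const)
        fix r :: real
        have l: "(\<lambda>n. x + \<delta> n * r) \<longlonglongrightarrow> x + 0 * r" by (intro tendsto_intros \<delta>0)
        have "\<forall>\<^sub>F n in sequentially. indicator {c..d} (x + \<delta> n * r) = (indicator {c<..<d} x :: real)"
        proof (cases "x \<in> {c<..<d}")
          case True
          then have "\<forall>\<^sub>F n in sequentially. x + \<delta> n * r \<in> {c<..<d}"
            using l by (intro topological_tendstoD[OF l]) auto
          then show ?thesis by eventually_elim (use True in auto)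
        next
          case False
          then have "x \<in> - {c..d}" using x by auto
          then have "\<forall>\<^sub>F n in sequentially. x + \<delta> n * r \<in> - {c..d}"
            by (intro topological_tendstoD[OF l]) auto
          then show ?thesis by eventually_elim (use False in \<open>auto simp: indicator_def\<close>)
        qed
        then show "(\<lambda>n. indicator {c..d} (x + \<delta> n * r)) \<longlonglongrightarrow> (indicator {c<..<d} x :: real)"
          by (rule tendsto_eventually)
      qed
    qed (auto simp: indicator_def)
    moreover have "(LINT r|lborel. exp (- 1 * (r::real)\<^sup>2)) = sqrt pi"
    proof -
      have "complex_of_real (LINT r|lborel. exp (- 1 * (r::real)\<^sup>2)) = complex_of_real (sqrt pi)"
        using gauss_fourier_integral[of 1 0] by (simp add: exp_of_real[symmetric] flip: integral_complex_of_real)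
      then show ?thesis by (simp only: of_real_eq_iff)
    qed
    ultimately show ?thesis by (simp add: mult.commute)
  qed
  have J0: "J (u(j := \<lambda>x. complex_of_real (exp (- x\<^sup>2 / 2) * a n x))) = 0" for n
  proof -
    define V where "V s x = complex_of_real (indicator {c..d} s) * complex_of_real (exp (- x\<^sup>2 / 2) * exp (- ((x - s)\<^sup>2 / (\<delta> n)\<^sup>2)))" for s x
    have "J (u(j := \<lambda>x. LINT s|lborel. V s x)) = 0"
    proof (rule J_fub)
      show "(\<lambda>(s, x). V s x) \<in> borel_measurable (lborel \<Otimes>\<^sub>M lborel)"
        unfolding V_def by measurable
      show "integrable lborel (indicator {c..d} :: real \<Rightarrow> real)" by (rule integrable_real_indicator) (auto simp: emeasure_lborel_Icc_eq)
      show "norm (V s x) \<le> indicator {c..d} s * exp (- x\<^sup>2 / 4)" for s x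
      proof -
        have "exp (- x\<^sup>2 / 2) * exp (- ((x - s)\<^sup>2 / (\<delta> n)\<^sup>2)) \<le> exp (- x\<^sup>2 / 4) * 1" by (intro mult_mono) auto
        then show ?thesis by (simp add: V_def norm_mult indicator_def del: of_real_mult)
      qed
      show "J (u(j := V s)) = 0" for s
        unfolding V_def by (rule J_scale[OF _ J_gauss[OF hc \<delta>]]) (rule gb_gauss[where C = 1], auto)
    qed
    moreover have e: "(\<lambda>x. LINT s|lborel. V s x) = (\<lambda>x. complex_of_real (\<delta> n) * complex_of_real (exp (- x\<^sup>2 / 2) * a n x))"
    proof
      fix x
      have "V s x = complex_of_real (exp (- x\<^sup>2 / 2) * (indicator {c..d} s * exp (- ((x - s)\<^sup>2 / (\<delta> n)\<^sup>2))))" for s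
        by (simp add: V_def)
      then show "(LINT s|lborel. V s x) = complex_of_real (\<delta> n) * complex_of_real (exp (- x\<^sup>2 / 2) * a n x)"
        using \<delta>[of n] by (simp only: integral_complex_of_real integral_mult_right_zero a_alt) simp
    qed
    ultimately show ?thesis using J_lin[OF gba gba, of "complex_of_real (\<delta> n)" n 0 n] \<delta>[of n] unfolding e by simp
  qed
  have gbi: "gb (\<lambda>x. complex_of_real (exp (- x\<^sup>2 / 2) * indicator {c<..<d} x))"
    by (rule gb_gauss[where C = 1]) (auto simp: indicator_def)
  have "J (u(j := \<lambda>x. complex_of_real (sqrt pi) * complex_of_real (exp (- x\<^sup>2 / 2) * indicator {c<..<d} x))) = 0"
  proof (rule J_lim[OF _ _ _ _ _ J0])
    show "(\<lambda>x. complex_of_real (exp (- x\<^sup>2 / 2) * a n x)) \<in> borel_measurable borel" for n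
      using gba by (simp add: gb_def)
    show "norm (complex_of_real (exp (- x\<^sup>2 / 2) * a n x)) \<le> (LINT r|lborel. exp (- 1 * (r::real)\<^sup>2)) * exp (- x\<^sup>2 / 4)" for n x
    proof -
      have "\<bar>a n x\<bar> * exp (- x\<^sup>2 / 2) \<le> (LINT r|lborel. exp (- 1 * (r::real)\<^sup>2)) * exp (- x\<^sup>2 / 4)"
        using a_le[of n x] by (intro mult_mono) (auto intro!: integral_nonneg_AE)
      then show ?thesis by (simp only: norm_of_real abs_mult abs_exp_cancel mult.commute)
    qed
    show "gb (\<lambda>x. complex_of_real (sqrt pi) * complex_of_real (exp (- x\<^sup>2 / 2) * indicator {c<..<d} x))"
      using gb_lin[OF gbi gbi, of "complex_of_real (sqrt pi)" 0] by simp
    show "(\<lambda>n. complex_of_real (exp (- x\<^sup>2 / 2) * a n x)) \<longlonglongrightarrow> complex_of_real (sqrt pi) * complex_of_real (exp (- x\<^sup>2 / 2) * indicator {c<..<d} x)" if "x \<notin> {c, d}" for x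
    proof -
      have "(\<lambda>n. complex_of_real (exp (- x\<^sup>2 / 2) * a n x)) \<longlonglongrightarrow> complex_of_real (exp (- x\<^sup>2 / 2) * (sqrt pi * indicator {c<..<d} x))"
        by (intro tendsto_intros lim that)
      then show ?thesis by (simp add: mult_ac)
    qed
  qed auto
  then show ?thesis using J_lin[OF gbi gbi, of "complex_of_real (sqrt pi)" 0] by simp
qed

end

text \<open>Induction over the coordinates that already carry indicators. The hypothesis for the
  smaller set covers every Hermite function in the slot \<open>j\<close>, which is what
  \<open>J_indicator\<close> asks for.\<close>

lemma J_boxes:
  assumes "finite S" "\<And>\<alpha>. J (\<lambda>i x. hc (\<alpha> i) (complex_of_real x)) = 0"
    and "\<And>i. i \<in> S \<Longrightarrow> \<exists>c d. u i = (\<lambda>x. complex_of_real (exp (- x\<^sup>2 / 2) * indicator {c<..<d} x))"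
    and "\<And>i. i \<notin> S \<Longrightarrow> \<exists>k. u i = (\<lambda>x. hc k (complex_of_real x))"
  shows "J u = 0"
  using assms(1,3,4)
proof (induction S arbitrary: u rule: finite_induct)
  case empty
  then have "\<forall>i. \<exists>k. u i = (\<lambda>x. hc k (complex_of_real x))" by blast
  then obtain \<alpha> where \<alpha>: "\<forall>i. u i = (\<lambda>x. hc (\<alpha> i) (complex_of_real x))" by (rule choice[THEN exE])
  have "u = (\<lambda>i x. hc (\<alpha> i) (complex_of_real x))" by (rule ext) (rule \<alpha>[rule_format])
  then show ?case using assms(2) by (simp only:)
next
  case (insert j S)
  have gbi: "gb (\<lambda>x. complex_of_real (exp (- x\<^sup>2 / 2) * indicator {c<..<d} x))" for c d
    by (rule gb_gauss[where C = 1]) (auto simp: indicator_def)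
  have u: "gb (u i)" for i using insert.prems(1)[of i] insert.prems(2)[of i] gbi gb_hc by (cases "i \<in> insert j S") metis+
  obtain c d where cd: "u j = (\<lambda>x. complex_of_real (exp (- x\<^sup>2 / 2) * indicator {c<..<d} x))"
    using insert.prems(1) by blast
  have "J (u(j := \<lambda>x. hc k (complex_of_real x))) = 0" for k
  proof (rule insert.IH)
    show "\<exists>c d. (u(j := \<lambda>x. hc k (complex_of_real x))) i = (\<lambda>x. complex_of_real (exp (- x\<^sup>2 / 2) * indicator {c<..<d} x))" if "i \<in> S" for i
      using insert.prems(1)[of i] insert.hyps that by auto
    show "\<exists>l. (u(j := \<lambda>x. hc k (complex_of_real x))) i = (\<lambda>x. hc l (complex_of_real x))" if "i \<notin> S" for i
      using insert.prems(2)[of i] that by (cases "i = j") auto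
  qed
  from J_indicator[OF u this, of c d] show ?case
    unfolding cd[symmetric] by simp
qed

end

section \<open>From vanishing box integrals to completeness\<close>

text \<open>Boxes are stable under intersection and generate the Borel sets, so Dynkin's argument
  extends the vanishing from boxes to all Borel sets; the complement step uses the whole space, an
  increasing union of boxes.\<close>

lemma integral_box_zero_imp_AE_zero:
  fixes G :: "'a::euclidean_space \<Rightarrow> complex"
  assumes G: "integrable lborel G" and box: "\<And>a b. set_lebesgue_integral lborel (box a b) G = 0"
  shows "AE x in lborel. G x = 0"
proof (rule sigma_finite_measure.density_zero[OF sigma_finite_lborel G])
  have [measurable]: "G \<in> borel_measurable borel" using G by auto
  have univ: "set_lebesgue_integral lborel UNIV G = 0"
  proof -
    define B where "B n = box (- (real n *\<^sub>R One)) (real n *\<^sub>R One :: 'a)" for n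
    have "(\<lambda>n. set_lebesgue_integral lborel (B n) G) \<longlonglongrightarrow> set_lebesgue_integral lborel (\<Union>n. B n) G"
    proof (rule set_integral_cont_up)
      show "incseq B"
        unfolding incseq_def
      proof (intro allI impI)
        fix m n :: nat assume "m \<le> n"
        then show "B m \<subseteq> B n" unfolding B_def by (intro subset_box_imp) auto
      qed
      show "set_integrable lborel (\<Union>n. B n) G"
        using G unfolding set_integrable_def B_def by (intro integrable_mult_indicator) auto
    qed (auto simp: B_def)
    moreover have "(\<Union>n. B n) = UNIV" unfolding B_def by (rule UN_box_eq_UNIV)
    moreover have "set_lebesgue_integral lborel (B n) G = 0" for n unfolding B_def by (rule box)
    ultimately show ?thesis by (simp add: LIMSEQ_const_iff)
  qed
  fix A :: "'a set" assume "A \<in> sets lborel"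
  then have A: "A \<in> sigma_sets UNIV (range (\<lambda>(a, b). box a b))"
    by (simp add: borel_eq_box)
  have si: "set_integrable lborel A G" if "A \<in> sets borel" for A
    using G that unfolding set_integrable_def by (intro integrable_mult_indicator) auto
  have sb: "B \<in> sets borel" if "B \<in> sigma_sets UNIV (range (\<lambda>(a, b). box a b :: 'a set))" for B
    using that by (simp add: borel_eq_box)
  have "Int_stable (range (\<lambda>(a, b). box a b :: 'a set))"
    by (auto simp: Int_stable_def Int_interval box_Int_box)
  moreover have "range (\<lambda>(a, b). box a b :: 'a set) \<subseteq> Pow UNIV" by simp
  ultimately show "set_lebesgue_integral lborel A G = 0"
    using A
  proof (induction rule: sigma_sets_induct_disjoint)
    case (basic A) then show ?case using box by auto
  next
    case empty show ?case by (simp add: set_lebesgue_integral_def)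
  next
    case (compl A)
    have "set_lebesgue_integral lborel (A \<union> (UNIV - A)) G = set_lebesgue_integral lborel A G + set_lebesgue_integral lborel (UNIV - A) G"
      using sb[OF compl(1)] by (intro set_integral_Un si) auto
    then show ?case using univ compl by simp
  next
    case (union A)
    have "set_lebesgue_integral lborel (\<Union>i. A i) G = (\<Sum>i. set_lebesgue_integral lborel (A i) G)"
    proof (rule lebesgue_integral_countable_add)
      have Ai: "A i \<in> sets borel" for i using union(2) by (intro sb) auto
      then show "A i \<in> sets lborel" for i by simp
      show "set_integrable lborel (\<Union>i. A i) G" using Ai by (intro si) auto
      show "A i \<inter> A j = {}" if "i \<noteq> j" for i j using union(1) that by (auto simp: disjoint_family_on_def)
    qed
    then show ?case using union(3) by simp
  qed
qed

definition Phi :: "nat ^ 'n \<Rightarrow> real ^ 'n \<Rightarrow> complex" where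
  "Phi \<alpha> x = complex_of_real (Hermite_Phi \<alpha> x)"

lemma Phi_eq: "Phi \<alpha> x = (\<Prod>i\<in>UNIV. hc (\<alpha> $ i) (complex_of_real (x $ i)))"
  by (simp add: Phi_def Hermite_Phi_def hc_of_real)

lemma cnj_Phi [simp]: "cnj (Phi \<alpha> x) = Phi \<alpha> x"
  by (simp add: Phi_def)

theorem Hermite_complete:
  fixes g :: "real ^ 'n \<Rightarrow> complex"
  assumes g: "L2 lborel g" and 0: "\<And>\<alpha>. ip lborel g (Phi \<alpha>) = 0"
  shows "AE x in lborel. g x = 0"
proof -
  interpret L2_pairing g by standard fact
  define G where "G x = g x * complex_of_real (exp (- (norm x)\<^sup>2 / 2))" for x
  have hc0: "J (\<lambda>i x. hc (\<alpha> i) (complex_of_real x)) = 0" for \<alpha> :: "'n \<Rightarrow> nat"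
    
  proof -
    have "ip lborel g (Phi (\<chi> i. \<alpha> i)) = (LINT x|lborel. g x * Phi (\<chi> i. \<alpha> i) x)"
      unfolding ip_def cnj_Phi ..
    then show ?thesis using 0[of "\<chi> i. \<alpha> i"] by (simp add: J_def Phi_eq)
  qed
  have B: "J (\<lambda>i x. complex_of_real (exp (- x\<^sup>2 / 2) * indicator {a i<..<b i} x)) = 0" for a b
    by (rule J_boxes[of UNIV]) (simp, rule hc0, blast, simp)
  have "AE x in lborel. G x = 0"
  proof (rule integral_box_zero_imp_AE_zero)
    show "integrable lborel G"
    proof (rule Bochner_Integration.integrable_bound[OF w_integrable])
      show "G \<in> borel_measurable lborel" unfolding G_def by measurable
      show "AE x in lborel. norm (G x) \<le> norm (norm (g x) * exp (- (norm x)\<^sup>2 / 4))"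
        by (intro AE_I2) (auto simp: G_def norm_mult intro!: mult_left_mono)
    qed
    fix a b :: "real ^ 'n"
    have "indicator (box a b) x *\<^sub>R G x = g x * (\<Prod>i\<in>UNIV. complex_of_real (exp (- (x $ i)\<^sup>2 / 2) * indicator {a $ i<..<b $ i} (x $ i)))" for x
    proof -
      have "(\<Prod>i\<in>UNIV. exp (- (x $ i)\<^sup>2 / 2)) = exp (- (norm x)\<^sup>2 / 2)"
        by (simp add: exp_sum[symmetric] norm_vec_power2 sum_divide_distrib sum_negf[symmetric])
      moreover have "(\<Prod>i\<in>UNIV. indicator {a $ i<..<b $ i} (x $ i)) = (indicator (box a b) x :: real)"
      proof (cases "x \<in> box a b")
        case True
        then have "x $ i \<in> {a $ i<..<b $ i}" for i by (simp add: mem_box_cart)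
        then show ?thesis using True by simp
      next
        case False
        then obtain i where "x $ i \<notin> {a $ i<..<b $ i}" by (auto simp: mem_box_cart)
        then have "(\<Prod>i\<in>UNIV. indicator {a $ i<..<b $ i} (x $ i)) = (0::real)"
          by (intro prod_zero bexI[of _ i]) (auto simp: indicator_def)
        then show ?thesis using False by simp
      qed
      ultimately show ?thesis
        unfolding G_def of_real_prod[symmetric] prod.distrib by (simp add: scaleR_conv_of_real mult_ac)
    qed
    then show "set_lebesgue_integral lborel (box a b) G = 0"
      using B[of "\<lambda>i. a $ i" "\<lambda>i. b $ i"] unfolding J_def set_lebesgue_integral_def by simp
  qed
  then show ?thesis by eventually_elim (simp add: G_def)
qed

subsection \<open>The heat series\<close>

definition Phi_c :: "nat ^ 'n \<Rightarrow> complex ^ 'n \<Rightarrow> complex" where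
  "Phi_c \<alpha> z = (\<Prod>i\<in>UNIV. hc (\<alpha> $ i) (z $ i))"

lemma Phi_c_Rn: "Phi_c \<alpha> (Rn_to_Cn x) = Phi \<alpha> x"
  by (simp add: Phi_c_def Phi_eq Rn_to_Cn_def)

lemma entire_Phi_c: "entire_Cn (Phi_c \<alpha>)"
  unfolding Phi_c_def[abs_def] by (intro entire_prod entire_compose[OF holomorphic_on_hc] entire_nth)

lemma cnj_Hp: "cnj (Hp k z) = Hp k (cnj z)"
  by (induction k z rule: Hp.induct) (simp_all add: Hp.simps)

lemma cnj_hc: "cnj (hc k z) = hc k (cnj z)"
  by (simp add: hc_def cnj_Hp exp_cnj)

text \<open>Conjugation turns into a reflection of the imaginary part, so the conjugated factor of
  the pairing extends holomorphically from real \<open>x\<close>.\<close>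

lemma cnj_Phi_c: "cnj (Phi_c \<alpha> (cvec x y)) = Phi_c \<alpha> (cvec x (- y))"
proof -
  have "cnj (Complex a b) = Complex a (- b)" for a b by (simp add: complex_eq_iff)
  then show ?thesis by (simp add: Phi_c_def cnj_hc)
qed

text \<open>The polynomial factor costs an arbitrarily small \<delta> in both Gaussian exponents;
  weights with \<open>T < 1\<close> leave a margin that can pay for it.\<close>

lemma hc_bound:
  assumes "\<delta> > 0"
  obtains C where "C > 0" "\<And>z. norm (hc k z) \<le> C * exp (- (1/2 - \<delta>) * (Re z)\<^sup>2 + (1/2 + \<delta>) * (Im z)\<^sup>2)"
proof -
  obtain C where C: "C > 0" "\<And>z::complex. norm (Hp k z) \<le> C * (1 + norm z) ^ k" using Hp_bound[of k] by blast
  obtain D where D: "D > 0" "\<And>r. r \<ge> 0 \<Longrightarrow> (1 + r) ^ k \<le> D * exp (\<delta> * r\<^sup>2)" using pow_le_gauss[OF assms] by blast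
  show ?thesis
  proof
    show "C * D / hnorm k > 0" using C D hnorm_pos by simp
    fix z :: complex
    have "norm (hc k z) = norm (Hp k z) * exp (- ((Re z)\<^sup>2 - (Im z)\<^sup>2) / 2) / hnorm k"
    proof -
      have "Re (- (z\<^sup>2) / 2) = - ((Re z)\<^sup>2 - (Im z)\<^sup>2) / 2" by (simp add: power2_eq_square diff_divide_distrib)
      then show ?thesis using hnorm_pos[of k] by (simp only: hc_def norm_mult norm_divide norm_exp_eq_Re norm_of_real abs_of_pos)
    qed
    also have "\<dots> \<le> C * (D * exp (\<delta> * (norm z)\<^sup>2)) * exp (- ((Re z)\<^sup>2 - (Im z)\<^sup>2) / 2) / hnorm k"
    proof (intro divide_right_mono mult_right_mono)
      have "norm (Hp k z) \<le> C * (1 + norm z) ^ k" by (rule C)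
      also have "\<dots> \<le> C * (D * exp (\<delta> * (norm z)\<^sup>2))" using C(1) by (intro mult_left_mono D) auto
      finally show "norm (Hp k z) \<le> C * (D * exp (\<delta> * (norm z)\<^sup>2))" .
    qed (use hnorm_pos[of k] in auto)
    also have "\<dots> = C * D / hnorm k * (exp (\<delta> * (norm z)\<^sup>2) * exp (- ((Re z)\<^sup>2 - (Im z)\<^sup>2) / 2))" by simp
    also have "exp (\<delta> * (norm z)\<^sup>2) * exp (- ((Re z)\<^sup>2 - (Im z)\<^sup>2) / 2) = exp (- (1/2 - \<delta>) * (Re z)\<^sup>2 + (1/2 + \<delta>) * (Im z)\<^sup>2)"
      unfolding exp_add[symmetric] cmod_power2 by (simp add: field_simps)
    finally show "norm (hc k z) \<le> C * D / hnorm k * exp (- (1/2 - \<delta>) * (Re z)\<^sup>2 + (1/2 + \<delta>) * (Im z)\<^sup>2)" .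
  qed
qed

definition sqRe :: "complex ^ 'n \<Rightarrow> real" where "sqRe z = (\<Sum>i\<in>UNIV. (Re (z $ i))\<^sup>2)"
definition sqIm :: "complex ^ 'n \<Rightarrow> real" where "sqIm z = (\<Sum>i\<in>UNIV. (Im (z $ i))\<^sup>2)"

lemma gw_eq: "gw T z = exp (T * sqRe z - sqIm z / T)"
  by (simp add: gw_def sqRe_def sqIm_def)

lemma sqRe_cvec [simp]: "sqRe (cvec x y) = (norm x)\<^sup>2" and sqIm_cvec [simp]: "sqIm (cvec x y) = (norm y)\<^sup>2"
  by (simp_all add: sqRe_def sqIm_def norm_vec_power2)

lemma sqRe_nonneg: "sqRe z \<ge> 0" and sqIm_nonneg: "sqIm z \<ge> 0"
  by (simp_all add: sqRe_def sqIm_def sum_nonneg)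

lemma norm_sq_eq: "(norm z)\<^sup>2 = sqRe z + sqIm z"
  by (simp add: sqRe_def sqIm_def norm_vec_power2 cmod_power2 sum.distrib)

lemma Phi_c_bound:
  fixes \<alpha> :: "nat ^ 'n"
  assumes "\<delta> > 0"
  obtains C where "C > 0" "\<And>z. norm (Phi_c \<alpha> z) \<le> C * exp (- (1/2 - \<delta>) * sqRe z + (1/2 + \<delta>) * sqIm z)"
proof -
  have "\<exists>C>0. \<forall>z. norm (hc (\<alpha> $ i) z) \<le> C * exp (- (1/2 - \<delta>) * (Re z)\<^sup>2 + (1/2 + \<delta>) * (Im z)\<^sup>2)" for i
    using hc_bound[OF assms, of "\<alpha> $ i"] by blast
  then obtain C where C: "\<And>i. C i > 0" "\<And>i z. norm (hc (\<alpha> $ i) z) \<le> C i * exp (- (1/2 - \<delta>) * (Re z)\<^sup>2 + (1/2 + \<delta>) * (Im z)\<^sup>2)"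
    by metis
  show ?thesis
  proof
    show "(\<Prod>i\<in>UNIV. C i) > 0" using C(1) by (intro prod_pos) auto
    fix z
    have "norm (Phi_c \<alpha> z) \<le> (\<Prod>i\<in>UNIV. C i * exp (- (1/2 - \<delta>) * (Re (z $ i))\<^sup>2 + (1/2 + \<delta>) * (Im (z $ i))\<^sup>2))"
      unfolding Phi_c_def prod_norm[symmetric] using C(2) by (intro prod_mono) auto
    also have "\<dots> = (\<Prod>i\<in>UNIV. C i) * exp (- (1/2 - \<delta>) * sqRe z + (1/2 + \<delta>) * sqIm z)"
      by (simp add: prod.distrib exp_sum[symmetric] sqRe_def sqIm_def sum.distrib sum_distrib_left sum_negf)
    finally show "norm (Phi_c \<alpha> z) \<le> (\<Prod>i\<in>UNIV. C i) * exp (- (1/2 - \<delta>) * sqRe z + (1/2 + \<delta>) * sqIm z)" .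
  qed
qed

lemma continuous_on_Phi: "continuous_on S (Phi \<alpha>)"
  unfolding Phi_eq by (intro continuous_intros)

lemma Phi_measurable [measurable]: "Phi \<alpha> \<in> borel_measurable borel"
  by (intro borel_measurable_continuous_onI continuous_on_Phi)

lemma integral_Phi_Phi:
  "integrable lborel (\<lambda>x. Phi \<alpha> x * Phi \<beta> x)"
  "(LINT x|lborel. Phi \<alpha> x * Phi \<beta> x) = (if \<alpha> = \<beta> then 1 else 0)"
proof -
  have e: "Phi \<alpha> x * Phi \<beta> x = (\<Prod>i\<in>UNIV. hc (\<alpha> $ i) (complex_of_real (x $ i)) * hc (\<beta> $ i) (complex_of_real (x $ i)))" for x
    by (simp add: Phi_eq prod.distrib)
  show "integrable lborel (\<lambda>x. Phi \<alpha> x * Phi \<beta> x)"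
    unfolding e by (intro integrable_lborel_vec_prod[where f = "\<lambda>i u. hc (\<alpha> $ i) (complex_of_real u) * hc (\<beta> $ i) (complex_of_real u)"] integrable_hc_hc)
  have "(LINT x|lborel. Phi \<alpha> x * Phi \<beta> x) = (\<Prod>i\<in>UNIV. if \<alpha> $ i = \<beta> $ i then 1 else 0)"
    unfolding e by (subst integral_lborel_vec_prod[where f = "\<lambda>i u. hc (\<alpha> $ i) (complex_of_real u) * hc (\<beta> $ i) (complex_of_real u)"])
      (simp_all add: integrable_hc_hc integral_hc_hc)
  also have "\<dots> = (if \<alpha> = \<beta> then 1 else 0)"
    by (auto simp: vec_eq_iff intro: prod_zero)
  finally show "(LINT x|lborel. Phi \<alpha> x * Phi \<beta> x) = (if \<alpha> = \<beta> then 1 else 0)" .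
qed

lemma orthonormal_Phi: "orthonormal lborel Phi"
proof
  show "L2 lborel (Phi \<alpha>)" for \<alpha> :: "nat ^ 'n"
  proof -
    have "(norm (Phi \<alpha> x))\<^sup>2 = norm (Phi \<alpha> x * Phi \<alpha> x)" for x by (simp add: norm_mult power2_eq_square)
    then show ?thesis unfolding L2_def using integral_Phi_Phi(1)[of \<alpha> \<alpha>] by (auto intro: integrable_norm)
  qed
  show "ip lborel (Phi \<alpha>) (Phi \<beta>) = (if \<alpha> = \<beta> then 1 else 0)" for \<alpha> \<beta> :: "nat ^ 'n"
    unfolding ip_def cnj_Phi by (rule integral_Phi_Phi(2))
qed

lemma L2_Phi: "L2 lborel (Phi \<alpha>)"
  using orthonormal_Phi by (rule orthonormal.L2)

lemma eigenvalue_alt: "Hermite_eigenvalue \<alpha> = (\<Sum>i\<in>UNIV. 2 * real (\<alpha> $ i) + 1)"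
  by (simp add: Hermite_eigenvalue_def sum.distrib sum_distrib_left)

lemma eigenvalue_ge_1: "Hermite_eigenvalue (\<alpha> :: nat ^ 'n) \<ge> 1"
proof -
  have "CARD('n) \<ge> 1" by (simp add: Suc_leI)
  then have "real CARD('n) \<ge> 1" by simp
  moreover have "real (\<Sum>i\<in>UNIV. \<alpha> $ i) \<ge> 0" by (rule of_nat_0_le_iff)
  ultimately show ?thesis unfolding Hermite_eigenvalue_def by linarith
qed

text \<open>A finite set of multi-indices lies in a cube, over which the sum factors into
  one-dimensional geometric sums.\<close>

lemma summable_geometric_multi:
  fixes r :: real
  assumes r: "0 \<le> r" "r < 1"
  shows "(\<lambda>\<alpha> :: nat ^ 'n. \<Prod>i\<in>UNIV. r ^ (\<alpha> $ i)) summable_on UNIV"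
proof (rule nonneg_bounded_partial_sums_imp_summable_on)
  show "\<And>\<alpha> :: nat ^ 'n. 0 \<le> (\<Prod>i\<in>UNIV. r ^ (\<alpha> $ i))" using r by (simp add: prod_nonneg)
  have "(\<Sum>\<alpha>\<in>A. \<Prod>i\<in>UNIV. r ^ (\<alpha> $ i)) \<le> (1 / (1 - r)) ^ CARD('n)" if A: "finite A" for A :: "(nat ^ 'n) set"
  proof -
    define N where "N = Max (insert 0 ((\<lambda>(\<alpha>, i). \<alpha> $ i) ` (A \<times> UNIV)))"
    have N: "\<alpha> $ i \<le> N" if "\<alpha> \<in> A" for \<alpha> i
      unfolding N_def using A that by (intro Max_ge) force+
    have inj: "inj_on vec_nth A" by (auto simp: inj_on_def vec_eq_iff)
    have "(\<Sum>\<alpha>\<in>A. \<Prod>i\<in>UNIV. r ^ (\<alpha> $ i)) = (\<Sum>\<alpha>\<in>vec_nth ` A. \<Prod>i\<in>UNIV. r ^ (\<alpha> i))"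
      by (simp add: sum.reindex[OF inj])
    also have "\<dots> \<le> (\<Sum>\<alpha>\<in>PiE (UNIV :: 'n set) (\<lambda>_. {..N}). \<Prod>i\<in>UNIV. r ^ (\<alpha> i))"
    proof (rule sum_mono2)
      show "vec_nth ` A \<subseteq> PiE UNIV (\<lambda>_. {..N})" using N by auto
    qed (use r in \<open>auto intro!: finite_PiE prod_nonneg\<close>)
    also have "\<dots> = (\<Prod>i\<in>(UNIV :: 'n set). \<Sum>k\<le>N. r ^ k)"
      by (rule prod_sum_PiE[symmetric]) auto
    also have "\<dots> = (\<Sum>k\<le>N. r ^ k) ^ CARD('n)" by simp
    also have "\<dots> \<le> (1 / (1 - r)) ^ CARD('n)"
    proof (intro power_mono)
      have "(\<Sum>k\<le>N. r ^ k) \<le> (\<Sum>k. r ^ k)" using r by (intro sum_le_suminf summable_geometric) auto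
      also have "\<dots> = 1 / (1 - r)" using r by (intro suminf_geometric) auto
      finally show "(\<Sum>k\<le>N. r ^ k) \<le> 1 / (1 - r)" .
    qed (use r in \<open>auto intro: sum_nonneg\<close>)
    finally show ?thesis .
  qed
  note bound = this
  show "\<forall>\<^sub>F A in finite_subsets_at_top UNIV. (\<Sum>\<alpha> :: nat ^ 'n\<in>A. \<Prod>i\<in>UNIV. r ^ (\<alpha> $ i)) \<le> (1 / (1 - r)) ^ CARD('n)"
    by (rule eventually_finite_subsets_at_top_weakI) (rule bound)
qed

definition heat_term :: "real \<Rightarrow> (nat ^ 'n \<Rightarrow> complex) \<Rightarrow> nat ^ 'n \<Rightarrow> complex ^ 'n \<Rightarrow> complex" where
  "heat_term t a \<alpha> z = a \<alpha> * complex_of_real (exp (- (Hermite_eigenvalue \<alpha> * t))) * Phi_c \<alpha> z"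

definition heat :: "real \<Rightarrow> (nat ^ 'n \<Rightarrow> complex) \<Rightarrow> complex ^ 'n \<Rightarrow> complex" where
  "heat t a z = (\<Sum>\<^sub>\<infinity>\<alpha>. heat_term t a \<alpha> z)"

text \<open>With \<open>\<epsilon> = exp t - 1\<close> in \<open>hc_growth\<close>, each unit of the
  multi-index contributes a growth of at most \<open>exp t\<close> against the heat factor
  \<open>exp (- 2 t)\<close>; a geometric series with ratio \<open>exp (- t)\<close>
  remains.\<close>

lemma heat_term_M_test:
  fixes a :: "nat ^ 'n \<Rightarrow> complex"
  assumes t: "t > 0" and a: "\<And>\<alpha>. norm (a \<alpha>) \<le> A"
  shows "\<exists>M. M summable_on UNIV \<and> (\<forall>\<alpha> z. norm z \<le> R \<longrightarrow> norm (heat_term t a \<alpha> z) \<le> M \<alpha>)"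
proof -
  obtain C where C: "C > 0" "\<And>k z. norm z \<le> R \<Longrightarrow> norm (hc k z) \<le> C * (1 + (exp t - 1)) ^ k"
    using hc_growth[of "exp t - 1" R] t by auto
  define M where "M \<alpha> = A * C ^ CARD('n) * (\<Prod>i\<in>UNIV. exp (- t) ^ (\<alpha> $ i))" for \<alpha> :: "nat ^ 'n"
  have "M summable_on UNIV"
    unfolding M_def using t by (intro summable_on_cmult_right summable_geometric_multi) auto
  moreover have "norm (heat_term t a \<alpha> z) \<le> M \<alpha>" if z: "norm z \<le> R" for \<alpha> z
  proof -
    have A: "A \<ge> 0" using order_trans[OF norm_ge_zero a] by blast
    have "norm (Phi_c \<alpha> z) \<le> (\<Prod>i\<in>UNIV. C * exp t ^ (\<alpha> $ i))"
      unfolding Phi_c_def prod_norm[symmetric]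
    proof (intro prod_mono conjI norm_ge_zero)
      fix i
      have "norm (z $ i) \<le> R" using z Finite_Cartesian_Product.norm_nth_le[of z i] by simp
      then show "norm (hc (\<alpha> $ i) (z $ i)) \<le> C * exp t ^ (\<alpha> $ i)" using C(2) by simp
    qed
    also have "\<dots> = C ^ CARD('n) * (\<Prod>i\<in>UNIV. exp t ^ (\<alpha> $ i))" by (simp add: prod.distrib)
    finally have P: "norm (Phi_c \<alpha> z) \<le> C ^ CARD('n) * (\<Prod>i\<in>UNIV. exp t ^ (\<alpha> $ i))" .
    have e: "exp (- (Hermite_eigenvalue \<alpha> * t)) \<le> (\<Prod>i\<in>UNIV. exp (- (2 * t)) ^ (\<alpha> $ i))"
    proof -
      have "(\<Prod>i\<in>UNIV. exp (- (2 * t)) ^ (\<alpha> $ i)) = exp (\<Sum>i\<in>UNIV. real (\<alpha> $ i) * (- (2 * t)))"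
        by (simp add: exp_sum exp_of_nat_mult[symmetric])
      moreover have "- (Hermite_eigenvalue \<alpha> * t) \<le> (\<Sum>i\<in>UNIV. real (\<alpha> $ i) * (- (2 * t)))"
        unfolding eigenvalue_alt sum_distrib_right sum_negf[symmetric] using t
        by (intro sum_mono) (simp add: algebra_simps)
      ultimately show ?thesis by simp
    qed
    have "norm (heat_term t a \<alpha> z) = norm (a \<alpha>) * exp (- (Hermite_eigenvalue \<alpha> * t)) * norm (Phi_c \<alpha> z)"
      by (simp add: heat_term_def norm_mult)
    also have "\<dots> \<le> A * (\<Prod>i\<in>UNIV. exp (- (2 * t)) ^ (\<alpha> $ i)) * (C ^ CARD('n) * (\<Prod>i\<in>UNIV. exp t ^ (\<alpha> $ i)))"
      using A by (intro mult_mono a e P) (auto intro!: prod_nonneg mult_nonneg_nonneg)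
    also have "\<dots> = A * C ^ CARD('n) * (\<Prod>i\<in>UNIV. exp (- (2 * t)) ^ (\<alpha> $ i) * exp t ^ (\<alpha> $ i))"
      by (simp add: prod.distrib)
    also have "\<dots> = M \<alpha>"
      unfolding M_def power_mult_distrib[symmetric] exp_add[symmetric] by simp
    finally show ?thesis .
  qed
  ultimately show ?thesis by blast
qed

lemma entire_heat_term: "entire_Cn (heat_term t a \<alpha>)"
  unfolding heat_term_def[abs_def] by (intro entire_scale entire_Phi_c)

lemma
  assumes "t > 0" "\<And>\<alpha>. norm (a \<alpha>) \<le> A"
  shows entire_heat: "entire_Cn (heat t a)"
    and heat_has_sum: "((\<lambda>\<alpha>. heat_term t a \<alpha> z) has_sum heat t a z) UNIV"
proof -
  have M: "\<exists>M. M summable_on UNIV \<and> (\<forall>\<alpha> z. norm z \<le> R \<longrightarrow> norm (heat_term t a \<alpha> z) \<le> M \<alpha>)" for R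
    using heat_term_M_test[OF assms] .
  show "entire_Cn (heat t a)"
    unfolding heat_def[abs_def] by (rule entire_series_entire[OF entire_heat_term M])
  show "((\<lambda>\<alpha>. heat_term t a \<alpha> z) has_sum heat t a z) UNIV"
    unfolding heat_def by (rule entire_series_has_sum[OF entire_heat_term M])
qed

subsection \<open>Shifting the contour\<close>

text \<open>Difference quotients are dominated by the majorant of \<open>h\<close> itself on a
  larger disc, through Cauchy's inequality and the mean value bound.\<close>

lemma holomorphic_lborel_integral:
  fixes h :: "complex \<Rightarrow> 'a::euclidean_space \<Rightarrow> complex"
  assumes hol: "\<And>x. (\<lambda>\<zeta>. h \<zeta> x) holomorphic_on UNIV"
    and meas: "\<And>\<zeta>. h \<zeta> \<in> borel_measurable borel"
    and dom: "\<And>R. \<exists>w. integrable lborel w \<and> (\<forall>\<zeta> x. norm \<zeta> \<le> R \<longrightarrow> norm (h \<zeta> x) \<le> w x)"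
  shows "(\<lambda>\<zeta>. LINT x|lborel. h \<zeta> x) holomorphic_on UNIV"
proof -
  have int: "integrable lborel (h \<zeta>)" for \<zeta>
  proof -
    obtain w where w: "integrable lborel w" "\<And>x. norm (h \<zeta> x) \<le> w x" using dom[of "norm \<zeta>"] by auto
    show ?thesis
      by (rule Bochner_Integration.integrable_bound[OF w(1)])
        (use meas in \<open>auto intro!: AE_I2 order_trans[OF w(2) abs_ge_self]\<close>)
  qed
  have "\<exists>f'. ((\<lambda>\<zeta>. LINT x|lborel. h \<zeta> x) has_field_derivative f') (at \<zeta>)" for \<zeta>
  proof -
    \<comment> \<open>The 2 is one unit for the increment and one for the radius in Cauchy's
      inequality.\<close>
    obtain w where w: "integrable lborel w" "\<And>\<zeta>' x. norm \<zeta>' \<le> norm \<zeta> + 2 \<Longrightarrow> norm (h \<zeta>' x) \<le> w x"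
      using dom[of "norm \<zeta> + 2"] by auto
    define D where "D x = deriv (\<lambda>\<zeta>. h \<zeta> x) \<zeta>" for x
    have db: "norm (deriv (\<lambda>\<zeta>. h \<zeta> x) \<xi>) \<le> w x" if "\<xi> \<in> cball \<zeta> 1" for \<xi> x
    proof -
      have "norm ((deriv ^^ 1) (\<lambda>\<zeta>. h \<zeta> x) \<xi>) \<le> fact 1 * w x / 1 ^ 1"
      proof (rule Cauchy_inequality)
        show "(\<lambda>\<zeta>. h \<zeta> x) holomorphic_on ball \<xi> 1" "continuous_on (cball \<xi> 1) (\<lambda>\<zeta>. h \<zeta> x)"
          using hol[of x] holomorphic_on_subset holomorphic_on_imp_continuous_on by blast+
        fix u assume "norm (\<xi> - u) = 1"
        have "norm u \<le> norm (u - \<xi>) + norm (\<xi> - \<zeta>) + norm \<zeta>"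
          using norm_triangle_ineq[of "u - \<xi> + (\<xi> - \<zeta>)" \<zeta>] norm_triangle_ineq[of "u - \<xi>" "\<xi> - \<zeta>"] by simp
        then have "norm u \<le> norm \<zeta> + 2"
          using \<open>norm (\<xi> - u) = 1\<close> that by (simp add: dist_norm norm_minus_commute)
        then show "norm (h u x) \<le> w x" by (rule w)
      qed auto
      then show ?thesis by simp
    qed
    have lip: "norm (h (\<zeta> + \<eta>) x - h \<zeta> x) \<le> w x * norm \<eta>" if "norm \<eta> \<le> 1" for \<eta> x
    proof -
      have "norm (h (\<zeta> + \<eta>) x - h \<zeta> x) \<le> w x * norm (\<zeta> + \<eta> - \<zeta>)"
      proof (rule field_differentiable_bound[of "cball \<zeta> 1" "\<lambda>\<zeta>. h \<zeta> x"])
        show "((\<lambda>\<zeta>. h \<zeta> x) has_field_derivative deriv (\<lambda>\<zeta>. h \<zeta> x) u) (at u within cball \<zeta> 1)" for u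
          by (rule has_field_derivative_at_within, rule holomorphic_derivI[OF hol open_UNIV]) simp
        show "norm (deriv (\<lambda>\<zeta>. h \<zeta> x) u) \<le> w x" if "u \<in> cball \<zeta> 1" for u
          using that by (rule db)
        show "\<zeta> + \<eta> \<in> cball \<zeta> 1" using that by (simp add: dist_norm)
      qed simp_all
      then show ?thesis by simp
    qed
    have dq: "((\<lambda>\<eta>. (h (\<zeta> + \<eta>) x - h \<zeta> x) / \<eta>) \<longlongrightarrow> D x) (at 0)" for x
    proof -
      have "((\<lambda>\<zeta>. h \<zeta> x) has_field_derivative D x) (at \<zeta>)"
        unfolding D_def by (rule holomorphic_derivI[OF hol open_UNIV]) simp
      then show ?thesis unfolding DERIV_def .
    qed
    have "((\<lambda>\<eta>. ((LINT x|lborel. h (\<zeta> + \<eta>) x) - (LINT x|lborel. h \<zeta> x)) / \<eta>) \<longlongrightarrow> (LINT x|lborel. D x)) (at 0)"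
      unfolding tendsto_at_iff_sequentially
    proof (intro allI impI)
      fix X :: "nat \<Rightarrow> complex"
      assume X: "\<forall>i. X i \<in> UNIV - {0}" "X \<longlonglongrightarrow> 0"
      have "\<forall>\<^sub>F i in sequentially. dist (X i) 0 < 1" using X(2) by (rule tendstoD) simp
      then obtain N where N: "\<And>i. i \<ge> N \<Longrightarrow> norm (X i) < 1" by (auto simp: eventually_sequentially)
      define Y where "Y i = X (i + N)" for i
      have Y: "Y i \<noteq> 0" "norm (Y i) \<le> 1" for i using X(1) N[of "i + N"] by (auto simp: Y_def intro: less_imp_le)
      have Y0: "Y \<longlonglongrightarrow> 0" unfolding Y_def using X(2) by (rule LIMSEQ_ignore_initial_segment)
      have lim: "(\<lambda>i. (h (\<zeta> + Y i) x - h \<zeta> x) / Y i) \<longlonglongrightarrow> D x" for x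
        using dq[of x] Y Y0 unfolding tendsto_at_iff_sequentially o_def by auto
      have m: "(\<lambda>x. (h (\<zeta> + Y i) x - h \<zeta> x) / Y i) \<in> borel_measurable borel" for i
        using meas by (intro borel_measurable_divide borel_measurable_diff) auto
      have "(\<lambda>i. LINT x|lborel. (h (\<zeta> + Y i) x - h \<zeta> x) / Y i) \<longlonglongrightarrow> (LINT x|lborel. D x)"
      proof (rule integral_dominated_convergence[OF _ _ w(1)])
        show "D \<in> borel_measurable lborel"
          using borel_measurable_LIMSEQ_metric[of "\<lambda>i x. (h (\<zeta> + Y i) x - h \<zeta> x) / Y i" borel D] m lim by simp
        show "AE x in lborel. norm ((h (\<zeta> + Y i) x - h \<zeta> x) / Y i) \<le> w x" for i
          using lip[OF Y(2)[of i]] Y(1)[of i] by (intro AE_I2) (simp add: norm_divide field_simps)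
      qed (use m lim in auto)
      moreover have eq: "(LINT x|lborel. (h (\<zeta> + Y i) x - h \<zeta> x) / Y i) = ((LINT x|lborel. h (\<zeta> + Y i) x) - (LINT x|lborel. h \<zeta> x)) / Y i" for i
        using int by simp
      ultimately have "(\<lambda>i. ((LINT x|lborel. h (\<zeta> + Y i) x) - (LINT x|lborel. h \<zeta> x)) / Y i) \<longlonglongrightarrow> (LINT x|lborel. D x)"
        by (simp only: eq)
      then show "((\<lambda>\<eta>. ((LINT x|lborel. h (\<zeta> + \<eta>) x) - (LINT x|lborel. h \<zeta> x)) / \<eta>) \<circ> X) \<longlonglongrightarrow> (LINT x|lborel. D x)"
        unfolding o_def Y_def by (rule LIMSEQ_offset)
    qed
    then have "((\<lambda>\<zeta>. LINT x|lborel. h \<zeta> x) has_field_derivative (LINT x|lborel. D x)) (at \<zeta>)"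
      unfolding DERIV_def .
    then show ?thesis by blast
  qed
  then show ?thesis unfolding holomorphic_on_def field_differentiable_def by simp
qed

definition sqC :: "complex ^ 'n \<Rightarrow> complex" where "sqC z = (\<Sum>i\<in>UNIV. (z $ i)\<^sup>2)"

lemma Re_sqC: "Re (sqC z) = sqRe z - sqIm z"
  by (simp add: sqC_def sqRe_def sqIm_def power2_eq_square sum_subtractf)

lemma entire_sqC: "entire_Cn sqC"
  unfolding sqC_def[abs_def] by (intro entire_sum entire_power entire_nth)

lemma line_cvec: "Rn_to_Cn x + \<zeta> *s Rn_to_Cn y = cvec (x + Re \<zeta> *\<^sub>R y) (Im \<zeta> *\<^sub>R y)"
  by (simp add: vec_eq_iff Rn_to_Cn_def complex_eq_iff)

lemma Rn_to_Cn_cvec: "Rn_to_Cn x = cvec x 0"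
  by (simp add: vec_eq_iff Rn_to_Cn_def complex_eq_iff)

lemma gw_bound_imp:
  assumes B: "(norm (F z))\<^sup>2 * gw T z \<le> B"
  shows "norm (F z :: complex) \<le> sqrt B * exp (- (T * sqRe z - sqIm z / T) / 2)"
proof (rule power2_le_imp_le)
  have "0 \<le> (norm (F z))\<^sup>2 * gw T z" using gw_pos[of T z] by simp
  then have B0: "B \<ge> 0" using B by linarith
  have "(norm (F z))\<^sup>2 \<le> B / gw T z" using B gw_pos[of T z] by (simp add: pos_le_divide_eq)
  also have "\<dots> = B * exp (- (T * sqRe z - sqIm z / T))"
    by (simp only: gw_eq exp_minus divide_inverse)
  also have "\<dots> = (sqrt B * exp (- (T * sqRe z - sqIm z / T) / 2))\<^sup>2"
    using B0 by (simp add: power_mult_distrib exp_double[symmetric])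
  finally show "(norm (F z))\<^sup>2 \<le> (sqrt B * exp (- (T * sqRe z - sqIm z / T) / 2))\<^sup>2" .
  show "0 \<le> sqrt B * exp (- (T * sqRe z - sqIm z / T) / 2)" using B0 by simp
qed

lemma continuous_on_Rn_to_Cn [continuous_intros]:
  "continuous_on S f \<Longrightarrow> continuous_on S (\<lambda>x. Rn_to_Cn (f x))"
  unfolding Rn_to_Cn_def by (intro continuous_intros)

lemma norm_add_sq_ge: "(norm (x + v))\<^sup>2 \<ge> (norm x)\<^sup>2 / 2 - (norm (v :: 'a::real_inner))\<^sup>2"
proof -
  have "0 \<le> (norm (x + 2 *\<^sub>R v))\<^sup>2" by simp
  then show ?thesis by (simp add: power2_norm_eq_inner inner_simps inner_commute algebra_simps)
qed

text \<open>The integral over \<open>x\<close> is entire in the shift parameter \<open>\<zeta>\<close> and constant for real \<open>\<zeta>\<close>,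
  hence constant.\<close>

lemma contour_shift:
  fixes F :: "complex ^ 'n \<Rightarrow> complex"
  assumes F: "entire_Cn F" and T: "0 < T" "T < 1" and B: "\<And>z. (norm (F z))\<^sup>2 * gw T z \<le> B"
  shows "(LINT x|lborel. F (cvec x y) * Phi_c \<alpha> (cvec x (- y)) * complex_of_real (gw T (cvec x y))) =
    (LINT x|lborel. F (Rn_to_Cn x) * Phi_c \<alpha> (cvec x (- 2 *\<^sub>R y)) * exp (T * sqC (cvec x (- y)) - complex_of_real ((norm y)\<^sup>2 / T)))"
proof -
  \<comment> \<open>\<open>h \<i>\<close> is the integrand on the left and \<open>h 0\<close> the
    one on the right. All arguments move in the same direction \<open>y\<close>, so a real change of
    \<zeta> is a translation of \<open>x\<close>.\<close>
  define h where "h \<zeta> x = F (Rn_to_Cn x + \<zeta> *s Rn_to_Cn y) * Phi_c \<alpha> (Rn_to_Cn x + (\<zeta> - 2 * \<i>) *s Rn_to_Cn y) *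
    exp (T * sqC (Rn_to_Cn x + (\<zeta> - \<i>) *s Rn_to_Cn y) - complex_of_real ((norm y)\<^sup>2 / T))" for \<zeta> x
  \<comment> \<open>In the exponent of the bound, \<open>(norm u)^2\<close> has the coefficient
    \<open>T / 2 - 1 / 2 + \<delta>\<close>, which is \<open>- \<delta>\<close> for this
    choice.\<close>
  define \<delta> where "\<delta> = (1 - T) / 4"
  have \<delta>: "\<delta> > 0" "\<delta> < 1" using T by (auto simp: \<delta>_def)
  obtain C where C: "C > 0" "\<And>z. norm (Phi_c \<alpha> z) \<le> C * exp (- (1/2 - \<delta>) * sqRe z + (1/2 + \<delta>) * sqIm z)"
    using Phi_c_bound[OF \<delta>(1)] by blast
  have Fb: "norm (F z) \<le> sqrt B * exp (- (T * sqRe z - sqIm z / T) / 2)" for z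
    using B by (rule gw_bound_imp[of F z])
  have bound: "norm (h \<zeta> x) \<le> sqrt B * C * exp ((\<delta> * R\<^sup>2 + R\<^sup>2 / (2 * T) + 2 * (R + 2)\<^sup>2) * (norm y)\<^sup>2) * exp (- (\<delta> / 2) * (norm x)\<^sup>2)"
    if R: "norm \<zeta> \<le> R" for \<zeta> R x
  proof -
    define p where "p = Re \<zeta>"
    define q where "q = Im \<zeta>"
    define u where "u = x + p *\<^sub>R y"
    have R0: "R \<ge> 0" using R norm_ge_zero order_trans by blast
    have pq: "\<bar>p\<bar> \<le> R" "\<bar>q\<bar> \<le> R" using abs_Re_le_cmod[of \<zeta>] abs_Im_le_cmod[of \<zeta>] R by (auto simp: p_def q_def)
    have z1: "Rn_to_Cn x + \<zeta> *s Rn_to_Cn y = cvec u (q *\<^sub>R y)" unfolding line_cvec by (simp add: u_def p_def q_def)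
    have z2: "Rn_to_Cn x + (\<zeta> - 2 * \<i>) *s Rn_to_Cn y = cvec u ((q - 2) *\<^sub>R y)" unfolding line_cvec by (simp add: u_def p_def q_def)
    have z3: "Rn_to_Cn x + (\<zeta> - \<i>) *s Rn_to_Cn y = cvec u ((q - 1) *\<^sub>R y)" unfolding line_cvec by (simp add: u_def p_def q_def)
    have n: "(norm (r *\<^sub>R y))\<^sup>2 = r\<^sup>2 * (norm y)\<^sup>2" for r by (simp add: power_mult_distrib)
    have "norm (h \<zeta> x) = norm (F (cvec u (q *\<^sub>R y))) * norm (Phi_c \<alpha> (cvec u ((q - 2) *\<^sub>R y))) *
       exp (T * ((norm u)\<^sup>2 - (q - 1)\<^sup>2 * (norm y)\<^sup>2) - (norm y)\<^sup>2 / T)"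
      unfolding h_def z1 z2 z3 norm_mult norm_exp_eq_Re by (simp add: Re_sqC power_mult_distrib)
    also have "\<dots> \<le> (sqrt B * exp (- (T * (norm u)\<^sup>2 - q\<^sup>2 * (norm y)\<^sup>2 / T) / 2)) *
       (C * exp (- (1/2 - \<delta>) * (norm u)\<^sup>2 + (1/2 + \<delta>) * ((q - 2)\<^sup>2 * (norm y)\<^sup>2))) *
       exp (T * ((norm u)\<^sup>2 - (q - 1)\<^sup>2 * (norm y)\<^sup>2) - (norm y)\<^sup>2 / T)"
      using Fb[of "cvec u (q *\<^sub>R y)"] C(2)[of "cvec u ((q - 2) *\<^sub>R y)"]
      by (intro mult_right_mono mult_mono') (simp_all add: power_mult_distrib)
    also have "\<dots> = sqrt B * C * exp (- (T * (norm u)\<^sup>2 - q\<^sup>2 * (norm y)\<^sup>2 / T) / 2 +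
       (- (1/2 - \<delta>) * (norm u)\<^sup>2 + (1/2 + \<delta>) * ((q - 2)\<^sup>2 * (norm y)\<^sup>2)) +
       (T * ((norm u)\<^sup>2 - (q - 1)\<^sup>2 * (norm y)\<^sup>2) - (norm y)\<^sup>2 / T))"
      by (simp add: exp_add)
    also have "\<dots> \<le> sqrt B * C * exp ((\<delta> * R\<^sup>2 + R\<^sup>2 / (2 * T) + 2 * (R + 2)\<^sup>2) * (norm y)\<^sup>2 + - (\<delta> / 2) * (norm x)\<^sup>2)"
    proof (intro mult_left_mono iffD2[OF exp_le_cancel_iff])
      have "(norm u)\<^sup>2 \<ge> (norm x)\<^sup>2 / 2 - p\<^sup>2 * (norm y)\<^sup>2" unfolding u_def n[symmetric] by (rule norm_add_sq_ge)
      moreover have "p\<^sup>2 * (norm y)\<^sup>2 \<le> R\<^sup>2 * (norm y)\<^sup>2"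
        using pq(1) R0 by (intro mult_right_mono) (auto simp: abs_le_square_iff[symmetric])
      ultimately have "(norm u)\<^sup>2 \<ge> (norm x)\<^sup>2 / 2 - R\<^sup>2 * (norm y)\<^sup>2" by linarith
      then have 1: "\<delta> * (norm u)\<^sup>2 \<ge> \<delta> * ((norm x)\<^sup>2 / 2 - R\<^sup>2 * (norm y)\<^sup>2)" using \<delta> by (intro mult_left_mono) auto
      have "q\<^sup>2 \<le> R\<^sup>2" using pq(2) R0 by (simp add: abs_le_square_iff[symmetric])
      then have 2: "q\<^sup>2 * (norm y)\<^sup>2 / T / 2 \<le> R\<^sup>2 * (norm y)\<^sup>2 / T / 2"
        using T by (intro divide_right_mono mult_right_mono) auto
      have "\<bar>q - 2\<bar> \<le> \<bar>R + 2\<bar>" using pq(2) by linarith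
      then have "(q - 2)\<^sup>2 \<le> (R + 2)\<^sup>2" by (simp only: abs_le_square_iff)
      then have 3: "(1/2 + \<delta>) * ((q - 2)\<^sup>2 * (norm y)\<^sup>2) \<le> 2 * ((R + 2)\<^sup>2 * (norm y)\<^sup>2)"
        using \<delta> by (intro mult_mono mult_right_mono) auto
      have 4: "0 \<le> T * ((q - 1)\<^sup>2 * (norm y)\<^sup>2)" "0 \<le> (norm y)\<^sup>2 / T" using T by auto
      have TU: "T * (norm u)\<^sup>2 = (norm u)\<^sup>2 - 4 * (\<delta> * (norm u)\<^sup>2)" by (simp add: \<delta>_def field_simps)
      have s1: "- (T * (norm u)\<^sup>2 - q\<^sup>2 * (norm y)\<^sup>2 / T) / 2 = - (T * (norm u)\<^sup>2 / 2) + q\<^sup>2 * (norm y)\<^sup>2 / T / 2"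
        by (simp add: diff_divide_distrib)
      have s2: "- (1/2 - \<delta>) * (norm u)\<^sup>2 = - ((norm u)\<^sup>2 / 2) + \<delta> * (norm u)\<^sup>2" by (simp add: algebra_simps)
      have s3: "T * ((norm u)\<^sup>2 - (q - 1)\<^sup>2 * (norm y)\<^sup>2) = T * (norm u)\<^sup>2 - T * ((q - 1)\<^sup>2 * (norm y)\<^sup>2)"
        by (simp add: right_diff_distrib)
      have s4: "(\<delta> * R\<^sup>2 + R\<^sup>2 / (2 * T) + 2 * (R + 2)\<^sup>2) * (norm y)\<^sup>2 = \<delta> * (R\<^sup>2 * (norm y)\<^sup>2) + R\<^sup>2 * (norm y)\<^sup>2 / T / 2 + 2 * ((R + 2)\<^sup>2 * (norm y)\<^sup>2)"
        by (simp add: algebra_simps)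
      have s5: "\<delta> * ((norm x)\<^sup>2 / 2 - R\<^sup>2 * (norm y)\<^sup>2) = \<delta> * (norm x)\<^sup>2 / 2 - \<delta> * (R\<^sup>2 * (norm y)\<^sup>2)"
        "- (\<delta> / 2) * (norm x)\<^sup>2 = - (\<delta> * (norm x)\<^sup>2 / 2)"
        by (simp_all add: algebra_simps)
      show "- (T * (norm u)\<^sup>2 - q\<^sup>2 * (norm y)\<^sup>2 / T) / 2 +
         (- (1/2 - \<delta>) * (norm u)\<^sup>2 + (1/2 + \<delta>) * ((q - 2)\<^sup>2 * (norm y)\<^sup>2)) +
         (T * ((norm u)\<^sup>2 - (q - 1)\<^sup>2 * (norm y)\<^sup>2) - (norm y)\<^sup>2 / T)
         \<le> (\<delta> * R\<^sup>2 + R\<^sup>2 / (2 * T) + 2 * (R + 2)\<^sup>2) * (norm y)\<^sup>2 + - (\<delta> / 2) * (norm x)\<^sup>2"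
        unfolding s1 s2 s3 s4 s5(2) using 1[unfolded s5(1)] 2 3 4 TU by linarith
      have "0 \<le> (norm (F 0))\<^sup>2 * gw T (0 :: complex ^ 'n)" using gw_pos[of T "0 :: complex ^ 'n"] by simp
      then have "B \<ge> 0" using B[of 0] by linarith
      then show "0 \<le> sqrt B * C" using C(1) by simp
    qed
    finally show ?thesis unfolding exp_add by (simp only: mult.assoc)
  qed
  define K where "K \<zeta> = (LINT x|lborel. h \<zeta> x)" for \<zeta>
  have cont: "continuous_on UNIV (h \<zeta>)" for \<zeta>
    unfolding h_def
    by (intro continuous_intros continuous_on_compose2[OF entire_continuous[OF F]] T
        continuous_on_compose2[OF entire_continuous[OF entire_Phi_c]] continuous_on_compose2[OF entire_continuous[OF entire_sqC]]) auto
  have "K holomorphic_on UNIV"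
    unfolding K_def[abs_def]
  proof (rule holomorphic_lborel_integral)
    show "(\<lambda>\<zeta>. h \<zeta> x) holomorphic_on UNIV" for x
    proof -
      have shift: "(\<lambda>\<zeta>. G (Rn_to_Cn x + (\<zeta> - c) *s Rn_to_Cn y)) holomorphic_on UNIV" if "entire_Cn G" for G :: "complex ^ 'n \<Rightarrow> complex" and c
      proof -
        have "(\<lambda>\<zeta>. G (Rn_to_Cn x + \<zeta> *s Rn_to_Cn y)) \<circ> (\<lambda>\<zeta>. \<zeta> - c) holomorphic_on UNIV"
          by (intro holomorphic_on_compose_gen[of _ _ _ UNIV] holomorphic_intros entire_line_holomorphic that) auto
        then show ?thesis by (simp add: o_def)
      qed
      show ?thesis unfolding h_def
        by (intro holomorphic_intros shift entire_Phi_c entire_sqC entire_line_holomorphic F)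
    qed
    show "h \<zeta> \<in> borel_measurable borel" for \<zeta> using cont by (rule borel_measurable_continuous_onI)
    show "\<exists>w. integrable lborel w \<and> (\<forall>\<zeta> x. norm \<zeta> \<le> R \<longrightarrow> norm (h \<zeta> x) \<le> w x)" for R
    proof (intro exI conjI allI impI)
      show "integrable lborel (\<lambda>x :: real ^ 'n. sqrt B * C * exp ((\<delta> * R\<^sup>2 + R\<^sup>2 / (2 * T) + 2 * (R + 2)\<^sup>2) * (norm y)\<^sup>2) * exp (- (\<delta> / 2) * (norm x)\<^sup>2))"
        using \<delta> by (intro integrable_mult_right integrable_gauss_vec) auto
    qed (rule bound)
  qed
  then have "(\<lambda>\<zeta>. K \<zeta> - K 0) holomorphic_on UNIV" by (intro holomorphic_intros)
  then have "K \<i> - K 0 = 0"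
  proof (rule analytic_continuation)
    show "(0::complex) islimpt \<real>"
      unfolding islimpt_approachable
    proof safe
      fix e :: real assume "e > 0"
      then show "\<exists>x'\<in>\<real>. x' \<noteq> (0::complex) \<and> dist x' 0 < e"
        by (intro bexI[of _ "complex_of_real (e/2)"]) auto
    qed
    fix s :: complex assume "s \<in> \<real>"
    then obtain r where s: "s = complex_of_real r" by (auto elim: Reals_cases)
    have "K s = (LINT x|lborel. h 0 (r *\<^sub>R y + x))"
      unfolding K_def
      by (intro Bochner_Integration.integral_cong refl) (unfold h_def line_cvec, simp add: s add.commute)
    also have "\<dots> = (LINT x|lborel. h 0 x)"
      by (rule lborel_integral_shift(2)) (rule borel_measurable_continuous_onI[OF cont])
    finally show "K s - K 0 = 0" unfolding K_def by simp
  qed auto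
  then have K: "K \<i> = K 0" by simp
  have hi: "h \<i> x = F (cvec x y) * Phi_c \<alpha> (cvec x (- y)) * complex_of_real (gw T (cvec x y))" for x
  proof -
    have "sqC (cvec x 0) = complex_of_real ((norm x)\<^sup>2)"
      unfolding norm_vec_power2 of_real_sum by (auto simp: sqC_def complex_eq_iff power2_eq_square intro!: sum.cong)
    then show ?thesis unfolding h_def line_cvec by (simp add: gw_eq exp_of_real[symmetric])
  qed
  have h0: "h 0 x = F (Rn_to_Cn x) * Phi_c \<alpha> (cvec x (- 2 *\<^sub>R y)) * exp (T * sqC (cvec x (- y)) - complex_of_real ((norm y)\<^sup>2 / T))" for x
    unfolding h_def line_cvec unfolding Rn_to_Cn_cvec by simp
  show ?thesis unfolding hi[symmetric] h0[symmetric] using K by (simp only: K_def)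
qed

subsection \<open>Pairing entire functions with Hermite functions\<close>

lemma hermite_gauss_integrable:
  fixes T x :: real
  assumes T: "0 < T" "T < 1"
  shows "integrable lborel (\<lambda>y. hc k (x - 2 * \<i> * y) * exp (T * (x - \<i> * y)\<^sup>2 - y\<^sup>2 / T))"
proof -
  \<comment> \<open>Chosen so that \<open>4 \<delta>\<close> takes half of the decay rate
    \<open>T + 1 / T - 2\<close> in \<open>y\<close>; the other half is the rate
    \<open>a\<close>.\<close>
  define \<delta> where "\<delta> = (1 - T)\<^sup>2 / (8 * T)"
  have \<delta>: "\<delta> > 0" using T by (simp add: \<delta>_def)
  obtain C where C: "C > 0" "\<And>z. norm (hc k z) \<le> C * exp (- (1/2 - \<delta>) * (Re z)\<^sup>2 + (1/2 + \<delta>) * (Im z)\<^sup>2)"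
    using hc_bound[OF \<delta>] by blast
  define a where "a = (1 - T)\<^sup>2 / (2 * T)"
  have a: "a > 0" using T by (simp add: a_def)
  show ?thesis
  proof (rule integrable_gauss_boundI[OF _ a])
    show "continuous_on UNIV (\<lambda>y. hc k (x - 2 * \<i> * complex_of_real y) * exp (T * (x - \<i> * complex_of_real y)\<^sup>2 - complex_of_real (y\<^sup>2 / T)))"
      using T by (intro continuous_intros) auto
    fix y :: real
    have "norm (exp (T * (x - \<i> * complex_of_real y)\<^sup>2 - complex_of_real (y\<^sup>2 / T))) = exp (T * (x\<^sup>2 - y\<^sup>2) - y\<^sup>2 / T)"
      by (simp add: norm_exp_eq_Re power2_eq_square)
    moreover have "norm (hc k (x - 2 * \<i> * complex_of_real y)) \<le> C * exp (- (1/2 - \<delta>) * x\<^sup>2 + (1/2 + \<delta>) * (2 * y)\<^sup>2)"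
      using C(2)[of "x - 2 * \<i> * complex_of_real y"] by simp
    ultimately have "norm (hc k (x - 2 * \<i> * complex_of_real y) * exp (T * (x - \<i> * complex_of_real y)\<^sup>2 - complex_of_real (y\<^sup>2 / T)))
      \<le> C * exp (- (1/2 - \<delta>) * x\<^sup>2 + (1/2 + \<delta>) * (2 * y)\<^sup>2) * exp (T * (x\<^sup>2 - y\<^sup>2) - y\<^sup>2 / T)"
      unfolding norm_mult by (simp only:) (rule mult_right_mono, simp_all)
    also have "\<dots> = C * exp ((T - 1/2 + \<delta>) * x\<^sup>2) * exp (- a * y\<^sup>2)"
    proof -
      have "(1/2 + \<delta>) * 4 - T - 1 / T = - a"
        unfolding \<delta>_def a_def using T by (simp add: field_simps power2_eq_square)
      then have "((1/2 + \<delta>) * 4 - T - 1 / T) * y\<^sup>2 = - a * y\<^sup>2" by simp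
      then have "- (1/2 - \<delta>) * x\<^sup>2 + (1/2 + \<delta>) * (2 * y)\<^sup>2 + (T * (x\<^sup>2 - y\<^sup>2) - y\<^sup>2 / T) = (T - 1/2 + \<delta>) * x\<^sup>2 + - a * y\<^sup>2"
        by (simp add: power_mult_distrib algebra_simps)
      then show ?thesis by (simp only: mult.assoc exp_add[symmetric])
    qed
    finally show "norm (hc k (x - 2 * \<i> * complex_of_real y) * exp (T * (x - \<i> * complex_of_real y)\<^sup>2 - complex_of_real (y\<^sup>2 / T)))
      \<le> C * exp ((T - 1/2 + \<delta>) * x\<^sup>2) * (1 + \<bar>y\<bar>) ^ 0 * exp (- a * y\<^sup>2)" by simp
  qed
qed

lemma integrable_gauss_pair:
  assumes a: "a > 0"
  shows "integrable (lborel \<Otimes>\<^sub>M lborel) (\<lambda>p :: (real ^ 'n) \<times> (real ^ 'n). exp (- a * (norm (fst p))\<^sup>2) * exp (- a * (norm (snd p))\<^sup>2))"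
  using integrable_gauss_vec[OF a]
  by (intro lborel_pair.Fubini_integrable) (auto simp: case_prod_beta')

lemma Phi_gauss_transform:
  fixes x :: "real ^ 'n"
  assumes T: "0 < T" "T < 1"
  shows "(LINT y|lborel. Phi_c \<alpha> (cvec x (- 2 *\<^sub>R y)) * exp (T * sqC (cvec x (- y)) - complex_of_real ((norm y)\<^sup>2 / T))) =
    complex_of_real (\<Prod>i\<in>UNIV. sqrt (pi * T) / (1 - T) * ((1 + T) / (1 - T)) ^ (\<alpha> $ i)) * Phi \<alpha> x"
proof -
  define f where "f i y = hc (\<alpha> $ i) (x $ i - 2 * \<i> * complex_of_real y) * exp (T * (x $ i - \<i> * complex_of_real y)\<^sup>2 - complex_of_real (y\<^sup>2 / T))" for i and y :: real
  have e: "Phi_c \<alpha> (cvec x (- 2 *\<^sub>R y)) * exp (T * sqC (cvec x (- y)) - complex_of_real ((norm y)\<^sup>2 / T)) = (\<Prod>i\<in>UNIV. f i (y $ i))" for y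
  proof -
    have c: "Complex a (- b) = complex_of_real a - \<i> * complex_of_real b" for a b by (simp add: complex_eq_iff)
    have c2: "Complex a (- (2 * b)) = complex_of_real a - 2 * \<i> * complex_of_real b" for a b by (simp add: complex_eq_iff)
    have "T * sqC (cvec x (- y)) - complex_of_real ((norm y)\<^sup>2 / T) = (\<Sum>i\<in>UNIV. T * (x $ i - \<i> * complex_of_real (y $ i))\<^sup>2 - complex_of_real ((y $ i)\<^sup>2 / T))"
      by (simp add: sqC_def norm_vec_power2 c sum_subtractf sum_distrib_left sum_divide_distrib)
    then have "exp (T * sqC (cvec x (- y)) - complex_of_real ((norm y)\<^sup>2 / T)) = (\<Prod>i\<in>UNIV. exp (T * (x $ i - \<i> * complex_of_real (y $ i))\<^sup>2 - complex_of_real ((y $ i)\<^sup>2 / T)))"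
      by (simp add: exp_sum)
    then show ?thesis by (simp add: Phi_c_def f_def prod.distrib c2)
  qed
  have "(LINT y|lborel. (\<Prod>i\<in>UNIV. f i ((y :: real ^ 'n) $ i))) = (\<Prod>i\<in>UNIV. (LINT u|lborel. f i u))"
    by (rule integral_lborel_vec_prod) (unfold f_def, rule hermite_gauss_integrable[OF T])
  also have "\<dots> = (\<Prod>i\<in>UNIV. complex_of_real (sqrt (pi * T) / (1 - T) * ((1 + T) / (1 - T)) ^ (\<alpha> $ i)) * hc (\<alpha> $ i) (x $ i))"
    unfolding f_def hermite_gauss_transform[OF T] ..
  also have "\<dots> = complex_of_real (\<Prod>i\<in>UNIV. sqrt (pi * T) / (1 - T) * ((1 + T) / (1 - T)) ^ (\<alpha> $ i)) * Phi \<alpha> x"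
    unfolding Phi_eq of_real_prod by (rule prod.distrib)
  finally show ?thesis unfolding e .
qed

text \<open>Fubini is applied before and after the shift, so both integrands must be absolutely
  integrable. The pointwise bound makes \<open>F\<close> at most a constant times the reciprocal
  square root of the weight, and \<open>T < 1\<close> gives the Hermite function times the other
  square root a Gaussian decay.\<close>

theorem pairing_identity:
  fixes F :: "complex ^ 'n \<Rightarrow> complex"
  assumes F: "entire_Cn F" and T: "0 < T" "T < 1" and int: "integrable lborel (\<lambda>z. (norm (F z))\<^sup>2 * gw T z)"
  shows pairing_integrable: "integrable lborel (\<lambda>z. F z * cnj (Phi_c \<alpha> z) * complex_of_real (gw T z))"
    and pairing_eq: "(LINT z|lborel. F z * cnj (Phi_c \<alpha> z) * complex_of_real (gw T z)) =
      complex_of_real (\<Prod>i\<in>UNIV. sqrt (pi * T) / (1 - T) * ((1 + T) / (1 - T)) ^ (\<alpha> $ i)) *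
      (LINT x|lborel. F (Rn_to_Cn x) * Phi \<alpha> x)"
proof -
  have "\<exists>B. \<forall>z. (norm (F z))\<^sup>2 * gw T z \<le> B"
  proof (rule entire_gw_bound[OF T, where 'n = 'n])
    fix C
    assume C: "\<And>F :: complex ^ 'n \<Rightarrow> complex. \<And>z. entire_Cn F \<Longrightarrow> integrable lborel (\<lambda>z. (norm (F z))\<^sup>2 * gw T z) \<Longrightarrow>
       (norm (F z))\<^sup>2 * gw T z \<le> C * (LINT z|lborel. (norm (F z))\<^sup>2 * gw T z)"
    show ?thesis by (intro exI allI) (rule C[OF F int])
  qed
  then obtain B where B_all: "\<forall>z. (norm (F z))\<^sup>2 * gw T z \<le> B" ..
  have B: "(norm (F z))\<^sup>2 * gw T z \<le> B" for z by (rule B_all[rule_format])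
  have Fb: "norm (F z) \<le> sqrt B * exp (- (T * sqRe z - sqIm z / T) / 2)" for z
    using B by (rule gw_bound_imp[of F z])
  have "0 \<le> (norm (F 0))\<^sup>2 * gw T (0 :: complex ^ 'n)" using gw_pos[of T "0 :: complex ^ 'n"] by simp
  then have B0: "B \<ge> 0" using B[of 0] by linarith
  \<comment> \<open>One margin for both integrands: before the shift the decay rates are at least
    \<open>(1 - T) / 2 - \<delta>\<close>, after it the rate in \<open>y\<close> is
    \<open>(1 - T)^2 / T - 4 \<delta>\<close>, and all of these are at least \<delta>.\<close>
  define \<delta> where "\<delta> = (1 - T)\<^sup>2 / 8"
  have "(1 - T)\<^sup>2 \<le> 1 - T" using T by (simp add: power2_eq_square mult_left_le)
  then have \<delta>: "\<delta> > 0" "4 * \<delta> \<le> (1 - T) / 2" using T by (auto simp: \<delta>_def)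
  have T2: "1 / T - 1 \<ge> 1 - T"
  proof -
    have "0 \<le> (1 - T)\<^sup>2 / T" using T by simp
    also have "\<dots> = (1 / T - 1) - (1 - T)" using T by (simp add: field_simps power2_eq_square)
    finally show ?thesis by simp
  qed
  obtain C where C: "C > 0" "\<And>z. norm (Phi_c \<alpha> z) \<le> C * exp (- (1/2 - \<delta>) * sqRe z + (1/2 + \<delta>) * sqIm z)"
    using Phi_c_bound[OF \<delta>(1)] by blast
  note cF = continuous_on_compose2[OF entire_continuous[OF F, of UNIV]]
  note cP = continuous_on_compose2[OF entire_continuous[OF entire_Phi_c, of UNIV]]
  note cS = continuous_on_compose2[OF entire_continuous[OF entire_sqC, of UNIV]]
  define f where "f p = F (cvec (fst p) (snd p)) * Phi_c \<alpha> (cvec (fst p) (- snd p)) * complex_of_real (gw T (cvec (fst p) (snd p)))" for p :: "(real ^ 'n) \<times> (real ^ 'n)"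
  define g where "g p = F (Rn_to_Cn (fst p)) * (Phi_c \<alpha> (cvec (fst p) (- 2 *\<^sub>R snd p)) * exp (T * sqC (cvec (fst p) (- snd p)) - complex_of_real ((norm (snd p))\<^sup>2 / T)))" for p :: "(real ^ 'n) \<times> (real ^ 'n)"
  have cf: "continuous_on UNIV f"
    unfolding f_def by (intro continuous_intros cF cP) auto
  have cg: "continuous_on UNIV g"
    unfolding g_def using T by (intro continuous_intros cF cP cS) auto
  have dom: "integrable (lborel \<Otimes>\<^sub>M lborel) (\<lambda>p :: (real ^ 'n) \<times> (real ^ 'n). sqrt B * C * (exp (- \<delta> * (norm (fst p))\<^sup>2) * exp (- \<delta> * (norm (snd p))\<^sup>2)))"
    by (intro integrable_mult_right integrable_gauss_pair \<delta>)
  have fb: "norm (f (x, y)) \<le> sqrt B * C * (exp (- \<delta> * (norm x)\<^sup>2) * exp (- \<delta> * (norm y)\<^sup>2))" for x y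
  proof -
    have "norm (f (x, y)) = norm (F (cvec x y)) * norm (Phi_c \<alpha> (cvec x (- y))) * exp (T * (norm x)\<^sup>2 - (norm y)\<^sup>2 / T)"
      by (simp add: f_def norm_mult gw_eq)
    also have "\<dots> \<le> (sqrt B * exp (- (T * (norm x)\<^sup>2 - (norm y)\<^sup>2 / T) / 2)) * (C * exp (- (1/2 - \<delta>) * (norm x)\<^sup>2 + (1/2 + \<delta>) * (norm y)\<^sup>2)) * exp (T * (norm x)\<^sup>2 - (norm y)\<^sup>2 / T)"
      using Fb[of "cvec x y"] C(2)[of "cvec x (- y)"] by (intro mult_right_mono mult_mono') simp_all
    also have "\<dots> = sqrt B * C * exp (- (T * (norm x)\<^sup>2 - (norm y)\<^sup>2 / T) / 2 + (- (1/2 - \<delta>) * (norm x)\<^sup>2 + (1/2 + \<delta>) * (norm y)\<^sup>2) + (T * (norm x)\<^sup>2 - (norm y)\<^sup>2 / T))"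
      by (simp only: exp_add mult_ac)
    also have "\<dots> \<le> sqrt B * C * exp (- \<delta> * (norm x)\<^sup>2 + - \<delta> * (norm y)\<^sup>2)"
    proof (intro mult_left_mono iffD2[OF exp_le_cancel_iff])
      have e: "- (T * (norm x)\<^sup>2 - (norm y)\<^sup>2 / T) / 2 + (- (1/2 - \<delta>) * (norm x)\<^sup>2 + (1/2 + \<delta>) * (norm y)\<^sup>2) + (T * (norm x)\<^sup>2 - (norm y)\<^sup>2 / T) =
         (- ((1 - T) / 2 - \<delta>)) * (norm x)\<^sup>2 + (- ((1 / T - 1) / 2 - \<delta>)) * (norm y)\<^sup>2"
        using T by (simp add: field_simps)
      show "- (T * (norm x)\<^sup>2 - (norm y)\<^sup>2 / T) / 2 + (- (1/2 - \<delta>) * (norm x)\<^sup>2 + (1/2 + \<delta>) * (norm y)\<^sup>2) + (T * (norm x)\<^sup>2 - (norm y)\<^sup>2 / T) \<le> - \<delta> * (norm x)\<^sup>2 + - \<delta> * (norm y)\<^sup>2"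
        unfolding e using \<delta> T2 by (intro add_mono mult_right_mono) auto
    qed (use B0 C in auto)
    finally show ?thesis unfolding exp_add .
  qed
  have gb: "norm (g (x, y)) \<le> sqrt B * C * (exp (- \<delta> * (norm x)\<^sup>2) * exp (- \<delta> * (norm y)\<^sup>2))" for x y
  proof -
    have "norm (g (x, y)) = norm (F (cvec x 0)) * norm (Phi_c \<alpha> (cvec x (- 2 *\<^sub>R y))) * exp (T * ((norm x)\<^sup>2 - (norm y)\<^sup>2) - (norm y)\<^sup>2 / T)"
      by (simp add: g_def norm_mult norm_exp_eq_Re Re_sqC Rn_to_Cn_cvec)
    also have "\<dots> \<le> (sqrt B * exp (- (T * (norm x)\<^sup>2) / 2)) * (C * exp (- (1/2 - \<delta>) * (norm x)\<^sup>2 + (1/2 + \<delta>) * (4 * (norm y)\<^sup>2))) * exp (T * ((norm x)\<^sup>2 - (norm y)\<^sup>2) - (norm y)\<^sup>2 / T)"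
      using Fb[of "cvec x 0"] C(2)[of "cvec x (- 2 *\<^sub>R y)"] by (intro mult_right_mono mult_mono') (simp_all add: power_mult_distrib)
    also have "\<dots> = sqrt B * C * exp (- (T * (norm x)\<^sup>2) / 2 + (- (1/2 - \<delta>) * (norm x)\<^sup>2 + (1/2 + \<delta>) * (4 * (norm y)\<^sup>2)) + (T * ((norm x)\<^sup>2 - (norm y)\<^sup>2) - (norm y)\<^sup>2 / T))"
      by (simp only: exp_add mult_ac)
    also have "\<dots> \<le> sqrt B * C * exp (- \<delta> * (norm x)\<^sup>2 + - \<delta> * (norm y)\<^sup>2)"
    proof (intro mult_left_mono iffD2[OF exp_le_cancel_iff])
      have e: "- (T * (norm x)\<^sup>2) / 2 + (- (1/2 - \<delta>) * (norm x)\<^sup>2 + (1/2 + \<delta>) * (4 * (norm y)\<^sup>2)) + (T * ((norm x)\<^sup>2 - (norm y)\<^sup>2) - (norm y)\<^sup>2 / T) =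
         (- ((1 - T) / 2 - \<delta>)) * (norm x)\<^sup>2 + (- (1 / T - 2 + T - 4 * \<delta>)) * (norm y)\<^sup>2"
        using T by (simp add: field_simps)
      have "(1 - T)\<^sup>2 \<le> (1 - T)\<^sup>2 / T" using T by (simp add: field_simps mult_left_le)
      also have "\<dots> = 1 / T - 2 + T" using T by (simp add: field_simps power2_eq_square)
      finally have "8 * \<delta> \<le> 1 / T - 2 + T" by (simp add: \<delta>_def)
      then have 1: "- (1 / T - 2 + T - 4 * \<delta>) \<le> - \<delta>" using \<delta>(1) by linarith
      have 2: "- ((1 - T) / 2 - \<delta>) \<le> - \<delta>" using \<delta> by linarith
      show "- (T * (norm x)\<^sup>2) / 2 + (- (1/2 - \<delta>) * (norm x)\<^sup>2 + (1/2 + \<delta>) * (4 * (norm y)\<^sup>2)) + (T * ((norm x)\<^sup>2 - (norm y)\<^sup>2) - (norm y)\<^sup>2 / T) \<le> - \<delta> * (norm x)\<^sup>2 + - \<delta> * (norm y)\<^sup>2"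
        unfolding e by (intro add_mono mult_right_mono 1 2) auto
    qed (use B0 C in auto)
    finally show ?thesis unfolding exp_add .
  qed
  have intf: "integrable (lborel \<Otimes>\<^sub>M lborel) f"
  proof (rule Bochner_Integration.integrable_bound[OF dom])
    show "f \<in> borel_measurable (lborel \<Otimes>\<^sub>M lborel)"
      unfolding lborel_prod using cf by (simp add: borel_measurable_continuous_onI)
    show "AE p in lborel \<Otimes>\<^sub>M lborel. norm (f p) \<le> norm (sqrt B * C * (exp (- \<delta> * (norm (fst p))\<^sup>2) * exp (- \<delta> * (norm (snd p))\<^sup>2)))"
    proof (rule AE_I2)
      fix p :: "(real ^ 'n) \<times> (real ^ 'n)"
      show "norm (f p) \<le> norm (sqrt B * C * (exp (- \<delta> * (norm (fst p))\<^sup>2) * exp (- \<delta> * (norm (snd p))\<^sup>2)))"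
        using order_trans[OF fb[of "fst p" "snd p"] abs_ge_self] by simp
    qed
  qed
  have intg: "integrable (lborel \<Otimes>\<^sub>M lborel) g"
  proof (rule Bochner_Integration.integrable_bound[OF dom])
    show "g \<in> borel_measurable (lborel \<Otimes>\<^sub>M lborel)"
      unfolding lborel_prod using cg by (simp add: borel_measurable_continuous_onI)
    show "AE p in lborel \<Otimes>\<^sub>M lborel. norm (g p) \<le> norm (sqrt B * C * (exp (- \<delta> * (norm (fst p))\<^sup>2) * exp (- \<delta> * (norm (snd p))\<^sup>2)))"
    proof (rule AE_I2)
      fix p :: "(real ^ 'n) \<times> (real ^ 'n)"
      show "norm (g p) \<le> norm (sqrt B * C * (exp (- \<delta> * (norm (fst p))\<^sup>2) * exp (- \<delta> * (norm (snd p))\<^sup>2)))"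
        using order_trans[OF gb[of "fst p" "snd p"] abs_ge_self] by simp
    qed
  qed
  define k where "k z = F z * cnj (Phi_c \<alpha> z) * complex_of_real (gw T z)" for z
  have km: "k \<in> borel_measurable borel"
    unfolding k_def
    by (intro borel_measurable_continuous_onI continuous_intros entire_continuous F entire_Phi_c)
  have kf: "k (cvec x y) = f (x, y)" for x y
    by (simp add: k_def f_def cnj_Phi_c)
  have kfp: "(\<lambda>p. k (case p of (x, y) \<Rightarrow> cvec x y)) = f"
    by (auto simp: fun_eq_iff kf)
  show "integrable lborel (\<lambda>z. F z * cnj (Phi_c \<alpha> z) * complex_of_real (gw T z))"
    unfolding k_def[symmetric] lborel_complex_vec integrable_distr_eq[OF cvec_measurable km] kfp by (rule intf)
  have "(LINT z|lborel. F z * cnj (Phi_c \<alpha> z) * complex_of_real (gw T z)) = (LINT p|(lborel \<Otimes>\<^sub>M lborel). f p)"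
    unfolding k_def[symmetric] lborel_complex_vec integral_distr[OF cvec_measurable km] kfp ..
  also have "\<dots> = (LINT y|lborel. LINT x|lborel. f (x, y))"
    using lborel_pair.integral_snd[of "\<lambda>x y. f (x, y)"] intf by simp
  also have "\<dots> = (LINT y|lborel. LINT x|lborel. g (x, y))"
    unfolding f_def g_def fst_conv snd_conv mult.assoc[symmetric] by (subst contour_shift[OF F T B]) simp
  also have "\<dots> = (LINT x|lborel. LINT y|lborel. g (x, y))"
    using lborel_pair.Fubini_integral[of "\<lambda>x y. g (x, y)"] intg by simp
  also have "\<dots> = (LINT x|lborel. F (Rn_to_Cn x) * (complex_of_real (\<Prod>i\<in>UNIV. sqrt (pi * T) / (1 - T) * ((1 + T) / (1 - T)) ^ (\<alpha> $ i)) * Phi \<alpha> x))"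
    unfolding g_def fst_conv snd_conv integral_mult_right_zero Phi_gauss_transform[OF T] ..
  also have "\<dots> = complex_of_real (\<Prod>i\<in>UNIV. sqrt (pi * T) / (1 - T) * ((1 + T) / (1 - T)) ^ (\<alpha> $ i)) *
      (LINT x|lborel. F (Rn_to_Cn x) * Phi \<alpha> x)"
    by (subst integral_mult_right_zero[symmetric]) (simp only: mult.left_commute)
  finally show "(LINT z|lborel. F z * cnj (Phi_c \<alpha> z) * complex_of_real (gw T z)) =
      complex_of_real (\<Prod>i\<in>UNIV. sqrt (pi * T) / (1 - T) * ((1 + T) / (1 - T)) ^ (\<alpha> $ i)) *
      (LINT x|lborel. F (Rn_to_Cn x) * Phi \<alpha> x)" .
qed

subsection \<open>Time derivatives of the weight\<close>

text \<open>Polynomials of degree \<open>d\<close> in \<open>X\<close>, \<open>Y\<close> whose coefficients are polynomials in \<open>tanh (2 s)\<close> and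
  \<open>coth (2 s)\<close>: a class closed under \<open>\<partial>/\<partial>s\<close> that contains the logarithmic derivative of the weight.\<close>

inductive wpoly :: "nat \<Rightarrow> (real \<Rightarrow> real \<Rightarrow> real \<Rightarrow> real) \<Rightarrow> bool" where
  wtanh: "wpoly 0 (\<lambda>s X Y. tanh (2 * s))"
| wcoth: "wpoly 0 (\<lambda>s X Y. 1 / tanh (2 * s))"
| wconst: "wpoly 0 (\<lambda>s X Y. c)"
| wX: "wpoly 1 (\<lambda>s X Y. X)"
| wY: "wpoly 1 (\<lambda>s X Y. Y)"
| wadd: "wpoly d p \<Longrightarrow> wpoly d q \<Longrightarrow> wpoly d (\<lambda>s X Y. p s X Y + q s X Y)"
| wmult: "wpoly d p \<Longrightarrow> wpoly e q \<Longrightarrow> wpoly (d + e) (\<lambda>s X Y. p s X Y * q s X Y)"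
| wmono: "wpoly d p \<Longrightarrow> d \<le> e \<Longrightarrow> wpoly e p"

lemma wcmult: "wpoly d p \<Longrightarrow> wpoly d (\<lambda>s X Y. c * p s X Y)"
  using wmult[OF wconst[of c], of d p] by simp

lemma wpower: "wpoly d p \<Longrightarrow> wpoly (d * k) (\<lambda>s X Y. p s X Y ^ k)"
proof (induction k)
  case 0 then show ?case using wconst[of 1] by simp
next
  case (Suc k)
  then have "wpoly (d * Suc k) (\<lambda>s X Y. p s X Y * p s X Y ^ k)"
    using wmult[of d p "d * k" "\<lambda>s X Y. p s X Y ^ k"] by (simp add: algebra_simps)
  then show ?case by simp
qed

lemma tanh_2_deriv: "((\<lambda>s. tanh (2 * s)) has_real_derivative 2 * (1 - (tanh (2 * s))\<^sup>2)) (at s)" for s :: real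
proof -
  have "cosh (2 * s) \<noteq> 0" by (metis cosh_real_nonzero)
  then show ?thesis by (auto intro!: derivative_eq_intros)
qed

lemma coth_2_deriv:
  assumes "s > (0::real)"
  shows "((\<lambda>s. 1 / tanh (2 * s)) has_real_derivative 2 * (1 - (1 / tanh (2 * s))\<^sup>2)) (at s)"
proof -
  have t: "tanh (2 * s) \<noteq> 0" using assms by simp
  have "((\<lambda>s. 1 / tanh (2 * s)) has_real_derivative (0 * tanh (2 * s) - 1 * (2 * (1 - (tanh (2 * s))\<^sup>2))) / (tanh (2 * s) * tanh (2 * s))) (at s)"
    by (rule DERIV_divide[OF DERIV_const tanh_2_deriv t])
  also have "(0 * tanh (2 * s) - 1 * (2 * (1 - (tanh (2 * s))\<^sup>2))) / (tanh (2 * s) * tanh (2 * s)) = 2 * (1 - (1 / tanh (2 * s))\<^sup>2)"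
    using t by (simp add: field_simps power2_eq_square)
  finally show ?thesis .
qed

text \<open>\<open>tanh (2 s)\<close> and \<open>coth (2 s)\<close> both solve
  \<open>u' = 2 (1 - u^2)\<close>, so differentiating in \<open>s\<close> stays within polynomials
  in them and does not raise the degree in \<open>X\<close> and \<open>Y\<close>.\<close>

lemma wpoly_deriv:
  "wpoly d p \<Longrightarrow> \<exists>p'. wpoly d p' \<and> (\<forall>s>0. \<forall>X Y. ((\<lambda>s. p s X Y) has_real_derivative p' s X Y) (at s))"
proof (induction rule: wpoly.induct)
  case wtanh
  have "wpoly 0 (\<lambda>s X Y. 2 * (1 + (- 1) * (tanh (2 * s))\<^sup>2))"
    using wcmult[OF wadd[OF wconst[of 1] wcmult[OF wpower[OF wpoly.wtanh, of 2], of "- 1", simplified mult_0]], of 2] by simp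
  then show ?case using tanh_2_deriv by (intro exI[of _ "\<lambda>s X Y. 2 * (1 - (tanh (2 * s))\<^sup>2)"]) simp
next
  case wcoth
  have "wpoly 0 (\<lambda>s X Y. 2 * (1 + (- 1) * (1 / tanh (2 * s))\<^sup>2))"
    using wcmult[OF wadd[OF wconst[of 1] wcmult[OF wpower[OF wpoly.wcoth, of 2], of "- 1", simplified mult_0]], of 2] by simp
  then show ?case using coth_2_deriv by (intro exI[of _ "\<lambda>s X Y. 2 * (1 - (1 / tanh (2 * s))\<^sup>2)"]) simp
next
  case (wconst c)
  show ?case by (intro exI[of _ "\<lambda>s X Y. 0"]) (simp add: wpoly.wconst)
next
  case wX
  show ?case by (intro exI[of _ "\<lambda>s X Y. 0"]) (auto intro: wmono[OF wpoly.wconst])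
next
  case wY
  show ?case by (intro exI[of _ "\<lambda>s X Y. 0"]) (auto intro: wmono[OF wpoly.wconst])
next
  case (wadd d p q)
  then obtain p' q' where p': "wpoly d p'" "\<forall>s>0. \<forall>X Y. ((\<lambda>s. p s X Y) has_real_derivative p' s X Y) (at s)"
    and q': "wpoly d q'" "\<forall>s>0. \<forall>X Y. ((\<lambda>s. q s X Y) has_real_derivative q' s X Y) (at s)" by blast
  show ?case
    by (rule exI[of _ "\<lambda>s X Y. p' s X Y + q' s X Y"]) (auto intro!: wpoly.wadd p' q' DERIV_add p'(2)[rule_format] q'(2)[rule_format])
next
  case (wmult d p e q)
  then obtain p' q' where p': "wpoly d p'" "\<forall>s>0. \<forall>X Y. ((\<lambda>s. p s X Y) has_real_derivative p' s X Y) (at s)"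
    and q': "wpoly e q'" "\<forall>s>0. \<forall>X Y. ((\<lambda>s. q s X Y) has_real_derivative q' s X Y) (at s)" by blast
  have "wpoly (d + e) (\<lambda>s X Y. p' s X Y * q s X Y + q' s X Y * p s X Y)"
    using wpoly.wadd[OF wpoly.wmult[OF p'(1) wmult.hyps(2)] wpoly.wmult[OF q'(1) wmult.hyps(1), unfolded add.commute[of e d]]] .
  moreover have "((\<lambda>s. p s X Y * q s X Y) has_real_derivative p' s X Y * q s X Y + q' s X Y * p s X Y) (at s)" if "s > 0" for s X Y
    using that p'(2) q'(2) by (intro DERIV_mult) auto
  ultimately show ?case by blast
next
  case (wmono d p e)
  then show ?case using wpoly.wmono by blast
qed

text \<open>\<open>coth\<close> blows up at 0 but decreases, so the bounds are uniform on
  \<open>s \<ge> s0\<close> for positive \<open>s0\<close>.\<close>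

lemma wpoly_bound:
  assumes "wpoly d p" "s0 > 0"
  shows "\<exists>C\<ge>0. \<forall>s\<ge>s0. \<forall>X\<ge>0. \<forall>Y\<ge>0. \<bar>p s X Y\<bar> \<le> C * (1 + X + Y) ^ d"
  using assms
proof (induction rule: wpoly.induct)
  case wtanh
  have "\<bar>tanh (2 * s)\<bar> \<le> 1" for s :: real using tanh_real_lt_1[of "2 * s"] tanh_real_gt_neg1[of "2 * s"] by linarith
  then show ?case by (intro exI[of _ 1]) auto
next
  case wcoth
  have "\<bar>1 / tanh (2 * s)\<bar> \<le> 1 / tanh (2 * s0)" if "s \<ge> s0" for s :: real
  proof -
    have "tanh (2 * s0) \<le> tanh (2 * s)" using that by (simp add: tanh_real_le_iff)
    then show ?thesis using wcoth that by (simp add: frac_le)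
  qed
  then show ?case using wcoth by (intro exI[of _ "1 / tanh (2 * s0)"]) auto
next
  case (wconst c)
  show ?case by (intro exI[of _ "\<bar>c\<bar>"]) auto
next
  case (wadd d p q)
  then obtain C D where C: "C \<ge> 0" "\<forall>s\<ge>s0. \<forall>X\<ge>0. \<forall>Y\<ge>0. \<bar>p s X Y\<bar> \<le> C * (1 + X + Y) ^ d"
    and D: "D \<ge> 0" "\<forall>s\<ge>s0. \<forall>X\<ge>0. \<forall>Y\<ge>0. \<bar>q s X Y\<bar> \<le> D * (1 + X + Y) ^ d" by blast
  have "\<bar>p s X Y + q s X Y\<bar> \<le> (C + D) * (1 + X + Y) ^ d" if "s \<ge> s0" "X \<ge> 0" "Y \<ge> 0" for s X Y
    unfolding distrib_right by (rule order_trans[OF abs_triangle_ineq]) (intro add_mono C(2)[rule_format] D(2)[rule_format] that)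
  then show ?case using C D by (intro exI[of _ "C + D"]) auto
next
  case (wmult d p e q)
  then obtain C D where C: "C \<ge> 0" "\<forall>s\<ge>s0. \<forall>X\<ge>0. \<forall>Y\<ge>0. \<bar>p s X Y\<bar> \<le> C * (1 + X + Y) ^ d"
    and D: "D \<ge> 0" "\<forall>s\<ge>s0. \<forall>X\<ge>0. \<forall>Y\<ge>0. \<bar>q s X Y\<bar> \<le> D * (1 + X + Y) ^ e" by blast
  have "\<bar>p s X Y * q s X Y\<bar> \<le> (C * D) * (1 + X + Y) ^ (d + e)" if "s \<ge> s0" "X \<ge> 0" "Y \<ge> 0" for s X Y
  proof -
    have "\<bar>p s X Y\<bar> * \<bar>q s X Y\<bar> \<le> (C * (1 + X + Y) ^ d) * (D * (1 + X + Y) ^ e)"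
      using C D that by (intro mult_mono) auto
    then show ?thesis by (simp add: abs_mult power_add mult_ac)
  qed
  then show ?case using C D by (intro exI[of _ "C * D"]) auto
next
  case (wmono d p e)
  then obtain C where C: "C \<ge> 0" "\<forall>s\<ge>s0. \<forall>X\<ge>0. \<forall>Y\<ge>0. \<bar>p s X Y\<bar> \<le> C * (1 + X + Y) ^ d" by blast
  have "C * (1 + X + Y) ^ d \<le> C * (1 + X + Y) ^ e" if "X \<ge> 0" "Y \<ge> 0" for X Y
    using C(1) wmono.hyps that by (intro mult_left_mono power_increasing) auto
  then show ?case using C by (intro exI[of _ C]) (meson order_trans)
qed (auto intro!: exI[of _ 1])

lemma wpoly_continuous: "wpoly d p \<Longrightarrow> continuous_on UNIV (\<lambda>v. p s (fst v) (snd v))"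
  by (induction rule: wpoly.induct) (auto intro!: continuous_intros)

definition wU :: "nat \<Rightarrow> real \<Rightarrow> real \<Rightarrow> real \<Rightarrow> real" where
  "wU n s X Y = 2 ^ n * sinh (4 * s) powr (- (real n / 2)) * exp (tanh (2 * s) * X - (1 / tanh (2 * s)) * Y)"

text \<open>The logarithmic derivative of \<open>wU\<close> in \<open>s\<close>. The coefficients of
  \<open>X\<close> and \<open>Y\<close> are written so that both are visibly of one sign: they are
  positive for \<open>s > 0\<close>, hence linear growth in \<open>X + Y\<close>.\<close>

definition wL :: "nat \<Rightarrow> real \<Rightarrow> real \<Rightarrow> real \<Rightarrow> real" where
  "wL n s X Y = 2 * (1 - (tanh (2 * s))\<^sup>2) * X + - (2 * (1 - (1 / tanh (2 * s))\<^sup>2)) * Y - real n * (tanh (2 * s) + 1 / tanh (2 * s))"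

lemma wU_deriv:
  assumes s: "s > 0"
  shows "((\<lambda>s. wU n s X Y) has_real_derivative wL n s X Y * wU n s X Y) (at s)"
proof -
  have sh: "sinh (4 * s) > 0" "sinh (2 * s) > 0" "cosh (2 * s) > 0" using s by auto
  have d1: "((\<lambda>s. sinh (4 * s) powr (- (real n / 2))) has_real_derivative
     (- (real n / 2)) * sinh (4 * s) powr (- (real n / 2) - 1) * (4 * cosh (4 * s))) (at s)"
    using sh by (auto intro!: derivative_eq_intros simp: powr_diff field_simps)
  have coth: "4 * cosh (4 * s) / sinh (4 * s) = 2 * (tanh (2 * s) + 1 / tanh (2 * s))"
  proof -
    have "cosh (4 * s) = (cosh (2 * s))\<^sup>2 + (sinh (2 * s))\<^sup>2" "sinh (4 * s) = 2 * sinh (2 * s) * cosh (2 * s)"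
      using cosh_double[of "2 * s"] sinh_double[of "2 * s"] by simp_all
    then show ?thesis using sh by (simp add: tanh_def field_simps power2_eq_square)
  qed
  have d1': "((\<lambda>s. sinh (4 * s) powr (- (real n / 2))) has_real_derivative
     (- (real n * (tanh (2 * s) + 1 / tanh (2 * s)))) * sinh (4 * s) powr (- (real n / 2))) (at s)"
  proof -
    have "(- (real n / 2)) * sinh (4 * s) powr (- (real n / 2) - 1) * (4 * cosh (4 * s)) =
       (- (real n / 2)) * (4 * cosh (4 * s) / sinh (4 * s)) * sinh (4 * s) powr (- (real n / 2))"
      using sh by (simp add: powr_diff)
    also have "\<dots> = (- (real n * (tanh (2 * s) + 1 / tanh (2 * s)))) * sinh (4 * s) powr (- (real n / 2))"
      unfolding coth by simp
    finally have e: "(- (real n / 2)) * sinh (4 * s) powr (- (real n / 2) - 1) * (4 * cosh (4 * s)) =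
       (- (real n * (tanh (2 * s) + 1 / tanh (2 * s)))) * sinh (4 * s) powr (- (real n / 2))" .
    show ?thesis using d1 unfolding e .
  qed
  have d2: "((\<lambda>s. exp (tanh (2 * s) * X - (1 / tanh (2 * s)) * Y)) has_real_derivative
     exp (tanh (2 * s) * X - (1 / tanh (2 * s)) * Y) * (2 * (1 - (tanh (2 * s))\<^sup>2) * X - 2 * (1 - (1 / tanh (2 * s))\<^sup>2) * Y)) (at s)"
    by (intro DERIV_fun_exp DERIV_diff DERIV_cmult_right tanh_2_deriv coth_2_deriv s)
  have "((\<lambda>s. 2 ^ n * (sinh (4 * s) powr (- (real n / 2)) * exp (tanh (2 * s) * X - (1 / tanh (2 * s)) * Y))) has_real_derivative
     2 ^ n * ((- (real n * (tanh (2 * s) + 1 / tanh (2 * s)))) * sinh (4 * s) powr (- (real n / 2)) * exp (tanh (2 * s) * X - (1 / tanh (2 * s)) * Y) +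
      (exp (tanh (2 * s) * X - (1 / tanh (2 * s)) * Y) * (2 * (1 - (tanh (2 * s))\<^sup>2) * X - 2 * (1 - (1 / tanh (2 * s))\<^sup>2) * Y)) * sinh (4 * s) powr (- (real n / 2)))) (at s)"
    by (intro DERIV_cmult DERIV_mult d1' d2)
  moreover have "2 ^ n * ((- (real n * (tanh (2 * s) + 1 / tanh (2 * s)))) * P * E + (E * (A * X - B * Y)) * P) =
     (A * X + - B * Y - real n * (tanh (2 * s) + 1 / tanh (2 * s))) * (2 ^ n * P * E)" for P E A B :: real
    by (simp add: algebra_simps)
  ultimately show ?thesis unfolding wU_def wL_def by (simp only: mult.assoc[of "2 ^ n", symmetric])
qed

lemma wpoly_wL: "wpoly 1 (wL n)"
proof -
  have A: "wpoly 0 (\<lambda>s X Y. 2 * (1 + (- 1) * (tanh (2 * s))\<^sup>2))"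
    using wcmult[OF wadd[OF wconst[of 1] wcmult[OF wpower[OF wtanh, of 2], of "- 1", simplified mult_0]], of 2] by simp
  have B: "wpoly 0 (\<lambda>s X Y. - 1 * (2 * (1 + (- 1) * (1 / tanh (2 * s))\<^sup>2)))"
    using wcmult[OF wcmult[OF wadd[OF wconst[of 1] wcmult[OF wpower[OF wcoth, of 2], of "- 1", simplified mult_0]], of 2], of "- 1"] by simp
  have C: "wpoly 1 (\<lambda>s X Y. - real n * (tanh (2 * s) + 1 / tanh (2 * s)))"
    using wmono[OF wcmult[OF wadd[OF wtanh wcoth], of "- real n"], of 1] by simp
  have "wpoly 1 (\<lambda>s X Y. (2 * (1 + (- 1) * (tanh (2 * s))\<^sup>2)) * X + (- 1 * (2 * (1 + (- 1) * (1 / tanh (2 * s))\<^sup>2))) * Y + - real n * (tanh (2 * s) + 1 / tanh (2 * s)))"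
    by (rule wadd[OF wadd[OF wmult[OF A wX, unfolded add_0] wmult[OF B wY, unfolded add_0]] C])
  moreover have "(\<lambda>s X Y. (2 * (1 + (- 1) * (tanh (2 * s))\<^sup>2)) * X + (- 1 * (2 * (1 + (- 1) * (1 / tanh (2 * s))\<^sup>2))) * Y + - real n * (tanh (2 * s) + 1 / tanh (2 * s))) = wL n"
    by (intro ext) (simp add: wL_def)
  ultimately show ?thesis by simp
qed

text \<open>Differentiating \<open>p * wU\<close> leads to \<open>(p' + p * wL) * wU\<close>. Only
  the product with \<open>wL\<close> raises the degree, so the leading part is \<open>wL ^ k\<close>
  and the remainder has degree \<open>k - 1\<close>; the case \<open>k = 0\<close>, where this
  difference is truncated, has remainder zero.\<close>

lemma wU_funpow_deriv:
  "\<exists>p r. wpoly k p \<and> (\<forall>s>0. \<forall>X Y. (deriv ^^ k) (\<lambda>s. wU n s X Y) s = p s X Y * wU n s X Y) \<and>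
     (\<forall>s X Y. p s X Y = wL n s X Y ^ k + r s X Y) \<and> (if k = 0 then r = (\<lambda>s X Y. 0) else wpoly (k - 1) r)"
proof (induction k)
  case 0
  show ?case by (rule exI[of _ "\<lambda>s X Y. 1"], rule exI[of _ "\<lambda>s X Y. 0"]) (simp add: wconst)
next
  case (Suc k)
  then obtain p r where p: "wpoly k p" "\<And>s X Y. s > 0 \<Longrightarrow> (deriv ^^ k) (\<lambda>s. wU n s X Y) s = p s X Y * wU n s X Y"
    "\<And>s X Y. p s X Y = wL n s X Y ^ k + r s X Y" and r: "if k = 0 then r = (\<lambda>s X Y. 0) else wpoly (k - 1) r" by blast
  obtain p' where p': "wpoly k p'" "\<And>s X Y. s > 0 \<Longrightarrow> ((\<lambda>s. p s X Y) has_real_derivative p' s X Y) (at s)"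
    using wpoly_deriv[OF p(1)] by blast
  have rL: "wpoly k (\<lambda>s X Y. r s X Y * wL n s X Y)"
  proof (cases k)
    case 0 then show ?thesis using r wconst[of 0] by simp
  next
    case (Suc j) then show ?thesis using r wmult[of j r 1 "wL n"] wpoly_wL by simp
  qed
  have 1: "(deriv ^^ Suc k) (\<lambda>s. wU n s X Y) s = (p' s X Y + p s X Y * wL n s X Y) * wU n s X Y" if s: "s > 0" for s X Y
  proof -
    have "((\<lambda>s. p s X Y * wU n s X Y) has_real_derivative p' s X Y * wU n s X Y + (wL n s X Y * wU n s X Y) * p s X Y) (at s)"
      by (intro DERIV_mult p' wU_deriv s)
    then have "((deriv ^^ k) (\<lambda>s. wU n s X Y) has_real_derivative p' s X Y * wU n s X Y + (wL n s X Y * wU n s X Y) * p s X Y) (at s)"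
      by (rule has_field_derivative_transform_within_open[where S = "{0<..}"]) (use s p(2) in auto)
    then show ?thesis by (simp add: DERIV_imp_deriv algebra_simps)
  qed
  have 2: "wpoly (Suc k) (\<lambda>s X Y. p' s X Y + p s X Y * wL n s X Y)"
  proof (rule wadd)
    show "wpoly (Suc k) p'" by (rule wmono[OF p'(1)]) simp
    show "wpoly (Suc k) (\<lambda>s X Y. p s X Y * wL n s X Y)" using wmult[OF p(1) wpoly_wL[of n]] by simp
  qed
  have 3: "p' s X Y + p s X Y * wL n s X Y = wL n s X Y ^ Suc k + (p' s X Y + r s X Y * wL n s X Y)" for s X Y
    by (simp add: p(3) algebra_simps)
  have 4: "wpoly k (\<lambda>s X Y. p' s X Y + r s X Y * wL n s X Y)" by (rule wadd[OF p'(1) rL])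
  show ?case
  proof (rule exI[of _ "\<lambda>s X Y. p' s X Y + p s X Y * wL n s X Y"], rule exI[of _ "\<lambda>s X Y. p' s X Y + r s X Y * wL n s X Y"], intro conjI allI impI)
    show "if Suc k = 0 then (\<lambda>s X Y. p' s X Y + r s X Y * wL n s X Y) = (\<lambda>s X Y. 0) else wpoly (Suc k - 1) (\<lambda>s X Y. p' s X Y + r s X Y * wL n s X Y)"
      using 4 by simp
  qed (rule 2, erule 1, rule 3)
qed

lemma wL_lower:
  assumes s: "s > 0"
  obtains \<kappa> C where "\<kappa> > 0" "C \<ge> 0" "\<And>X Y. X \<ge> 0 \<Longrightarrow> Y \<ge> 0 \<Longrightarrow> wL n s X Y \<ge> \<kappa> * (1 + X + Y) - C"
proof -
  define T where "T = tanh (2 * s)"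
  have T: "0 < T" "T < 1" using s tanh_real_lt_1[of "2 * s"] by (auto simp: T_def)
  have A: "2 * (1 - T\<^sup>2) > 0" using T by (simp add: power_less_one_iff)
  have B: "- (2 * (1 - (1 / T)\<^sup>2)) > 0" using T by (simp add: one_less_power field_simps power_less_one_iff)
  define \<kappa> where "\<kappa> = min (2 * (1 - T\<^sup>2)) (- (2 * (1 - (1 / T)\<^sup>2)))"
  define C where "C = \<kappa> + real n * (T + 1 / T)"
  show ?thesis
  proof
    show k: "\<kappa> > 0" using A B by (simp add: \<kappa>_def)
    show "C \<ge> 0" using k T by (auto simp: C_def)
    fix X Y :: real assume XY: "X \<ge> 0" "Y \<ge> 0"
    have "\<kappa> \<le> 2 * (1 - T\<^sup>2)" "\<kappa> \<le> - (2 * (1 - (1 / T)\<^sup>2))" unfolding \<kappa>_def by (rule min.cobounded1, rule min.cobounded2)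
    then have "\<kappa> * X \<le> 2 * (1 - T\<^sup>2) * X" "\<kappa> * Y \<le> - (2 * (1 - (1 / T)\<^sup>2)) * Y"
      using XY by (auto intro: mult_right_mono simp del: minus_mult_left)
    then show "wL n s X Y \<ge> \<kappa> * (1 + X + Y) - C"
      unfolding wL_def T_def[symmetric] C_def by (simp only: distrib_left)
  qed
qed

text \<open>Far out \<open>wL\<close> exceeds half its linear growth, and the remainder, smaller by
  one power of \<open>1 + X + Y\<close>, is at most half of the leading bound. Multiplying
  \<open>r\<close> by \<open>1 + X + Y\<close> in the hypothesis expresses the lower degree also for
  \<open>k = 0\<close>.\<close>

lemma poly_lower:
  assumes s: "s > 0" and L: "\<And>X Y. p X Y = wL n s X Y ^ k + r X Y"
    and r: "\<And>X Y. X \<ge> 0 \<Longrightarrow> Y \<ge> 0 \<Longrightarrow> \<bar>r X Y\<bar> * (1 + X + Y) \<le> D * (1 + X + Y) ^ k"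
  obtains c R where "c > 0" "R > 0" "\<And>X Y. X \<ge> 0 \<Longrightarrow> Y \<ge> 0 \<Longrightarrow> X + Y \<ge> R \<Longrightarrow> p X Y \<ge> c * (1 + X + Y) ^ k"
proof -
  obtain \<kappa> C where k: "\<kappa> > 0" "C \<ge> 0" "\<And>X Y. X \<ge> 0 \<Longrightarrow> Y \<ge> 0 \<Longrightarrow> wL n s X Y \<ge> \<kappa> * (1 + X + Y) - C"
    using wL_lower[OF s] by blast
  define c where "c = (\<kappa> / 2) ^ k"
  have c: "c > 0" using k by (simp add: c_def)
  show ?thesis
  proof
    show "c / 2 > 0" using c by simp
    show "1 + 2 * C / \<kappa> + 2 * \<bar>D\<bar> / c > 0" using k c by (intro add_pos_nonneg) auto
    fix X Y :: real assume XY: "X \<ge> 0" "Y \<ge> 0" and R: "X + Y \<ge> 1 + 2 * C / \<kappa> + 2 * \<bar>D\<bar> / c"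
    define N where "N = 1 + X + Y"
    have N: "N > 0" using XY by (simp add: N_def)
    have C0: "0 \<le> 2 * C / \<kappa>" "0 \<le> 2 * \<bar>D\<bar> / c" using k c by auto
    have "2 * C / \<kappa> \<le> N" using R C0 by (simp add: N_def)
    then have "C \<le> \<kappa> / 2 * N" using k by (simp add: field_simps)
    then have "\<kappa> / 2 * N \<le> wL n s X Y" using k(3)[OF XY] unfolding N_def[symmetric] by (simp add: field_simps)
    then have "(\<kappa> / 2 * N) ^ k \<le> wL n s X Y ^ k" using k N by (intro power_mono) auto
    then have 1: "c * N ^ k \<le> wL n s X Y ^ k" by (simp only: power_mult_distrib c_def)
    have "2 * \<bar>D\<bar> / c \<le> N" using R C0 by (simp add: N_def)
    then have "2 * \<bar>D\<bar> \<le> c * N" using c by (simp add: field_simps)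
    have "\<bar>r X Y\<bar> * N \<le> D * N ^ k" using r[OF XY] unfolding N_def .
    also have "\<dots> \<le> \<bar>D\<bar> * N ^ k" using N by (intro mult_right_mono) auto
    also have "\<dots> \<le> c / 2 * N * N ^ k" using \<open>2 * \<bar>D\<bar> \<le> c * N\<close> N by (intro mult_right_mono) auto
    finally have "\<bar>r X Y\<bar> * N \<le> (c / 2 * N ^ k) * N" by (simp add: mult_ac)
    then have "\<bar>r X Y\<bar> \<le> c / 2 * N ^ k" using N by simp
    then show "p X Y \<ge> c / 2 * (1 + X + Y) ^ k" unfolding N_def[symmetric] L using 1 by linarith
  qed
qed

lemma weight_U_eq: "weight_U s z = wU CARD('n) s (sqRe z) (sqIm z)" for z :: "complex ^ 'n"
  by (simp add: weight_U_def wU_def sqRe_def sqIm_def tanh_def)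

text \<open>Collects what is used about the time derivatives while keeping the polynomial factor
  \<open>p\<close> abstract. The lower bound is confined to large arguments, where the leading power
  of \<open>wL\<close> controls the sign.\<close>

theorem weight_deriv:
  obtains p where
    "\<And>s z. s > 0 \<Longrightarrow> (deriv ^^ k) (\<lambda>s. weight_U s (z :: complex ^ 'n)) s = p s (sqRe z) (sqIm z) * weight_U s z"
    "\<And>s z. s > 0 \<Longrightarrow> ((deriv ^^ k) (\<lambda>s. weight_U s (z :: complex ^ 'n)) has_real_derivative (deriv ^^ Suc k) (\<lambda>s. weight_U s z) s) (at s)"
    "\<And>s. continuous_on UNIV (\<lambda>v. p s (fst v) (snd v))"
    "\<And>s0. s0 > 0 \<Longrightarrow> \<exists>C\<ge>0. \<forall>s\<ge>s0. \<forall>X\<ge>0. \<forall>Y\<ge>0. \<bar>p s X Y\<bar> \<le> C * (1 + X + Y) ^ k"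
    "\<And>s. s > 0 \<Longrightarrow> \<exists>c>0. \<exists>R>0. \<forall>X\<ge>0. \<forall>Y\<ge>0. X + Y \<ge> R \<longrightarrow> p s X Y \<ge> c * (1 + X + Y) ^ k"
proof -
  obtain p r where p: "wpoly k p" "\<And>s X Y. s > 0 \<Longrightarrow> (deriv ^^ k) (\<lambda>s. wU CARD('n) s X Y) s = p s X Y * wU CARD('n) s X Y"
    "\<And>s X Y. p s X Y = wL CARD('n) s X Y ^ k + r s X Y" and r: "if k = 0 then r = (\<lambda>s X Y. 0) else wpoly (k - 1) r"
    using wU_funpow_deriv[of k "CARD('n)"] by blast
  obtain p' where p': "wpoly k p'" "\<And>s X Y. s > 0 \<Longrightarrow> ((\<lambda>s. p s X Y) has_real_derivative p' s X Y) (at s)"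
    using wpoly_deriv[OF p(1)] by blast
  show ?thesis
  proof (rule that[of p])
    show 1: "(deriv ^^ k) (\<lambda>s. weight_U s z) s = p s (sqRe z) (sqIm z) * weight_U s z" if "s > 0" for s and z :: "complex ^ 'n"
      unfolding weight_U_eq using that by (rule p)
    show "((deriv ^^ k) (\<lambda>s. weight_U s z) has_real_derivative (deriv ^^ Suc k) (\<lambda>s. weight_U s z) s) (at s)" if s: "s > 0" for s and z :: "complex ^ 'n"
    proof -
      have "((\<lambda>s. p s (sqRe z) (sqIm z) * wU CARD('n) s (sqRe z) (sqIm z)) has_real_derivative
        p' s (sqRe z) (sqIm z) * wU CARD('n) s (sqRe z) (sqIm z) + (wL CARD('n) s (sqRe z) (sqIm z) * wU CARD('n) s (sqRe z) (sqIm z)) * p s (sqRe z) (sqIm z)) (at s)"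
        (is "(_ has_real_derivative ?D) _")
        by (intro DERIV_mult p' wU_deriv s)
      then have "((deriv ^^ k) (\<lambda>s. weight_U s z) has_real_derivative ?D) (at s)"
        by (rule has_field_derivative_transform_within_open[where S = "{0<..}"]) (use s 1 in \<open>auto simp: weight_U_eq\<close>)
      then show ?thesis by (simp add: DERIV_imp_deriv)
    qed
    show "continuous_on UNIV (\<lambda>v. p s (fst v) (snd v))" for s by (rule wpoly_continuous[OF p(1)])
    show "\<exists>C\<ge>0. \<forall>s\<ge>s0. \<forall>X\<ge>0. \<forall>Y\<ge>0. \<bar>p s X Y\<bar> \<le> C * (1 + X + Y) ^ k" if "s0 > 0" for s0
      by (rule wpoly_bound[OF p(1) that])
    show "\<exists>c>0. \<exists>R>0. \<forall>X\<ge>0. \<forall>Y\<ge>0. X + Y \<ge> R \<longrightarrow> p s X Y \<ge> c * (1 + X + Y) ^ k" if s: "s > 0" for s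
    proof -
      have "\<exists>D. \<forall>X\<ge>0. \<forall>Y\<ge>0. \<bar>r s X Y\<bar> * (1 + X + Y) \<le> D * (1 + X + Y) ^ k"
      proof (cases k)
        case 0 then show ?thesis using r by (intro exI[of _ 0]) simp
      next
        case (Suc j)
        then obtain D where "\<forall>s'\<ge>s. \<forall>X\<ge>0. \<forall>Y\<ge>0. \<bar>r s' X Y\<bar> \<le> D * (1 + X + Y) ^ j"
          using wpoly_bound[of j r s] r s by auto
        then have "\<bar>r s X Y\<bar> * (1 + X + Y) \<le> D * (1 + X + Y) ^ j * (1 + X + Y)" if "X \<ge> 0" "Y \<ge> 0" for X Y
          using that by (intro mult_right_mono) auto
        then show ?thesis unfolding Suc by (intro exI[of _ D]) (auto simp: mult_ac)
      qed
      then obtain D where D: "\<And>X Y. X \<ge> 0 \<Longrightarrow> Y \<ge> 0 \<Longrightarrow> \<bar>r s X Y\<bar> * (1 + X + Y) \<le> D * (1 + X + Y) ^ k" by blast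
      show ?thesis
        by (rule poly_lower[OF s p(3)[of s] D]) blast+
    qed
  qed
qed

subsection \<open>The weighted Bergman space\<close>

lemma orthonormal_scale:
  assumes L2: "\<And>i. L2 M (\<phi> i)" and ip: "\<And>i j. ip M (\<phi> i) (\<phi> j) = (if i = j then complex_of_real (N i) else 0)"
    and N: "\<And>i. N i > 0"
  shows "orthonormal M (\<lambda>i x. complex_of_real (1 / sqrt (N i)) * \<phi> i x)"
proof
  show "L2 M (\<lambda>x. complex_of_real (1 / sqrt (N i)) * \<phi> i x)" for i by (rule L2_scale[OF L2])
  have r: "ip M f (\<lambda>x. complex_of_real c * \<phi> j x) = complex_of_real c * ip M f (\<phi> j)" for f c j
    using ip_scale[of M "complex_of_real c" "\<phi> j" f] ip_cnj[of M "\<lambda>x. complex_of_real c * \<phi> j x" f] ip_cnj[of M "\<phi> j" f]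
    by (metis complex_cnj_complex_of_real complex_cnj_mult)
  show "ip M (\<lambda>x. complex_of_real (1 / sqrt (N i)) * \<phi> i x) (\<lambda>x. complex_of_real (1 / sqrt (N j)) * \<phi> j x) = (if i = j then 1 else 0)" for i j
  proof (cases "i = j")
    case True
    have "1 / sqrt (N j) * (1 / sqrt (N j) * N j) = 1" using N[of j] by (simp add: field_simps)
    then show ?thesis unfolding ip_scale r ip using True by (simp flip: of_real_mult)
  next
    case False
    then show ?thesis unfolding ip_scale r ip by simp
  qed
qed

lemma continuous_AE_eq:
  fixes f g :: "'a::euclidean_space \<Rightarrow> 'b::real_normed_vector"
  assumes "continuous_on UNIV f" "continuous_on UNIV g" "AE x in lborel. f x = g x"
  shows "f = g"
proof -
  have op: "open {x. f x - g x \<noteq> 0}"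
    using assms(1,2) by (intro open_Collect_neq continuous_intros)
  have "{x. f x - g x \<noteq> 0} = {}"
  proof (rule ccontr)
    assume ne: "{x. f x - g x \<noteq> 0} \<noteq> {}"
    have "AE x in lborel. x \<notin> {x. f x - g x \<noteq> 0}" using assms(3) by eventually_elim simp
    then have "{x. f x - g x \<noteq> 0} \<in> null_sets lborel"
      using op by (subst AE_iff_null_sets) (auto simp: borel_open)
    then have "negligible {x. f x - g x \<noteq> 0}" by (simp add: negligible_iff_null_sets null_sets_completionI)
    then show False using open_not_negligible[OF op ne] by blast
  qed
  then show ?thesis by (auto simp: fun_eq_iff)
qed

lemma tanh_2_bounds: "s > 0 \<Longrightarrow> 0 < tanh (2 * s) \<and> tanh (2 * s) < (1::real)"
  using tanh_real_lt_1[of "2 * s"] by simp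

text \<open>The argument of type \<open>'n itself\<close> carries the dimension, which no other
  argument determines.\<close>

definition U_const :: "'n itself \<Rightarrow> real \<Rightarrow> real" where
  "U_const _ s = 2 ^ CARD('n) * sinh (4 * s) powr (- (real CARD('n) / 2))"

lemma U_const_pos: "s > 0 \<Longrightarrow> U_const TYPE('n) s > 0"
  by (simp add: U_const_def)

lemma weight_U_gw: "weight_U s z = U_const TYPE('n) s * gw (tanh (2 * s)) z" for z :: "complex ^ 'n"
  by (simp add: weight_U_def gw_def U_const_def tanh_def)

lemma weight_U_pos: "s > 0 \<Longrightarrow> weight_U s z > 0"
  by (simp add: weight_U_gw U_const_pos gw_pos)

lemma weight_U_measurable [measurable]: "weight_U s \<in> borel_measurable borel"
  unfolding weight_U_gw[abs_def] by measurable

text \<open>The constant \<open>(2 pi) ^ (n / 2)\<close> that remains in the weighted norms of the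
  Hermite functions once the exponential in \<open>s\<close> is split off.\<close>

definition C0 :: "'n itself \<Rightarrow> real" where "C0 _ = sqrt (2 * pi) ^ CARD('n)"

lemma C0_pos: "C0 TYPE('n) > 0" by (simp add: C0_def)

text \<open>The hyperbolic identities give \<open>(1 + T) / (1 - T) = exp (4 s)\<close>, and per
  coordinate the prefactor of the weight reduces the part free of the degree to
  \<open>sqrt (2 pi) * exp (2 s)\<close>. That \<open>C0\<close> does not depend on \<open>s\<close>
  is what makes derivatives in \<open>s\<close> produce pure powers of the eigenvalue.\<close>

lemma transform_constant:
  fixes \<alpha> :: "nat ^ 'n"
  assumes s: "s > 0"
  defines "T \<equiv> tanh (2 * s)"
  shows "U_const TYPE('n) s * (\<Prod>i\<in>UNIV. sqrt (pi * T) / (1 - T) * ((1 + T) / (1 - T)) ^ (\<alpha> $ i)) =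
    C0 TYPE('n) * exp (2 * Hermite_eigenvalue \<alpha> * s)"
proof -
  have sh: "sinh (2 * s) > 0" "cosh (2 * s) > 0" "sinh (4 * s) > 0" using s by auto
  have T: "0 < T" "T < 1" using tanh_2_bounds[OF s] by (auto simp: T_def)
  have cp: "cosh (2 * s) + sinh (2 * s) = exp (2 * s)" and cm: "cosh (2 * s) - sinh (2 * s) = exp (- (2 * s))"
    by (simp_all add: cosh_plus_sinh cosh_minus_sinh)
  have "(1 + T) / (1 - T) = (cosh (2 * s) + sinh (2 * s)) / (cosh (2 * s) - sinh (2 * s))"
  proof -
    have "cosh (2 * s) - sinh (2 * s) > 0" unfolding cm by simp
    then have "(1 + sinh (2 * s) / cosh (2 * s)) / (1 - sinh (2 * s) / cosh (2 * s)) = (cosh (2 * s) + sinh (2 * s)) / (cosh (2 * s) - sinh (2 * s))"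
      using sh by (simp add: divide_simps)
    then show ?thesis by (simp only: T_def tanh_def)
  qed
  also have "\<dots> = exp (4 * s)" unfolding cp cm by (simp add: exp_minus exp_add[symmetric] divide_inverse)
  finally have rho: "(1 + T) / (1 - T) = exp (4 * s)" .
  have "sinh (4 * s) = 2 * sinh (2 * s) * cosh (2 * s)" using sinh_double[of "2 * s"] by simp
  moreover have "1 - T\<^sup>2 = 1 / (cosh (2 * s))\<^sup>2"
  proof -
    have "1 - T\<^sup>2 = ((cosh (2 * s))\<^sup>2 - (sinh (2 * s))\<^sup>2) / (cosh (2 * s))\<^sup>2"
      using sh unfolding T_def tanh_def by (simp add: power_divide diff_divide_distrib)
    then show ?thesis by (simp only: hyperbolic_pythagoras)
  qed
  moreover have "T = sinh (2 * s) / cosh (2 * s)" by (simp only: T_def tanh_def)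
  ultimately have sinh4: "sinh (4 * s) * (1 - T\<^sup>2) = 2 * T"
    using sh by (simp add: power2_eq_square)
  have one: "2 / sqrt (sinh (4 * s)) * (sqrt (pi * T) / (1 - T)) = sqrt (2 * pi) * exp (2 * s)"
  proof (rule power2_eq_imp_eq)
    have T2: "1 - T\<^sup>2 \<noteq> 0" using T by (simp add: power2_eq_1_iff)
    have sT: "sinh (4 * s) = 2 * T / (1 - T\<^sup>2)" using sinh4 T2 by (simp add: field_simps)
    have "(2 / sqrt (sinh (4 * s)) * (sqrt (pi * T) / (1 - T)))\<^sup>2 = 4 / sinh (4 * s) * (pi * T / (1 - T)\<^sup>2)"
      using sh T by (simp add: power_mult_distrib power_divide)
    also have "\<dots> = 2 * pi * (1 - T\<^sup>2) / (1 - T)\<^sup>2"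
      unfolding sT using T T2 by (simp add: field_simps)
    also have "\<dots> = 2 * pi * ((1 + T) / (1 - T))"
    proof -
      have "2 * pi * (d * e) / (d * d) = 2 * pi * (e / d)" if "d \<noteq> 0" for d e :: real using that by simp
      from this[of "1 - T" "1 + T"] T have "2 * pi * ((1 - T) * (1 + T)) / ((1 - T) * (1 - T)) = 2 * pi * ((1 + T) / (1 - T))" by simp
      moreover have "1 - T\<^sup>2 = (1 - T) * (1 + T)" by (simp add: power2_eq_square algebra_simps)
      ultimately show ?thesis by (simp only: power2_eq_square)
    qed
    also have "\<dots> = (sqrt (2 * pi) * exp (2 * s))\<^sup>2" unfolding rho by (simp add: power_mult_distrib exp_double[symmetric])
    finally show "(2 / sqrt (sinh (4 * s)) * (sqrt (pi * T) / (1 - T)))\<^sup>2 = (sqrt (2 * pi) * exp (2 * s))\<^sup>2" .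
  qed (use T sh in auto)
  have "U_const TYPE('n) s = (\<Prod>i\<in>(UNIV :: 'n set). 2 / sqrt (sinh (4 * s)))"
  proof -
    have "sinh (4 * s) powr (- (real CARD('n) / 2)) = (sinh (4 * s) powr (- (1/2))) ^ CARD('n)"
      using sh by (simp add: powr_powr powr_realpow[symmetric])
    also have "sinh (4 * s) powr (- (1/2)) = 1 / sqrt (sinh (4 * s))"
      by (simp only: powr_minus powr_half_sqrt[OF less_imp_le[OF sh(3)]] inverse_eq_divide)
    finally show ?thesis by (simp add: U_const_def power_mult_distrib power_divide)
  qed
  then have "U_const TYPE('n) s * (\<Prod>i\<in>UNIV. sqrt (pi * T) / (1 - T) * ((1 + T) / (1 - T)) ^ (\<alpha> $ i)) =
    (\<Prod>i\<in>UNIV. (2 / sqrt (sinh (4 * s)) * (sqrt (pi * T) / (1 - T))) * ((1 + T) / (1 - T)) ^ (\<alpha> $ i))"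
    by (simp only: prod.distrib[symmetric] mult.assoc)
  also have "\<dots> = (\<Prod>i\<in>UNIV. sqrt (2 * pi) * exp (2 * s * (2 * real (\<alpha> $ i) + 1)))"
    unfolding one rho by (intro prod.cong refl) (simp add: exp_of_nat_mult[symmetric] exp_add[symmetric] algebra_simps)
  also have "\<dots> = C0 TYPE('n) * exp (2 * Hermite_eigenvalue \<alpha> * s)"
    by (simp add: prod.distrib exp_sum[symmetric] eigenvalue_alt sum_distrib_left sum_distrib_right C0_def mult_ac)
  finally show ?thesis .
qed

definition MU :: "real \<Rightarrow> (complex ^ 'n) measure" where
  "MU s = density lborel (\<lambda>z. ennreal (weight_U s z))"

lemma sets_MU [simp, measurable_cong]: "sets (MU s) = sets borel" by (simp add: MU_def)

lemma integral_MU: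
  fixes f :: "complex ^ 'n \<Rightarrow> 'b::{banach, second_countable_topology}"
  assumes s: "s > 0" and f: "f \<in> borel_measurable borel"
  shows "integrable (MU s) f \<longleftrightarrow> integrable lborel (\<lambda>z. weight_U s z *\<^sub>R f z)"
    and "(LINT z|MU s. f z) = (LINT z|lborel. weight_U s z *\<^sub>R f z)"
proof -
  have w: "AE z in lborel. 0 \<le> weight_U s (z :: complex ^ 'n)" by (rule AE_I2) (rule less_imp_le[OF weight_U_pos[OF s]])
  have m: "weight_U s \<in> borel_measurable (lborel :: (complex ^ 'n) measure)" and f': "f \<in> borel_measurable lborel"
    using f by simp_all
  show "integrable (MU s) f \<longleftrightarrow> integrable lborel (\<lambda>z. weight_U s z *\<^sub>R f z)"
    unfolding MU_def by (rule integrable_density[OF f' m w])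
  show "(LINT z|MU s. f z) = (LINT z|lborel. weight_U s z *\<^sub>R f z)"
    unfolding MU_def by (rule integral_density[OF f' m w])
qed

lemma L2_MU:
  fixes F :: "complex ^ 'n \<Rightarrow> complex"
  assumes s: "s > 0" and F: "entire_Cn F"
  shows "L2 (MU s) F \<longleftrightarrow> integrable lborel (\<lambda>z. (norm (F z))\<^sup>2 * gw (tanh (2 * s)) z)"
proof -
  have [measurable]: "F \<in> borel_measurable borel" by (rule entire_measurable[OF F])
  have Fm: "F \<in> borel_measurable (MU s)" by simp
  have "L2 (MU s) F \<longleftrightarrow> integrable lborel (\<lambda>z. weight_U s z *\<^sub>R (norm (F z))\<^sup>2)"
    unfolding L2_def by (simp only: Fm simp_thms) (rule integral_MU(1)[OF s], measurable)
  also have "(\<lambda>z. weight_U s z *\<^sub>R (norm (F z))\<^sup>2) = (\<lambda>z. U_const TYPE('n) s * ((norm (F z))\<^sup>2 * gw (tanh (2 * s)) z))"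
    by (simp add: weight_U_gw fun_eq_iff)
  also have "integrable lborel \<dots> \<longleftrightarrow> integrable lborel (\<lambda>z. (norm (F z))\<^sup>2 * gw (tanh (2 * s)) z)"
    using U_const_pos[OF s, where 'n = 'n] by (simp add: integrable_mult_right_iff)
  finally show ?thesis .
qed

lemma ip_MU_Phi_c:
  fixes F :: "complex ^ 'n \<Rightarrow> complex"
  assumes s: "s > 0" and F: "entire_Cn F" "L2 (MU s) F"
  shows "ip (MU s) F (Phi_c \<alpha>) = complex_of_real (C0 TYPE('n) * exp (2 * Hermite_eigenvalue \<alpha> * s)) * ip lborel (\<lambda>x. F (Rn_to_Cn x)) (Phi \<alpha>)"
proof -
  define T where "T = tanh (2 * s)"
  have T: "0 < T" "T < 1" using tanh_2_bounds[OF s] by (auto simp: T_def)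
  have int: "integrable lborel (\<lambda>z. (norm (F z))\<^sup>2 * gw T z)" using F(2) unfolding L2_MU[OF s F(1)] T_def .
  have [measurable]: "F \<in> borel_measurable borel" by (rule entire_measurable[OF F(1)])
  have m: "(\<lambda>z. F z * cnj (Phi_c \<alpha> z)) \<in> borel_measurable borel"
    by (intro borel_measurable_continuous_onI continuous_intros entire_continuous F(1) entire_Phi_c)
  have "ip (MU s) F (Phi_c \<alpha>) = (LINT z|lborel. complex_of_real (U_const TYPE('n) s) * (F z * cnj (Phi_c \<alpha> z) * complex_of_real (gw T z)))"
    unfolding ip_def integral_MU(2)[OF s m] by (simp add: weight_U_gw scaleR_conv_of_real T_def mult_ac)
  also have "\<dots> = complex_of_real (U_const TYPE('n) s) * (LINT z|lborel. F z * cnj (Phi_c \<alpha> z) * complex_of_real (gw T z))"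
    by simp
  also have "\<dots> = complex_of_real (U_const TYPE('n) s * (\<Prod>i\<in>UNIV. sqrt (pi * T) / (1 - T) * ((1 + T) / (1 - T)) ^ (\<alpha> $ i))) *
      (LINT x|lborel. F (Rn_to_Cn x) * Phi \<alpha> x)"
    unfolding pairing_eq[OF F(1) T int] by (simp only: of_real_mult mult.assoc)
  also have "U_const TYPE('n) s * (\<Prod>i\<in>UNIV. sqrt (pi * T) / (1 - T) * ((1 + T) / (1 - T)) ^ (\<alpha> $ i)) = C0 TYPE('n) * exp (2 * Hermite_eigenvalue \<alpha> * s)"
    unfolding T_def by (rule transform_constant[OF s])
  finally show ?thesis unfolding ip_def cnj_Phi .
qed

lemma integrable_gauss_Cn:
  assumes a: "a > 0"
  shows "integrable lborel (\<lambda>z :: complex ^ 'n. (1 + norm z) ^ k * exp (- a * (norm z)\<^sup>2))"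
proof -
  obtain C where C: "C > 0" "\<And>r. r \<ge> 0 \<Longrightarrow> (1 + r) ^ k \<le> C * exp ((a/2) * r\<^sup>2)"
    using pow_le_gauss[of "a/2" k] a by auto
  have "integrable lborel (\<lambda>z :: complex ^ 'n. exp (- (a/2) * (norm z)\<^sup>2))"
  proof -
    have m: "(\<lambda>z :: complex ^ 'n. exp (- (a/2) * (norm z)\<^sup>2)) \<in> borel_measurable borel" by measurable
    have e: "(\<lambda>p. exp (- (a/2) * (norm (case p of (x, y) \<Rightarrow> cvec x y))\<^sup>2)) = (\<lambda>p :: (real ^ 'n) \<times> (real ^ 'n). exp (- (a/2) * (norm (fst p))\<^sup>2) * exp (- (a/2) * (norm (snd p))\<^sup>2))"
      by (auto simp: fun_eq_iff norm_sq_eq exp_add[symmetric] algebra_simps)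
    show ?thesis
      unfolding lborel_complex_vec integrable_distr_eq[OF cvec_measurable m] e by (rule integrable_gauss_pair) (use a in simp)
  qed
  then have "integrable lborel (\<lambda>z :: complex ^ 'n. C * exp (- (a/2) * (norm z)\<^sup>2))" by (rule integrable_mult_right)
  then show ?thesis
  proof (rule Bochner_Integration.integrable_bound)
    show "AE z in lborel. norm ((1 + norm (z :: complex ^ 'n)) ^ k * exp (- a * (norm z)\<^sup>2)) \<le> norm (C * exp (- (a/2) * (norm z)\<^sup>2))"
    proof (rule AE_I2)
      fix z :: "complex ^ 'n"
      have "(1 + norm z) ^ k * exp (- a * (norm z)\<^sup>2) \<le> C * exp ((a/2) * (norm z)\<^sup>2) * exp (- a * (norm z)\<^sup>2)"
        by (intro mult_right_mono C) auto
      also have "\<dots> = C * exp (- (a/2) * (norm z)\<^sup>2)" by (simp add: exp_add[symmetric])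
      finally show "norm ((1 + norm z) ^ k * exp (- a * (norm z)\<^sup>2)) \<le> norm (C * exp (- (a/2) * (norm z)\<^sup>2))"
        using C(1) by simp
    qed
  qed measurable
qed

lemma Phi_c_gw_bound:
  fixes \<alpha> :: "nat ^ 'n"
  assumes T: "0 < T" "T < 1"
  obtains C a where "C > 0" "a > 0" "\<And>z. (norm (Phi_c \<alpha> z))\<^sup>2 * gw T z \<le> C * exp (- a * (norm z)\<^sup>2)"
proof -
  define \<delta> where "\<delta> = (1 - T) / 4"
  have \<delta>: "\<delta> > 0" using T by (simp add: \<delta>_def)
  obtain C where C: "C > 0" "\<And>z. norm (Phi_c \<alpha> z) \<le> C * exp (- (1/2 - \<delta>) * sqRe z + (1/2 + \<delta>) * sqIm z)"
    using Phi_c_bound[OF \<delta>] by blast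
  have T2: "1 / T - 1 \<ge> 1 - T"
  proof -
    have "0 \<le> (1 - T)\<^sup>2 / T" using T by simp
    also have "\<dots> = (1 / T - 1) - (1 - T)" using T by (simp add: field_simps power2_eq_square)
    finally show ?thesis by simp
  qed
  show ?thesis
  proof
    show "C\<^sup>2 > 0" "2 * \<delta> > 0" using C \<delta> by auto
    fix z
    have "(norm (Phi_c \<alpha> z))\<^sup>2 * gw T z \<le> (C * exp (- (1/2 - \<delta>) * sqRe z + (1/2 + \<delta>) * sqIm z))\<^sup>2 * exp (T * sqRe z - sqIm z / T)"
      unfolding gw_eq by (intro mult_right_mono power_mono C) auto
    also have "\<dots> = C\<^sup>2 * exp (2 * (- (1/2 - \<delta>) * sqRe z + (1/2 + \<delta>) * sqIm z) + (T * sqRe z - sqIm z / T))"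
      by (simp only: power_mult_distrib exp_double exp_add[of "2 * _"] mult.assoc)
    also have "\<dots> \<le> C\<^sup>2 * exp (- (2 * \<delta>) * (norm z)\<^sup>2)"
    proof (intro mult_left_mono iffD2[OF exp_le_cancel_iff])
      have e: "2 * (- (1/2 - \<delta>) * sqRe z + (1/2 + \<delta>) * sqIm z) + (T * sqRe z - sqIm z / T) = - (2 * \<delta>) * sqRe z + - (1 / T - 1 - 2 * \<delta>) * sqIm z"
        by (simp add: \<delta>_def field_simps)
      have "- (1 / T - 1 - 2 * \<delta>) * sqIm z \<le> - (2 * \<delta>) * sqIm z"
      proof (intro mult_right_mono sqIm_nonneg)
        have "4 * \<delta> = 1 - T" by (simp add: \<delta>_def)
        then show "- (1 / T - 1 - 2 * \<delta>) \<le> - (2 * \<delta>)" using T2 by linarith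
      qed
      then show "2 * (- (1/2 - \<delta>) * sqRe z + (1/2 + \<delta>) * sqIm z) + (T * sqRe z - sqIm z / T) \<le> - (2 * \<delta>) * (norm z)\<^sup>2"
        unfolding e norm_sq_eq by (simp add: algebra_simps)
    qed simp
    finally show "(norm (Phi_c \<alpha> z))\<^sup>2 * gw T z \<le> C\<^sup>2 * exp (- (2 * \<delta>) * (norm z)\<^sup>2)" .
  qed
qed

lemma Phi_c_weighted_integrable:
  assumes T: "0 < T" "T < 1"
  shows "integrable lborel (\<lambda>z. (1 + norm z) ^ k * ((norm (Phi_c \<alpha> z))\<^sup>2 * gw T z))"
proof -
  obtain C a where C: "C > 0" "a > 0" "\<And>z. (norm (Phi_c \<alpha> z))\<^sup>2 * gw T z \<le> C * exp (- a * (norm z)\<^sup>2)"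
    using Phi_c_gw_bound[OF T] by blast
  have [measurable]: "Phi_c \<alpha> \<in> borel_measurable borel" by (rule entire_measurable[OF entire_Phi_c])
  show ?thesis
  proof (rule Bochner_Integration.integrable_bound)
    show "integrable lborel (\<lambda>z :: complex ^ 'a. C * ((1 + norm z) ^ k * exp (- a * (norm z)\<^sup>2)))"
      by (intro integrable_mult_right integrable_gauss_Cn C)
    show "AE z in lborel. norm ((1 + norm z) ^ k * ((norm (Phi_c \<alpha> z))\<^sup>2 * gw T z)) \<le> norm (C * ((1 + norm z) ^ k * exp (- a * (norm z)\<^sup>2)))"
    proof (rule AE_I2)
      fix z
      have "(1 + norm z) ^ k * ((norm (Phi_c \<alpha> z))\<^sup>2 * gw T z) \<le> (1 + norm z) ^ k * (C * exp (- a * (norm z)\<^sup>2))"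
        by (intro mult_left_mono C) auto
      then show "norm ((1 + norm z) ^ k * ((norm (Phi_c \<alpha> z))\<^sup>2 * gw T z)) \<le> norm (C * ((1 + norm z) ^ k * exp (- a * (norm z)\<^sup>2)))"
        using C gw_pos[of T z] by (simp add: mult_ac)
    qed
  qed measurable
qed

lemma L2_MU_Phi_c: "s > 0 \<Longrightarrow> L2 (MU s) (Phi_c \<alpha>)"
  unfolding L2_MU[OF _ entire_Phi_c] using Phi_c_weighted_integrable[of "tanh (2 * s)" 0 \<alpha>] tanh_2_bounds by simp

lemma orthonormal_Phi_c:
  assumes s: "s > 0"
  shows "orthonormal (MU s) (\<lambda>\<alpha> z. complex_of_real (1 / sqrt (C0 TYPE('n) * exp (2 * Hermite_eigenvalue \<alpha> * s))) * Phi_c (\<alpha> :: nat ^ 'n) z)"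
proof (rule orthonormal_scale)
  show "L2 (MU s) (Phi_c \<alpha>)" for \<alpha> :: "nat ^ 'n" by (rule L2_MU_Phi_c[OF s])
  show "C0 TYPE('n) * exp (2 * Hermite_eigenvalue \<alpha> * s) > 0" for \<alpha> :: "nat ^ 'n" by (simp add: C0_pos)
  show "ip (MU s) (Phi_c \<alpha>) (Phi_c \<beta>) = (if \<alpha> = \<beta> then complex_of_real (C0 TYPE('n) * exp (2 * Hermite_eigenvalue \<alpha> * s)) else 0)" for \<alpha> \<beta> :: "nat ^ 'n"
    unfolding ip_MU_Phi_c[OF s entire_Phi_c L2_MU_Phi_c[OF s]] Phi_c_Rn orthonormal.ortho[OF orthonormal_Phi] by simp
qed

lemma continuous_on_restrict:
  assumes "entire_Cn F" shows "continuous_on UNIV (\<lambda>x. F (Rn_to_Cn x))"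
  using continuous_on_compose[OF continuous_on_Rn_to_Cn[OF continuous_on_id, of UNIV], of F] entire_continuous[OF assms]
  by (simp add: o_def continuous_on_subset)

lemma measurable_restrict:
  assumes "entire_Cn F" shows "(\<lambda>x. F (Rn_to_Cn x)) \<in> borel_measurable lborel"
  using borel_measurable_continuous_onI[OF continuous_on_restrict[OF assms]] by simp

section \<open>Heat series with square summable coefficients\<close>

lemma l2_bounded:
  fixes a :: "'i \<Rightarrow> complex"
  assumes "(\<lambda>i. (norm (a i))\<^sup>2) summable_on UNIV"
  obtains A where "\<And>i. norm (a i) \<le> A"
proof
  fix i
  have "(norm (a i))\<^sup>2 = (\<Sum>\<^sub>\<infinity>j\<in>{i}. (norm (a j))\<^sup>2)" by simp
  also have "\<dots> \<le> (\<Sum>\<^sub>\<infinity>j. (norm (a j))\<^sup>2)"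
    using assms by (intro infsum_mono_neutral) auto
  finally show "norm (a i) \<le> sqrt (\<Sum>\<^sub>\<infinity>j. (norm (a j))\<^sup>2)" by (rule real_le_rsqrt)
qed

lemma l2_scale_le:
  fixes a :: "'i \<Rightarrow> complex"
  assumes a: "(\<lambda>i. (norm (a i))\<^sup>2) summable_on UNIV" and r: "\<And>i. 0 \<le> r i" "\<And>i. r i \<le> 1"
  shows "(\<lambda>i. (norm (a i * complex_of_real (r i)))\<^sup>2) summable_on UNIV"
proof (rule summable_on_comparison_test[OF a])
  fix i
  have "(r i)\<^sup>2 \<le> 1" using r[of i] by (simp add: power_le_one)
  then have "(norm (a i))\<^sup>2 * (r i)\<^sup>2 \<le> (norm (a i))\<^sup>2 * 1" by (intro mult_left_mono) auto
  then show "(norm (a i * complex_of_real (r i)))\<^sup>2 \<le> (norm (a i))\<^sup>2" by (simp add: norm_mult power_mult_distrib)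
qed auto

text \<open>The link between Riesz-Fischer and pointwise sums: wherever a subsequence of the partial
  sums converges, its limit is the value of the entire series. It serves real and complex arguments
  alike.\<close>

lemma heat_AE_eq:
  fixes a :: "nat ^ 'n \<Rightarrow> complex"
  assumes t: "t > 0" and a: "(\<lambda>\<alpha>. (norm (a \<alpha>))\<^sup>2) summable_on UNIV" and N: "strict_mono N"
    and lim: "(\<lambda>k. \<Sum>\<alpha>\<in>initial_set (N k). heat_term t a \<alpha> z) \<longlonglongrightarrow> w"
  shows "w = heat t a z"
proof -
  obtain A where A: "\<And>\<alpha>. norm (a \<alpha>) \<le> A" using l2_bounded[OF a] by blast
  have "(\<lambda>k. \<Sum>\<alpha>\<in>initial_set k. heat_term t a \<alpha> z) \<longlonglongrightarrow> heat t a z"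
    by (rule has_sum_initial_set[OF heat_has_sum[OF t A]])
  from LIMSEQ_subseq_LIMSEQ[OF this N] have "(\<lambda>k. \<Sum>\<alpha>\<in>initial_set (N k). heat_term t a \<alpha> z) \<longlonglongrightarrow> heat t a z"
    by (simp add: o_def)
  with lim show ?thesis by (rule LIMSEQ_unique)
qed

text \<open>Pointwise convergence alone does not give the coefficients of the restriction.
  Riesz-Fischer supplies an element with the right coefficients, and by almost everywhere
  convergence it agrees with the series.\<close>

lemma
  fixes a :: "nat ^ 'n \<Rightarrow> complex"
  assumes t: "t > 0" and a: "(\<lambda>\<alpha>. (norm (a \<alpha>))\<^sup>2) summable_on UNIV"
  shows heat_entire: "entire_Cn (heat t a)"
    and heat_L2: "L2 lborel (\<lambda>x. heat t a (Rn_to_Cn x))"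
    and heat_coeff: "ip lborel (\<lambda>x. heat t a (Rn_to_Cn x)) (Phi \<alpha>) = a \<alpha> * complex_of_real (exp (- (Hermite_eigenvalue \<alpha> * t)))"
proof -
  define c where "c \<alpha> = a \<alpha> * complex_of_real (exp (- (Hermite_eigenvalue \<alpha> * t)))" for \<alpha>
  have c: "(\<lambda>\<alpha>. (norm (c \<alpha>))\<^sup>2) summable_on UNIV"
    unfolding c_def
  proof (rule l2_scale_le[OF a])
    fix \<alpha> :: "nat ^ 'n"
    have "Hermite_eigenvalue \<alpha> * t \<ge> 0" using t eigenvalue_ge_1[of \<alpha>] by simp
    then show "exp (- (Hermite_eigenvalue \<alpha> * t)) \<le> 1" by simp
  qed auto
  obtain A where A: "\<And>\<alpha>. norm (a \<alpha>) \<le> A" using l2_bounded[OF a] by blast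
  show H: "entire_Cn (heat t a)" by (rule entire_heat[OF t A])
  obtain f N where f: "L2 lborel f" "\<And>\<alpha>. ip lborel f (Phi \<alpha>) = c \<alpha>" and "nsq lborel f = (\<Sum>\<^sub>\<infinity>\<alpha>. (norm (c \<alpha>))\<^sup>2)"
    and N: "strict_mono N" and ae: "AE x in lborel. (\<lambda>k. \<Sum>\<alpha>\<in>initial_set (N k). c \<alpha> * Phi \<alpha> x) \<longlonglongrightarrow> f x"
    by (rule Riesz_Fischer[OF orthonormal_Phi c]) (rule that, assumption, blast, assumption+)
  have eq: "AE x in lborel. f x = heat t a (Rn_to_Cn x)"
    using ae
  proof eventually_elim
    case (elim x)
    show ?case by (rule heat_AE_eq[OF t a N]) (use elim in \<open>simp add: heat_term_def Phi_c_Rn c_def\<close>)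
  qed
  have m: "(\<lambda>x. heat t a (Rn_to_Cn x)) \<in> borel_measurable lborel"
    by (rule measurable_restrict[OF H])
  have fm: "f \<in> borel_measurable lborel" using f(1) by (rule L2_measurable)
  have i: "integrable lborel (\<lambda>x. (norm (heat t a (Rn_to_Cn x)))\<^sup>2)"
    using L2_integrable[OF f(1)]
  proof (rule Bochner_Integration.integrable_cong_AE_imp)
    show "AE x in lborel. (norm (f x))\<^sup>2 = (norm (heat t a (Rn_to_Cn x)))\<^sup>2" using eq by eventually_elim simp
  qed (use m in measurable)
  then show "L2 lborel (\<lambda>x. heat t a (Rn_to_Cn x))" using m by (simp add: L2_def)
  have pm: "(\<lambda>x. cnj (Phi \<alpha> x)) \<in> borel_measurable lborel" unfolding cnj_Phi using L2_measurable[OF L2_Phi] .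
  have "ip lborel (\<lambda>x. heat t a (Rn_to_Cn x)) (Phi \<alpha>) = ip lborel f (Phi \<alpha>)"
    unfolding ip_def
  proof (rule integral_cong_AE)
    show "AE x in lborel. heat t a (Rn_to_Cn x) * cnj (Phi \<alpha> x) = f x * cnj (Phi \<alpha> x)" using eq by eventually_elim simp
  qed (use m fm pm in measurable)
  then show "ip lborel (\<lambda>x. heat t a (Rn_to_Cn x)) (Phi \<alpha>) = a \<alpha> * complex_of_real (exp (- (Hermite_eigenvalue \<alpha> * t)))"
    by (simp only: f(2) c_def)
qed

lemma sqRe_Rn [simp]: "sqRe (Rn_to_Cn x) = (norm x)\<^sup>2" "sqIm (Rn_to_Cn x) = 0"
  by (simp_all add: Rn_to_Cn_cvec)

lemma L2_MU_restrict:
  fixes F :: "complex ^ 'n \<Rightarrow> complex"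
  assumes s: "s > 0" and F: "entire_Cn F" "L2 (MU s) F"
  shows "L2 lborel (\<lambda>x. F (Rn_to_Cn x))"
proof -
  define T where "T = tanh (2 * s)"
  have T: "0 < T" "T < 1" using tanh_2_bounds[OF s] by (auto simp: T_def)
  have int: "integrable lborel (\<lambda>z. (norm (F z))\<^sup>2 * gw T z)" using F(2) unfolding L2_MU[OF s F(1)] T_def .
  obtain C where C: "\<And>F :: complex ^ 'n \<Rightarrow> complex. \<And>z. entire_Cn F \<Longrightarrow> integrable lborel (\<lambda>z. (norm (F z))\<^sup>2 * gw T z) \<Longrightarrow>
       (norm (F z))\<^sup>2 * gw T z \<le> C * (LINT z|lborel. (norm (F z))\<^sup>2 * gw T z)"
    by (rule entire_gw_bound[OF T, where 'n = 'n]) (rule that)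
  define B where "B = C * (LINT z|lborel. (norm (F z))\<^sup>2 * gw T z)"
  have B: "(norm (F z))\<^sup>2 * gw T z \<le> B" for z unfolding B_def by (rule C[OF F(1) int])
  have m: "(\<lambda>x. F (Rn_to_Cn x)) \<in> borel_measurable lborel"
    by (rule measurable_restrict[OF F(1)])
  have "integrable lborel (\<lambda>x. (norm (F (Rn_to_Cn x)))\<^sup>2)"
  proof (rule Bochner_Integration.integrable_bound)
    show "integrable lborel (\<lambda>x :: real ^ 'n. B * exp (- T * (norm x)\<^sup>2))"
      using integrable_gauss_vec[of T] T by (intro integrable_mult_right) simp
    show "AE x in lborel. norm ((norm (F (Rn_to_Cn x)))\<^sup>2) \<le> norm (B * exp (- T * (norm x)\<^sup>2))"
    proof (rule AE_I2)
      fix x :: "real ^ 'n"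
      have "(norm (F (Rn_to_Cn x)))\<^sup>2 = (norm (F (Rn_to_Cn x)))\<^sup>2 * gw T (Rn_to_Cn x) * exp (- T * (norm x)\<^sup>2)"
        by (simp add: gw_eq mult.assoc exp_add[symmetric])
      also have "\<dots> \<le> B * exp (- T * (norm x)\<^sup>2)" by (intro mult_right_mono B) simp
      finally show "norm ((norm (F (Rn_to_Cn x)))\<^sup>2) \<le> norm (B * exp (- T * (norm x)\<^sup>2))" by simp
    qed
  qed (use m in measurable)
  then show ?thesis using m by (simp add: L2_def)
qed

lemma gw_mono:
  assumes "0 < S" "S \<le> T" shows "gw S z \<le> gw T z"
proof -
  have "S * sqRe z \<le> T * sqRe z" using assms by (intro mult_right_mono sqRe_nonneg)
  moreover have "sqIm z / T \<le> sqIm z / S" using assms by (intro divide_left_mono sqIm_nonneg) auto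
  ultimately show ?thesis unfolding gw_eq by simp
qed

text \<open>In \<open>s\<close> the exponential grows while the prefactor decreases; a ratio of
  prefactors compensates the latter, so the weight at the end point \<open>t\<close> dominates
  uniformly.\<close>

lemma weight_U_le:
  fixes z :: "complex ^ 'n"
  assumes s: "0 < s0" "s0 \<le> s" "s \<le> t"
  shows "weight_U s z \<le> U_const TYPE('n) s0 / U_const TYPE('n) t * weight_U t z"
proof -
  have "gw (tanh (2 * s)) z \<le> gw (tanh (2 * t)) z" using s by (intro gw_mono) (auto simp: tanh_real_le_iff)
  moreover have "U_const TYPE('n) s \<le> U_const TYPE('n) s0"
    unfolding U_const_def using s by (intro mult_left_mono powr_mono2') auto
  ultimately have "weight_U s z \<le> U_const TYPE('n) s0 * gw (tanh (2 * t)) z"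
    unfolding weight_U_gw using s U_const_pos[of s0, where 'n = 'n] gw_pos[of _ z] by (intro mult_mono) (auto intro: less_imp_le)
  then show ?thesis using s U_const_pos[of t, where 'n = 'n] by (simp add: weight_U_gw)
qed

lemma L2_MU_mono:
  fixes F :: "complex ^ 'n \<Rightarrow> complex"
  assumes s: "0 < s" "s \<le> t" and F: "entire_Cn F" "L2 (MU t) F"
  shows "L2 (MU s) F"
proof -
  have t: "t > 0" using s by simp
  have [measurable]: "F \<in> borel_measurable borel" by (rule entire_measurable[OF F(1)])
  show ?thesis unfolding L2_MU[OF s(1) F(1)]
  proof (rule Bochner_Integration.integrable_bound)
    show "integrable lborel (\<lambda>z. (norm (F z))\<^sup>2 * gw (tanh (2 * t)) z)" using F(2) unfolding L2_MU[OF t F(1)] .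
    show "AE z in lborel. norm ((norm (F z))\<^sup>2 * gw (tanh (2 * s)) z) \<le> norm ((norm (F z))\<^sup>2 * gw (tanh (2 * t)) z)"
    proof (rule AE_I2)
      fix z :: "complex ^ 'n"
      have "gw (tanh (2 * s)) z \<le> gw (tanh (2 * t)) z" using s by (intro gw_mono) (auto simp: tanh_real_le_iff)
      then have "(norm (F z))\<^sup>2 * gw (tanh (2 * s)) z \<le> (norm (F z))\<^sup>2 * gw (tanh (2 * t)) z" by (intro mult_left_mono) auto
      then show "norm ((norm (F z))\<^sup>2 * gw (tanh (2 * s)) z) \<le> norm ((norm (F z))\<^sup>2 * gw (tanh (2 * t)) z)"
        using gw_pos[of _ z] by (simp add: abs_mult less_imp_le)
    qed
  qed measurable
qed

text \<open>Bessel's inequality in the weighted space, where the normalised coefficient of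
  \<open>F\<close> is \<open>sqrt (N \<alpha>)\<close> times its coefficient on the real
  side.\<close>

lemma L2_MU_Bessel:
  fixes F :: "complex ^ 'n \<Rightarrow> complex"
  assumes s: "s > 0" and F: "entire_Cn F" "L2 (MU s) F"
  defines "b \<equiv> \<lambda>\<alpha>. ip lborel (\<lambda>x. F (Rn_to_Cn x)) (Phi \<alpha>)"
  shows "(\<lambda>\<alpha>. (norm (b \<alpha> * complex_of_real (exp (Hermite_eigenvalue \<alpha> * s))))\<^sup>2) summable_on UNIV"
proof -
  define N where "N \<alpha> = C0 TYPE('n) * exp (2 * Hermite_eigenvalue \<alpha> * s)" for \<alpha> :: "nat ^ 'n"
  have N: "N \<alpha> > 0" for \<alpha> by (simp add: N_def C0_pos)
  define \<psi> where "\<psi> = (\<lambda>(\<alpha> :: nat ^ 'n) z. complex_of_real (1 / sqrt (N \<alpha>)) * Phi_c \<alpha> z)"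
  interpret orthonormal "MU s" \<psi> unfolding \<psi>_def N_def by (rule orthonormal_Phi_c[OF s])
  have ip: "(norm (ip (MU s) F (\<psi> \<alpha>)))\<^sup>2 = N \<alpha> * (norm (b \<alpha>))\<^sup>2" for \<alpha>
  proof -
    have "ip (MU s) F (\<psi> \<alpha>) = cnj (complex_of_real (1 / sqrt (N \<alpha>)) * cnj (ip (MU s) F (Phi_c \<alpha>)))"
      unfolding ip_cnj \<psi>_def ip_scale[symmetric] ..
    also have "\<dots> = complex_of_real (1 / sqrt (N \<alpha>) * N \<alpha>) * b \<alpha>"
      unfolding ip_MU_Phi_c[OF s F] b_def N_def[symmetric] by simp
    also have "1 / sqrt (N \<alpha>) * N \<alpha> = sqrt (N \<alpha>)" using N[of \<alpha>] by (simp add: real_div_sqrt)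
    finally show ?thesis using N[of \<alpha>] by (simp add: norm_mult power_mult_distrib)
  qed
  have "(\<lambda>\<alpha>. N \<alpha> * (norm (b \<alpha>))\<^sup>2) summable_on UNIV"
  proof (rule nonneg_bounded_partial_sums_imp_summable_on)
    show "\<forall>\<^sub>F A in finite_subsets_at_top UNIV. (\<Sum>\<alpha>\<in>A. N \<alpha> * (norm (b \<alpha>))\<^sup>2) \<le> nsq (MU s) F"
      using Bessel[OF F(2)] unfolding ip by (intro eventually_finite_subsets_at_top_weakI)
  qed (use N in \<open>auto simp: less_imp_le\<close>)
  then have "(\<lambda>\<alpha>. 1 / C0 TYPE('n) * (N \<alpha> * (norm (b \<alpha>))\<^sup>2)) summable_on UNIV" by (rule summable_on_cmult_right)
  moreover have "1 / C0 TYPE('n) * (N \<alpha> * (norm (b \<alpha>))\<^sup>2) = (norm (b \<alpha> * complex_of_real (exp (Hermite_eigenvalue \<alpha> * s))))\<^sup>2" for \<alpha>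
  proof -
    have "exp (2 * Hermite_eigenvalue \<alpha> * s) = (exp (Hermite_eigenvalue \<alpha> * s))\<^sup>2" by (simp only: exp_double mult.assoc)
    then show ?thesis using C0_pos[where 'n = 'n] by (simp add: N_def norm_mult power_mult_distrib)
  qed
  ultimately show ?thesis by simp
qed

lemma Hermite_coeff_eq_imp_AE:
  fixes f g :: "real ^ 'n \<Rightarrow> complex"
  assumes "L2 lborel f" "L2 lborel g" "\<And>\<alpha>. ip lborel f (Phi \<alpha>) = ip lborel g (Phi \<alpha>)"
  shows "AE x in lborel. f x = g x"
proof -
  have "AE x in lborel. f x - g x = 0"
    by (rule Hermite_complete) (use assms in \<open>simp_all add: L2_minus ip_minus L2_Phi\<close>)
  then show ?thesis by simp
qed

lemma entire_eq_coeff: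
  fixes F G :: "complex ^ 'n \<Rightarrow> complex"
  assumes F: "entire_Cn F" "L2 lborel (\<lambda>x. F (Rn_to_Cn x))" and G: "entire_Cn G" "L2 lborel (\<lambda>x. G (Rn_to_Cn x))"
    and eq: "\<And>\<alpha>. ip lborel (\<lambda>x. F (Rn_to_Cn x)) (Phi \<alpha>) = ip lborel (\<lambda>x. G (Rn_to_Cn x)) (Phi \<alpha>)"
  shows "F = G"
proof (rule entire_eq_on_Rn[OF F(1) G(1)])
  have "(\<lambda>x. F (Rn_to_Cn x)) = (\<lambda>x. G (Rn_to_Cn x))"
    by (rule continuous_AE_eq[OF continuous_on_restrict[OF F(1)] continuous_on_restrict[OF G(1)] Hermite_coeff_eq_imp_AE[OF F(2) G(2) eq]])
  then show "F (Rn_to_Cn x) = G (Rn_to_Cn x)" for x by (rule fun_cong)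
qed

text \<open>Completeness on the weighted side is borrowed from the real side. \<open>F\<close> and
  the heat series have the same coefficients on real arguments and are therefore equal as entire
  functions; the element built by Riesz-Fischer in \<open>MU s\<close> has the asserted norm and
  agrees almost everywhere with the heat series, hence with \<open>F\<close>.\<close>

lemma
  fixes F :: "complex ^ 'n \<Rightarrow> complex"
  assumes t: "t > 0" and F: "entire_Cn F" "L2 (MU t) F"
  defines "b \<equiv> \<lambda>\<alpha>. ip lborel (\<lambda>x. F (Rn_to_Cn x)) (Phi \<alpha>)"
  shows L2_MU_heat: "F = heat t (\<lambda>\<alpha>. b \<alpha> * complex_of_real (exp (Hermite_eigenvalue \<alpha> * t)))" (is "F = heat t ?a")
    and L2_MU_Parseval: "0 < s \<Longrightarrow> s \<le> t \<Longrightarrow>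
      nsq (MU s) F = C0 TYPE('n) * (\<Sum>\<^sub>\<infinity>\<alpha>. (norm (b \<alpha> * complex_of_real (exp (Hermite_eigenvalue \<alpha> * s))))\<^sup>2)"
proof -
  have a: "(\<lambda>\<alpha>. (norm (?a \<alpha>))\<^sup>2) summable_on UNIV" unfolding b_def by (rule L2_MU_Bessel[OF t F])
  show Fh: "F = heat t ?a"
  proof (rule entire_eq_coeff[OF F(1) L2_MU_restrict[OF t F] heat_entire[OF t a] heat_L2[OF t a]])
    fix \<alpha> :: "nat ^ 'n"
    have "exp (Hermite_eigenvalue \<alpha> * t) * exp (- (Hermite_eigenvalue \<alpha> * t)) = 1" by (simp add: exp_add[symmetric])
    then show "ip lborel (\<lambda>x. F (Rn_to_Cn x)) (Phi \<alpha>) = ip lborel (\<lambda>x. heat t ?a (Rn_to_Cn x)) (Phi \<alpha>)"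
      unfolding heat_coeff[OF t a] mult.assoc of_real_mult[symmetric] by (simp add: b_def)
  qed
  assume s: "0 < s" "s \<le> t"
  have Fs: "L2 (MU s) F" by (rule L2_MU_mono[OF s F])
  define N where "N \<alpha> = C0 TYPE('n) * exp (2 * Hermite_eigenvalue \<alpha> * s)" for \<alpha> :: "nat ^ 'n"
  have N: "N \<alpha> > 0" for \<alpha> by (simp add: N_def C0_pos)
  define \<psi> where "\<psi> = (\<lambda>(\<alpha> :: nat ^ 'n) z. complex_of_real (1 / sqrt (N \<alpha>)) * Phi_c \<alpha> z)"
  define c where "c \<alpha> = complex_of_real (sqrt (N \<alpha>)) * b \<alpha>" for \<alpha>
  have csq: "(norm (c \<alpha>))\<^sup>2 = C0 TYPE('n) * (norm (b \<alpha> * complex_of_real (exp (Hermite_eigenvalue \<alpha> * s))))\<^sup>2" for \<alpha>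
  proof -
    have "exp (2 * Hermite_eigenvalue \<alpha> * s) = (exp (Hermite_eigenvalue \<alpha> * s))\<^sup>2" by (simp only: exp_double mult.assoc)
    then show ?thesis using C0_pos[where 'n = 'n] N[of \<alpha>] unfolding c_def norm_mult power_mult_distrib by (simp add: N_def)
  qed
  have "(\<lambda>\<alpha>. (norm (c \<alpha>))\<^sup>2) summable_on UNIV"
    unfolding csq by (intro summable_on_cmult_right) (unfold b_def, rule L2_MU_Bessel[OF s(1) F(1) Fs])
  note csum = this
  interpret orthonormal "MU s" \<psi> unfolding \<psi>_def N_def by (rule orthonormal_Phi_c[OF s(1)])
  obtain f M where f: "L2 (MU s) f" and "\<And>\<alpha>. ip (MU s) f (\<psi> \<alpha>) = c \<alpha>" and f2: "nsq (MU s) f = (\<Sum>\<^sub>\<infinity>\<alpha>. (norm (c \<alpha>))\<^sup>2)" and M: "strict_mono M"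
    and ae: "AE z in MU s. (\<lambda>k. \<Sum>\<alpha>\<in>initial_set (M k). c \<alpha> * \<psi> \<alpha> z) \<longlonglongrightarrow> f z"
    by (rule Riesz_Fischer[OF orthonormal_axioms csum]) (rule that, assumption, blast, assumption+)
  have term_eq: "c \<alpha> * \<psi> \<alpha> z = heat_term t ?a \<alpha> z" for \<alpha> z
  proof -
    have "c \<alpha> * \<psi> \<alpha> z = complex_of_real (sqrt (N \<alpha>) * (1 / sqrt (N \<alpha>))) * (b \<alpha> * Phi_c \<alpha> z)"
      by (simp add: c_def \<psi>_def)
    also have "sqrt (N \<alpha>) * (1 / sqrt (N \<alpha>)) = exp (Hermite_eigenvalue \<alpha> * t) * exp (- (Hermite_eigenvalue \<alpha> * t))"
      using N[of \<alpha>] by (simp add: exp_add[symmetric])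
    finally show ?thesis by (simp only: heat_term_def of_real_mult mult_ac)
  qed
  have eq: "AE z in MU s. f z = F z"
    using ae
  proof eventually_elim
    case (elim z)
    have "f z = heat t ?a z" by (rule heat_AE_eq[OF t a M]) (use elim in \<open>simp only: term_eq\<close>)
    then show ?case using Fh by simp
  qed
  have "nsq (MU s) F = nsq (MU s) f"
  proof (rule integral_cong_AE)
    show "AE z in MU s. (norm (F z))\<^sup>2 = (norm (f z))\<^sup>2" using eq by eventually_elim simp
  qed (use L2_measurable[OF Fs] L2_measurable[OF f] in measurable)
  then show "nsq (MU s) F = C0 TYPE('n) * (\<Sum>\<^sub>\<infinity>\<alpha>. (norm (b \<alpha> * complex_of_real (exp (Hermite_eigenvalue \<alpha> * s))))\<^sup>2)"
    unfolding f2 csq by (simp add: infsum_cmult_right')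
qed

subsection \<open>Differentiating the Parseval identity\<close>

text \<open>Stated for an arbitrary measure because it differentiates both sides of the Parseval
  identity: the integral over complex vectors, and the series read as an integral over a counting
  measure.\<close>

lemma integral_has_real_derivative:
  fixes f :: "real \<Rightarrow> 'a \<Rightarrow> real"
  assumes d: "\<And>s x. s \<in> {l<..<u} \<Longrightarrow> x \<in> space M \<Longrightarrow> ((\<lambda>s. f s x) has_real_derivative f' s x) (at s)"
    and m: "\<And>s. s \<in> {l<..<u} \<Longrightarrow> f s \<in> borel_measurable M" "\<And>s. s \<in> {l<..<u} \<Longrightarrow> f' s \<in> borel_measurable M"
    and b: "\<And>s x. s \<in> {l<..<u} \<Longrightarrow> x \<in> space M \<Longrightarrow> \<bar>f s x\<bar> \<le> w x" "\<And>s x. s \<in> {l<..<u} \<Longrightarrow> x \<in> space M \<Longrightarrow> \<bar>f' s x\<bar> \<le> w x"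
    and w: "integrable M w" and s: "s \<in> {l<..<u}"
  shows "((\<lambda>s. LINT x|M. f s x) has_real_derivative (LINT x|M. f' s x)) (at s)"
proof -
  have int: "integrable M (f r)" if "r \<in> {l<..<u}" for r
    by (rule Bochner_Integration.integrable_bound[OF w m(1)[OF that]]) (intro AE_I2, use b(1)[OF that] in force)
  have "((\<lambda>y. ((LINT x|M. f y x) - (LINT x|M. f s x)) / (y - s)) \<longlongrightarrow> (LINT x|M. f' s x)) (at s within {l<..<u})"
    unfolding tendsto_at_iff_sequentially
  proof (intro allI impI)
    fix X assume X: "\<forall>i. X i \<in> {l<..<u} - {s}" and lim: "X \<longlonglongrightarrow> s"
    have "(\<lambda>i. LINT x|M. (f (X i) x - f s x) / (X i - s)) \<longlonglongrightarrow> (LINT x|M. f' s x)"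
    proof (rule integral_dominated_convergence[OF m(2)[OF s] _ w])
      show "(\<lambda>x. (f (X i) x - f s x) / (X i - s)) \<in> borel_measurable M" for i
        using m(1)[of "X i"] m(1)[OF s] X by simp
      show "AE x in M. (\<lambda>i. (f (X i) x - f s x) / (X i - s)) \<longlonglongrightarrow> f' s x"
      proof (rule AE_I2)
        fix x assume "x \<in> space M"
        from d[OF s this] have "((\<lambda>y. (f y x - f s x) / (y - s)) \<longlongrightarrow> f' s x) (at s)"
          by (simp add: has_field_derivative_iff)
        then show "(\<lambda>i. (f (X i) x - f s x) / (X i - s)) \<longlonglongrightarrow> f' s x"
          using X lim unfolding tendsto_at_iff_sequentially o_def by auto
      qed
      show "AE x in M. norm ((f (X i) x - f s x) / (X i - s)) \<le> w x" for i
      proof (rule AE_I2)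
        fix x assume x: "x \<in> space M"
        have "norm (f (X i) x - f s x) \<le> w x * norm (X i - s)"
        proof (rule field_differentiable_bound[of "{l<..<u}" "\<lambda>s. f s x" "\<lambda>s. f' s x"])
          show "((\<lambda>s. f s x) has_real_derivative f' r x) (at r within {l<..<u})" if "r \<in> {l<..<u}" for r
            by (rule has_field_derivative_at_within[OF d[OF that x]])
          show "norm (f' r x) \<le> w x" if "r \<in> {l<..<u}" for r using b(2)[OF that x] by simp
        qed (use X s in auto)
        moreover have "X i - s \<noteq> 0" using X[rule_format, of i] by simp
        ultimately show "norm ((f (X i) x - f s x) / (X i - s)) \<le> w x" by (simp add: norm_divide divide_le_eq abs_divide)
      qed
    qed
    moreover have "(LINT x|M. (f (X i) x - f s x) / (X i - s)) = ((LINT x|M. f (X i) x) - (LINT x|M. f s x)) / (X i - s)" for i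
      using X int[of "X i"] int[OF s] by simp
    ultimately show "((\<lambda>y. ((LINT x|M. f y x) - (LINT x|M. f s x)) / (y - s)) \<circ> X) \<longlonglongrightarrow> (LINT x|M. f' s x)"
      by (simp only: o_def)
  qed
  then show ?thesis using s by (simp add: has_field_derivative_iff at_within_open[OF s])
qed

lemma integral_higher_deriv:
  fixes f :: "nat \<Rightarrow> real \<Rightarrow> 'a \<Rightarrow> real"
  assumes d: "\<And>j s x. j < k \<Longrightarrow> s \<in> {l<..<u} \<Longrightarrow> x \<in> space M \<Longrightarrow> ((\<lambda>s. f j s x) has_real_derivative f (Suc j) s x) (at s)"
    and m: "\<And>j s. j \<le> k \<Longrightarrow> s \<in> {l<..<u} \<Longrightarrow> f j s \<in> borel_measurable M"
    and b: "\<And>j s x. j \<le> k \<Longrightarrow> s \<in> {l<..<u} \<Longrightarrow> x \<in> space M \<Longrightarrow> \<bar>f j s x\<bar> \<le> w x"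
    and w: "integrable M w" and s: "s \<in> {l<..<u}" and j: "j \<le> k"
  shows "(deriv ^^ j) (\<lambda>s. LINT x|M. f 0 s x) s = (LINT x|M. f j s x)"
  using j s
proof (induction j arbitrary: s)
  case (Suc j)
  have "((\<lambda>s. LINT x|M. f j s x) has_real_derivative (LINT x|M. f (Suc j) s x)) (at s)"
    by (rule integral_has_real_derivative[where l = l and u = u and w = w]) (use d m b w Suc in auto)
  then have "((deriv ^^ j) (\<lambda>s. LINT x|M. f 0 s x) has_real_derivative (LINT x|M. f (Suc j) s x)) (at s)"
    by (rule has_field_derivative_transform_within_open[where S = "{l<..<u}"]) (use Suc in auto)
  then show ?case by (simp add: DERIV_imp_deriv)
qed simp

lemma integral_count_space_infsum:
  fixes f :: "'a \<Rightarrow> real"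
  assumes "\<And>x. f x \<ge> 0"
  shows "integrable (count_space UNIV) f \<longleftrightarrow> f summable_on UNIV"
    and "f summable_on UNIV \<Longrightarrow> (LINT x|count_space UNIV. f x) = infsum f UNIV"
proof -
  have 1: "integrable (count_space UNIV) f \<longleftrightarrow> f summable_on UNIV"
    using abs_summable_equivalent[of f UNIV] assms unfolding Infinite_Set_Sum.abs_summable_on_def by simp
  then show "integrable (count_space UNIV) f \<longleftrightarrow> f summable_on UNIV" .
  assume "f summable_on UNIV"
  then show "(LINT x|count_space UNIV. f x) = infsum f UNIV"
    using infsetsum_infsum[of f UNIV] 1 unfolding Infinite_Set_Sum.abs_summable_on_def infsetsum_def by simp
qed

text \<open>From \<open>(1 + y / j) ^ j \<le> exp y\<close>. An arbitrarily small exponential rate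
  \<open>d\<close> absorbs the powers of the eigenvalue that differentiation produces.\<close>

lemma power_le_exp:
  assumes "x \<ge> 0" "d > 0" shows "x ^ j \<le> (real j / d) ^ j * exp (d * x)"
proof (cases "j = 0")
  case False
  have "(d * x / real j) ^ j \<le> (1 + d * x / real j) ^ j" using assms by (intro power_mono) auto
  also have "\<dots> \<le> exp (d * x)" using assms False by (intro exp_ge_one_plus_x_over_n_power_n) (auto intro: order_trans[of _ 0])
  finally have "(real j / d) ^ j * (d * x / real j) ^ j \<le> (real j / d) ^ j * exp (d * x)"
    using assms by (intro mult_left_mono) auto
  moreover have "(real j / d) ^ j * (d * x / real j) ^ j = x ^ j"
    using assms False by (simp add: power_mult_distrib[symmetric])
  ultimately show ?thesis by simp
qed (use assms in simp)

section \<open>Time derivatives of the weight as functions on complex vectors\<close>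

definition dU :: "nat \<Rightarrow> real \<Rightarrow> complex ^ 'n \<Rightarrow> real" where
  "dU k s z = (deriv ^^ k) (\<lambda>s. weight_U s z) s"

lemma dU_0: "dU 0 s z = weight_U s z" by (simp add: dU_def)

lemma dU_deriv:
  assumes "s > 0" shows "((\<lambda>s. dU k s (z :: complex ^ 'n)) has_real_derivative dU (Suc k) s z) (at s)"
proof -
  obtain p :: "real \<Rightarrow> real \<Rightarrow> real \<Rightarrow> real" where
    "\<And>s z. s > 0 \<Longrightarrow> ((deriv ^^ k) (\<lambda>s. weight_U s (z :: complex ^ 'n)) has_real_derivative (deriv ^^ Suc k) (\<lambda>s. weight_U s z) s) (at s)"
    by (rule weight_deriv[of k]) blast
  from this[OF assms] show ?thesis unfolding dU_def[abs_def] .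
qed

lemma dU_measurable [measurable]:
  assumes "s > 0" shows "(dU k s :: complex ^ 'n \<Rightarrow> real) \<in> borel_measurable borel"
proof -
  obtain p :: "real \<Rightarrow> real \<Rightarrow> real \<Rightarrow> real" where
    p: "\<And>s z. s > 0 \<Longrightarrow> (deriv ^^ k) (\<lambda>s. weight_U s (z :: complex ^ 'n)) s = p s (sqRe z) (sqIm z) * weight_U s z"
      "\<And>s. continuous_on UNIV (\<lambda>v. p s (fst v) (snd v))"
    by (rule weight_deriv[of k]) blast
  have c: "continuous_on UNIV (\<lambda>z :: complex ^ 'n. (sqRe z, sqIm z))"
    unfolding sqRe_def sqIm_def by (intro continuous_intros)
  have "continuous_on UNIV (\<lambda>z :: complex ^ 'n. p s (sqRe z) (sqIm z))"
    using continuous_on_compose2[OF p(2) c] by simp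
  from borel_measurable_continuous_onI[OF this]
  have "(\<lambda>z :: complex ^ 'n. p s (sqRe z) (sqIm z) * weight_U s z) \<in> borel_measurable borel"
    by (intro borel_measurable_times weight_U_measurable)
  then show ?thesis unfolding dU_def[abs_def] p(1)[OF assms] .
qed

lemma dU_bound:
  assumes s0: "s0 > 0" and t: "s0 \<le> t"
  obtains C where "C \<ge> 0" "\<And>s z. s0 \<le> s \<Longrightarrow> s \<le> t \<Longrightarrow> \<bar>dU k s (z :: complex ^ 'n)\<bar> \<le> C * ((1 + (norm z)\<^sup>2) ^ k * weight_U t z)"
proof -
  obtain p :: "real \<Rightarrow> real \<Rightarrow> real \<Rightarrow> real" where
    p: "\<And>s z. s > 0 \<Longrightarrow> (deriv ^^ k) (\<lambda>s. weight_U s (z :: complex ^ 'n)) s = p s (sqRe z) (sqIm z) * weight_U s z"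
      "\<And>s0. s0 > 0 \<Longrightarrow> \<exists>C\<ge>0. \<forall>s\<ge>s0. \<forall>X\<ge>0. \<forall>Y\<ge>0. \<bar>p s X Y\<bar> \<le> C * (1 + X + Y) ^ k"
    by (rule weight_deriv[of k]) blast
  obtain C where C: "C \<ge> 0" "\<forall>s\<ge>s0. \<forall>X\<ge>0. \<forall>Y\<ge>0. \<bar>p s X Y\<bar> \<le> C * (1 + X + Y) ^ k" using p(2)[OF s0] by blast
  define D where "D = U_const TYPE('n) s0 / U_const TYPE('n) t"
  have D: "D \<ge> 0" using U_const_pos[of s0, where 'n = 'n] U_const_pos[of t, where 'n = 'n] s0 t by (simp add: D_def)
  show ?thesis
  proof (rule that[of "C * D"])
    show "C * D \<ge> 0" using C D by simp
    fix s and z :: "complex ^ 'n" assume s: "s0 \<le> s" "s \<le> t"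
    have sp: "s > 0" using s s0 by simp
    have "\<bar>dU k s z\<bar> = \<bar>p s (sqRe z) (sqIm z)\<bar> * weight_U s z"
      unfolding dU_def p(1)[OF sp] using weight_U_pos[OF sp, of z] by (simp add: abs_mult)
    also have "\<dots> \<le> (C * (1 + sqRe z + sqIm z) ^ k) * (D * weight_U t z)"
      unfolding D_def using C s s0 weight_U_pos[OF sp, of z]
      by (intro mult_mono C(2)[rule_format] weight_U_le sqRe_nonneg sqIm_nonneg) (auto simp: sqRe_nonneg sqIm_nonneg less_imp_le)
    also have "\<dots> = C * D * ((1 + (norm z)\<^sup>2) ^ k * weight_U t z)" by (simp add: norm_sq_eq add.assoc)
    finally show "\<bar>dU k s z\<bar> \<le> C * D * ((1 + (norm z)\<^sup>2) ^ k * weight_U t z)" .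
  qed
qed

lemma dU_lower:
  assumes t: "t > 0"
  obtains c R where "c > 0" "R > 0" "\<And>z :: complex ^ 'n. (norm z)\<^sup>2 \<ge> R \<Longrightarrow> dU k t z \<ge> c * ((1 + (norm z)\<^sup>2) ^ k * weight_U t z)"
proof -
  obtain p :: "real \<Rightarrow> real \<Rightarrow> real \<Rightarrow> real" where
    p: "\<And>s z. s > 0 \<Longrightarrow> (deriv ^^ k) (\<lambda>s. weight_U s (z :: complex ^ 'n)) s = p s (sqRe z) (sqIm z) * weight_U s z"
      "\<And>s. s > 0 \<Longrightarrow> \<exists>c>0. \<exists>R>0. \<forall>X\<ge>0. \<forall>Y\<ge>0. X + Y \<ge> R \<longrightarrow> p s X Y \<ge> c * (1 + X + Y) ^ k"
    by (rule weight_deriv[of k]) blast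
  obtain c R where c: "c > 0" "R > 0" "\<forall>X\<ge>0. \<forall>Y\<ge>0. X + Y \<ge> R \<longrightarrow> p t X Y \<ge> c * (1 + X + Y) ^ k" using p(2)[OF t] by blast
  show ?thesis
  proof (rule that[OF c(1,2)])
    fix z :: "complex ^ 'n" assume z: "(norm z)\<^sup>2 \<ge> R"
    have "c * (1 + sqRe z + sqIm z) ^ k \<le> p t (sqRe z) (sqIm z)"
      using c(3) z sqRe_nonneg[of z] sqIm_nonneg[of z] by (simp add: norm_sq_eq)
    then have "c * (1 + sqRe z + sqIm z) ^ k * weight_U t z \<le> p t (sqRe z) (sqIm z) * weight_U t z"
      using weight_U_pos[OF t, of z] by (intro mult_right_mono) auto
    then show "dU k t z \<ge> c * ((1 + (norm z)\<^sup>2) ^ k * weight_U t z)"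
      unfolding dU_def p(1)[OF t] by (simp add: norm_sq_eq add.assoc mult.assoc)
  qed
qed

text \<open>Domination of the differentiated series fails at \<open>s = t\<close>, where it is not known to converge a
  priori; monotone convergence from \<open>s < t\<close> supplies its summability there.\<close>

theorem weighted_Parseval:
  fixes F :: "complex ^ 'n \<Rightarrow> complex"
  assumes t: "t > 0" and F: "entire_Cn F" "L2 (MU t) F"
    and int: "integrable lborel (\<lambda>z. (1 + (norm z)\<^sup>2) ^ k * ((norm (F z))\<^sup>2 * weight_U t z))"
  defines "a \<equiv> \<lambda>\<alpha>. ip lborel (\<lambda>x. F (Rn_to_Cn x)) (Phi \<alpha>) * complex_of_real (exp (Hermite_eigenvalue \<alpha> * t))"
  shows "(\<lambda>\<alpha>. (2 * Hermite_eigenvalue \<alpha>) ^ k * (norm (a \<alpha>))\<^sup>2) summable_on UNIV"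
    and "(LINT z|lborel. (norm (F z))\<^sup>2 * dU k t z) = C0 TYPE('n) * (\<Sum>\<^sub>\<infinity>\<alpha>. (2 * Hermite_eigenvalue \<alpha>) ^ k * (norm (a \<alpha>))\<^sup>2)"
proof -
  define b where "b \<alpha> = ip lborel (\<lambda>x. F (Rn_to_Cn x)) (Phi \<alpha>)" for \<alpha> :: "nat ^ 'n"
  define \<mu> where "\<mu> \<alpha> = 2 * Hermite_eigenvalue \<alpha>" for \<alpha> :: "nat ^ 'n"
  have \<mu>: "\<mu> \<alpha> \<ge> 0" for \<alpha> using eigenvalue_ge_1[of \<alpha>] by (simp add: \<mu>_def)
  have [measurable]: "F \<in> borel_measurable borel" by (rule entire_measurable[OF F(1)])
  define W where "W z = (1 + (norm z)\<^sup>2) ^ k * ((norm (F z))\<^sup>2 * weight_U t z)" for z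
  define f where "f j s z = (norm (F z))\<^sup>2 * dU j s z" for j s z
  define g where "g j s \<alpha> = C0 TYPE('n) * (\<mu> \<alpha> ^ j * ((norm (b \<alpha>))\<^sup>2 * exp (\<mu> \<alpha> * s)))" for j s \<alpha>
  have bs: "(norm (b \<alpha> * complex_of_real (exp (Hermite_eigenvalue \<alpha> * s))))\<^sup>2 = (norm (b \<alpha>))\<^sup>2 * exp (\<mu> \<alpha> * s)" for \<alpha> s
  proof -
    have "exp (\<mu> \<alpha> * s) = (exp (Hermite_eigenvalue \<alpha> * s))\<^sup>2" by (simp only: exp_double mult.assoc \<mu>_def)
    then show ?thesis by (simp add: norm_mult power_mult_distrib)
  qed
  have gt: "g k t \<alpha> = C0 TYPE('n) * (\<mu> \<alpha> ^ k * (norm (a \<alpha>))\<^sup>2)" for \<alpha> by (simp only: g_def a_def b_def[symmetric] bs)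
  have gpos: "g j s \<alpha> \<ge> 0" for j s \<alpha> unfolding g_def using \<mu>[of \<alpha>] C0_pos[where 'n = 'n] by simp

  have "\<forall>j. \<exists>C\<ge>0. \<forall>s z. t / 2 \<le> s \<longrightarrow> s \<le> t \<longrightarrow> \<bar>dU j s (z :: complex ^ 'n)\<bar> \<le> C * ((1 + (norm z)\<^sup>2) ^ j * weight_U t z)"
    proof
    fix j
    have h: "0 < t / 2" "t / 2 \<le> t" using t by auto
    show "\<exists>C\<ge>0. \<forall>s z. t / 2 \<le> s \<longrightarrow> s \<le> t \<longrightarrow> \<bar>dU j s (z :: complex ^ 'n)\<bar> \<le> C * ((1 + (norm z)\<^sup>2) ^ j * weight_U t z)"
      by (rule dU_bound[OF h, of j, where 'n = 'n]) blast
  qed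
  then obtain C where C: "\<And>j. C j \<ge> 0" "\<And>j s z. t / 2 \<le> s \<Longrightarrow> s \<le> t \<Longrightarrow> \<bar>dU j s (z :: complex ^ 'n)\<bar> \<le> C j * ((1 + (norm z)\<^sup>2) ^ j * weight_U t z)"
    by metis
  define D where "D = (\<Sum>j\<le>k. C j)"
  have CD: "C j \<le> D" if "j \<le> k" for j unfolding D_def using that C(1) by (intro member_le_sum) auto
  have fb: "\<bar>f j s z\<bar> \<le> D * W z" if "j \<le> k" "t / 2 \<le> s" "s \<le> t" for j s z
  proof -
    have wp: "weight_U t z \<ge> 0" using weight_U_pos[OF t, of z] by simp
    have "\<bar>dU j s z\<bar> \<le> C j * ((1 + (norm z)\<^sup>2) ^ j * weight_U t z)" by (rule C(2)[OF that(2,3)])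
    also have "\<dots> \<le> D * ((1 + (norm z)\<^sup>2) ^ k * weight_U t z)"
      using C(1)[of j] CD[OF that(1)] wp that by (intro mult_mono power_increasing) auto
    finally have "(norm (F z))\<^sup>2 * \<bar>dU j s z\<bar> \<le> (norm (F z))\<^sup>2 * (D * ((1 + (norm z)\<^sup>2) ^ k * weight_U t z))"
      by (intro mult_left_mono) auto
    then show ?thesis by (simp add: f_def W_def abs_mult mult_ac)
  qed
  have W: "integrable lborel (\<lambda>z. D * W z)" unfolding W_def by (intro integrable_mult_right int)
  have fm: "f j s \<in> borel_measurable lborel" if "s > 0" for j s
    unfolding f_def[abs_def] using dU_measurable[OF that, of j] by measurable
  have fd: "((\<lambda>s. f j s z) has_real_derivative f (Suc j) s z) (at s)" if "s > 0" for j s z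
    unfolding f_def by (intro DERIV_cmult dU_deriv that)

  have eq0: "(LINT z|lborel. f 0 s z) = (LINT \<alpha>|count_space UNIV. g 0 s \<alpha>)"
    and gint0: "integrable (count_space UNIV) (\<lambda>\<alpha>. (norm (b \<alpha>))\<^sup>2 * exp (\<mu> \<alpha> * s))" if s: "0 < s" "s \<le> t" for s
  proof -
    have sm: "(\<lambda>\<alpha>. (norm (b \<alpha>))\<^sup>2 * exp (\<mu> \<alpha> * s)) summable_on UNIV"
      using L2_MU_Bessel[OF s(1) F(1) L2_MU_mono[OF s F]] unfolding b_def[symmetric] bs .
    then show "integrable (count_space UNIV) (\<lambda>\<alpha>. (norm (b \<alpha>))\<^sup>2 * exp (\<mu> \<alpha> * s))"
      by (subst integral_count_space_infsum(1)) auto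
    have "(LINT z|lborel. f 0 s z) = nsq (MU s) F"
      by (subst integral_MU(2)[OF s(1)]) (auto simp: f_def[abs_def] dU_0 mult.commute)
    also have "\<dots> = C0 TYPE('n) * (\<Sum>\<^sub>\<infinity>\<alpha>. (norm (b \<alpha>))\<^sup>2 * exp (\<mu> \<alpha> * s))"
      using L2_MU_Parseval[OF t F s] unfolding b_def[symmetric] bs .
    also have "(\<Sum>\<^sub>\<infinity>\<alpha>. (norm (b \<alpha>))\<^sup>2 * exp (\<mu> \<alpha> * s)) = (LINT \<alpha>|count_space UNIV. (norm (b \<alpha>))\<^sup>2 * exp (\<mu> \<alpha> * s))"
      by (subst integral_count_space_infsum(2)) (use sm in auto)
    finally show "(LINT z|lborel. f 0 s z) = (LINT \<alpha>|count_space UNIV. g 0 s \<alpha>)"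
      by (simp add: g_def)
  qed
  \<comment> \<open>A single constant for all orders \<open>j \<le> k\<close>; it blows up as
    \<open>u\<close> tends to \<open>t\<close>.\<close>
  define E where "E u = (\<Sum>j\<le>k. (real j / (t - u)) ^ j)" for u
  have gb: "\<bar>g j s \<alpha>\<bar> \<le> C0 TYPE('n) * (E u * ((norm (b \<alpha>))\<^sup>2 * exp (\<mu> \<alpha> * t)))" if "j \<le> k" "s \<le> u" "u < t" for j s u \<alpha>
  proof -
    have "\<mu> \<alpha> ^ j * exp (\<mu> \<alpha> * s) \<le> ((real j / (t - u)) ^ j * exp ((t - u) * \<mu> \<alpha>)) * exp (\<mu> \<alpha> * u)"
      using that \<mu>[of \<alpha>] by (intro mult_mono power_le_exp) (auto simp: mult_left_mono)
    also have "\<dots> = (real j / (t - u)) ^ j * exp (\<mu> \<alpha> * t)"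
      by (simp add: mult.assoc exp_add[symmetric] algebra_simps)
    also have "\<dots> \<le> E u * exp (\<mu> \<alpha> * t)"
      unfolding E_def using that by (intro mult_right_mono member_le_sum) auto
    finally have "(norm (b \<alpha>))\<^sup>2 * (\<mu> \<alpha> ^ j * exp (\<mu> \<alpha> * s)) \<le> (norm (b \<alpha>))\<^sup>2 * (E u * exp (\<mu> \<alpha> * t))"
      by (intro mult_left_mono) auto
    then have "C0 TYPE('n) * ((norm (b \<alpha>))\<^sup>2 * (\<mu> \<alpha> ^ j * exp (\<mu> \<alpha> * s))) \<le> C0 TYPE('n) * ((norm (b \<alpha>))\<^sup>2 * (E u * exp (\<mu> \<alpha> * t)))"
      by (rule mult_left_mono) (use C0_pos[where 'n = 'n] in simp)
    then show ?thesis unfolding abs_of_nonneg[OF gpos] by (simp add: g_def mult_ac)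
  qed
  have gd: "((\<lambda>s. g j s \<alpha>) has_real_derivative g (Suc j) s \<alpha>) (at s)" for j s \<alpha>
    unfolding g_def by (auto intro!: derivative_eq_intros)
  have gw: "integrable (count_space UNIV) (\<lambda>\<alpha>. C0 TYPE('n) * (E u * ((norm (b \<alpha>))\<^sup>2 * exp (\<mu> \<alpha> * t))))" for u
    using gint0[of t] t by (intro integrable_mult_right) auto

  have eqk: "(LINT z|lborel. f k s z) = (LINT \<alpha>|count_space UNIV. g k s \<alpha>)"
    and gint: "integrable (count_space UNIV) (g k s)" if s: "t / 2 < s" "s < t" for s
  proof -
    \<comment> \<open>The gap \<open>t - u\<close> pays for the powers of
      \<open>\<mu> \<alpha>\<close> in the majorant of the series.\<close>
    define u where "u = (s + t) / 2"
    have u: "s < u" "u < t" using s by (auto simp: u_def)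
    have "(LINT z|lborel. f k s z) = (deriv ^^ k) (\<lambda>s. LINT z|lborel. f 0 s z) s"
      by (rule integral_higher_deriv[where k = k and l = "t/2" and u = u and w = "\<lambda>z. D * W z", symmetric])
        (use fd fm fb W s u t in auto)
    also have "\<dots> = (deriv ^^ k) (\<lambda>s. LINT \<alpha>|count_space UNIV. g 0 s \<alpha>) s"
    proof (rule higher_deriv_cong_ev)
      have "eventually (\<lambda>r. r \<in> {t/2<..<t}) (nhds s)" using s by (intro eventually_nhds_in_open) auto
      then show "\<forall>\<^sub>F s in nhds s. (LINT z|lborel. f 0 s z) = (LINT \<alpha>|count_space UNIV. g 0 s \<alpha>)"
        by eventually_elim (use t in \<open>auto intro!: eq0\<close>)
    qed simp
    also have "\<dots> = (LINT \<alpha>|count_space UNIV. g k s \<alpha>)"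
      by (rule integral_higher_deriv[where k = k and l = "t/2" and u = u and w = "\<lambda>\<alpha>. C0 TYPE('n) * (E u * ((norm (b \<alpha>))\<^sup>2 * exp (\<mu> \<alpha> * t)))"])
        (use gd gb[where u = u] gw s u in auto)
    finally show "(LINT z|lborel. f k s z) = (LINT \<alpha>|count_space UNIV. g k s \<alpha>)" .
    show "integrable (count_space UNIV) (g k s)"
    proof (rule Bochner_Integration.integrable_bound[OF gw[of u]])
      show "AE \<alpha> in count_space UNIV. norm (g k s \<alpha>) \<le> norm (C0 TYPE('n) * (E u * ((norm (b \<alpha>))\<^sup>2 * exp (\<mu> \<alpha> * t))))"
        unfolding real_norm_def by (intro AE_I2 order_trans[OF gb[OF order_refl less_imp_le[OF u(1)] u(2)] abs_ge_self])
    qed simp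
  qed
  \<comment> \<open>The 3 keeps every \<open>r i\<close> above \<open>t / 2\<close>, the left end of
    the range in which the derivatives are dominated.\<close>
  define r where "r i = t - t / (real i + 3)" for i
  have r: "t / 2 < r i" "r i < t" for i
  proof -
    have "t / (real i + 3) < t / 2" by (rule divide_strict_left_mono) (use t in auto)
    moreover have "t / (real i + 3) > 0" using t by simp
    ultimately show "t / 2 < r i" "r i < t" unfolding r_def by linarith+
  qed
  have rlim: "r \<longlonglongrightarrow> t" unfolding r_def by real_asymp
  have rmono: "r i \<le> r j" if "i \<le> j" for i j using that t by (auto simp: r_def intro!: divide_left_mono)
  have L: "(\<lambda>i. LINT z|lborel. f k (r i) z) \<longlonglongrightarrow> (LINT z|lborel. f k t z)"
  proof (rule integral_dominated_convergence[OF fm[OF t] _ W])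
    show "f k (r i) \<in> borel_measurable lborel" for i using r[of i] t by (intro fm) auto
    show "AE z in lborel. (\<lambda>i. f k (r i) z) \<longlonglongrightarrow> f k t z"
      by (intro AE_I2 isCont_tendsto_compose[OF DERIV_isCont[OF fd[OF t]] rlim])
    show "AE z in lborel. norm (f k (r i) z) \<le> D * W z" for i
      using fb[of k "r i"] r[of i] by (intro AE_I2) auto
  qed
  have M: "integrable (count_space UNIV) (g k t) \<and> (LINT \<alpha>|count_space UNIV. g k t \<alpha>) = (LINT z|lborel. f k t z)"
  proof (intro conjI)
    have i: "integrable (count_space UNIV) (g k (r i))" for i by (rule gint[OF r])
    have mono: "AE \<alpha> in count_space UNIV. mono (\<lambda>i. g k (r i) \<alpha>)"
      unfolding g_def mono_def using \<mu> rmono C0_pos[where 'n = 'n]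
      by (intro AE_I2 allI impI mult_left_mono iffD2[OF exp_le_cancel_iff]) auto
    have lim: "AE \<alpha> in count_space UNIV. (\<lambda>i. g k (r i) \<alpha>) \<longlonglongrightarrow> g k t \<alpha>"
      by (intro AE_I2 isCont_tendsto_compose[OF DERIV_isCont[OF gd] rlim])
    have ilim: "(\<lambda>i. LINT \<alpha>|count_space UNIV. g k (r i) \<alpha>) \<longlonglongrightarrow> (LINT z|lborel. f k t z)"
      using L unfolding eqk[OF r] .
    have u: "g k t \<in> borel_measurable (count_space UNIV)" by simp
    show "integrable (count_space UNIV) (g k t)" by (rule integrable_monotone_convergence[OF i mono lim ilim u])
    show "(LINT \<alpha>|count_space UNIV. g k t \<alpha>) = (LINT z|lborel. f k t z)" by (rule integral_monotone_convergence[OF i mono lim ilim u])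
  qed
  then have gs0: "g k t summable_on UNIV" using integral_count_space_infsum(1)[of "g k t"] gpos by blast
  then have gs: "(\<lambda>\<alpha>. C0 TYPE('n) * (\<mu> \<alpha> ^ k * (norm (a \<alpha>))\<^sup>2)) summable_on UNIV" by (simp only: gt[symmetric])
  from summable_on_cmult_right[OF this, of "1 / C0 TYPE('n)"]
  show "(\<lambda>\<alpha>. (2 * Hermite_eigenvalue \<alpha>) ^ k * (norm (a \<alpha>))\<^sup>2) summable_on UNIV"
    using C0_pos[where 'n = 'n] by (simp add: \<mu>_def)
  have "(LINT z|lborel. (norm (F z))\<^sup>2 * dU k t z) = (LINT \<alpha>|count_space UNIV. g k t \<alpha>)" using M by (simp add: f_def)
  also have "\<dots> = (\<Sum>\<^sub>\<infinity>\<alpha>. g k t \<alpha>)" by (rule integral_count_space_infsum(2)[OF gpos gs0])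
  also have "\<dots> = C0 TYPE('n) * (\<Sum>\<^sub>\<infinity>\<alpha>. (2 * Hermite_eigenvalue \<alpha>) ^ k * (norm (a \<alpha>))\<^sup>2)"
    unfolding gt \<mu>_def by (rule infsum_cmult_right')
  finally show "(LINT z|lborel. (norm (F z))\<^sup>2 * dU k t z) = C0 TYPE('n) * (\<Sum>\<^sub>\<infinity>\<alpha>. (2 * Hermite_eigenvalue \<alpha>) ^ k * (norm (a \<alpha>))\<^sup>2)" .
qed

section \<open>The space \<open>F_space\<close> and its norm in terms of coefficients\<close>

lemma weight_dU_eq: "weight_dU m t z = dU (2 * m) t z"
  by (simp add: weight_dU_def dU_def)

text \<open>Off a ball the upper and lower bounds make the modulus of the differentiated weight
  comparable to a positive weight; inside, where no lower bound is available, continuity of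
  \<open>F\<close> on a compact set suffices. Membership thus becomes a condition that is visibly
  stable under sums.\<close>

lemma F_space_iff:
  fixes F :: "complex ^ 'n \<Rightarrow> complex"
  assumes t: "t > 0"
  shows "F \<in> F_space t m \<longleftrightarrow> entire_Cn F \<and> integrable lborel (\<lambda>z. (1 + (norm z)\<^sup>2) ^ (2 * m) * ((norm (F z))\<^sup>2 * weight_U t z))"
    (is "_ \<longleftrightarrow> _ \<and> integrable lborel ?W")
proof (cases "entire_Cn F")
  case F: True
  have [measurable]: "F \<in> borel_measurable borel" by (rule entire_measurable[OF F])
  have dm: "(dU (2 * m) t :: complex ^ 'n \<Rightarrow> real) \<in> borel_measurable borel" by (rule dU_measurable[OF t])
  have wp: "weight_U t z > 0" for z :: "complex ^ 'n" by (rule weight_U_pos[OF t])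
  have Wp: "?W z \<ge> 0" for z using wp[of z] by simp
  have "integrable lborel (\<lambda>z. (norm (F z))\<^sup>2 * \<bar>dU (2 * m) t z\<bar>) \<longleftrightarrow> integrable lborel ?W"
  proof
    assume i: "integrable lborel (\<lambda>z. (norm (F z))\<^sup>2 * \<bar>dU (2 * m) t z\<bar>)"
    obtain c R where c: "c > 0" "R > 0" "\<And>z :: complex ^ 'n. (norm z)\<^sup>2 \<ge> R \<Longrightarrow> dU (2 * m) t z \<ge> c * ((1 + (norm z)\<^sup>2) ^ (2 * m) * weight_U t z)"
      using dU_lower[OF t, of "2 * m", where 'n = 'n] by blast
    have "continuous_on (cball 0 (sqrt R)) ?W"
      unfolding weight_U_gw by (intro continuous_intros entire_continuous F)
    then have ib: "integrable lborel (\<lambda>z. indicator (cball 0 (sqrt R)) z *\<^sub>R ?W z)"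
      using borel_integrable_compact[of "cball 0 (sqrt R)" ?W] by (simp add: mult.commute)
    show "integrable lborel ?W"
    proof (rule Bochner_Integration.integrable_bound)
      show "integrable lborel (\<lambda>z. 1 / c * ((norm (F z))\<^sup>2 * \<bar>dU (2 * m) t z\<bar>) + indicator (cball 0 (sqrt R)) z *\<^sub>R ?W z)"
        by (intro Bochner_Integration.integrable_add integrable_mult_right i ib)
      show "AE z in lborel. norm (?W z) \<le> norm (1 / c * ((norm (F z))\<^sup>2 * \<bar>dU (2 * m) t z\<bar>) + indicator (cball 0 (sqrt R)) z *\<^sub>R ?W z)"
      proof (rule AE_I2)
        fix z :: "complex ^ 'n"
        have p1: "1 / c * ((norm (F z))\<^sup>2 * \<bar>dU (2 * m) t z\<bar>) \<ge> 0" using c by simp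
        have p2: "indicator (cball 0 (sqrt R)) z *\<^sub>R ?W z \<ge> 0" using Wp[of z] by (simp add: indicator_def)
        have "?W z \<le> 1 / c * ((norm (F z))\<^sup>2 * \<bar>dU (2 * m) t z\<bar>) + indicator (cball 0 (sqrt R)) z *\<^sub>R ?W z"
        proof (cases "z \<in> cball 0 (sqrt R)")
          case True then show ?thesis using p1 by (simp add: indicator_def)
        next
          case False
          then have "sqrt R < norm z" by simp
          then have "R < (norm z)\<^sup>2" using c(2) by (metis less_imp_le real_sqrt_ge_zero real_sqrt_pow2 power_strict_mono pos2)
          then have "c * ((1 + (norm z)\<^sup>2) ^ (2 * m) * weight_U t z) \<le> \<bar>dU (2 * m) t z\<bar>" using c(3)[of z] by linarith
          then have "(norm (F z))\<^sup>2 * (c * ((1 + (norm z)\<^sup>2) ^ (2 * m) * weight_U t z)) \<le> (norm (F z))\<^sup>2 * \<bar>dU (2 * m) t z\<bar>"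
            by (rule mult_left_mono[OF _ zero_le_power2])
          then have "1 / c * ((norm (F z))\<^sup>2 * (c * ((1 + (norm z)\<^sup>2) ^ (2 * m) * weight_U t z))) \<le> 1 / c * ((norm (F z))\<^sup>2 * \<bar>dU (2 * m) t z\<bar>)"
            by (rule mult_left_mono) (use c(1) in simp)
          moreover have "1 / c * ((norm (F z))\<^sup>2 * (c * ((1 + (norm z)\<^sup>2) ^ (2 * m) * weight_U t z))) = ?W z"
            using c(1) by simp
          ultimately show ?thesis using p2 by linarith
        qed
        then show "norm (?W z) \<le> norm (1 / c * ((norm (F z))\<^sup>2 * \<bar>dU (2 * m) t z\<bar>) + indicator (cball 0 (sqrt R)) z *\<^sub>R ?W z)"
          using Wp[of z] unfolding real_norm_def by linarith
      qed
    qed measurable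
  next
    assume i: "integrable lborel ?W"
    obtain C where C: "C \<ge> 0" "\<And>s z. t \<le> s \<Longrightarrow> s \<le> t \<Longrightarrow> \<bar>dU (2 * m) s (z :: complex ^ 'n)\<bar> \<le> C * ((1 + (norm z)\<^sup>2) ^ (2 * m) * weight_U t z)"
      using dU_bound[OF t order_refl, of "2 * m", where 'n = 'n] by blast
    show "integrable lborel (\<lambda>z. (norm (F z))\<^sup>2 * \<bar>dU (2 * m) t z\<bar>)"
    proof (rule Bochner_Integration.integrable_bound)
      show "integrable lborel (\<lambda>z. C * ?W z)" by (rule integrable_mult_right[OF i])
      show "AE z in lborel. norm ((norm (F z))\<^sup>2 * \<bar>dU (2 * m) t z\<bar>) \<le> norm (C * ?W z)"
      proof (rule AE_I2)
        fix z :: "complex ^ 'n"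
        have "(norm (F z))\<^sup>2 * \<bar>dU (2 * m) t z\<bar> \<le> (norm (F z))\<^sup>2 * (C * ((1 + (norm z)\<^sup>2) ^ (2 * m) * weight_U t z))"
          using C(2)[of t z] by (intro mult_left_mono) auto
        also have "\<dots> = C * ?W z" by (simp only: mult_ac)
        finally show "norm ((norm (F z))\<^sup>2 * \<bar>dU (2 * m) t z\<bar>) \<le> norm (C * ?W z)"
          unfolding real_norm_def abs_of_nonneg[OF mult_nonneg_nonneg[OF C(1) Wp[of z]]] by simp
      qed
      show "(\<lambda>z. (norm (F z))\<^sup>2 * \<bar>dU (2 * m) t z\<bar>) \<in> borel_measurable lborel" using dm by measurable
    qed
  qed
  then show ?thesis using F by (simp add: F_space_def weight_dU_eq)
qed (simp add: F_space_def)

text \<open>The Parseval identity of order \<open>2 * m\<close>: the power of twice the eigenvalue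
  splits into \<open>2 ^ (2 * m)\<close> and the Sobolev weight. In particular the form takes
  nonnegative values on the diagonal, which its weight alone does not show.\<close>

lemma F_space_heat:
  fixes F :: "complex ^ 'n \<Rightarrow> complex"
  assumes t: "t > 0" and F: "F \<in> F_space t m"
  obtains a where "(\<lambda>\<alpha>. Hermite_eigenvalue \<alpha> ^ (2 * m) * (norm (a \<alpha>))\<^sup>2) summable_on UNIV" "F = heat t a"
    "F_norm t m F = sqrt (C0 TYPE('n)) * 2 ^ m * sqrt (\<Sum>\<^sub>\<infinity>\<alpha>. Hermite_eigenvalue \<alpha> ^ (2 * m) * (norm (a \<alpha>))\<^sup>2)"
proof -
  have e: "entire_Cn F" and i: "integrable lborel (\<lambda>z. (1 + (norm z)\<^sup>2) ^ (2 * m) * ((norm (F z))\<^sup>2 * weight_U t z))"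
    using F unfolding F_space_iff[OF t] by auto
  have [measurable]: "F \<in> borel_measurable borel" by (rule entire_measurable[OF e])
  have wp: "weight_U t z > 0" for z :: "complex ^ 'n" by (rule weight_U_pos[OF t])
  have "integrable (MU t) (\<lambda>z. (norm (F z))\<^sup>2)"
  proof (subst integral_MU(1)[OF t])
    show "integrable lborel (\<lambda>z. weight_U t z *\<^sub>R (norm (F z))\<^sup>2)"
    proof (rule Bochner_Integration.integrable_bound[OF i])
      show "AE z in lborel. norm (weight_U t z *\<^sub>R (norm (F z))\<^sup>2) \<le> norm ((1 + (norm z)\<^sup>2) ^ (2 * m) * ((norm (F z))\<^sup>2 * weight_U t z))"
      proof (rule AE_I2)
        fix z :: "complex ^ 'n"
        have "1 * ((norm (F z))\<^sup>2 * weight_U t z) \<le> (1 + (norm z)\<^sup>2) ^ (2 * m) * ((norm (F z))\<^sup>2 * weight_U t z)"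
          using wp[of z] by (intro mult_right_mono one_le_power) auto
        then show "norm (weight_U t z *\<^sub>R (norm (F z))\<^sup>2) \<le> norm ((1 + (norm z)\<^sup>2) ^ (2 * m) * ((norm (F z))\<^sup>2 * weight_U t z))"
          using wp[of z] by (simp add: abs_mult mult_ac)
      qed
    qed measurable
  qed measurable
  then have L: "L2 (MU t) F" by (simp add: L2_def)
  define a where "a = (\<lambda>\<alpha>. ip lborel (\<lambda>x. F (Rn_to_Cn x)) (Phi \<alpha>) * complex_of_real (exp (Hermite_eigenvalue \<alpha> * t)))"
  have pw: "(2 * Hermite_eigenvalue \<alpha>) ^ (2 * m) * (norm (a \<alpha>))\<^sup>2 = 2 ^ (2 * m) * (Hermite_eigenvalue \<alpha> ^ (2 * m) * (norm (a \<alpha>))\<^sup>2)" for \<alpha> :: "nat ^ 'n"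
    by (simp only: power_mult_distrib mult.assoc)
  have s: "(\<lambda>\<alpha>. 2 ^ (2 * m) * (Hermite_eigenvalue \<alpha> ^ (2 * m) * (norm (a \<alpha>))\<^sup>2)) summable_on UNIV"
    using weighted_Parseval(1)[OF t e L i] unfolding pw[symmetric] unfolding a_def .
  show ?thesis
  proof (rule that[of a])
    have "(\<lambda>\<alpha>. 1 / 2 ^ (2 * m) * (2 ^ (2 * m) * (Hermite_eigenvalue \<alpha> ^ (2 * m) * (norm (a \<alpha>))\<^sup>2))) summable_on UNIV"
      by (rule summable_on_cmult_right[OF s])
    then show "(\<lambda>\<alpha>. Hermite_eigenvalue \<alpha> ^ (2 * m) * (norm (a \<alpha>))\<^sup>2) summable_on UNIV" by simp
    show "F = heat t a" unfolding a_def by (rule L2_MU_heat[OF t e L])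
    have "F_form t m F F = (LINT z|lborel. complex_of_real ((norm (F z))\<^sup>2 * dU (2 * m) t z))"
      unfolding F_form_def weight_dU_eq by (simp only: complex_norm_square[symmetric] of_real_mult)
    then have "Re (F_form t m F F) = (LINT z|lborel. (norm (F z))\<^sup>2 * dU (2 * m) t z)"
      by (simp only: integral_complex_of_real Re_complex_of_real)
    also have "\<dots> = C0 TYPE('n) * (2 ^ (2 * m) * (\<Sum>\<^sub>\<infinity>\<alpha>. Hermite_eigenvalue \<alpha> ^ (2 * m) * (norm (a \<alpha>))\<^sup>2))"
      using weighted_Parseval(2)[OF t e L i] unfolding infsum_cmult_right'[symmetric] pw[symmetric] unfolding a_def .
    finally show "F_norm t m F = sqrt (C0 TYPE('n)) * 2 ^ m * sqrt (\<Sum>\<^sub>\<infinity>\<alpha>. Hermite_eigenvalue \<alpha> ^ (2 * m) * (norm (a \<alpha>))\<^sup>2)"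
      by (simp add: F_norm_def real_sqrt_mult power_even_eq)
  qed
qed

lemma F_space_add:
  fixes F G :: "complex ^ 'n \<Rightarrow> complex"
  assumes t: "t > 0" and F: "F \<in> F_space t m" and G: "G \<in> F_space t m"
  shows "(\<lambda>z. F z + G z) \<in> F_space t m"
proof -
  have e: "entire_Cn F" "entire_Cn G"
    and i: "integrable lborel (\<lambda>z. (1 + (norm z)\<^sup>2) ^ (2 * m) * ((norm (F z))\<^sup>2 * weight_U t z))"
      "integrable lborel (\<lambda>z. (1 + (norm z)\<^sup>2) ^ (2 * m) * ((norm (G z))\<^sup>2 * weight_U t z))"
    using F G unfolding F_space_iff[OF t] by auto
  have [measurable]: "F \<in> borel_measurable borel" "G \<in> borel_measurable borel" by (intro entire_measurable e)+
  have "integrable lborel (\<lambda>z. (1 + (norm z)\<^sup>2) ^ (2 * m) * ((norm (F z + G z))\<^sup>2 * weight_U t z))"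
  proof (rule Bochner_Integration.integrable_bound)
    show "integrable lborel (\<lambda>z. 2 * ((1 + (norm z)\<^sup>2) ^ (2 * m) * ((norm (F z))\<^sup>2 * weight_U t z)) + 2 * ((1 + (norm z)\<^sup>2) ^ (2 * m) * ((norm (G z))\<^sup>2 * weight_U t z)))"
      by (intro Bochner_Integration.integrable_add integrable_mult_right i)
    show "AE z in lborel. norm ((1 + (norm z)\<^sup>2) ^ (2 * m) * ((norm (F z + G z))\<^sup>2 * weight_U t z)) \<le>
      norm (2 * ((1 + (norm z)\<^sup>2) ^ (2 * m) * ((norm (F z))\<^sup>2 * weight_U t z)) + 2 * ((1 + (norm z)\<^sup>2) ^ (2 * m) * ((norm (G z))\<^sup>2 * weight_U t z)))"
    proof (rule AE_I2)
      fix z :: "complex ^ 'n"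
      have wp: "weight_U t z > 0" by (rule weight_U_pos[OF t])
      have "(norm (F z + G z))\<^sup>2 \<le> (norm (F z) + norm (G z))\<^sup>2" by (intro power_mono norm_triangle_ineq) auto
      also have "\<dots> \<le> 2 * (norm (F z))\<^sup>2 + 2 * (norm (G z))\<^sup>2"
        using sum_squares_bound[of "norm (F z)" "norm (G z)"] by (simp add: power2_sum)
      finally have "(1 + (norm z)\<^sup>2) ^ (2 * m) * ((norm (F z + G z))\<^sup>2 * weight_U t z) \<le>
        (1 + (norm z)\<^sup>2) ^ (2 * m) * ((2 * (norm (F z))\<^sup>2 + 2 * (norm (G z))\<^sup>2) * weight_U t z)"
        using wp by (intro mult_left_mono mult_right_mono) auto
      also have "\<dots> = 2 * ((1 + (norm z)\<^sup>2) ^ (2 * m) * ((norm (F z))\<^sup>2 * weight_U t z)) + 2 * ((1 + (norm z)\<^sup>2) ^ (2 * m) * ((norm (G z))\<^sup>2 * weight_U t z))"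
        by (simp add: algebra_simps)
      finally show "norm ((1 + (norm z)\<^sup>2) ^ (2 * m) * ((norm (F z + G z))\<^sup>2 * weight_U t z)) \<le>
        norm (2 * ((1 + (norm z)\<^sup>2) ^ (2 * m) * ((norm (F z))\<^sup>2 * weight_U t z)) + 2 * ((1 + (norm z)\<^sup>2) ^ (2 * m) * ((norm (G z))\<^sup>2 * weight_U t z)))"
        using wp by (simp add: abs_mult)
    qed
  qed measurable
  then show ?thesis unfolding F_space_iff[OF t] using e by (auto intro: entire_add)
qed

lemma F_space_scale:
  assumes t: "t > 0" and F: "F \<in> F_space t m"
  shows "(\<lambda>z. c * F z) \<in> F_space t m"
proof -
  have e: "entire_Cn F" and i: "integrable lborel (\<lambda>z. (1 + (norm z)\<^sup>2) ^ (2 * m) * ((norm (F z))\<^sup>2 * weight_U t z))"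
    using F unfolding F_space_iff[OF t] by auto
  have "(\<lambda>z. (1 + (norm z)\<^sup>2) ^ (2 * m) * ((norm (c * F z))\<^sup>2 * weight_U t z)) =
      (\<lambda>z. (norm c)\<^sup>2 * ((1 + (norm z)\<^sup>2) ^ (2 * m) * ((norm (F z))\<^sup>2 * weight_U t z)))"
    by (simp add: norm_mult power_mult_distrib mult_ac)
  then show ?thesis unfolding F_space_iff[OF t] using e integrable_mult_right[OF i, of "(norm c)\<^sup>2"] by (auto intro: entire_scale)
qed

lemma F_space_0: "(\<lambda>z. 0) \<in> F_space t m"
  by (simp add: F_space_def entire_const)

lemma F_space_sum:
  assumes t: "t > 0"
  shows "(\<And>i. i \<in> A \<Longrightarrow> F i \<in> F_space t m) \<Longrightarrow> (\<lambda>z. \<Sum>i\<in>A. F i z) \<in> F_space t m"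
  by (induction A rule: infinite_finite_induct) (auto simp: F_space_0 intro!: F_space_add[OF t])

lemma F_space_Phi_c:
  assumes t: "t > 0"
  shows "Phi_c (\<alpha> :: nat ^ 'n) \<in> F_space t m"
proof -
  have T: "0 < tanh (2 * t)" "tanh (2 * t) < 1" using tanh_2_bounds[OF t] by auto
  have [measurable]: "Phi_c \<alpha> \<in> borel_measurable borel" by (rule entire_measurable[OF entire_Phi_c])
  have "integrable lborel (\<lambda>z. (1 + (norm z)\<^sup>2) ^ (2 * m) * ((norm (Phi_c \<alpha> z))\<^sup>2 * weight_U t z))"
  proof (rule Bochner_Integration.integrable_bound)
    show "integrable lborel (\<lambda>z. U_const TYPE('n) t * ((1 + norm z) ^ (2 * (2 * m)) * ((norm (Phi_c \<alpha> z))\<^sup>2 * gw (tanh (2 * t)) z)))"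
      by (intro integrable_mult_right Phi_c_weighted_integrable T)
    show "AE z in lborel. norm ((1 + (norm z)\<^sup>2) ^ (2 * m) * ((norm (Phi_c \<alpha> z))\<^sup>2 * weight_U t z)) \<le>
      norm (U_const TYPE('n) t * ((1 + norm z) ^ (2 * (2 * m)) * ((norm (Phi_c \<alpha> z))\<^sup>2 * gw (tanh (2 * t)) z)))"
    proof (rule AE_I2)
      fix z :: "complex ^ 'n"
      have wp: "weight_U t z > 0" by (rule weight_U_pos[OF t])
      have "(1 + (norm z)\<^sup>2) ^ (2 * m) \<le> ((1 + norm z)\<^sup>2) ^ (2 * m)"
        by (intro power_mono) (auto simp: power2_sum)
      then have "(1 + (norm z)\<^sup>2) ^ (2 * m) * ((norm (Phi_c \<alpha> z))\<^sup>2 * weight_U t z) \<le> ((1 + norm z)\<^sup>2) ^ (2 * m) * ((norm (Phi_c \<alpha> z))\<^sup>2 * weight_U t z)"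
        using wp by (intro mult_right_mono) auto
      also have "\<dots> = U_const TYPE('n) t * ((1 + norm z) ^ (2 * (2 * m)) * ((norm (Phi_c \<alpha> z))\<^sup>2 * gw (tanh (2 * t)) z))"
        by (simp only: power_mult[symmetric] weight_U_gw mult_ac)
      finally have le: "(1 + (norm z)\<^sup>2) ^ (2 * m) * ((norm (Phi_c \<alpha> z))\<^sup>2 * weight_U t z) \<le>
        U_const TYPE('n) t * ((1 + norm z) ^ (2 * (2 * m)) * ((norm (Phi_c \<alpha> z))\<^sup>2 * gw (tanh (2 * t)) z))" .
      show "norm ((1 + (norm z)\<^sup>2) ^ (2 * m) * ((norm (Phi_c \<alpha> z))\<^sup>2 * weight_U t z)) \<le>
        norm (U_const TYPE('n) t * ((1 + norm z) ^ (2 * (2 * m)) * ((norm (Phi_c \<alpha> z))\<^sup>2 * gw (tanh (2 * t)) z)))"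
      proof -
        have "0 \<le> (1 + (norm z)\<^sup>2) ^ (2 * m) * ((norm (Phi_c \<alpha> z))\<^sup>2 * weight_U t z)" using wp by simp
        then show ?thesis using le unfolding real_norm_def by linarith
      qed
    qed
  qed measurable
  then show ?thesis unfolding F_space_iff[OF t] by (simp add: entire_Phi_c)
qed

subsection \<open>The Hermite semigroup\<close>

lemma L2_Rn_iff: "f \<in> L2_Rn \<longleftrightarrow> L2 lebesgue f"
  by (simp add: L2_Rn_def L2_def)

lemma Hermite_coeff_eq: "Hermite_coeff f \<alpha> = ip lebesgue f (Phi \<alpha>)"
  by (simp add: Hermite_coeff_def ip_def Phi_def)

lemma L2_lebesgue: "g \<in> borel_measurable lborel \<Longrightarrow> L2 lebesgue g \<longleftrightarrow> L2 lborel g"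
  unfolding L2_def by (auto simp: integrable_completion measurable_completion)

lemma ip_lebesgue:
  assumes "g \<in> borel_measurable lborel" "h \<in> borel_measurable lborel"
  shows "ip lebesgue g h = ip lborel g h"
proof -
  have "(\<lambda>x. cnj (h x)) \<in> borel_measurable lborel"
    by (rule measurable_compose[OF assms(2) borel_measurable_continuous_onI]) (intro continuous_intros)
  then have "(\<lambda>x. g x * cnj (h x)) \<in> borel_measurable lborel" using assms(1) by (rule borel_measurable_times[rotated])
  then show ?thesis unfolding ip_def by (rule integral_completion)
qed

lemma orthonormal_lebesgue: "orthonormal lebesgue Phi"
proof
  have m: "Phi \<alpha> \<in> borel_measurable lborel" for \<alpha> :: "nat ^ 'n" by (rule L2_measurable[OF L2_Phi])
  show "L2 lebesgue (Phi \<alpha>)" for \<alpha> :: "nat ^ 'n" using L2_lebesgue[OF m] L2_Phi by blast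
  show "ip lebesgue (Phi \<alpha>) (Phi \<beta>) = (if \<alpha> = \<beta> then 1 else 0)" for \<alpha> \<beta> :: "nat ^ 'n"
    unfolding ip_lebesgue[OF m m] by (rule orthonormal.ortho[OF orthonormal_Phi])
qed

lemma Hermite_coeff_inj:
  fixes f g :: "real ^ 'n \<Rightarrow> complex"
  assumes f: "f \<in> L2_Rn" and g: "g \<in> L2_Rn"
  shows "Hermite_coeff f = Hermite_coeff g \<longleftrightarrow> (AE x in lebesgue. f x = g x)"
proof
  have Phim: "Phi \<alpha> \<in> borel_measurable lborel" for \<alpha> :: "nat ^ 'n" by (rule L2_measurable[OF L2_Phi])
  have cm: "(\<lambda>x. cnj (Phi \<alpha> x)) \<in> borel_measurable lebesgue" for \<alpha> :: "nat ^ 'n"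
    unfolding cnj_Phi by (rule measurable_completion[OF Phim])
  have cong: "ip lebesgue u (Phi \<alpha>) = ip lebesgue v (Phi \<alpha>)"
    if "u \<in> borel_measurable lebesgue" "v \<in> borel_measurable lebesgue" "AE x in lebesgue. u x = v x" for u v and \<alpha> :: "nat ^ 'n"
    unfolding ip_def
  proof (rule integral_cong_AE)
    show "AE x in lebesgue. u x * cnj (Phi \<alpha> x) = v x * cnj (Phi \<alpha> x)" using that(3) by eventually_elim simp
  qed (use that cm[of \<alpha>] in measurable)
  have fm: "f \<in> borel_measurable lebesgue" and gm: "g \<in> borel_measurable lebesgue"
    using f g unfolding L2_Rn_iff by (auto intro: L2_measurable)
  show "Hermite_coeff f = Hermite_coeff g" if "AE x in lebesgue. f x = g x"
    by (rule ext) (simp only: Hermite_coeff_eq cong[OF fm gm that])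
  assume eq: "Hermite_coeff f = Hermite_coeff g"
  define h where "h x = f x - g x" for x
  have h: "L2 lebesgue h" unfolding h_def using f g unfolding L2_Rn_iff by (rule L2_minus)
  have hm: "h \<in> borel_measurable lebesgue" by (rule L2_measurable[OF h])
  have 0: "ip lebesgue h (Phi \<alpha>) = 0" for \<alpha>
    unfolding h_def using ip_minus[of lebesgue f g "Phi \<alpha>"] f g fun_cong[OF eq, of \<alpha>] orthonormal.L2[OF orthonormal_lebesgue, of \<alpha>]
    by (simp add: L2_Rn_iff Hermite_coeff_eq)
  have "(\<lambda>x. Re (h x)) \<in> borel_measurable lebesgue" "(\<lambda>x. Im (h x)) \<in> borel_measurable lebesgue"
    using hm by measurable
  then obtain u v where u: "u \<in> borel_measurable lborel" "AE x in lborel. Re (h x) = u x"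
    and v: "v \<in> borel_measurable lborel" "AE x in lborel. Im (h x) = v x"
    using completion_ex_borel_measurable_real[of "\<lambda>x. Re (h x)" lborel] completion_ex_borel_measurable_real[of "\<lambda>x. Im (h x)" lborel] by blast
  \<comment> \<open>Completeness is stated for Borel functions, so the Lebesgue measurable
    \<open>h\<close> is exchanged for a Borel function equal to it almost everywhere, built from
    real and imaginary parts.\<close>
  define h' where "h' x = complex_of_real (u x) + \<i> * complex_of_real (v x)" for x
  have h'm: "h' \<in> borel_measurable lborel" unfolding h'_def[abs_def] using u(1) v(1) by measurable
  have h'l: "h' \<in> borel_measurable lebesgue" by (rule measurable_completion[OF h'm])
  have ae: "AE x in lborel. h x = h' x" using u(2) v(2) by eventually_elim (simp add: h'_def complex_eq_iff)
  then have ae': "AE x in lebesgue. h x = h' x" by (rule AE_completion)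
  have "integrable lebesgue (\<lambda>x. (norm (h' x))\<^sup>2)"
    using L2_integrable[OF h]
  proof (rule Bochner_Integration.integrable_cong_AE_imp)
    show "AE x in lebesgue. (norm (h x))\<^sup>2 = (norm (h' x))\<^sup>2" using ae' by eventually_elim simp
  qed (use h'l in measurable)
  then have "L2 lborel h'" using L2_lebesgue[OF h'm] h'l by (simp add: L2_def)
  moreover have "ip lborel h' (Phi \<alpha>) = 0" for \<alpha>
    using cong[OF hm h'l ae', of \<alpha>] 0[of \<alpha>] ip_lebesgue[OF h'm Phim, of \<alpha>] by simp
  ultimately have "AE x in lborel. h' x = 0" by (rule Hermite_complete)
  then have "AE x in lebesgue. h' x = 0" by (rule AE_completion)
  then show "AE x in lebesgue. f x = g x" using ae' by eventually_elim (simp add: h_def)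
qed

lemma Hermite_coeff_summable:
  assumes "f \<in> L2_Rn" shows "(\<lambda>\<alpha>. (norm (Hermite_coeff f \<alpha>))\<^sup>2) summable_on UNIV"
proof (rule nonneg_bounded_partial_sums_imp_summable_on)
  show "\<forall>\<^sub>F A in finite_subsets_at_top UNIV. (\<Sum>\<alpha>\<in>A. (norm (Hermite_coeff f \<alpha>))\<^sup>2) \<le> nsq lebesgue f"
    unfolding Hermite_coeff_eq using orthonormal.Bessel[OF orthonormal_lebesgue assms[unfolded L2_Rn_iff]]
    by (intro eventually_finite_subsets_at_top_weakI)
qed simp

lemma Hermite_coeff_surj:
  fixes c :: "nat ^ 'n \<Rightarrow> complex"
  assumes c: "(\<lambda>\<alpha>. (norm (c \<alpha>))\<^sup>2) summable_on UNIV"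
  obtains f where "f \<in> L2_Rn" "Hermite_coeff f = c" "nsq lebesgue f = (\<Sum>\<^sub>\<infinity>\<alpha>. (norm (c \<alpha>))\<^sup>2)"
  by (rule Riesz_Fischer[OF orthonormal_lebesgue c], rule that, unfold L2_Rn_iff, assumption, unfold fun_eq_iff Hermite_coeff_eq, blast, assumption)

lemma Hermite_Parseval:
  fixes g :: "real ^ 'n \<Rightarrow> complex"
  assumes g: "g \<in> L2_Rn"
  shows "nsq lebesgue g = (\<Sum>\<^sub>\<infinity>\<alpha>. (norm (Hermite_coeff g \<alpha>))\<^sup>2)"
proof -
  obtain f where f: "f \<in> L2_Rn" "Hermite_coeff f = Hermite_coeff g" "nsq lebesgue f = (\<Sum>\<^sub>\<infinity>\<alpha>. (norm (Hermite_coeff g \<alpha>))\<^sup>2)"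
    by (rule Hermite_coeff_surj[OF Hermite_coeff_summable[OF g]])
  have ae: "AE x in lebesgue. f x = g x" using f(2) Hermite_coeff_inj[OF f(1) g] by blast
  have "nsq lebesgue g = nsq lebesgue f"
  proof (rule integral_cong_AE)
    show "AE x in lebesgue. (norm (g x))\<^sup>2 = (norm (f x))\<^sup>2" using ae by eventually_elim simp
  qed (use L2_measurable[OF f(1)[unfolded L2_Rn_iff]] L2_measurable[OF g[unfolded L2_Rn_iff]] in measurable)
  then show ?thesis using f(3) by simp
qed

text \<open>By \<open>nsq_diff\<close> the squared distance is a sum of two nonnegative terms, the
  tail of \<open>g\<close> and the mismatch of the coefficients on \<open>A\<close>. The second
  forces equality of the coefficients; the first tends to 0 by Parseval. A limit in norm thereby
  becomes a condition on coefficients.\<close>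

lemma is_Hermite_semigroup_iff:
  fixes f g :: "real ^ 'n \<Rightarrow> complex"
  shows "is_Hermite_semigroup t f g \<longleftrightarrow>
    g \<in> L2_Rn \<and> (\<forall>\<alpha>. Hermite_coeff g \<alpha> = complex_of_real (exp (- (Hermite_eigenvalue \<alpha> * t))) * Hermite_coeff f \<alpha>)"
proof (cases "g \<in> L2_Rn")
  case g: True
  interpret orthonormal lebesgue Phi by (rule orthonormal_lebesgue)
  define c where "c \<alpha> = complex_of_real (exp (- (Hermite_eigenvalue \<alpha> * t))) * Hermite_coeff f \<alpha>" for \<alpha> :: "nat ^ 'n"
  have S: "(\<Sum>\<alpha>\<in>A. complex_of_real (exp (- (Hermite_eigenvalue \<alpha> * t))) * Hermite_coeff f \<alpha> * complex_of_real (Hermite_Phi \<alpha> x)) = S c A x" for A and x :: "real ^ 'n"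
    by (simp add: S_def c_def Phi_def)
  have gL: "L2 lebesgue g" using g by (simp add: L2_Rn_iff)
  note D = nsq_diff[OF gL, folded Hermite_coeff_eq]
  have fin: "\<forall>\<^sub>F A in finite_subsets_at_top (UNIV :: (nat ^ 'n) set). finite A" by (rule eventually_finite_subsets_at_top_weakI)
  have "((\<lambda>A. nsq lebesgue (\<lambda>x. g x - S c A x)) \<longlongrightarrow> 0) (finite_subsets_at_top UNIV) \<longleftrightarrow> (\<forall>\<alpha>. Hermite_coeff g \<alpha> = c \<alpha>)"
  proof (intro iffI allI)
    fix \<beta> :: "nat ^ 'n" assume lim: "((\<lambda>A. nsq lebesgue (\<lambda>x. g x - S c A x)) \<longlongrightarrow> 0) (finite_subsets_at_top UNIV)"
    have "\<forall>\<^sub>F A in finite_subsets_at_top UNIV. {\<beta>} \<subseteq> A \<and> finite A"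
      unfolding eventually_finite_subsets_at_top by (intro exI[of _ "{\<beta>}"]) auto
    then have "\<forall>\<^sub>F A in finite_subsets_at_top UNIV. (norm (Hermite_coeff g \<beta> - c \<beta>))\<^sup>2 \<le> nsq lebesgue (\<lambda>x. g x - S c A x)"
    proof eventually_elim
      case (elim A)
      then have A: "finite A" "\<beta> \<in> A" by auto
      have "(norm (Hermite_coeff g \<beta> - c \<beta>))\<^sup>2 \<le> (\<Sum>\<alpha>\<in>A. (norm (Hermite_coeff g \<alpha> - c \<alpha>))\<^sup>2)"
        using A by (intro member_le_sum) auto
      moreover have "(\<Sum>\<alpha>\<in>A. (norm (Hermite_coeff g \<alpha>))\<^sup>2) \<le> nsq lebesgue g"
        using Bessel[OF gL A(1)] by (simp only: Hermite_coeff_eq)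
      ultimately show ?case unfolding D[OF A(1)] by linarith
    qed
    then have "(norm (Hermite_coeff g \<beta> - c \<beta>))\<^sup>2 \<le> 0" by (rule tendsto_lowerbound[OF lim]) simp
    then show "Hermite_coeff g \<beta> = c \<beta>" by simp
  next
    assume eq: "\<forall>\<alpha>. Hermite_coeff g \<alpha> = c \<alpha>"
    have "((\<lambda>A. \<Sum>\<alpha>\<in>A. (norm (Hermite_coeff g \<alpha>))\<^sup>2) \<longlongrightarrow> nsq lebesgue g) (finite_subsets_at_top UNIV)"
      using has_sum_infsum[OF Hermite_coeff_summable[OF g]] unfolding Hermite_Parseval[OF g] has_sum_def .
    then have lim: "((\<lambda>A. nsq lebesgue g - (\<Sum>\<alpha>\<in>A. (norm (Hermite_coeff g \<alpha>))\<^sup>2)) \<longlongrightarrow> nsq lebesgue g - nsq lebesgue g) (finite_subsets_at_top UNIV)"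
      by (intro tendsto_diff tendsto_const)
    show "((\<lambda>A. nsq lebesgue (\<lambda>x. g x - S c A x)) \<longlongrightarrow> 0) (finite_subsets_at_top UNIV)"
    proof (rule Lim_transform_eventually[OF lim[unfolded diff_self]])
      show "\<forall>\<^sub>F A in finite_subsets_at_top UNIV. nsq lebesgue g - (\<Sum>\<alpha>\<in>A. (norm (Hermite_coeff g \<alpha>))\<^sup>2) = nsq lebesgue (\<lambda>x. g x - S c A x)"
        using fin by eventually_elim (simp add: D eq)
    qed
  qed
  then show ?thesis using g unfolding is_Hermite_semigroup_def S by (simp add: c_def)
qed (simp add: is_Hermite_semigroup_def)

text \<open>The heat series meets both conditions of the definite description, and an entire
  function is determined by the Hermite coefficients of its restriction, so nothing else
  does.\<close>

lemma Hermite_semigroup_eq_heat: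
  fixes f :: "real ^ 'n \<Rightarrow> complex"
  assumes t: "t > 0" and f: "f \<in> L2_Rn"
  shows "Hermite_semigroup t f = heat t (Hermite_coeff f)"
proof -
  define a where "a = Hermite_coeff f"
  have a: "(\<lambda>\<alpha>. (norm (a \<alpha>))\<^sup>2) summable_on UNIV" unfolding a_def by (rule Hermite_coeff_summable[OF f])
  have R: "(\<lambda>x. F (Rn_to_Cn x)) \<in> L2_Rn \<longleftrightarrow> L2 lborel (\<lambda>x. F (Rn_to_Cn x))"
    "Hermite_coeff (\<lambda>x. F (Rn_to_Cn x)) \<alpha> = ip lborel (\<lambda>x. F (Rn_to_Cn x)) (Phi \<alpha>)"
    if "entire_Cn F" for F :: "complex ^ 'n \<Rightarrow> complex" and \<alpha> :: "nat ^ 'n"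
    unfolding L2_Rn_iff Hermite_coeff_eq
    using L2_lebesgue[OF measurable_restrict[OF that]] ip_lebesgue[OF measurable_restrict[OF that] L2_measurable[OF L2_Phi]] by blast+
  note H = heat_entire[OF t a] heat_L2[OF t a]
  show ?thesis
    unfolding Hermite_semigroup_def is_Hermite_semigroup_iff a_def[symmetric]
  proof (rule the_equality, intro conjI allI)
    show "entire_Cn (heat t a)" by (rule H)
    show "(\<lambda>x. heat t a (Rn_to_Cn x)) \<in> L2_Rn" using R(1)[OF H(1)] H(2) by blast
    show "Hermite_coeff (\<lambda>x. heat t a (Rn_to_Cn x)) \<alpha> = complex_of_real (exp (- (Hermite_eigenvalue \<alpha> * t))) * a \<alpha>" for \<alpha>
      unfolding R(2)[OF H(1)] heat_coeff[OF t a] by (rule mult.commute)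
    fix F assume F: "entire_Cn F \<and> (\<lambda>x. F (Rn_to_Cn x)) \<in> L2_Rn \<and>
      (\<forall>\<alpha>. Hermite_coeff (\<lambda>x. F (Rn_to_Cn x)) \<alpha> = complex_of_real (exp (- (Hermite_eigenvalue \<alpha> * t))) * a \<alpha>)"
    then have e: "entire_Cn F" by blast
    show "F = heat t a"
    proof (rule entire_eq_coeff[OF e _ H])
      show "L2 lborel (\<lambda>x. F (Rn_to_Cn x))" using F R(1)[OF e] by blast
      show "ip lborel (\<lambda>x. F (Rn_to_Cn x)) (Phi \<alpha>) = ip lborel (\<lambda>x. heat t a (Rn_to_Cn x)) (Phi \<alpha>)" for \<alpha>
        unfolding heat_coeff[OF t a] R(2)[OF e, symmetric] using F by (simp add: mult.commute)
    qed
  qed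
qed

subsection \<open>The completion\<close>

text \<open>The sequence space to which all spaces of the theorem are compared: \<open>WH\<close>
  through Hermite coefficients, \<open>W_hol\<close> through heat series, \<open>B_space\<close>
  through limits of coefficients.\<close>

definition Sob :: "nat \<Rightarrow> (nat ^ 'n \<Rightarrow> complex) set" where
  "Sob m = {a. (\<lambda>\<alpha>. Hermite_eigenvalue \<alpha> ^ (2 * m) * (norm (a \<alpha>))\<^sup>2) summable_on UNIV}"

definition Sob_norm :: "nat \<Rightarrow> (nat ^ 'n \<Rightarrow> complex) \<Rightarrow> real" where
  "Sob_norm m a = sqrt (\<Sum>\<^sub>\<infinity>\<alpha>. Hermite_eigenvalue \<alpha> ^ (2 * m) * (norm (a \<alpha>))\<^sup>2)"

text \<open>Finite parts of the norm, written as \<open>L2_set\<close> so that Minkowski's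
  inequality is at hand. Inequalities are proved for finite index sets and transferred to the full
  norm by \<open>Sob_I\<close> and \<open>Sob_norm_le\<close>.\<close>

definition Sob_partial_norm :: "nat \<Rightarrow> (nat ^ 'n) set \<Rightarrow> (nat ^ 'n \<Rightarrow> complex) \<Rightarrow> real" where
  "Sob_partial_norm m A a = L2_set (\<lambda>\<alpha>. Hermite_eigenvalue \<alpha> ^ m * norm (a \<alpha>)) A"

lemma eigenvalue_pos: "Hermite_eigenvalue \<alpha> > 0"
  using eigenvalue_ge_1[of \<alpha>] by simp

lemma weight_nonneg: "0 \<le> Hermite_eigenvalue \<alpha> ^ k * (norm (a \<alpha>))\<^sup>2"
  using eigenvalue_pos[of \<alpha>] by simp

lemma Sob_partial_norm_eq: "Sob_partial_norm m A a = sqrt (\<Sum>\<alpha>\<in>A. Hermite_eigenvalue \<alpha> ^ (2 * m) * (norm (a \<alpha>))\<^sup>2)"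
  by (simp add: Sob_partial_norm_def L2_set_def power_mult_distrib power_mult[symmetric] mult.commute)

lemma Sob_partial_norm_triangle: "Sob_partial_norm m A (\<lambda>\<alpha>. a \<alpha> + b \<alpha>) \<le> Sob_partial_norm m A a + Sob_partial_norm m A b"
proof -
  have p: "Hermite_eigenvalue \<alpha> ^ m \<ge> 0" for \<alpha> :: "nat ^ 'n" using eigenvalue_pos[of \<alpha>] by simp
  have "Sob_partial_norm m A (\<lambda>\<alpha>. a \<alpha> + b \<alpha>) \<le> L2_set (\<lambda>\<alpha>. Hermite_eigenvalue \<alpha> ^ m * norm (a \<alpha>) + Hermite_eigenvalue \<alpha> ^ m * norm (b \<alpha>)) A"
    unfolding Sob_partial_norm_def distrib_left[symmetric] using p by (intro L2_set_mono mult_left_mono norm_triangle_ineq) auto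
  also have "\<dots> \<le> Sob_partial_norm m A a + Sob_partial_norm m A b" unfolding Sob_partial_norm_def by (rule L2_set_triangle_ineq)
  finally show ?thesis .
qed

lemma Sob_partial_norm_le_Sob_norm: "a \<in> Sob m \<Longrightarrow> finite A \<Longrightarrow> Sob_partial_norm m A a \<le> Sob_norm m a"
  unfolding Sob_partial_norm_eq Sob_norm_def Sob_def by (intro real_sqrt_le_mono finite_sum_le_infsum) (auto simp: weight_nonneg)

lemma
  assumes "\<And>A. finite A \<Longrightarrow> Sob_partial_norm m A a \<le> e"
  shows Sob_I: "a \<in> Sob m" and Sob_norm_le: "Sob_norm m a \<le> e"
proof -
  have e: "0 \<le> e" using assms[of "{}"] by (simp add: Sob_partial_norm_eq)
  have b: "(\<Sum>\<alpha>\<in>A. Hermite_eigenvalue \<alpha> ^ (2 * m) * (norm (a \<alpha>))\<^sup>2) \<le> e\<^sup>2" if "finite A" for A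
  proof -
    have "(Sob_partial_norm m A a)\<^sup>2 \<le> e\<^sup>2" using assms[OF that] by (intro power_mono) (auto simp: Sob_partial_norm_eq sum_nonneg weight_nonneg)
    then show ?thesis by (simp add: Sob_partial_norm_eq sum_nonneg weight_nonneg)
  qed
  show a: "a \<in> Sob m"
    unfolding Sob_def mem_Collect_eq
  proof (rule nonneg_bounded_partial_sums_imp_summable_on[OF weight_nonneg])
    show "\<forall>\<^sub>F A in finite_subsets_at_top UNIV. (\<Sum>\<alpha>\<in>A. Hermite_eigenvalue \<alpha> ^ (2 * m) * (norm (a \<alpha>))\<^sup>2) \<le> e\<^sup>2"
      by (rule eventually_finite_subsets_at_top_weakI) (rule b)
  qed
  then have "(\<Sum>\<^sub>\<infinity>\<alpha>. Hermite_eigenvalue \<alpha> ^ (2 * m) * (norm (a \<alpha>))\<^sup>2) \<le> e\<^sup>2"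
    unfolding Sob_def mem_Collect_eq by (rule infsum_le_finite_sums) (rule b)
  then show "Sob_norm m a \<le> e" unfolding Sob_norm_def using e by (intro real_le_lsqrt) auto
qed

lemma
  assumes "a \<in> Sob m" "b \<in> Sob m"
  shows Sob_add: "(\<lambda>\<alpha>. a \<alpha> + b \<alpha>) \<in> Sob m" and Sob_norm_add: "Sob_norm m (\<lambda>\<alpha>. a \<alpha> + b \<alpha>) \<le> Sob_norm m a + Sob_norm m b"
proof -
  have "Sob_partial_norm m A (\<lambda>\<alpha>. a \<alpha> + b \<alpha>) \<le> Sob_norm m a + Sob_norm m b" if "finite A" for A
    using Sob_partial_norm_triangle[of m A a b] Sob_partial_norm_le_Sob_norm[OF assms(1) that] Sob_partial_norm_le_Sob_norm[OF assms(2) that] by linarith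
  note le = this
  show "(\<lambda>\<alpha>. a \<alpha> + b \<alpha>) \<in> Sob m" by (rule Sob_I) (rule le)
  show "Sob_norm m (\<lambda>\<alpha>. a \<alpha> + b \<alpha>) \<le> Sob_norm m a + Sob_norm m b" by (rule Sob_norm_le) (rule le)
qed

lemma Sob_norm_nonneg: "0 \<le> Sob_norm m a"
  unfolding Sob_norm_def by (intro real_sqrt_ge_zero infsum_nonneg weight_nonneg)

lemma
  shows Sob_norm_scale: "Sob_norm m (\<lambda>\<alpha>. c * a \<alpha>) = norm c * Sob_norm m a"
    and Sob_scale: "a \<in> Sob m \<Longrightarrow> (\<lambda>\<alpha>. c * a \<alpha>) \<in> Sob m"
proof -
  have e: "Hermite_eigenvalue \<alpha> ^ (2 * m) * (norm (c * a \<alpha>))\<^sup>2 = (norm c)\<^sup>2 * (Hermite_eigenvalue \<alpha> ^ (2 * m) * (norm (a \<alpha>))\<^sup>2)" for \<alpha>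
    by (simp add: norm_mult power_mult_distrib)
  show "Sob_norm m (\<lambda>\<alpha>. c * a \<alpha>) = norm c * Sob_norm m a" unfolding Sob_norm_def e by (simp add: infsum_cmult_right' real_sqrt_mult)
  show "a \<in> Sob m \<Longrightarrow> (\<lambda>\<alpha>. c * a \<alpha>) \<in> Sob m" unfolding Sob_def e mem_Collect_eq by (rule summable_on_cmult_right)
qed

lemma Sob_diff: "a \<in> Sob m \<Longrightarrow> b \<in> Sob m \<Longrightarrow> (\<lambda>\<alpha>. a \<alpha> - b \<alpha>) \<in> Sob m"
  using Sob_add[of a m "\<lambda>\<alpha>. - 1 * b \<alpha>"] Sob_scale[of b m "- 1"] by simp

lemma norm_le_Sob_norm:
  assumes "a \<in> Sob m" shows "norm (a \<alpha>) \<le> Sob_norm m a"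
proof -
  have "1 * norm (a \<alpha>) \<le> Hermite_eigenvalue \<alpha> ^ m * norm (a \<alpha>)"
    by (intro mult_right_mono one_le_power eigenvalue_ge_1) auto
  also have "\<dots> = Sob_partial_norm m {\<alpha>} a" using eigenvalue_pos[of \<alpha>] by (simp add: Sob_partial_norm_def)
  also have "\<dots> \<le> Sob_norm m a" by (rule Sob_partial_norm_le_Sob_norm[OF assms]) simp
  finally show ?thesis by simp
qed

lemma Sob_l2:
  assumes "a \<in> Sob m" shows "(\<lambda>\<alpha>. (norm (a \<alpha>))\<^sup>2) summable_on UNIV"
proof (rule summable_on_comparison_test[OF assms[unfolded Sob_def mem_Collect_eq]])
  fix \<alpha> :: "nat ^ 'a"
  have "1 * (norm (a \<alpha>))\<^sup>2 \<le> Hermite_eigenvalue \<alpha> ^ (2 * m) * (norm (a \<alpha>))\<^sup>2"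
    by (intro mult_right_mono one_le_power eigenvalue_ge_1) auto
  then show "(norm (a \<alpha>))\<^sup>2 \<le> Hermite_eigenvalue \<alpha> ^ (2 * m) * (norm (a \<alpha>))\<^sup>2" by simp
qed simp

section \<open>The sequence space as a complete metric space\<close>

definition Sob_dist :: "nat \<Rightarrow> (nat ^ 'n \<Rightarrow> complex) \<Rightarrow> (nat ^ 'n \<Rightarrow> complex) \<Rightarrow> real" where
  "Sob_dist m a b = Sob_norm m (\<lambda>\<alpha>. a \<alpha> - b \<alpha>)"

lemma Sob_dist_nonneg: "0 \<le> Sob_dist m a b"
  unfolding Sob_dist_def by (rule Sob_norm_nonneg)

lemma Sob_dist_self: "Sob_dist m a a = 0"
  by (simp add: Sob_dist_def Sob_norm_def)

lemma Sob_dist_commute: "Sob_dist m a b = Sob_dist m b a"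
  using Sob_norm_scale[of m "- 1" "\<lambda>\<alpha>. a \<alpha> - b \<alpha>"] by (simp add: Sob_dist_def)

lemma Sob_dist_triangle: "a \<in> Sob m \<Longrightarrow> b \<in> Sob m \<Longrightarrow> c \<in> Sob m \<Longrightarrow> Sob_dist m a c \<le> Sob_dist m a b + Sob_dist m b c"
  using Sob_norm_add[OF Sob_diff[of a m b] Sob_diff[of b m c]] by (simp add: Sob_dist_def)

lemma Sob_dist_0: "a \<in> Sob m \<Longrightarrow> b \<in> Sob m \<Longrightarrow> Sob_dist m a b = 0 \<Longrightarrow> a = b"
  using norm_le_Sob_norm[OF Sob_diff[of a m b]] by (auto simp: Sob_dist_def fun_eq_iff)

lemma Sob_norm_Sob_dist: "a \<in> Sob m \<Longrightarrow> b \<in> Sob m \<Longrightarrow> \<bar>Sob_norm m a - Sob_norm m b\<bar> \<le> Sob_dist m a b"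
  using Sob_norm_add[OF Sob_diff[of a m b], of b] Sob_norm_add[OF Sob_diff[of b m a], of a] Sob_dist_commute[of m a b]
  by (simp add: Sob_dist_def)

text \<open>Coordinates converge because single coefficients are bounded by the norm. The Cauchy
  estimate passes to the limit on finite index sets, hence to the norm, and
  \<open>b = a K - (a K - b)\<close> lies in the space.\<close>

lemma Sob_complete:
  fixes a :: "nat \<Rightarrow> nat ^ 'n \<Rightarrow> complex"
  assumes a: "\<And>k. a k \<in> Sob m" and C: "\<And>e. e > 0 \<Longrightarrow> \<exists>K. \<forall>j\<ge>K. \<forall>k\<ge>K. Sob_dist m (a j) (a k) < e"
  obtains b where "b \<in> Sob m" "(\<lambda>k. Sob_dist m (a k) b) \<longlonglongrightarrow> 0"
proof -
  have "Cauchy (\<lambda>k. a k \<alpha>)" for \<alpha>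
  proof (rule CauchyI)
    fix e :: real assume "e > 0"
    from C[OF this] obtain K where K: "\<forall>j\<ge>K. \<forall>k\<ge>K. Sob_dist m (a j) (a k) < e" by blast
    show "\<exists>M. \<forall>j\<ge>M. \<forall>k\<ge>M. norm (a j \<alpha> - a k \<alpha>) < e"
    proof (intro exI allI impI)
      fix j k assume jk: "K \<le> j" "K \<le> k"
      have "norm (a j \<alpha> - a k \<alpha>) \<le> Sob_dist m (a j) (a k)" unfolding Sob_dist_def by (rule norm_le_Sob_norm[OF Sob_diff[OF a a]])
      also have "\<dots> < e" using K jk by blast
      finally show "norm (a j \<alpha> - a k \<alpha>) < e" .
    qed
  qed
  then have "\<exists>b. \<forall>\<alpha>. (\<lambda>k. a k \<alpha>) \<longlonglongrightarrow> b \<alpha>" by (intro choice allI) (simp add: Cauchy_convergent_iff convergent_def)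
  then obtain b where b: "\<And>\<alpha>. (\<lambda>k. a k \<alpha>) \<longlonglongrightarrow> b \<alpha>" by blast
  have fb: "Sob_partial_norm m A (\<lambda>\<alpha>. a k \<alpha> - b \<alpha>) \<le> e" if K: "\<forall>j\<ge>K. \<forall>k\<ge>K. Sob_dist m (a j) (a k) < e" and k: "k \<ge> K" and A: "finite A" for A K k e
  proof (rule LIMSEQ_le_const2)
    show "(\<lambda>j. Sob_partial_norm m A (\<lambda>\<alpha>. a k \<alpha> - a j \<alpha>)) \<longlonglongrightarrow> Sob_partial_norm m A (\<lambda>\<alpha>. a k \<alpha> - b \<alpha>)"
      unfolding Sob_partial_norm_eq by (intro tendsto_intros b)
    have "Sob_partial_norm m A (\<lambda>\<alpha>. a k \<alpha> - a j \<alpha>) \<le> e" if "j \<ge> K" for j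
      using Sob_partial_norm_le_Sob_norm[OF Sob_diff[OF a[of k] a[of j]] A] K[rule_format, OF k that] unfolding Sob_dist_def by linarith
    then show "\<exists>N. \<forall>j\<ge>N. Sob_partial_norm m A (\<lambda>\<alpha>. a k \<alpha> - a j \<alpha>) \<le> e" by blast
  qed
  have bd: "(\<lambda>\<alpha>. a k \<alpha> - b \<alpha>) \<in> Sob m \<and> Sob_dist m (a k) b \<le> e" if K: "\<forall>j\<ge>K. \<forall>k\<ge>K. Sob_dist m (a j) (a k) < e" and k: "k \<ge> K" for K k e
    unfolding Sob_dist_def using Sob_I[OF fb[OF K k]] Sob_norm_le[OF fb[OF K k]] by blast
  obtain K where K: "\<forall>j\<ge>K. \<forall>k\<ge>K. Sob_dist m (a j) (a k) < 1" using C[of 1] by auto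
  have bH: "b \<in> Sob m" using Sob_diff[OF a[of K] conjunct1[OF bd[OF K order_refl]]] by simp
  have "(\<lambda>k. Sob_dist m (a k) b) \<longlonglongrightarrow> 0"
  proof (rule LIMSEQ_I)
    fix e :: real assume "e > 0"
    then have "e / 2 > 0" by simp
    from C[OF this] obtain K where K: "\<forall>j\<ge>K. \<forall>k\<ge>K. Sob_dist m (a j) (a k) < e / 2" by blast
    have "norm (Sob_dist m (a k) b - 0) < e" if "k \<ge> K" for k
      using bd[OF K that] Sob_dist_nonneg[of m "a k" b] \<open>e > 0\<close> by simp
    then show "\<exists>no. \<forall>n\<ge>no. norm (Sob_dist m (a n) b - 0) < e" by blast
  qed
  with bH show ?thesis by (rule that)
qed

lemma Sob_truncation:
  fixes b :: "nat ^ 'n \<Rightarrow> complex"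
  assumes b: "b \<in> Sob m"
  shows "(\<lambda>k. Sob_dist m (\<lambda>\<alpha>. if \<alpha> \<in> initial_set k then b \<alpha> else 0) b) \<longlonglongrightarrow> 0"
proof -
  define w where "w \<alpha> = Hermite_eigenvalue \<alpha> ^ (2 * m) * (norm (b \<alpha>))\<^sup>2" for \<alpha>
  have w: "w summable_on UNIV" using b unfolding Sob_def w_def[abs_def] by simp
  have "Sob_dist m (\<lambda>\<alpha>. if \<alpha> \<in> initial_set k then b \<alpha> else 0) b = sqrt (infsum w UNIV - sum w (initial_set k))" for k
  proof -
    have "(\<Sum>\<^sub>\<infinity>\<alpha>. Hermite_eigenvalue \<alpha> ^ (2 * m) * (norm ((if \<alpha> \<in> initial_set k then b \<alpha> else 0) - b \<alpha>))\<^sup>2) = infsum w (UNIV - initial_set k)"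
      by (rule infsum_cong_neutral) (auto simp: w_def)
    also have "\<dots> = infsum w UNIV - infsum w (initial_set k)"
      by (rule infsum_Diff[OF w]) (auto intro: summable_on_finite)
    finally show ?thesis by (simp add: Sob_dist_def Sob_norm_def)
  qed
  moreover have "(\<lambda>k. sqrt (infsum w UNIV - sum w (initial_set k))) \<longlonglongrightarrow> sqrt (infsum w UNIV - infsum w UNIV)"
    by (intro tendsto_intros has_sum_initial_set[OF has_sum_infsum[OF w]])
  ultimately show ?thesis by simp
qed

section \<open>The heat series as an injective linear map\<close>

lemma heat_add:
  assumes t: "t > 0" and a: "a \<in> Sob m" and b: "b \<in> Sob m"
  shows "heat t (\<lambda>\<alpha>. a \<alpha> + b \<alpha>) = (\<lambda>z. heat t a z + heat t b z)"
proof
  fix z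
  have "((\<lambda>\<alpha>. heat_term t a \<alpha> z + heat_term t b \<alpha> z) has_sum heat t a z + heat t b z) UNIV"
    by (intro has_sum_add heat_has_sum[OF t norm_le_Sob_norm[OF a]] heat_has_sum[OF t norm_le_Sob_norm[OF b]])
  then show "heat t (\<lambda>\<alpha>. a \<alpha> + b \<alpha>) z = heat t a z + heat t b z"
    unfolding heat_def[of t "\<lambda>\<alpha>. a \<alpha> + b \<alpha>"] by (intro infsumI) (simp add: heat_term_def distrib_right)
qed

lemma heat_scale: "heat t (\<lambda>\<alpha>. c * a \<alpha>) = (\<lambda>z. c * heat t a z)"
  unfolding heat_def[abs_def] by (simp add: heat_term_def mult.assoc infsum_cmult_right')

lemma heat_inj:
  assumes t: "t > 0" and a: "a \<in> Sob m" and b: "b \<in> Sob m" and eq: "heat t a = heat t b"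
  shows "a = b"
proof
  fix \<alpha>
  have "a \<alpha> * complex_of_real (exp (- (Hermite_eigenvalue \<alpha> * t))) = b \<alpha> * complex_of_real (exp (- (Hermite_eigenvalue \<alpha> * t)))"
    unfolding heat_coeff[OF t Sob_l2[OF a], symmetric] heat_coeff[OF t Sob_l2[OF b], symmetric] eq ..
  then show "a \<alpha> = b \<alpha>" by simp
qed

lemma heat_finite_F_space:
  assumes t: "t > 0" and A: "finite A"
  shows "heat t (\<lambda>\<alpha>. if \<alpha> \<in> A then b \<alpha> else 0) \<in> F_space t m"
proof -
  have "heat t (\<lambda>\<alpha>. if \<alpha> \<in> A then b \<alpha> else 0) z = (\<Sum>\<alpha>\<in>A. heat_term t b \<alpha> z)" for z
  proof -
    have "heat t (\<lambda>\<alpha>. if \<alpha> \<in> A then b \<alpha> else 0) z = (\<Sum>\<^sub>\<infinity>\<alpha>\<in>A. heat_term t b \<alpha> z)"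
      unfolding heat_def by (rule infsum_cong_neutral) (auto simp: heat_term_def)
    then show ?thesis using A by simp
  qed
  moreover have "(\<lambda>z. \<Sum>\<alpha>\<in>A. heat_term t b \<alpha> z) \<in> F_space t m"
    unfolding heat_term_def by (intro F_space_sum[OF t] F_space_scale[OF t] F_space_Phi_c[OF t])
  ultimately show ?thesis by presburger
qed

text \<open>The constant of the theorem, \<open>(2 pi) ^ (n / 4) * 2 ^ m\<close>.\<close>

definition F_const :: "'n itself \<Rightarrow> nat \<Rightarrow> real" where
  "F_const _ m = sqrt (C0 TYPE('n)) * 2 ^ m"

lemma F_const_pos: "F_const TYPE('n) m > 0"
  using C0_pos[where 'n = 'n] by (simp add: F_const_def)

text \<open>The inverse of \<open>heat t\<close> on the image of \<open>Sob m\<close>, well defined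
  there by injectivity.\<close>

definition Sob_coeff :: "real \<Rightarrow> nat \<Rightarrow> (complex ^ 'n \<Rightarrow> complex) \<Rightarrow> nat ^ 'n \<Rightarrow> complex" where
  "Sob_coeff t m F = (THE a. a \<in> Sob m \<and> F = heat t a)"

lemma Sob_coeff_heat:
  assumes "t > 0" "a \<in> Sob m" shows "Sob_coeff t m (heat t a) = a"
  unfolding Sob_coeff_def using assms heat_inj by blast

lemma
  fixes F :: "complex ^ 'n \<Rightarrow> complex"
  assumes t: "t > 0" and F: "F \<in> F_space t m"
  shows Sob_coeff_Sob: "Sob_coeff t m F \<in> Sob m" and heat_Sob_coeff: "heat t (Sob_coeff t m F) = F"
    and F_norm_Sob_coeff: "F_norm t m F = F_const TYPE('n) m * Sob_norm m (Sob_coeff t m F)"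
proof -
  obtain a where a: "(\<lambda>\<alpha>. Hermite_eigenvalue \<alpha> ^ (2 * m) * (norm (a \<alpha>))\<^sup>2) summable_on UNIV" "F = heat t a"
    "F_norm t m F = sqrt (C0 TYPE('n)) * 2 ^ m * sqrt (\<Sum>\<^sub>\<infinity>\<alpha>. Hermite_eigenvalue \<alpha> ^ (2 * m) * (norm (a \<alpha>))\<^sup>2)"
    by (rule F_space_heat[OF t F])
  have aH: "a \<in> Sob m" using a(1) by (simp add: Sob_def)
  have c: "Sob_coeff t m F = a" unfolding a(2) by (rule Sob_coeff_heat[OF t aH])
  show "Sob_coeff t m F \<in> Sob m" "heat t (Sob_coeff t m F) = F" "F_norm t m F = F_const TYPE('n) m * Sob_norm m (Sob_coeff t m F)"
    unfolding c using aH a by (auto simp: Sob_norm_def F_const_def)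
qed

lemma Sob_coeff_add:
  assumes t: "t > 0" and F: "F \<in> F_space t m" and G: "G \<in> F_space t m"
  shows "Sob_coeff t m (\<lambda>z. F z + G z) = (\<lambda>\<alpha>. Sob_coeff t m F \<alpha> + Sob_coeff t m G \<alpha>)"
  using Sob_coeff_heat[OF t Sob_add[OF Sob_coeff_Sob[OF t F] Sob_coeff_Sob[OF t G]]]
  unfolding heat_add[OF t Sob_coeff_Sob[OF t F] Sob_coeff_Sob[OF t G]] heat_Sob_coeff[OF t F] heat_Sob_coeff[OF t G] .

lemma Sob_coeff_scale:
  assumes t: "t > 0" and F: "F \<in> F_space t m"
  shows "Sob_coeff t m (\<lambda>z. c * F z) = (\<lambda>\<alpha>. c * Sob_coeff t m F \<alpha>)"
  using Sob_coeff_heat[OF t Sob_scale[OF Sob_coeff_Sob[OF t F], of c]] unfolding heat_scale heat_Sob_coeff[OF t F] .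

lemma F_norm_diff:
  fixes F G :: "complex ^ 'n \<Rightarrow> complex"
  assumes t: "t > 0" and F: "F \<in> F_space t m" and G: "G \<in> F_space t m"
  shows "F_norm t m (\<lambda>z. F z - G z) = F_const TYPE('n) m * Sob_dist m (Sob_coeff t m F) (Sob_coeff t m G)"
proof -
  have "(\<lambda>z. F z + - 1 * G z) \<in> F_space t m" by (intro F_space_add[OF t F] F_space_scale[OF t G])
  from F_norm_Sob_coeff[OF t this] show ?thesis
    unfolding Sob_coeff_add[OF t F F_space_scale[OF t G]] Sob_coeff_scale[OF t G] by (simp add: Sob_dist_def)
qed

section \<open>Points of the completion as limits of coefficient sequences\<close>

text \<open>A point of the completion described by its limit \<open>b\<close>. These sets turn out
  to be exactly the equivalence classes of Cauchy sequences, so that \<open>Sob m\<close> takes the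
  place of the quotient.\<close>

definition coeff_class :: "real \<Rightarrow> nat \<Rightarrow> (nat ^ 'n \<Rightarrow> complex) \<Rightarrow> (complex ^ 'n) compl" where
  "coeff_class t m b = {X. (\<forall>k. X k \<in> F_space t m) \<and> (\<lambda>k. Sob_dist m (Sob_coeff t m (X k)) b) \<longlonglongrightarrow> 0}"

lemma coeff_class_Cauchy:
  fixes b :: "nat ^ 'n \<Rightarrow> complex"
  assumes t: "t > 0" and b: "b \<in> Sob m" and X: "X \<in> coeff_class t m b"
  shows "X \<in> Cauchy_seqs (F_space t m) (F_norm t m)"
proof -
  have V: "X k \<in> F_space t m" and lim: "(\<lambda>k. Sob_dist m (Sob_coeff t m (X k)) b) \<longlonglongrightarrow> 0" for k using X by (auto simp: coeff_class_def)
  have "\<exists>K. \<forall>j\<ge>K. \<forall>k\<ge>K. F_norm t m (\<lambda>z. X j z - X k z) < e" if e: "e > 0" for e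
  proof -
    define d where "d = e / F_const TYPE('n) m / 2"
    have d: "d > 0" using e F_const_pos[where 'n = 'n] by (simp add: d_def)
    from LIMSEQ_D[OF lim this] obtain K where K: "\<forall>k\<ge>K. norm (Sob_dist m (Sob_coeff t m (X k)) b - 0) < d" by blast
    have "F_norm t m (\<lambda>z. X j z - X k z) < e" if "j \<ge> K" "k \<ge> K" for j k
    proof -
      have "Sob_dist m (Sob_coeff t m (X j)) (Sob_coeff t m (X k)) \<le> Sob_dist m (Sob_coeff t m (X j)) b + Sob_dist m b (Sob_coeff t m (X k))"
        by (intro Sob_dist_triangle Sob_coeff_Sob[OF t V] b)
      also have "\<dots> < d + d" using K that Sob_dist_commute[of m b] by (intro add_strict_mono) auto
      finally have "F_const TYPE('n) m * Sob_dist m (Sob_coeff t m (X j)) (Sob_coeff t m (X k)) < F_const TYPE('n) m * (d + d)"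
        using F_const_pos[where 'n = 'n] by (rule mult_strict_left_mono)
      also have "\<dots> = e" using F_const_pos[where 'n = 'n and m = m] by (simp add: d_def)
      finally show ?thesis unfolding F_norm_diff[OF t V V] .
    qed
    then show ?thesis by blast
  qed
  then show ?thesis using V by (simp add: Cauchy_seqs_def)
qed

lemma Cauchy_coeff_class:
  fixes X :: "nat \<Rightarrow> complex ^ 'n \<Rightarrow> complex"
  assumes t: "t > 0" and X: "X \<in> Cauchy_seqs (F_space t m) (F_norm t m)"
  obtains b where "b \<in> Sob m" "X \<in> coeff_class t m b"
proof -
  have V: "X k \<in> F_space t m" for k using X by (simp add: Cauchy_seqs_def)
  have "\<exists>K. \<forall>j\<ge>K. \<forall>k\<ge>K. Sob_dist m (Sob_coeff t m (X j)) (Sob_coeff t m (X k)) < e" if e: "e > 0" for e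
  proof -
    have "F_const TYPE('n) m * e > 0" using e F_const_pos[where 'n = 'n] by simp
    then obtain K where "\<forall>j\<ge>K. \<forall>k\<ge>K. F_norm t m (\<lambda>z. X j z - X k z) < F_const TYPE('n) m * e"
      using X unfolding Cauchy_seqs_def by blast
    then show ?thesis unfolding F_norm_diff[OF t V V] mult_less_cancel_left_pos[OF F_const_pos] by blast
  qed
  from Sob_complete[OF Sob_coeff_Sob[OF t V] this] obtain b where "b \<in> Sob m" "(\<lambda>k. Sob_dist m (Sob_coeff t m (X k)) b) \<longlonglongrightarrow> 0" by blast
  then show ?thesis using V by (intro that[of b]) (auto simp: coeff_class_def)
qed

lemma Sob_dist_squeeze:
  assumes "(\<lambda>k. r k + s k) \<longlonglongrightarrow> 0" "\<And>k. Sob_dist m (a k) (b k) \<le> r k + s k"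
  shows "(\<lambda>k. Sob_dist m (a k) (b k)) \<longlonglongrightarrow> 0"
proof (rule tendsto_sandwich[OF _ _ tendsto_const assms(1)])
  show "\<forall>\<^sub>F k in sequentially. 0 \<le> Sob_dist m (a k) (b k)" by (simp add: Sob_dist_nonneg)
  show "\<forall>\<^sub>F k in sequentially. Sob_dist m (a k) (b k) \<le> r k + s k" by (rule always_eventually) (rule allI, rule assms(2))
qed

lemma null_rel_coeff_class:
  fixes b :: "nat ^ 'n \<Rightarrow> complex"
  assumes t: "t > 0" and b: "b \<in> Sob m" and X: "X \<in> coeff_class t m b"
  shows "null_rel (F_space t m) (F_norm t m) `` {X} = coeff_class t m b"
proof -
  have V: "X k \<in> F_space t m" and lim: "(\<lambda>k. Sob_dist m (Sob_coeff t m (X k)) b) \<longlonglongrightarrow> 0" for k using X by (auto simp: coeff_class_def)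
  have c0: "F_const TYPE('n) m \<noteq> 0" using F_const_pos[where 'n = 'n and m = m] by simp
  have "(X, Y) \<in> null_rel (F_space t m) (F_norm t m) \<longleftrightarrow> Y \<in> coeff_class t m b" for Y
  proof
    assume "(X, Y) \<in> null_rel (F_space t m) (F_norm t m)"
    then have W: "Y k \<in> F_space t m" and l: "(\<lambda>k. F_norm t m (\<lambda>z. X k z - Y k z)) \<longlonglongrightarrow> 0" for k
      by (auto simp: null_rel_def Cauchy_seqs_def)
    have l': "(\<lambda>k. Sob_dist m (Sob_coeff t m (Y k)) (Sob_coeff t m (X k))) \<longlonglongrightarrow> 0"
      using tendsto_mult_left[OF l, of "1 / F_const TYPE('n) m"] c0 unfolding F_norm_diff[OF t V W] Sob_dist_commute[of m "Sob_coeff t m (X _)"] by simp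
    have "(\<lambda>k. Sob_dist m (Sob_coeff t m (Y k)) b) \<longlonglongrightarrow> 0"
      by (rule Sob_dist_squeeze[OF tendsto_add[OF l' lim, unfolded add_0] Sob_dist_triangle[OF Sob_coeff_Sob[OF t W] Sob_coeff_Sob[OF t V] b]])
    then show "Y \<in> coeff_class t m b" using W by (simp add: coeff_class_def)
  next
    assume Y: "Y \<in> coeff_class t m b"
    then have W: "Y k \<in> F_space t m" and l: "(\<lambda>k. Sob_dist m b (Sob_coeff t m (Y k))) \<longlonglongrightarrow> 0" for k
      by (auto simp: coeff_class_def Sob_dist_commute[of m b])
    have "(\<lambda>k. Sob_dist m (Sob_coeff t m (X k)) (Sob_coeff t m (Y k))) \<longlonglongrightarrow> 0"
      by (rule Sob_dist_squeeze[OF tendsto_add[OF lim l, unfolded add_0] Sob_dist_triangle[OF Sob_coeff_Sob[OF t V] b Sob_coeff_Sob[OF t W]]])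
    from tendsto_mult_left[OF this, of "F_const TYPE('n) m"]
    have "(\<lambda>k. F_norm t m (\<lambda>z. X k z - Y k z)) \<longlonglongrightarrow> 0" unfolding F_norm_diff[OF t V W] by simp
    then show "(X, Y) \<in> null_rel (F_space t m) (F_norm t m)"
      using coeff_class_Cauchy[OF t b X] coeff_class_Cauchy[OF t b Y] by (simp add: null_rel_def)
  qed
  then show ?thesis by blast
qed

text \<open>Density: truncations of \<open>b\<close> give finite combinations of the
  \<open>Phi_c\<close>, which belong to \<open>F_space\<close>, so every element of
  \<open>Sob m\<close> is the limit of some Cauchy sequence.\<close>

lemma coeff_class_nonempty:
  assumes t: "t > 0" and b: "b \<in> Sob m"
  obtains X where "X \<in> coeff_class t m b"
proof
  define a where "a k = (\<lambda>\<alpha>. if \<alpha> \<in> initial_set k then b \<alpha> else 0)" for k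
  have V: "heat t (a k) \<in> F_space t m" for k unfolding a_def by (rule heat_finite_F_space[OF t]) simp
  have aH: "a k \<in> Sob m" for k
    unfolding a_def Sob_def mem_Collect_eq by (rule summable_on_comparison_test[OF b[unfolded Sob_def mem_Collect_eq]]) (auto simp: weight_nonneg eigenvalue_pos less_imp_le)
  show "(\<lambda>k. heat t (a k)) \<in> coeff_class t m b"
    using V Sob_truncation[OF b] unfolding a_def[symmetric] coeff_class_def by (simp add: Sob_coeff_heat[OF t aH])
qed

lemma coeff_class_inj:
  assumes t: "t > 0" and b: "b \<in> Sob m" and b': "b' \<in> Sob m" and eq: "coeff_class t m b = coeff_class t m b'"
  shows "b = b'"
proof -
  obtain X where X: "X \<in> coeff_class t m b" by (rule coeff_class_nonempty[OF t b])
  have V: "X k \<in> F_space t m" and l: "(\<lambda>k. Sob_dist m b (Sob_coeff t m (X k))) \<longlonglongrightarrow> 0" and l': "(\<lambda>k. Sob_dist m (Sob_coeff t m (X k)) b') \<longlonglongrightarrow> 0" for k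
    using X X[unfolded eq] by (auto simp: coeff_class_def Sob_dist_commute[of m b])
  have "(\<lambda>k. Sob_dist m b b') \<longlonglongrightarrow> 0"
    by (rule Sob_dist_squeeze[OF tendsto_add[OF l l', unfolded add_0] Sob_dist_triangle[OF b Sob_coeff_Sob[OF t V] b']])
  then have "Sob_dist m b b' = 0" by (simp add: LIMSEQ_const_iff)
  then show ?thesis by (rule Sob_dist_0[OF b b'])
qed

lemma B_space_eq:
  assumes t: "t > 0"
  shows "B_space t m = coeff_class t m ` (Sob m :: (nat ^ 'n \<Rightarrow> complex) set)"
proof (intro equalityI subsetI)
  fix B :: "(complex ^ 'n) compl"
  assume "B \<in> B_space t m"
  then have "B \<in> Cauchy_seqs (F_space t m) (F_norm t m) // null_rel (F_space t m) (F_norm t m)"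
    by (simp only: B_space_def compl_space_def)
  then obtain X where X: "X \<in> Cauchy_seqs (F_space t m) (F_norm t m)" "B = null_rel (F_space t m) (F_norm t m) `` {X}"
    by (rule quotientE) (rule that)
  obtain b where b: "b \<in> Sob m" "X \<in> coeff_class t m b" by (rule Cauchy_coeff_class[OF t X(1)])
  show "B \<in> coeff_class t m ` Sob m" unfolding X(2) null_rel_coeff_class[OF t b] by (rule imageI[OF b(1)])
next
  fix B :: "(complex ^ 'n) compl"
  assume "B \<in> coeff_class t m ` Sob m"
  then obtain b where b: "b \<in> Sob m" "B = coeff_class t m b" by (rule imageE) (rule that)
  obtain X where X: "X \<in> coeff_class t m b" by (rule coeff_class_nonempty[OF t b(1)])
  show "B \<in> B_space t m"
    unfolding B_space_def compl_space_def b(2) null_rel_coeff_class[OF t b(1) X, symmetric]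
    by (rule quotientI[OF coeff_class_Cauchy[OF t b(1) X]])
qed

text \<open>The union over all representatives collapses because every pair yields the same class;
  it equals that class because both sets of representatives are nonempty.\<close>

lemma B_add_coeff_class:
  assumes t: "t > 0" and a: "a \<in> Sob m" and b: "b \<in> Sob m"
  shows "B_add t m (coeff_class t m a) (coeff_class t m b) = coeff_class t m (\<lambda>\<alpha>. a \<alpha> + b \<alpha>)"
proof -
  have "null_rel (F_space t m) (F_norm t m) `` {\<lambda>k z. X k z + Y k z} = coeff_class t m (\<lambda>\<alpha>. a \<alpha> + b \<alpha>)"
    if X: "X \<in> coeff_class t m a" and Y: "Y \<in> coeff_class t m b" for X Y
  proof (rule null_rel_coeff_class[OF t Sob_add[OF a b]])
    have V: "X k \<in> F_space t m" "Y k \<in> F_space t m" for k using X Y by (auto simp: coeff_class_def)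
    have lX: "(\<lambda>k. Sob_dist m (Sob_coeff t m (X k)) a) \<longlonglongrightarrow> 0" and lY: "(\<lambda>k. Sob_dist m (Sob_coeff t m (Y k)) b) \<longlonglongrightarrow> 0"
      using X Y by (auto simp: coeff_class_def)
    have "Sob_dist m (\<lambda>\<alpha>. p \<alpha> + q \<alpha>) (\<lambda>\<alpha>. a \<alpha> + b \<alpha>) \<le> Sob_dist m p a + Sob_dist m q b" if "p \<in> Sob m" "q \<in> Sob m" for p q
      using Sob_norm_add[OF Sob_diff[OF that(1) a] Sob_diff[OF that(2) b]] by (simp add: Sob_dist_def algebra_simps)
    from Sob_dist_squeeze[OF tendsto_add[OF lX lY, unfolded add_0] this[OF Sob_coeff_Sob[OF t V(1)] Sob_coeff_Sob[OF t V(2)]]]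
    have "(\<lambda>k. Sob_dist m (Sob_coeff t m (\<lambda>z. X k z + Y k z)) (\<lambda>\<alpha>. a \<alpha> + b \<alpha>)) \<longlonglongrightarrow> 0" unfolding Sob_coeff_add[OF t V] .
    then show "(\<lambda>k z. X k z + Y k z) \<in> coeff_class t m (\<lambda>\<alpha>. a \<alpha> + b \<alpha>)" using F_space_add[OF t V] by (simp add: coeff_class_def)
  qed
  moreover obtain X Y where "X \<in> coeff_class t m a" "Y \<in> coeff_class t m b" using coeff_class_nonempty[OF t a] coeff_class_nonempty[OF t b] by metis
  ultimately show ?thesis unfolding B_add_def compl_add_def by blast
qed

lemma B_scale_coeff_class:
  assumes t: "t > 0" and a: "a \<in> Sob m"
  shows "B_scale t m c (coeff_class t m a) = coeff_class t m (\<lambda>\<alpha>. c * a \<alpha>)"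
proof -
  have "null_rel (F_space t m) (F_norm t m) `` {\<lambda>k z. c * X k z} = coeff_class t m (\<lambda>\<alpha>. c * a \<alpha>)"
    if X: "X \<in> coeff_class t m a" for X
  proof (rule null_rel_coeff_class[OF t Sob_scale[OF a]])
    have V: "X k \<in> F_space t m" for k using X by (auto simp: coeff_class_def)
    have lX: "(\<lambda>k. Sob_dist m (Sob_coeff t m (X k)) a) \<longlonglongrightarrow> 0" using X by (auto simp: coeff_class_def)
    have e: "Sob_dist m (\<lambda>\<alpha>. c * p \<alpha>) (\<lambda>\<alpha>. c * a \<alpha>) = norm c * Sob_dist m p a" for p
      unfolding Sob_dist_def right_diff_distrib[symmetric] by (rule Sob_norm_scale)
    from tendsto_mult_left[OF lX, of "norm c"]
    have "(\<lambda>k. Sob_dist m (Sob_coeff t m (\<lambda>z. c * X k z)) (\<lambda>\<alpha>. c * a \<alpha>)) \<longlonglongrightarrow> 0" unfolding Sob_coeff_scale[OF t V] e by simp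
    then show "(\<lambda>k z. c * X k z) \<in> coeff_class t m (\<lambda>\<alpha>. c * a \<alpha>)" using F_space_scale[OF t V] by (simp add: coeff_class_def)
  qed
  moreover obtain X where "X \<in> coeff_class t m a" by (rule coeff_class_nonempty[OF t a])
  ultimately show ?thesis unfolding B_scale_def compl_scale_def by blast
qed

lemma B_embed_coeff_class:
  assumes t: "t > 0" and F: "F \<in> F_space t m"
  shows "B_embed t m F = coeff_class t m (Sob_coeff t m F)"
  unfolding B_embed_def compl_embed_def
  by (rule null_rel_coeff_class[OF t Sob_coeff_Sob[OF t F]]) (simp add: coeff_class_def F Sob_dist_self)

text \<open>The norms converge along every representative by the reverse triangle inequality, and a
  representative exists, so the definite description has exactly one value.\<close>

lemma B_norm_coeff_class:
  fixes b :: "nat ^ 'n \<Rightarrow> complex"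
  assumes t: "t > 0" and b: "b \<in> Sob m"
  shows "B_norm t m (coeff_class t m b) = F_const TYPE('n) m * Sob_norm m b"
proof -
  have lim: "(\<lambda>k. F_norm t m (X k)) \<longlonglongrightarrow> F_const TYPE('n) m * Sob_norm m b" if X: "X \<in> coeff_class t m b" for X
  proof -
    have V: "X k \<in> F_space t m" and l: "(\<lambda>k. Sob_dist m (Sob_coeff t m (X k)) b) \<longlonglongrightarrow> 0" for k using X by (auto simp: coeff_class_def)
    have "(\<lambda>k. Sob_norm m (Sob_coeff t m (X k))) \<longlonglongrightarrow> Sob_norm m b"
    proof (rule LIM_zero_cancel, rule tendsto_rabs_zero_cancel)
      show "(\<lambda>k. \<bar>Sob_norm m (Sob_coeff t m (X k)) - Sob_norm m b\<bar>) \<longlonglongrightarrow> 0"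
        by (rule tendsto_sandwich[OF _ _ tendsto_const l]) (auto intro!: always_eventually Sob_norm_Sob_dist Sob_coeff_Sob[OF t V] b)
    qed
    then show ?thesis unfolding F_norm_Sob_coeff[OF t V] by (rule tendsto_mult_left)
  qed
  obtain X where X: "X \<in> coeff_class t m b" by (rule coeff_class_nonempty[OF t b])
  show ?thesis
    unfolding B_norm_def compl_norm_def
  proof (rule the_equality)
    show "\<forall>X\<in>coeff_class t m b. (\<lambda>k. F_norm t m (X k)) \<longlonglongrightarrow> F_const TYPE('n) m * Sob_norm m b" using lim by blast
    show "r = F_const TYPE('n) m * Sob_norm m b" if "\<forall>X\<in>coeff_class t m b. (\<lambda>k. F_norm t m (X k)) \<longlonglongrightarrow> r" for r
      using that X lim[OF X] LIMSEQ_unique by blast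
  qed
qed

section \<open>Both Sobolev spaces in terms of coefficients\<close>

lemma WH_iff: "f \<in> WH m \<longleftrightarrow> f \<in> L2_Rn \<and> Hermite_coeff f \<in> Sob m"
  by (simp add: WH_def Sob_def)

lemma WH_norm_eq: "WH_norm m f = Sob_norm m (Hermite_coeff f)"
  by (simp add: WH_norm_def Sob_norm_def)

lemma WH_coeff_surj:
  assumes "a \<in> Sob m" obtains f where "f \<in> WH m" "Hermite_coeff f = a"
proof -
  obtain f where f: "f \<in> L2_Rn" "Hermite_coeff f = a" "nsq lebesgue f = (\<Sum>\<^sub>\<infinity>\<alpha>. (norm (a \<alpha>))\<^sup>2)"
    by (rule Hermite_coeff_surj[OF Sob_l2[OF assms]])
  then show ?thesis using assms by (intro that[of f]) (simp_all add: WH_iff)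
qed

lemma WH_semigroup: "t > 0 \<Longrightarrow> f \<in> WH m \<Longrightarrow> Hermite_semigroup t f = heat t (Hermite_coeff f)"
  by (rule Hermite_semigroup_eq_heat) (simp_all add: WH_iff)

lemma W_hol_eq:
  assumes t: "t > 0" shows "W_hol t m = heat t ` Sob m"
proof (intro equalityI subsetI)
  fix F :: "complex ^ 'a \<Rightarrow> complex"
  show "F \<in> heat t ` Sob m" if "F \<in> W_hol t m"
  proof -
    obtain f where f: "f \<in> WH m" "F = Hermite_semigroup t f" using \<open>F \<in> W_hol t m\<close> unfolding W_hol_def by blast
    then have "Hermite_coeff f \<in> Sob m" by (simp add: WH_iff)
    then show ?thesis unfolding f(2) WH_semigroup[OF t f(1)] by (rule imageI)
  qed
  assume "F \<in> heat t ` Sob m"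
  then obtain a where a: "a \<in> Sob m" "F = heat t a" by blast
  obtain f where f: "f \<in> WH m" "Hermite_coeff f = a" by (rule WH_coeff_surj[OF a(1)])
  then have "F = Hermite_semigroup t f" using WH_semigroup[OF t f(1)] a(2) by simp
  then show "F \<in> W_hol t m" using f(1) unfolding W_hol_def by blast
qed

lemma W_hol_norm_eq:
  assumes t: "t > 0" and a: "a \<in> Sob m" shows "W_hol_norm t m (heat t a) = Sob_norm m a"
  unfolding W_hol_norm_def
proof (rule the_equality)
  obtain f where f: "f \<in> WH m" "Hermite_coeff f = a" by (rule WH_coeff_surj[OF a])
  then show "\<exists>f\<in>WH m. Hermite_semigroup t f = heat t a \<and> WH_norm m f = Sob_norm m a"
    using WH_semigroup[OF t f(1)] by (auto simp: WH_norm_eq)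
  fix r assume "\<exists>f\<in>WH m. Hermite_semigroup t f = heat t a \<and> WH_norm m f = r"
  then obtain g where g: "g \<in> WH m" "Hermite_semigroup t g = heat t a" "WH_norm m g = r" by blast
  have "Hermite_coeff g = a" using heat_inj[OF t _ a, of "Hermite_coeff g"] g WH_semigroup[OF t g(1)] by (simp add: WH_iff)
  then show "r = Sob_norm m a" using g(3) by (simp add: WH_norm_eq)
qed

text \<open>With every space parametrised by \<open>Sob m\<close>, the maps become maps of
  coefficients: \<open>J\<close> sends the class of \<open>b\<close> to \<open>heat t b\<close>, and
  the semigroup followed by the inverse of \<open>J\<close> sends \<open>f\<close> to the class of
  its Hermite coefficients. Sums, multiples and norms are compared there.\<close>

theorem theorem2p3:
  fixes t :: real and m :: nat
  assumes "t > 0"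
  shows "\<exists>(J :: (complex ^ 'n) compl \<Rightarrow> complex ^ 'n \<Rightarrow> complex) (c :: real).
    c > 0 \<and> B_identification t m c J \<and>
    (let T = (\<lambda>f :: real ^ 'n \<Rightarrow> complex. inv_into (B_space t m) J (Hermite_semigroup t f)) in
       T ` WH m = B_space t m \<and>
       (\<forall>f\<in>WH m. \<forall>g\<in>WH m. T f = T g \<longleftrightarrow> (AE x in lebesgue. f x = g x)) \<and>
       (\<forall>f\<in>WH m. \<forall>g\<in>WH m. T (\<lambda>x. f x + g x) = B_add t m (T f) (T g)) \<and>
       (\<forall>a. \<forall>f\<in>WH m. T (\<lambda>x. a * f x) = B_scale t m a (T f)) \<and>
       (\<forall>f\<in>WH m. B_norm t m (T f) = c * WH_norm m f))"
proof -
  note t = assms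
  define J where "J B = heat t (THE b. b \<in> Sob m \<and> B = coeff_class t m b)" for B :: "(complex ^ 'n) compl"
  have J: "J (coeff_class t m b) = heat t b" if "b \<in> Sob m" for b
  proof -
    have "(THE b'. b' \<in> Sob m \<and> coeff_class t m b = coeff_class t m b') = b"
      by (rule the_equality) (use that coeff_class_inj[OF t] in auto)
    then show ?thesis by (simp add: J_def)
  qed
  have B: "B_space t m = coeff_class t m ` (Sob m :: (nat ^ 'n \<Rightarrow> complex) set)" by (rule B_space_eq[OF t])
  have inj: "inj_on J (B_space t m)"
    unfolding B by (rule inj_onI) (auto simp: J dest: heat_inj[OF t])
  have bij: "bij_betw J (B_space t m) (W_hol t m)"
    unfolding bij_betw_def W_hol_eq[OF t] using inj by (auto simp: B J image_image)
  have id: "B_identification t m (F_const TYPE('n) m) J"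
    unfolding B_identification_def
  proof (intro conjI ballI allI bij)
    fix b b' :: "(complex ^ 'n) compl" assume "b \<in> B_space t m" "b' \<in> B_space t m"
    then obtain a a' where a: "a \<in> Sob m" "a' \<in> Sob m" "b = coeff_class t m a" "b' = coeff_class t m a'" unfolding B by blast
    show "J (B_add t m b b') = (\<lambda>z. J b z + J b' z)"
      unfolding a(3,4) B_add_coeff_class[OF t a(1,2)] J[OF Sob_add[OF a(1,2)]] J[OF a(1)] J[OF a(2)] by (rule heat_add[OF t a(1,2)])
  next
    fix c and b :: "(complex ^ 'n) compl" assume "b \<in> B_space t m"
    then obtain a where a: "a \<in> Sob m" "b = coeff_class t m a" unfolding B by blast
    show "J (B_scale t m c b) = (\<lambda>z. c * J b z)"
      unfolding a(2) B_scale_coeff_class[OF t a(1)] J[OF Sob_scale[OF a(1)]] J[OF a(1)] by (rule heat_scale)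
  next
    fix F :: "complex ^ 'n \<Rightarrow> complex" assume F: "F \<in> F_space t m"
    show "J (B_embed t m F) = F" unfolding B_embed_coeff_class[OF t F] J[OF Sob_coeff_Sob[OF t F]] by (rule heat_Sob_coeff[OF t F])
  next
    fix b :: "(complex ^ 'n) compl" assume "b \<in> B_space t m"
    then obtain a where a: "a \<in> Sob m" "b = coeff_class t m a" unfolding B by blast
    show "B_norm t m b = F_const TYPE('n) m * W_hol_norm t m (J b)"
      unfolding a(2) B_norm_coeff_class[OF t a(1)] J[OF a(1)] W_hol_norm_eq[OF t a(1)] ..
  qed
  define T where "T = (\<lambda>f :: real ^ 'n \<Rightarrow> complex. inv_into (B_space t m) J (Hermite_semigroup t f))"
  have T: "T f = coeff_class t m (Hermite_coeff f)" if "f \<in> WH m" for f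
  proof -
    have a: "Hermite_coeff f \<in> Sob m" using that by (simp add: WH_iff)
    have "Hermite_semigroup t f = J (coeff_class t m (Hermite_coeff f))" unfolding J[OF a] by (rule WH_semigroup[OF t that])
    moreover have "coeff_class t m (Hermite_coeff f) \<in> B_space t m" using a unfolding B by blast
    ultimately show ?thesis unfolding T_def using inv_into_f_f[OF inj] by simp
  qed
  have lin: "(\<lambda>x. f x + g x) \<in> WH m \<and> Hermite_coeff (\<lambda>x. f x + g x) = (\<lambda>\<alpha>. Hermite_coeff f \<alpha> + Hermite_coeff g \<alpha>)"
    if "f \<in> WH m" "g \<in> WH m" for f g :: "real ^ 'n \<Rightarrow> complex"
  proof -
    have L: "L2 lebesgue f" "L2 lebesgue g" using that by (auto simp: WH_iff L2_Rn_iff)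
    have c: "Hermite_coeff (\<lambda>x. f x + g x) = (\<lambda>\<alpha>. Hermite_coeff f \<alpha> + Hermite_coeff g \<alpha>)"
      by (rule ext) (simp add: Hermite_coeff_eq ip_add[OF L] orthonormal.L2[OF orthonormal_lebesgue])
    show ?thesis unfolding WH_iff c L2_Rn_iff using that L2_add[OF L] Sob_add[of "Hermite_coeff f" m "Hermite_coeff g"] by (simp add: WH_iff)
  qed
  have sc: "(\<lambda>x. c * f x) \<in> WH m \<and> Hermite_coeff (\<lambda>x. c * f x) = (\<lambda>\<alpha>. c * Hermite_coeff f \<alpha>)"
    if "f \<in> WH m" for c and f :: "real ^ 'n \<Rightarrow> complex"
  proof -
    have L: "L2 lebesgue f" using that by (auto simp: WH_iff L2_Rn_iff)
    have c: "Hermite_coeff (\<lambda>x. c * f x) = (\<lambda>\<alpha>. c * Hermite_coeff f \<alpha>)"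
      by (rule ext) (simp add: Hermite_coeff_eq ip_scale)
    show ?thesis unfolding WH_iff c L2_Rn_iff using that L2_scale[OF L] Sob_scale[of "Hermite_coeff f" m c] by (simp add: WH_iff)
  qed
  have "T ` WH m = B_space t m"
  proof (intro equalityI subsetI)
    show "b \<in> B_space t m" if b: "b \<in> T ` WH m" for b
    proof -
      obtain f where f: "b = T f" "f \<in> WH m" using b by (rule imageE) (rule that)
      then have "Hermite_coeff f \<in> Sob m" by (simp add: WH_iff)
      then show ?thesis unfolding B f(1) T[OF f(2)] by (rule imageI)
    qed
    fix b :: "(complex ^ 'n) compl" assume "b \<in> B_space t m"
    then obtain a where a: "a \<in> Sob m" "b = coeff_class t m a" unfolding B by blast
    obtain f where "f \<in> WH m" "Hermite_coeff f = a" by (rule WH_coeff_surj[OF a(1)])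
    then have "b = T f" "f \<in> WH m" using T[of f] a(2) by simp_all
    then show "b \<in> T ` WH m" by (rule image_eqI)
  qed
  moreover have "\<forall>f\<in>WH m. \<forall>g\<in>WH m. T f = T g \<longleftrightarrow> (AE x in lebesgue. f x = g x)"
  proof (intro ballI)
    fix f g :: "real ^ 'n \<Rightarrow> complex" assume f: "f \<in> WH m" and g: "g \<in> WH m"
    then have "T f = T g \<longleftrightarrow> Hermite_coeff f = Hermite_coeff g"
      unfolding T[OF f] T[OF g] using coeff_class_inj[OF t, of "Hermite_coeff f" m "Hermite_coeff g"] by (auto simp: WH_iff)
    then show "T f = T g \<longleftrightarrow> (AE x in lebesgue. f x = g x)"
      using Hermite_coeff_inj[of f g] f g by (simp add: WH_iff)
  qed
  moreover have "\<forall>f\<in>WH m. \<forall>g\<in>WH m. T (\<lambda>x. f x + g x) = B_add t m (T f) (T g)"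
  proof (intro ballI)
    fix f g :: "real ^ 'n \<Rightarrow> complex" assume f: "f \<in> WH m" and g: "g \<in> WH m"
    have H: "Hermite_coeff f \<in> Sob m" "Hermite_coeff g \<in> Sob m" using f g by (simp_all add: WH_iff)
    show "T (\<lambda>x. f x + g x) = B_add t m (T f) (T g)"
      unfolding T[OF f] T[OF g] B_add_coeff_class[OF t H] T[OF conjunct1[OF lin[OF f g]]] conjunct2[OF lin[OF f g]] ..
  qed
  moreover have "\<forall>a. \<forall>f\<in>WH m. T (\<lambda>x. a * f x) = B_scale t m a (T f)"
  proof (intro allI ballI)
    fix a and f :: "real ^ 'n \<Rightarrow> complex" assume f: "f \<in> WH m"
    have H: "Hermite_coeff f \<in> Sob m" using f by (simp add: WH_iff)
    show "T (\<lambda>x. a * f x) = B_scale t m a (T f)"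
      unfolding T[OF f] B_scale_coeff_class[OF t H] T[OF conjunct1[OF sc[OF f]]] conjunct2[OF sc[OF f]] ..
  qed
  moreover have "\<forall>f\<in>WH m. B_norm t m (T f) = F_const TYPE('n) m * WH_norm m f"
  proof
    fix f :: "real ^ 'n \<Rightarrow> complex" assume f: "f \<in> WH m"
    have H: "Hermite_coeff f \<in> Sob m" using f by (simp add: WH_iff)
    show "B_norm t m (T f) = F_const TYPE('n) m * WH_norm m f"
      unfolding T[OF f] B_norm_coeff_class[OF t H] WH_norm_eq ..
  qed
  ultimately show ?thesis
    using F_const_pos[where 'n = 'n and m = m] id
    unfolding T_def Let_def by (intro exI[of _ J] exI[of _ "F_const TYPE('n) m"] conjI)
qed

end
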